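(* Consider the multicolored multiple-drawing randomly reinforced urn described in the context. Assume: (A1) there is a constant $C_2$ such that $\sup_n \mathbb{E}(A_{nk}^3)<C_2$ for all $k\in\{1,\dots,d\}$; (A2) for all $k\in\{1,\dots,d\}$, $m_{nk}:=\mathbb{E}(A_{nk})\to m_k$ as $n\to\infty$, where $m_1,\dots,m_d$ are finite reals with $m_1=\dots=m_t>m_{t+1}\ge m_{t+2}\ge\dots\ge m_d$ for some $t\in\{1,\dots,d\}$; moreover $m_{n1}=m_{n2}=\dots=m_{nt}$ for all $n\ge 1$; (A3) for all $k,j\in\{1,\dots,d\}$, $\sum_{n=1}^\infty \frac{|m_{n+1,k}m_j-m_km_{n+1,j}|}{n}<\infty$; (A4) for all $k\in\{1,\dots,d\}$, $|m_{nk}-m_k|=o(n^{-m_k/(2m_1)})$; (N) $\mathbb E(N_{n+1}\mid\mathcal F_n)\to N$ almost surely, for some random variable $N$; (Q) $\mathbb E(N_{n+1}^2\mid\mathcal F_n)\to Q$ almost surely, for some random variable $Q$; (M) $\mathbb E(A_{nk}^2)\to q_k$ and $\mathbb E(A_{nk}A_{ns})\to q_{ks}$ as $n\to\infty$, for all $k,s$. Let $Z_k$ be the almost sure limit of $Z_{nk}$, $\sigma_k^2=q_k-m_k^2$ and $c_{ij}=q_{ij}-m_im_j$, and let $\hat m_{A_k,n}=\sum_{j=1}^nA_{jk}X_{jk}/N_{A_k,n}$. Then $$\left(\sqrt{N_{A_1,n}}(\hat m_{A_1,n}-m_1),\dots,\sqrt{N_{A_d,n}}(\hat m_{A_d,n}-m_d)\right)^\top\to\mathcal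 N(0,\Sigma)\quad\text{stably},$$ where $\Sigma$ is the random symmetric $d\times d$ matrix with entries $$\Sigma_{kk}=\sigma_k^2\left[Z_k(Q/N-1)+1\right]\ (1\le k\le t),\qquad \Sigma_{kk}=\sigma_k^2\ (t<k\le d),$$ $$\Sigma_{ij}=c_{ij}\sqrt{Z_iZ_j}\,(Q/N-1)\ (1\le i\ne j\le t),\qquad \Sigma_{ij}=0\ \text{ if } i\neq j \text{ and } \max(i,j)>t.$$ On the event $\{Q=N\}=\{N=1\}$ (equality up to null sets), $\Sigma$ is diagonal and its diagonal elements are the asymptotic variances $\sigma_k^2=\lim_n\mathrm{Var}(A_{nk})$ of $A_{nk}$, $k\in\{1,\dots,d\}$.
   Context: Urn model. An urn contains balls of $d\ge 2$ colors. The initial composition is a deterministic vector $\mathbf H_0=(H_{01},\dots,H_{0d})^\top$ of positive integers. At each stage $n\ge1$, a random number $N_n$ of balls is drawn without replacement; $\mathbf X_n=(X_{n1},\dots,X_{nd})^\top$ records how many balls of each color are drawn, so $\sum_k X_{nk}=N_n$. The drawn balls are then returned together with $A_{nk}X_{nk}$ new balls of color $k$, for each $k$. Here $\mathbf R_n=\mathrm{diag}(A_{n1},\dots,A_{nd})$ is the random replacement matrix. So $H_{nk}=H_{0k}+\sum_{i=1}^n A_{ik}X_{ik}$, $S_n=\sum_{k=1}^d H_{nk}$ and $Z_{nk}=H_{nk}/S_n$; $N_{A_k,n}=\sum_{j=1}^nX_{jk}$ is the number of color-$k$ balls drawn in the first $n$ stages. Let $\mathcal F_0$ be trivial, $\mathcal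 F_n=\sigma\{N_1,\mathbf X_1,\mathbf R_1,\dots,N_n,\mathbf X_n,\mathbf R_n\}$ and $\mathcal G_n=\sigma(\mathcal F_n,N_{n+1})$. Standing assumptions, for all $n\ge0$: (I) $N_{n+1}$ takes values in $\{1,2,\dots,\min(S_n,C_1)\}$ for some constant positive integer $C_1$. (II) Conditionally on $\mathcal G_n$, $\mathbf X_{n+1}$ is multivariate hypergeometric with parameters $(S_n,N_{n+1},\mathbf H_n)$: $\mathbb P(\mathbf X_{n+1}=\mathbf x\mid\mathcal G_n)=\prod_{k=1}^d\binom{H_{nk}}{x_k}\big/\binom{S_n}{N_{n+1}}$ for integer vectors $\mathbf x$ with $0\le x_k\le H_{nk}$ and $\sum_k x_k=N_{n+1}$. (III) Each $A_{n+1,k}$ takes (integer) values in $[1,\infty)$, and $\mathbf R_{n+1}$ is independent of $\sigma(\mathcal G_n,\mathbf X_{n+1})$. The components of $\mathbf R_{n+1}$ may be correlated with each other. Under (A1)–(A2) the almost sure limits $Z_k=\lim_nZ_{nk}$ exist for all $k$. Stable convergence of random vectors $\mathbf V_n$ to $\mathcal N(0,\Sigma)$ with $\Sigma$ a random positive semidefinite matrix means: for every event $B$ and every $u\in\mathbb R^d$, $\mathbb E[e^{iu^\top\mathbf V_n}\mathbf 1_B]\to\mathbb E[e^{-u^\top\Sigma u/2}\mathbf 1_B]$. *)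

theory Defs
  imports "HOL-Probability.Probability" "HOL-Library.Landau_Symbols"
begin

text \<open>
  Colours are the numbers in \<open>{1..d}\<close>; a vector or matrix indexed by colours is a function on
  \<open>nat\<close> of which only the values at indices in \<open>{1..d}\<close> matter. Stages are numbered from 1:
  the values of \<open>N\<close>, \<open>X\<close> and \<open>A\<close> at stage 0 play no role.
\<close>

definition urn_H :: "(nat \<Rightarrow> nat) \<Rightarrow> (nat \<Rightarrow> nat \<Rightarrow> 'w \<Rightarrow> nat) \<Rightarrow> (nat \<Rightarrow> nat \<Rightarrow> 'w \<Rightarrow> nat)
    \<Rightarrow> nat \<Rightarrow> nat \<Rightarrow> 'w \<Rightarrow> nat" where
  "urn_H h0 X A n k \<omega> = h0 k + (\<Sum>i=1..n. A i k \<omega> * X i k \<omega>)"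

definition urn_S :: "nat \<Rightarrow> (nat \<Rightarrow> nat) \<Rightarrow> (nat \<Rightarrow> nat \<Rightarrow> 'w \<Rightarrow> nat) \<Rightarrow> (nat \<Rightarrow> nat \<Rightarrow> 'w \<Rightarrow> nat)
    \<Rightarrow> nat \<Rightarrow> 'w \<Rightarrow> nat" where
  "urn_S d h0 X A n \<omega> = (\<Sum>k=1..d. urn_H h0 X A n k \<omega>)"

definition urn_Z :: "nat \<Rightarrow> (nat \<Rightarrow> nat) \<Rightarrow> (nat \<Rightarrow> nat \<Rightarrow> 'w \<Rightarrow> nat) \<Rightarrow> (nat \<Rightarrow> nat \<Rightarrow> 'w \<Rightarrow> nat)
    \<Rightarrow> nat \<Rightarrow> nat \<Rightarrow> 'w \<Rightarrow> real" where
  "urn_Z d h0 X A n k \<omega> = real (urn_H h0 X A n k \<omega>) / real (urn_S d h0 X A n \<omega>)"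

text \<open>The pointwise limit of the proportions; \<open>lim\<close> has an unspecified value at those
  \<open>\<omega>\<close> for which the proportions do not converge.\<close>

definition urn_Zlim :: "nat \<Rightarrow> (nat \<Rightarrow> nat) \<Rightarrow> (nat \<Rightarrow> nat \<Rightarrow> 'w \<Rightarrow> nat) \<Rightarrow> (nat \<Rightarrow> nat \<Rightarrow> 'w \<Rightarrow> nat)
    \<Rightarrow> nat \<Rightarrow> 'w \<Rightarrow> real" where
  "urn_Zlim d h0 X A k \<omega> = lim (\<lambda>n. urn_Z d h0 X A n k \<omega>)"

definition urn_drawn :: "(nat \<Rightarrow> nat \<Rightarrow> 'w \<Rightarrow> nat) \<Rightarrow> nat \<Rightarrow> nat \<Rightarrow> 'w \<Rightarrow> nat" where
  "urn_drawn X n k \<omega> = (\<Sum>j=1..n. X j k \<omega>)"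

text \<open>The estimator is 0 as long as no ball of colour \<open>k\<close> has been drawn (\<open>x / 0 = 0\<close>).\<close>

definition urn_mhat :: "(nat \<Rightarrow> nat \<Rightarrow> 'w \<Rightarrow> nat) \<Rightarrow> (nat \<Rightarrow> nat \<Rightarrow> 'w \<Rightarrow> nat)
    \<Rightarrow> nat \<Rightarrow> nat \<Rightarrow> 'w \<Rightarrow> real" where
  "urn_mhat X A n k \<omega> = real (\<Sum>j=1..n. A j k \<omega> * X j k \<omega>) / real (urn_drawn X n k \<omega>)"

definition urn_mean :: "'w measure \<Rightarrow> (nat \<Rightarrow> nat \<Rightarrow> 'w \<Rightarrow> nat) \<Rightarrow> nat \<Rightarrow> nat \<Rightarrow> real" where
  "urn_mean M A n k = (\<integral>\<omega>. real (A n k \<omega>) \<partial>M)"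

text \<open>The \<open>\<sigma>\<close>-algebra on \<open>space M\<close> generated by a set of \<open>nat\<close>-valued random variables.\<close>

definition sigma_gen :: "'w measure \<Rightarrow> ('w \<Rightarrow> nat) set \<Rightarrow> 'w measure" where
  "sigma_gen M Y = sigma (space M) {f -` B \<inter> space M | f B. f \<in> Y}"

definition urn_hist :: "nat \<Rightarrow> (nat \<Rightarrow> 'w \<Rightarrow> nat) \<Rightarrow> (nat \<Rightarrow> nat \<Rightarrow> 'w \<Rightarrow> nat)
    \<Rightarrow> (nat \<Rightarrow> nat \<Rightarrow> 'w \<Rightarrow> nat) \<Rightarrow> nat \<Rightarrow> ('w \<Rightarrow> nat) set" where
  "urn_hist d N X A n = {N i | i. i \<in> {1..n}}
     \<union> {X i k | i k. i \<in> {1..n} \<and> k \<in> {1..d}} \<union> {A i k | i k. i \<in> {1..n} \<and> k \<in> {1..d}}"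

definition urn_F :: "'w measure \<Rightarrow> nat \<Rightarrow> (nat \<Rightarrow> 'w \<Rightarrow> nat) \<Rightarrow> (nat \<Rightarrow> nat \<Rightarrow> 'w \<Rightarrow> nat)
    \<Rightarrow> (nat \<Rightarrow> nat \<Rightarrow> 'w \<Rightarrow> nat) \<Rightarrow> nat \<Rightarrow> 'w measure" where
  "urn_F M d N X A n = sigma_gen M (urn_hist d N X A n)"

definition urn_G :: "'w measure \<Rightarrow> nat \<Rightarrow> (nat \<Rightarrow> 'w \<Rightarrow> nat) \<Rightarrow> (nat \<Rightarrow> nat \<Rightarrow> 'w \<Rightarrow> nat)
    \<Rightarrow> (nat \<Rightarrow> nat \<Rightarrow> 'w \<Rightarrow> nat) \<Rightarrow> nat \<Rightarrow> 'w measure" where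
  "urn_G M d N X A n = sigma_gen M (urn_hist d N X A n \<union> {N (Suc n)})"

definition mv_hypergeometric :: "nat \<Rightarrow> nat \<Rightarrow> nat \<Rightarrow> (nat \<Rightarrow> nat) \<Rightarrow> (nat \<Rightarrow> nat) \<Rightarrow> real" where
  "mv_hypergeometric d s r h x =
     (if (\<forall>k\<in>{1..d}. x k \<le> h k) \<and> (\<Sum>k=1..d. x k) = r
      then (\<Prod>k=1..d. real (h k choose x k)) / real (s choose r) else 0)"

locale reinforced_urn = prob_space M
  for M :: "'w measure" +
  fixes d C1 :: nat and h0 :: "nat \<Rightarrow> nat"
    and N :: "nat \<Rightarrow> 'w \<Rightarrow> nat" and X A :: "nat \<Rightarrow> nat \<Rightarrow> 'w \<Rightarrow> nat"
  assumes d_ge_2: "d \<ge> 2"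
    and h0_pos: "\<And>k. k \<in> {1..d} \<Longrightarrow> h0 k > 0"
    and N_measurable: "\<And>n. N (Suc n) \<in> measurable M (count_space UNIV)"
    and X_measurable: "\<And>n k. k \<in> {1..d} \<Longrightarrow> X (Suc n) k \<in> measurable M (count_space UNIV)"
    and A_measurable: "\<And>n k. k \<in> {1..d} \<Longrightarrow> A (Suc n) k \<in> measurable M (count_space UNIV)"
    and X_sum: "\<And>n. AE \<omega> in M. (\<Sum>k=1..d. X (Suc n) k \<omega>) = N (Suc n) \<omega>"
    and C1_pos: "C1 > 0"
    and N_range: "\<And>n. AE \<omega> in M. N (Suc n) \<omega> \<in> {1..min (urn_S d h0 X A n \<omega>) C1}"
    and X_hypergeometric: "\<And>n x. AE \<omega> in M.
      real_cond_exp M (urn_G M d N X A n)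
        (indicator {\<omega> \<in> space M. \<forall>k\<in>{1..d}. X (Suc n) k \<omega> = x k}) \<omega>
      = mv_hypergeometric d (urn_S d h0 X A n \<omega>) (N (Suc n) \<omega>) (\<lambda>k. urn_H h0 X A n k \<omega>) x"
    and A_ge_1: "\<And>n k. k \<in> {1..d} \<Longrightarrow> AE \<omega> in M. A (Suc n) k \<omega> \<ge> 1"
    and A_indep: "\<And>n. indep_set
      (sets (sigma_gen M {A (Suc n) k | k. k \<in> {1..d}}))
      (sets (sigma_gen M (urn_hist d N X A n \<union> {N (Suc n)} \<union> {X (Suc n) k | k. k \<in> {1..d}})))"

text \<open>Stable convergence of random vectors \<open>V n\<close> to the centred Gaussian law whose covariance
  is the random symmetric positive semidefinite \<open>d \<times> d\<close> matrix \<open>\<Sigma>\<close>.\<close>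

definition stably_normal :: "'w measure \<Rightarrow> nat \<Rightarrow> (nat \<Rightarrow> nat \<Rightarrow> 'w \<Rightarrow> real)
    \<Rightarrow> (nat \<Rightarrow> nat \<Rightarrow> 'w \<Rightarrow> real) \<Rightarrow> bool" where
  "stably_normal M d V \<Sigma> \<longleftrightarrow>
     (\<forall>n. \<forall>k\<in>{1..d}. V n k \<in> borel_measurable M) \<and>
     (\<forall>i\<in>{1..d}. \<forall>j\<in>{1..d}. \<Sigma> i j \<in> borel_measurable M) \<and>
     (AE \<omega> in M. (\<forall>i\<in>{1..d}. \<forall>j\<in>{1..d}. \<Sigma> i j \<omega> = \<Sigma> j i \<omega>) \<and>
        (\<forall>u :: nat \<Rightarrow> real. (\<Sum>i=1..d. \<Sum>j=1..d. u i * \<Sigma> i j \<omega> * u j) \<ge> 0)) \<and>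
     (\<forall>B\<in>sets M. \<forall>u :: nat \<Rightarrow> real.
        (\<lambda>n. LINT \<omega>:B|M. iexp (\<Sum>k=1..d. u k * V n k \<omega>)) \<longlonglongrightarrow>
        complex_of_real
          (LINT \<omega>:B|M. exp (- (\<Sum>i=1..d. \<Sum>j=1..d. u i * \<Sigma> i j \<omega> * u j) / 2)))"

text \<open>The limiting covariance matrix; \<open>v k\<close> stands for \<open>\<sigma>\<^sub>k\<^sup>2\<close>, \<open>c i j\<close> for the limiting
  covariances, \<open>Z\<close> for the limiting proportions, \<open>NN\<close> and \<open>Q\<close> for the limiting conditional
  first and second moments of the number of balls drawn.\<close>

definition urn_Sigma :: "nat \<Rightarrow> (nat \<Rightarrow> real) \<Rightarrow> (nat \<Rightarrow> nat \<Rightarrow> real) \<Rightarrow> (nat \<Rightarrow> 'w \<Rightarrow> real)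
    \<Rightarrow> ('w \<Rightarrow> real) \<Rightarrow> ('w \<Rightarrow> real) \<Rightarrow> nat \<Rightarrow> nat \<Rightarrow> 'w \<Rightarrow> real" where
  "urn_Sigma t v c Z NN Q i j \<omega> =
     (if i = j then
        (if i \<le> t then v i * (Z i \<omega> * (Q \<omega> / NN \<omega> - 1) + 1) else v i)
      else
        (if max i j \<le> t then c i j * sqrt (Z i \<omega> * Z j \<omega>) * (Q \<omega> / NN \<omega> - 1) else 0))"

end

theory Submission
  imports Defs "HOL-Computational_Algebra.Polynomial" "HOL-Library.Discrete_Functions"
begin

text \<open>
  Write \<open>D\<^sub>k\<close> for the number of drawn balls of colour \<open>k\<close>. The squared ratios \<open>(X\<^sub>k / H\<^sub>k)\<^sup>2\<close>
  of consecutive draws and contents are summable with bounded expectation, hence the noises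
  in \<open>ln H\<^sub>k\<close> are convergent martingales and, by (A3), \<open>ln H\<^sub>k - (m\<^sub>k / m\<^sub>1) ln H\<^sub>1\<close> converges. This
  gives the limits of the proportions, positive exactly for the dominant colours, and, with
  Kronecker's lemma, \<open>D\<^sub>k \<sim> w\<^sub>k n powr (m\<^sub>k / m\<^sub>1)\<close> with random \<open>w\<^sub>k > 0\<close>.

  For the central limit theorem the draws are normalised by an extrapolation of the composition at
  stage \<open>floor_sqrt n\<close>, so that the normalisation is known to the martingale from then on. With
  \<open>v\<close> the truncated conditional variance of the normalised martingale \<open>W\<close>, the bounded
  variables \<open>exp (i W + v / 2)\<close> are asymptotically uncorrelated with every fixed past, hence, by
  an argument of Renyi, with every bounded random variable; since \<open>v\<close> converges almost surely
  this is stable convergence. The draws enter \<open>v\<close> through hypergeometric second factorial moments, which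
  produce the factor \<open>Q / N - 1\<close>.
\<close>

section \<open>Deterministic averaging lemmas\<close>

text \<open>The estimation errors are divided by \<open>sqrt (Dr n k)\<close>, which is unknown
  before stage \<open>n\<close>; inside a sum over stages this factor would destroy the martingale
  property, and a deterministic power of \<open>n\<close> in its place would leave the random w_k in
  the limiting variance. Hence the extrapolation. The stage it starts from must tend to infinity, so
  that w_k can be read off, yet everything before it must be negligible against
  \<open>sqrt (Dr n k)\<close>. Kronecker's lemma gives no more than that the noise of the first r
  stages is o(H_k) at stage r, that is o(r^(m_k/m_1)); for r = \<open>floor_sqrt n\<close> this is
  just o(sqrt D_k) at stage n.

  A martingale difference is expressed by vanishing integrals against square-integrable functions of
  the past, which is all that the stopping argument needs.

  The limiting variance depends on the random Z, N and Q, so that convergence in law of the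
  martingale would not suffice. Testing against every bounded random variable allows the factor
  exp(-v/2), with v replaced by its random limit, to be part of the test variable.\<close>

lemma toeplitz_null:
  fixes e w B :: "nat \<Rightarrow> real"
  assumes e: "e \<longlonglongrightarrow> 0" and w: "\<And>i. 0 \<le> w i"
    and bound: "\<And>n. (\<Sum>i<n. w i) \<le> C * B n" and B: "filterlim B at_top sequentially"
  shows "(\<lambda>n. (\<Sum>i<n. e i * w i) / B n) \<longlonglongrightarrow> 0"
proof (rule LIMSEQ_I)
  fix r :: real assume r: "r > 0"
  define C' where "C' = max C 1"
  have C': "C' > 0" "C \<le> C'" by (auto simp: C'_def)
  define \<delta> where "\<delta> = r / (2 * C')"
  have \<delta>: "\<delta> > 0" using r C' by (simp add: \<delta>_def)
  obtain n0 where n0: "\<And>i. i \<ge> n0 \<Longrightarrow> \<bar>e i\<bar> < \<delta>"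
    using LIMSEQ_D[OF e \<delta>] by auto
  \<comment> \<open>The contribution of the indices where \<open>e\<close> is not yet small; it is
    fixed while \<open>B n\<close> tends to infinity.\<close>
  define K where "K = (\<Sum>i<n0. \<bar>e i\<bar> * w i)"
  have "eventually (\<lambda>n. B n > 2 * K / r \<and> B n > 0) sequentially"
    using B by (auto simp: filterlim_at_top_dense eventually_conj_iff)
  then obtain n1 where n1: "\<And>n. n \<ge> n1 \<Longrightarrow> B n > 2 * K / r \<and> B n > 0"
    by (auto simp: eventually_sequentially)
  show "\<exists>no. \<forall>n\<ge>no. norm ((\<Sum>i<n. e i * w i) / B n - 0) < r"
  proof (intro exI[of _ "max n0 n1"] allI impI)
    fix n assume n: "n \<ge> max n0 n1"
    have Bn: "B n > 2 * K / r" "B n > 0" using n1 n by auto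
    have "\<bar>\<Sum>i<n. e i * w i\<bar> \<le> (\<Sum>i<n. \<bar>e i\<bar> * w i)"
      by (rule order_trans[OF sum_abs]) (simp add: abs_mult w)
    also have "\<dots> = K + (\<Sum>i\<in>{n0..<n}. \<bar>e i\<bar> * w i)"
      unfolding K_def using n by (simp add: lessThan_atLeast0 sum.atLeastLessThan_concat)
    also have "(\<Sum>i\<in>{n0..<n}. \<bar>e i\<bar> * w i) \<le> (\<Sum>i\<in>{n0..<n}. \<delta> * w i)"
      by (intro sum_mono mult_right_mono) (use n0 w in \<open>auto intro: less_imp_le\<close>)
    also have "\<dots> \<le> (\<Sum>i<n. \<delta> * w i)"
      by (intro sum_mono2) (use w \<delta> in auto)
    also have "\<dots> = \<delta> * (\<Sum>i<n. w i)" by (simp add: sum_distrib_left)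
    also have "\<dots> \<le> \<delta> * (C' * B n)"
      using \<delta> bound[of n] C' Bn by (intro mult_left_mono) (auto intro: order_trans[OF _ mult_right_mono])
    also have "\<dots> = r / 2 * B n" using C' by (simp add: \<delta>_def)
    finally have "\<bar>\<Sum>i<n. e i * w i\<bar> \<le> K + r / 2 * B n" by simp
    also have "K < r / 2 * B n" using Bn r by (simp add: field_simps)
    finally have "\<bar>\<Sum>i<n. e i * w i\<bar> < r * B n" by simp
    then show "norm ((\<Sum>i<n. e i * w i) / B n - 0) < r"
      using Bn by (simp add: abs_divide divide_less_eq)
  qed
qed

text \<open>The weights are normalised by \<open>B n\<close>, not by their own sum, so their
  limiting mass \<open>c\<close> enters as a factor. Later \<open>c\<close> is 1,
  \<open>1 / m k\<close> or \<open>Q - NN\<close>.\<close>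

lemma weighted_cesaro:
  fixes x w B :: "nat \<Rightarrow> real"
  assumes x: "x \<longlonglongrightarrow> l" and w: "\<And>i. 0 \<le> w i"
    and lim: "(\<lambda>n. (\<Sum>i<n. w i) / B n) \<longlonglongrightarrow> c" and B: "filterlim B at_top sequentially"
    and Bpos: "\<And>n. B n > 0"
  shows "(\<lambda>n. (\<Sum>i<n. x i * w i) / B n) \<longlonglongrightarrow> l * c"
proof -
  obtain C where C: "\<And>n. norm ((\<Sum>i<n. w i) / B n) \<le> C"
    using convergent_imp_Bseq[OF convergentI[OF lim]] by (auto simp: Bseq_def)
  have "(\<Sum>i<n. w i) \<le> C * B n" for n
    using C[of n] Bpos[of n] by (simp add: abs_le_iff divide_le_eq)
  then have "(\<lambda>n. (\<Sum>i<n. (x i - l) * w i) / B n) \<longlonglongrightarrow> 0"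
    by (intro toeplitz_null[OF _ w _ B]) (use x in \<open>auto simp: LIM_zero_iff\<close>)
  from tendsto_add[OF this tendsto_mult_left[OF lim, of l]]
  show ?thesis
    by (simp add: sum_subtractf left_diff_distrib diff_divide_distrib sum_distrib_left)
qed

lemma kronecker_lemma:
  fixes y b :: "nat \<Rightarrow> real"
  assumes y: "summable (\<lambda>i. y i / b i)" and b: "incseq b" "\<And>n. b n > 0"
    and B: "filterlim b at_top sequentially"
  shows "(\<lambda>n. (\<Sum>i<n. y i) / b n) \<longlonglongrightarrow> 0"
proof -
  define s where "s n = (\<Sum>i<n. y i / b i)" for n
  obtain l where l: "s \<longlonglongrightarrow> l"
    using y using summable_LIMSEQ[OF y] unfolding s_def by blast
  \<comment> \<open>Summation by parts. The subtracted sum, divided by \<open>b n\<close>, is a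
    weighted average of the \<open>s i\<close> with weights \<open>b (Suc i) - b i\<close>, so it
    has the same limit as \<open>s n\<close>.\<close>
  have abel: "(\<Sum>i<n. y i) = b n * s n - (\<Sum>i<n. s (Suc i) * (b (Suc i) - b i))" for n
  proof (induction n)
    case (Suc n)
    have "y n = b n * (s (Suc n) - s n)" using b(2)[of n] by (simp add: s_def)
    with Suc show ?case by (simp add: algebra_simps)
  qed (simp add: s_def)
  have b0: "(\<lambda>n. b 0 / b n) \<longlonglongrightarrow> 0"
    by (intro real_tendsto_divide_at_top[OF tendsto_const] B)
  have "(\<lambda>n. (\<Sum>i<n. b (Suc i) - b i) / b n) = (\<lambda>n. 1 - b 0 / b n)"
    using b(2) by (auto simp: sum_lessThan_telescope diff_divide_distrib less_imp_neq[symmetric])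
  then have "(\<lambda>n. (\<Sum>i<n. b (Suc i) - b i) / b n) \<longlonglongrightarrow> 1"
    using tendsto_diff[OF tendsto_const[of 1] b0] by simp
  then have "(\<lambda>n. (\<Sum>i<n. s (Suc i) * (b (Suc i) - b i)) / b n) \<longlonglongrightarrow> l * 1"
    by (intro weighted_cesaro[OF _ _ _ B b(2)]) (use l b in \<open>auto simp: LIMSEQ_Suc incseq_SucD\<close>)
  from tendsto_diff[OF l this] have "(\<lambda>n. s n - (\<Sum>i<n. s (Suc i) * (b (Suc i) - b i)) / b n) \<longlonglongrightarrow> 0"
    by simp
  moreover have "s n - (\<Sum>i<n. s (Suc i) * (b (Suc i) - b i)) / b n = (\<Sum>i<n. y i) / b n" for n
    using b(2)[of n] by (simp add: abel diff_divide_distrib)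
  ultimately show ?thesis by simp
qed

section \<open>Almost sure convergence of square-summable martingales\<close>

lemma AE_summable_of_summable_integral:
  fixes f :: "nat \<Rightarrow> 'a \<Rightarrow> real"
  assumes int: "\<And>n. integrable M (f n)" and nonneg: "\<And>n. AE \<omega> in M. 0 \<le> f n \<omega>"
    and sum: "summable (\<lambda>n. \<integral>\<omega>. f n \<omega> \<partial>M)"
  shows "AE \<omega> in M. summable (\<lambda>n. f n \<omega>)"
proof -
  have [measurable]: "f n \<in> borel_measurable M" for n using int by auto
  have "(\<integral>\<^sup>+\<omega>. (\<Sum>n. ennreal (f n \<omega>)) \<partial>M) = (\<Sum>n. \<integral>\<^sup>+\<omega>. ennreal (f n \<omega>) \<partial>M)"
    by (rule nn_integral_suminf) simp
  also have "\<dots> = (\<Sum>n. ennreal (\<integral>\<omega>. f n \<omega> \<partial>M))"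
    by (simp add: nn_integral_eq_integral[OF int nonneg])
  also have "\<dots> = ennreal (\<Sum>n. \<integral>\<omega>. f n \<omega> \<partial>M)"
    by (rule suminf_ennreal2[OF integral_nonneg_AE[OF nonneg] sum])
  finally have "(\<integral>\<^sup>+\<omega>. (\<Sum>n. ennreal (f n \<omega>)) \<partial>M) \<noteq> \<infinity>" by simp
  then have "AE \<omega> in M. (\<Sum>n. ennreal (f n \<omega>)) \<noteq> \<infinity>"
    by (intro nn_integral_noteq_infinite) auto
  moreover have "AE \<omega> in M. \<forall>n. 0 \<le> f n \<omega>"
    using nonneg by (simp add: AE_all_countable)
  ultimately show ?thesis
    by eventually_elim (auto intro: summable_suminf_not_top)
qed

lemma square_integrable_mult:
  fixes f g :: "'a \<Rightarrow> real"
  assumes [measurable]: "f \<in> borel_measurable M" "g \<in> borel_measurable M"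
    and "integrable M (\<lambda>x. (f x)\<^sup>2)" "integrable M (\<lambda>x. (g x)\<^sup>2)"
  shows "integrable M (\<lambda>x. f x * g x)"
proof (rule Bochner_Integration.integrable_bound)
  show "integrable M (\<lambda>x. (f x)\<^sup>2 + (g x)\<^sup>2)" using assms by simp
  have "\<bar>a * b\<bar> \<le> a\<^sup>2 + b\<^sup>2" for a b :: real
  proof -
    have "2 * \<bar>a * b\<bar> \<le> a\<^sup>2 + b\<^sup>2" using sum_squares_bound[of "\<bar>a\<bar>" "\<bar>b\<bar>"] by (simp add: abs_mult)
    then show ?thesis by (smt (verit) abs_ge_zero)
  qed
  then show "AE x in M. norm (f x * g x) \<le> norm ((f x)\<^sup>2 + (g x)\<^sup>2)"
    by (auto intro!: AE_I2 simp del: abs_mult)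
qed simp

lemma square_integrable_add:
  fixes f g :: "'a \<Rightarrow> real"
  assumes "f \<in> borel_measurable M" "g \<in> borel_measurable M"
    and "integrable M (\<lambda>x. (f x)\<^sup>2)" "integrable M (\<lambda>x. (g x)\<^sup>2)"
  shows "integrable M (\<lambda>x. (f x + g x)\<^sup>2)"
  using square_integrable_mult[OF assms] assms by (simp add: power2_sum mult.assoc)

text \<open>The martingale is stopped when it leaves the interval of radius \<open>\<epsilon>\<close>, which does
  not increase its variance.\<close>

lemma (in prob_space) martingale_maximal_inequality:
  fixes F :: "nat \<Rightarrow> 'a measure" and D :: "nat \<Rightarrow> 'a \<Rightarrow> real"
  assumes sub: "\<And>n. subalgebra M (F n)" and mono: "\<And>n. subalgebra (F (Suc n)) (F n)"
    and D: "\<And>n. D n \<in> borel_measurable (F (Suc n))"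
    and sq: "\<And>n. integrable M (\<lambda>\<omega>. (D n \<omega>)\<^sup>2)"
    and orth: "\<And>n W. W \<in> borel_measurable (F n) \<Longrightarrow> integrable M (\<lambda>\<omega>. (W \<omega>)\<^sup>2) \<Longrightarrow>
      (\<integral>\<omega>. W \<omega> * D n \<omega> \<partial>M) = 0"
    and \<epsilon>: "\<epsilon> > 0" and mn: "m \<le> n"
  shows "prob {\<omega>\<in>space M. \<exists>j\<in>{m..n}. \<bar>\<Sum>i\<in>{m..<j}. D i \<omega>\<bar> > \<epsilon>}
    \<le> (\<Sum>i\<in>{m..<n}. \<integral>\<omega>. (D i \<omega>)\<^sup>2 \<partial>M) / \<epsilon>\<^sup>2"
proof -
  have mono': "i \<le> j \<Longrightarrow> subalgebra (F j) (F i)" for i j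
  proof (induction j)
    case (Suc j)
    then show ?case
      using mono[of j] by (cases "i = Suc j") (auto simp: subalgebra_def)
  qed (simp add: subalgebra_def)
  have DF: "D i \<in> borel_measurable (F j)" if "i < j" for i j
    using measurable_from_subalg[OF mono' D, of "i" j] that by simp
  have DM [measurable]: "D i \<in> borel_measurable M" for i
    using measurable_from_subalg[OF sub D] .
  \<comment> \<open>\<open>I i\<close> indicates that no sum over \<open>{m..<j}\<close> with
    \<open>j \<le> i\<close> has left the interval. It involves only the \<open>D l\<close> with
    \<open>l < i\<close>, so it is known to \<open>F i\<close> and may be moved into the test
    function of \<open>orth\<close>.\<close>
  define I where "I i \<omega> = (\<Prod>j\<in>{m..i}. indicator {..\<epsilon>} \<bar>\<Sum>l\<in>{m..<j}. D l \<omega>\<bar> :: real)" for i \<omega>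
  have IF: "I i \<in> borel_measurable (F i)" for i
    unfolding I_def
  proof (rule borel_measurable_prod)
    fix j assume "j \<in> {m..i}"
    then have [measurable]: "(\<lambda>\<omega>. \<Sum>l\<in>{m..<j}. D l \<omega>) \<in> borel_measurable (F i)"
      by (intro borel_measurable_sum DF) auto
    show "(\<lambda>\<omega>. indicator {..\<epsilon>} \<bar>\<Sum>l\<in>{m..<j}. D l \<omega>\<bar> :: real) \<in> borel_measurable (F i)"
      by measurable
  qed
  have IM [measurable]: "I i \<in> borel_measurable M" for i
    using measurable_from_subalg[OF sub IF] .
  have I01: "I i \<omega> = (if \<forall>j\<in>{m..i}. \<bar>\<Sum>l\<in>{m..<j}. D l \<omega>\<bar> \<le> \<epsilon> then 1 else 0)" for i \<omega>
    unfolding I_def by (auto simp: indicator_def intro!: prod.neutral prod_zero)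
  define T where "T k \<omega> = (\<Sum>i\<in>{m..<k}. I i \<omega> * D i \<omega>)" for k \<omega>
  have TF: "T k \<in> borel_measurable (F k)" for k
    unfolding T_def using DF measurable_from_subalg[OF mono' IF]
    by (intro borel_measurable_sum borel_measurable_times) auto
  have TM [measurable]: "T k \<in> borel_measurable M" for k
    using measurable_from_subalg[OF sub TF] .
  have IDsq: "integrable M (\<lambda>\<omega>. (I i \<omega> * D i \<omega>)\<^sup>2)" for i
    by (rule Bochner_Integration.integrable_bound[OF sq[of i]]) (auto simp: I01 intro!: AE_I2)
  have T: "integrable M (\<lambda>\<omega>. (T k \<omega>)\<^sup>2) \<and>
      (\<integral>\<omega>. (T k \<omega>)\<^sup>2 \<partial>M) \<le> (\<Sum>i\<in>{m..<k}. \<integral>\<omega>. (D i \<omega>)\<^sup>2 \<partial>M)" if "m \<le> k" for k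
    using that
  proof (induction k rule: dec_induct)
    case base then show ?case by (simp add: T_def)
  next
    case (step k)
    have TS: "T (Suc k) = (\<lambda>\<omega>. T k \<omega> + I k \<omega> * D k \<omega>)"
      using step.hyps by (auto simp: T_def fun_eq_iff)
    have int1: "integrable M (\<lambda>\<omega>. (T (Suc k) \<omega>)\<^sup>2)"
      unfolding TS by (rule square_integrable_add) (use step IDsq in auto)
    have ITsq: "integrable M (\<lambda>\<omega>. (T k \<omega> * I k \<omega>)\<^sup>2)"
      by (rule Bochner_Integration.integrable_bound[of _ "\<lambda>\<omega>. (T k \<omega>)\<^sup>2"]) (use step in \<open>auto simp: I01 intro!: AE_I2\<close>)
    have cross: "integrable M (\<lambda>\<omega>. T k \<omega> * I k \<omega> * D k \<omega>)"
      by (rule square_integrable_mult) (use ITsq sq in auto)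
    have "(\<integral>\<omega>. T k \<omega> * I k \<omega> * D k \<omega> \<partial>M) = 0"
      by (rule orth[of "\<lambda>\<omega>. T k \<omega> * I k \<omega>"]) (use ITsq TF IF in auto)
    moreover have "(\<integral>\<omega>. (T (Suc k) \<omega>)\<^sup>2 \<partial>M)
        = (\<integral>\<omega>. (T k \<omega>)\<^sup>2 \<partial>M) + (\<integral>\<omega>. (I k \<omega> * D k \<omega>)\<^sup>2 \<partial>M) + 2 * (\<integral>\<omega>. T k \<omega> * I k \<omega> * D k \<omega> \<partial>M)"
      using cross IDsq step unfolding TS by (simp add: power2_sum mult.assoc)
    moreover have "(\<integral>\<omega>. (I k \<omega> * D k \<omega>)\<^sup>2 \<partial>M) \<le> (\<integral>\<omega>. (D k \<omega>)\<^sup>2 \<partial>M)"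
      by (intro integral_mono IDsq sq) (auto simp: I01)
    ultimately show ?case using step int1 by simp
  qed
  \<comment> \<open>The stopped sum \<open>T\<close> is frozen at the first exit, so its final value
    still lies outside the interval.\<close>
  have exit: "\<bar>T n \<omega>\<bar> > \<epsilon>" if ex: "\<exists>j\<in>{m..n}. \<bar>\<Sum>i\<in>{m..<j}. D i \<omega>\<bar> > \<epsilon>" for \<omega>
  proof -
    define P where "P j \<longleftrightarrow> j \<in> {m..n} \<and> \<bar>\<Sum>i\<in>{m..<j}. D i \<omega>\<bar> > \<epsilon>" for j
    define j where "j = (LEAST j. P j)"
    have "\<exists>j. P j" using ex by (auto simp: P_def)
    then have j: "P j" unfolding j_def by (rule LeastI_ex)
    have min: "\<not> P i" if "i < j" for i using not_less_Least[of i P] that by (simp add: j_def)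
    have I1: "I i \<omega> = 1" if "i \<in> {m..<j}" for i
      using min that j by (force simp: I01 P_def not_less)
    have I0: "I i \<omega> = 0" if "i \<in> {j..<n}" for i
      using that j by (force simp: I01 P_def)
    have "T n \<omega> = (\<Sum>i\<in>{m..<j}. I i \<omega> * D i \<omega>) + (\<Sum>i\<in>{j..<n}. I i \<omega> * D i \<omega>)"
      unfolding T_def using j by (simp add: P_def sum.atLeastLessThan_concat)
    also have "\<dots> = (\<Sum>i\<in>{m..<j}. D i \<omega>)"
      using I1 I0 by simp
    finally show ?thesis using j by (simp add: P_def)
  qed
  have "prob {\<omega>\<in>space M. \<exists>j\<in>{m..n}. \<bar>\<Sum>i\<in>{m..<j}. D i \<omega>\<bar> > \<epsilon>} \<le> prob {\<omega>\<in>space M. (T n \<omega>)\<^sup>2 \<ge> \<epsilon>\<^sup>2}"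
  proof (rule finite_measure_mono)
    have "(T n \<omega>)\<^sup>2 \<ge> \<epsilon>\<^sup>2" if "\<bar>T n \<omega>\<bar> > \<epsilon>" for \<omega>
      using that \<epsilon> abs_le_square_iff[of \<epsilon> "T n \<omega>"] by simp
    then show "{\<omega>\<in>space M. \<exists>j\<in>{m..n}. \<bar>\<Sum>i\<in>{m..<j}. D i \<omega>\<bar> > \<epsilon>} \<subseteq> {\<omega>\<in>space M. (T n \<omega>)\<^sup>2 \<ge> \<epsilon>\<^sup>2}"
      using exit by blast
  qed measurable
  also have "\<dots> \<le> (\<integral>\<omega>. (T n \<omega>)\<^sup>2 \<partial>M) / \<epsilon>\<^sup>2"
    using T[OF mn] \<epsilon> by (intro integral_Markov_inequality_measure[where A="{}"]) auto
  also have "\<dots> \<le> (\<Sum>i\<in>{m..<n}. \<integral>\<omega>. (D i \<omega>)\<^sup>2 \<partial>M) / \<epsilon>\<^sup>2"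
    using T[OF mn] by (intro divide_right_mono) auto
  finally show ?thesis .
qed

text \<open>The maximal inequality, with its right end sent to infinity, bounds the probability of
  ever moving by more than \<epsilon> after stage \<open>m\<close> by the variance tail
  \<open>\<tau> m\<close>. Since the tails vanish, almost every path is Cauchy.\<close>

lemma (in prob_space) martingale_differences_summable:
  fixes F :: "nat \<Rightarrow> 'a measure" and D :: "nat \<Rightarrow> 'a \<Rightarrow> real"
  assumes sub: "\<And>n. subalgebra M (F n)" and mono: "\<And>n. subalgebra (F (Suc n)) (F n)"
    and D: "\<And>n. D n \<in> borel_measurable (F (Suc n))"
    and sq: "\<And>n. integrable M (\<lambda>\<omega>. (D n \<omega>)\<^sup>2)"
    and orth: "\<And>n W. W \<in> borel_measurable (F n) \<Longrightarrow> integrable M (\<lambda>\<omega>. (W \<omega>)\<^sup>2) \<Longrightarrow>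
      (\<integral>\<omega>. W \<omega> * D n \<omega> \<partial>M) = 0"
    and sum: "summable (\<lambda>n. \<integral>\<omega>. (D n \<omega>)\<^sup>2 \<partial>M)"
  shows "AE \<omega> in M. summable (\<lambda>n. D n \<omega>)"
proof -
  have [measurable]: "D i \<in> borel_measurable M" for i
    using measurable_from_subalg[OF sub D] .
  define \<tau> where "\<tau> m = (\<Sum>i. \<integral>\<omega>. (D (i + m) \<omega>)\<^sup>2 \<partial>M)" for m
  have \<tau>0: "\<tau> \<longlonglongrightarrow> 0"
    using suminf_exist_split2[OF sum] unfolding \<tau>_def .
  have tail: "(\<Sum>i\<in>{m..<n}. \<integral>\<omega>. (D i \<omega>)\<^sup>2 \<partial>M) \<le> \<tau> m" if "m \<le> n" for m n
  proof -
    have "(\<Sum>i\<in>{m..<n}. \<integral>\<omega>. (D i \<omega>)\<^sup>2 \<partial>M) = (\<Sum>i<n - m. \<integral>\<omega>. (D (i + m) \<omega>)\<^sup>2 \<partial>M)"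
      using sum.shift_bounds_nat_ivl[of "\<lambda>i. \<integral>\<omega>. (D i \<omega>)\<^sup>2 \<partial>M" 0 m "n - m"] that
      by (simp add: lessThan_atLeast0)
    also have "\<dots> \<le> \<tau> m"
      unfolding \<tau>_def by (intro sum_le_suminf) (use sum in \<open>auto simp: summable_iff_shift[of "\<lambda>n. \<integral>\<omega>. (D n \<omega>)\<^sup>2 \<partial>M" m]\<close>)
    finally show ?thesis .
  qed
  have osc: "AE \<omega> in M. \<exists>m. \<forall>j\<ge>m. \<bar>\<Sum>i\<in>{m..<j}. D i \<omega>\<bar> \<le> \<epsilon>" if \<epsilon>: "\<epsilon> > 0" for \<epsilon>
  proof -
    define E where "E m n = {\<omega>\<in>space M. \<exists>j\<in>{m..n}. \<bar>\<Sum>i\<in>{m..<j}. D i \<omega>\<bar> > \<epsilon>}" for m n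
    have E [measurable]: "E m n \<in> sets M" for m n unfolding E_def by measurable
    have Eb: "prob (E m n) \<le> \<tau> m / \<epsilon>\<^sup>2" if "m \<le> n" for m n
    proof -
      have "prob (E m n) \<le> (\<Sum>i\<in>{m..<n}. \<integral>\<omega>. (D i \<omega>)\<^sup>2 \<partial>M) / \<epsilon>\<^sup>2"
        unfolding E_def
        by (rule martingale_maximal_inequality[where F=F]) (use sub mono D sq orth \<epsilon> that in auto)
      also have "\<dots> \<le> \<tau> m / \<epsilon>\<^sup>2" by (intro divide_right_mono tail that) simp
      finally show ?thesis .
    qed
    have U: "prob (\<Union>n. E m n) \<le> \<tau> m / \<epsilon>\<^sup>2" for m
    proof -
      have "incseq (E m)" by (force simp: incseq_def E_def)
      then have "(\<lambda>n. prob (E m n)) \<longlonglongrightarrow> prob (\<Union>n. E m n)"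
        by (intro finite_Lim_measure_incseq) auto
      then show ?thesis
        by (rule LIMSEQ_le_const2) (use Eb in auto)
    qed
    have "prob (\<Inter>m. \<Union>n. E m n) \<le> \<tau> m / \<epsilon>\<^sup>2" for m
      by (rule order_trans[OF finite_measure_mono U[of m]]) auto
    moreover have "(\<lambda>m. \<tau> m / \<epsilon>\<^sup>2) \<longlonglongrightarrow> 0"
      using tendsto_divide[OF \<tau>0 tendsto_const, of "\<epsilon>\<^sup>2"] \<epsilon> by simp
    ultimately have "prob (\<Inter>m. \<Union>n. E m n) \<le> 0"
      by (intro LIMSEQ_le_const) auto
    then have "prob (\<Inter>m. \<Union>n. E m n) = 0" by (simp add: measure_le_0_iff)
    then have "AE \<omega> in M. \<omega> \<notin> (\<Inter>m. \<Union>n. E m n)"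
      by (intro AE_not_in) (auto simp: null_sets_def emeasure_eq_measure)
    then show ?thesis
      using AE_space
    proof eventually_elim
      case (elim \<omega>)
      then obtain m where "\<And>n. \<omega> \<notin> E m n" by auto
      with elim have "\<forall>j\<ge>m. \<bar>\<Sum>i\<in>{m..<j}. D i \<omega>\<bar> \<le> \<epsilon>"
        by (force simp: E_def not_less)
      then show ?case by blast
    qed
  qed
  \<comment> \<open>Countably many radii, so that one null set serves for all of them.\<close>
  have "AE \<omega> in M. \<forall>p. \<exists>m. \<forall>j\<ge>m. \<bar>\<Sum>i\<in>{m..<j}. D i \<omega>\<bar> \<le> 1 / real (Suc p)"
    by (subst AE_all_countable) (auto intro!: osc)
  then show ?thesis
  proof eventually_elim
    case (elim \<omega>)
    show ?case
    proof (subst summable_Cauchy, intro allI impI)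
      fix e :: real assume "e > 0"
      then obtain p where p: "1 / real (Suc p) < e / 2"
        using nat_approx_posE[of "e/2"] by auto
      obtain m where m: "\<And>j. j \<ge> m \<Longrightarrow> \<bar>\<Sum>i\<in>{m..<j}. D i \<omega>\<bar> \<le> 1 / real (Suc p)"
        using elim by blast
      show "\<exists>N. \<forall>a\<ge>N. \<forall>b. norm (\<Sum>i\<in>{a..<b}. D i \<omega>) < e"
      proof (intro exI[of _ m] allI impI)
        fix a b assume a: "m \<le> a"
        show "norm (\<Sum>i\<in>{a..<b}. D i \<omega>) < e"
        proof (cases "a \<le> b")
          case True
          then have "(\<Sum>i\<in>{m..<b}. D i \<omega>) = (\<Sum>i\<in>{m..<a}. D i \<omega>) + (\<Sum>i\<in>{a..<b}. D i \<omega>)"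
            using a by (simp add: sum.atLeastLessThan_concat)
          with m[of a] m[of b] a True p show ?thesis unfolding real_norm_def by linarith
        qed (use \<open>e > 0\<close> in simp)
      qed
    qed
  qed
qed

section \<open>Weak convergence of asymptotically orthogonal sequences\<close>

text \<open>If \<open>E (g U\<^sub>n)\<close> stayed away from 0 along a subsequence, the average of
  \<open>K\<close> nearly orthogonal members would have norm of order \<open>1 / sqrt K\<close>, contradicting
  Cauchy--Schwarz.\<close>

lemma (in prob_space) asymptotically_orthogonal_weakly_null:
  fixes U :: "nat \<Rightarrow> 'a \<Rightarrow> real"
  assumes U [measurable]: "\<And>n. U n \<in> borel_measurable M" and bd: "\<And>n \<omega>. \<bar>U n \<omega>\<bar> \<le> C"
    and orth: "\<And>m. (\<lambda>n. \<integral>\<omega>. U m \<omega> * U n \<omega> \<partial>M) \<longlonglongrightarrow> 0"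
    and g [measurable]: "g \<in> borel_measurable M" and gb: "\<And>\<omega>. \<bar>g \<omega>\<bar> \<le> (G::real)"
  shows "(\<lambda>n. \<integral>\<omega>. g \<omega> * U n \<omega> \<partial>M) \<longlonglongrightarrow> 0"
proof (rule ccontr)
  define a where "a n = (\<integral>\<omega>. g \<omega> * U n \<omega> \<partial>M)" for n
  assume "\<not> (\<lambda>n. \<integral>\<omega>. g \<omega> * U n \<omega> \<partial>M) \<longlonglongrightarrow> 0"
  then obtain \<epsilon> where \<epsilon>: "\<epsilon> > 0" and freq: "\<And>N. \<exists>n\<ge>N. \<bar>a n\<bar> \<ge> \<epsilon>"
    unfolding a_def[symmetric] by (fastforce simp: LIMSEQ_iff not_less)
  have C: "C \<ge> 0" using bd[of 0 undefined] by linarith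
  have G: "G \<ge> 0" using gb[of undefined] by linarith
  \<comment> \<open>Greedy choice: the next index lies beyond all earlier ones and so far out that
    it is nearly uncorrelated with each of them.\<close>
  have pick: "\<exists>S. finite S \<and> card S = k \<and> (\<forall>n\<in>S. \<bar>a n\<bar> \<ge> \<epsilon>) \<and>
      (\<forall>m\<in>S. \<forall>n\<in>S. m \<noteq> n \<longrightarrow> \<bar>\<integral>\<omega>. U m \<omega> * U n \<omega> \<partial>M\<bar> \<le> \<delta>)" if \<delta>: "\<delta> > 0" for k :: nat and \<delta>
  proof (induction k)
    case 0 then show ?case by (intro exI[of _ "{}"]) auto
  next
    case (Suc k)
    then obtain S where S: "finite S" "card S = k" "\<forall>n\<in>S. \<bar>a n\<bar> \<ge> \<epsilon>"
      "\<forall>m\<in>S. \<forall>n\<in>S. m \<noteq> n \<longrightarrow> \<bar>\<integral>\<omega>. U m \<omega> * U n \<omega> \<partial>M\<bar> \<le> \<delta>" by blast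
    have "\<forall>\<^sub>F n in sequentially. \<bar>\<integral>\<omega>. U m \<omega> * U n \<omega> \<partial>M\<bar> < \<delta>" for m
      using tendstoD[OF orth[of m] \<delta>] by (simp add: dist_real_def)
    then have "\<forall>\<^sub>F n in sequentially. \<forall>m\<in>S. \<bar>\<integral>\<omega>. U m \<omega> * U n \<omega> \<partial>M\<bar> < \<delta>"
      using S(1) by (simp add: eventually_ball_finite)
    then obtain N where N: "\<And>n m. n \<ge> N \<Longrightarrow> m \<in> S \<Longrightarrow> \<bar>\<integral>\<omega>. U m \<omega> * U n \<omega> \<partial>M\<bar> < \<delta>"
      by (auto simp: eventually_sequentially)
    obtain n where n: "n \<ge> max N (Suc (Max (insert 0 S)))" "\<bar>a n\<bar> \<ge> \<epsilon>" using freq by blast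
    have nS: "n \<notin> S" 
    proof
      assume "n \<in> S"
      then have "n \<le> Max (insert 0 S)" using S(1) by (intro Max_ge) auto
      with n(1) show False by linarith
    qed
    show ?case
    proof (intro exI[of _ "insert n S"] conjI)
      show "\<forall>p\<in>insert n S. \<forall>q\<in>insert n S. p \<noteq> q \<longrightarrow> \<bar>\<integral>\<omega>. U p \<omega> * U q \<omega> \<partial>M\<bar> \<le> \<delta>"
      proof (intro ballI impI)
        fix p q assume pq: "p \<in> insert n S" "q \<in> insert n S" "p \<noteq> q"
        have Nn: "\<bar>\<integral>\<omega>. U m \<omega> * U n \<omega> \<partial>M\<bar> \<le> \<delta>" if "m \<in> S" for m
          using N[OF _ that, of n] n(1) by simp
        consider "p \<in> S" "q \<in> S" | "p = n" "q \<in> S" | "q = n" "p \<in> S" using pq by blast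
        then show "\<bar>\<integral>\<omega>. U p \<omega> * U q \<omega> \<partial>M\<bar> \<le> \<delta>"
        proof cases
          case 2
          have "(\<integral>\<omega>. U n \<omega> * U q \<omega> \<partial>M) = (\<integral>\<omega>. U q \<omega> * U n \<omega> \<partial>M)"
            by (rule Bochner_Integration.integral_cong) auto
          then show ?thesis using 2 Nn by simp
        qed (use S(4) pq Nn in blast)+
      qed
    qed (use S nS n in auto)
  qed
  \<comment> \<open>Large enough to contradict the inequality \<open>real K * \<epsilon>\<^sup>2
    \<le> G\<^sup>2 * (C\<^sup>2 + 1)\<close> reached at the end.\<close>
  obtain K :: nat where K: "K > 0" "real K > G\<^sup>2 * (C\<^sup>2 + 1) / \<epsilon>\<^sup>2"
    using reals_Archimedean2[of "max 0 (G\<^sup>2 * (C\<^sup>2 + 1) / \<epsilon>\<^sup>2)"]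
    unfolding max_less_iff_conj by (metis of_nat_0_less_iff)
  \<comment> \<open>With tolerance \<open>1 / real K\<close> the \<open>K * K\<close> pairs together
    contribute only \<open>K\<close> to the second moment of \<open>V\<close>, no more than the
    order of the diagonal.\<close>
  obtain S where S: "finite S" "card S = K" "\<And>n. n\<in>S \<Longrightarrow> \<bar>a n\<bar> \<ge> \<epsilon>"
      "\<And>m n. m\<in>S \<Longrightarrow> n\<in>S \<Longrightarrow> m \<noteq> n \<Longrightarrow> \<bar>\<integral>\<omega>. U m \<omega> * U n \<omega> \<partial>M\<bar> \<le> 1 / real K"
    using pick[of "1 / real K" K] K by auto
  define V where "V \<omega> = (\<Sum>n\<in>S. sgn (a n) * U n \<omega>)" for \<omega>
  have V [measurable]: "V \<in> borel_measurable M" unfolding V_def by measurable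
  have intU: "integrable M (\<lambda>\<omega>. U m \<omega> * U n \<omega>)" for m n
    by (rule integrable_const_bound[where B="C * C"])
      (auto simp: abs_mult intro!: mult_mono bd C)
  have intgU: "integrable M (\<lambda>\<omega>. g \<omega> * U n \<omega>)" for n
    by (rule integrable_const_bound[where B="G * C"])
      (auto simp: abs_mult intro!: mult_mono bd gb G)
  have intg: "integrable M (\<lambda>\<omega>. (g \<omega>)\<^sup>2)"
    by (rule integrable_const_bound[where B="G\<^sup>2"])
      (use gb G in \<open>auto simp: abs_le_square_iff[symmetric]\<close>)
  have sq: "(\<lambda>\<omega>. (V \<omega>)\<^sup>2) = (\<lambda>\<omega>. \<Sum>m\<in>S. \<Sum>n\<in>S. sgn (a m) * sgn (a n) * (U m \<omega> * U n \<omega>))"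
    by (auto simp: fun_eq_iff V_def power2_eq_square sum_product intro!: sum.cong)
  have intV: "integrable M (\<lambda>\<omega>. (V \<omega>)\<^sup>2)" unfolding sq using intU by auto
  have sgn1: "\<bar>sgn x\<bar> \<le> 1" for x :: real by (auto simp: sgn_if)
  have "(\<integral>\<omega>. (V \<omega>)\<^sup>2 \<partial>M) = (\<Sum>m\<in>S. \<Sum>n\<in>S. sgn (a m) * sgn (a n) * (\<integral>\<omega>. U m \<omega> * U n \<omega> \<partial>M))"
    unfolding sq using intU by simp
  also have "\<dots> \<le> (\<Sum>m\<in>S. \<Sum>n\<in>S. (if m = n then C\<^sup>2 else 0) + 1 / real K)"
  proof (intro sum_mono)
    fix m n assume mn: "m \<in> S" "n \<in> S"
    have "sgn (a m) * sgn (a n) * (\<integral>\<omega>. U m \<omega> * U n \<omega> \<partial>M) \<le> 1 * 1 * \<bar>\<integral>\<omega>. U m \<omega> * U n \<omega> \<partial>M\<bar>"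
      by (rule order_trans[OF abs_ge_self]) (unfold abs_mult, intro mult_mono sgn1, auto)
    also have "\<dots> \<le> (if m = n then C\<^sup>2 else 0) + 1 / real K"
    proof (cases "m = n")
      case True
      have "(\<integral>\<omega>. U n \<omega> * U n \<omega> \<partial>M) \<le> (\<integral>\<omega>. C\<^sup>2 \<partial>M)"
        using bd intU[of n n] by (intro integral_mono) (auto simp: power2_eq_square[symmetric] abs_le_square_iff[symmetric] C)
      then show ?thesis using True by (simp add: prob_space add_increasing2)
    qed (use S(4) mn in auto)
    finally show "sgn (a m) * sgn (a n) * (\<integral>\<omega>. U m \<omega> * U n \<omega> \<partial>M) \<le> (if m = n then C\<^sup>2 else 0) + 1 / real K" .
  qed
  also have "\<dots> = real K * (C\<^sup>2 + 1)"
    using S(1,2) K by (simp add: sum.distrib algebra_simps)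
  finally have Vb: "(\<integral>\<omega>. (V \<omega>)\<^sup>2 \<partial>M) \<le> real K * (C\<^sup>2 + 1)" .
  have intgV: "integrable M (\<lambda>\<omega>. g \<omega> * V \<omega>)"
    by (rule square_integrable_mult) (use intg intV in auto)
  have "(\<integral>\<omega>. g \<omega> * V \<omega> \<partial>M) = (\<Sum>n\<in>S. sgn (a n) * a n)"
  proof -
    have "(\<lambda>\<omega>. g \<omega> * V \<omega>) = (\<lambda>\<omega>. \<Sum>n\<in>S. sgn (a n) * (g \<omega> * U n \<omega>))"
      by (auto simp: V_def sum_distrib_left fun_eq_iff mult.left_commute)
    then show ?thesis using intgU by (simp add: a_def)
  qed
  also have "\<dots> \<ge> (\<Sum>n\<in>S. \<epsilon>)"
    using S(3) by (intro sum_mono) (auto simp: sgn_mult_self_eq abs_sgn mult.commute)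
  finally have lower: "real K * \<epsilon> \<le> (\<integral>\<omega>. g \<omega> * V \<omega> \<partial>M)" using S(2) by simp
  \<comment> \<open>The minimiser of the quadratic bound for the integral of
    \<open>(g - s * V)\<^sup>2\<close>: this is Cauchy--Schwarz in the form of a
    discriminant.\<close>
  define s where "s = \<epsilon> / (C\<^sup>2 + 1)"
  have C1: "C\<^sup>2 + 1 > 0" by (simp add: add_nonneg_pos)
  have "0 \<le> (\<integral>\<omega>. (g \<omega> - s * V \<omega>)\<^sup>2 \<partial>M)" by simp
  also have "\<dots> = (\<integral>\<omega>. (g \<omega>)\<^sup>2 \<partial>M) - 2 * s * (\<integral>\<omega>. g \<omega> * V \<omega> \<partial>M) + s\<^sup>2 * (\<integral>\<omega>. (V \<omega>)\<^sup>2 \<partial>M)"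
  proof -
    have "(\<lambda>\<omega>. (g \<omega> - s * V \<omega>)\<^sup>2) = (\<lambda>\<omega>. (g \<omega>)\<^sup>2 - 2 * s * (g \<omega> * V \<omega>) + s\<^sup>2 * (V \<omega>)\<^sup>2)"
      by (auto simp: fun_eq_iff power2_eq_square algebra_simps)
    then show ?thesis using intg intV intgV by simp
  qed
  also have "\<dots> \<le> G\<^sup>2 - 2 * s * (real K * \<epsilon>) + s\<^sup>2 * (real K * (C\<^sup>2 + 1))"
  proof -
    have "(\<integral>\<omega>. (g \<omega>)\<^sup>2 \<partial>M) \<le> (\<integral>\<omega>. G\<^sup>2 \<partial>M)"
      using intg gb by (intro integral_mono) (auto simp: abs_le_square_iff[symmetric] G)
    moreover have "2 * s * (real K * \<epsilon>) \<le> 2 * s * (\<integral>\<omega>. g \<omega> * V \<omega> \<partial>M)"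
      using lower \<epsilon> C1 by (intro mult_left_mono) (auto simp: s_def)
    moreover have "s\<^sup>2 * (\<integral>\<omega>. (V \<omega>)\<^sup>2 \<partial>M) \<le> s\<^sup>2 * (real K * (C\<^sup>2 + 1))"
      using Vb by (intro mult_left_mono) auto
    ultimately show ?thesis by (simp add: prob_space)
  qed
  also have "\<dots> = G\<^sup>2 - real K * \<epsilon>\<^sup>2 / (C\<^sup>2 + 1)"
  proof -
    have "c > 0 \<Longrightarrow> G\<^sup>2 - 2 * (\<epsilon> / c) * (real K * \<epsilon>) + (\<epsilon> / c)\<^sup>2 * (real K * c) = G\<^sup>2 - real K * \<epsilon>\<^sup>2 / c" for c
      by (simp add: field_simps power2_eq_square)
    from this[OF C1] show ?thesis unfolding s_def .
  qed
  finally have "real K * \<epsilon>\<^sup>2 \<le> G\<^sup>2 * (C\<^sup>2 + 1)" using C1 by (simp add: field_simps)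
  then show False using K(2) \<epsilon> by (simp add: divide_less_eq)
qed

section \<open>Mixed factorial moments of the multivariate hypergeometric distribution\<close>

text \<open>Generating function form of the identity (j choose p)(h choose j) = (h choose p)(h - p
  choose j - p). Any range \<open>{..C}\<close> that contains \<open>h\<close> gives the same
  polynomial.\<close>

lemma binomial_moment_poly:
  fixes h p C :: nat
  assumes "h \<le> C"
  shows "(\<Sum>j\<le>C. monom (real ((j choose p) * (h choose j))) j)
    = smult (real (h choose p)) (monom 1 p * [:1, 1:] ^ (h - p))"
proof (rule poly_eqI)
  fix n
  have "coeff (\<Sum>j\<le>C. monom (real ((j choose p) * (h choose j))) j) n
      = real ((n choose p) * (h choose n))"
  proof -
    have "coeff (\<Sum>j\<le>C. monom (real ((j choose p) * (h choose j))) j) n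
        = (\<Sum>j\<le>C. if j = n then real ((n choose p) * (h choose n)) else 0)"
      unfolding coeff_sum by (rule sum.cong) auto
    then show ?thesis using assms by (simp add: binomial_eq_0)
  qed
  also have "\<dots> = real (h choose p) * (if n < p then 0 else real ((h - p) choose (n - p)))"
  proof (cases "p \<le> n \<and> n \<le> h")
    case True
    then show ?thesis
      using choose_mult[of p n h] by (simp flip: of_nat_mult add: mult.commute)
  next
    case False
    then have "n < p \<or> h < n" by auto
    then show ?thesis by (auto simp: binomial_eq_0)
  qed
  also have "\<dots> = coeff (smult (real (h choose p)) (monom 1 p * [:1, 1:] ^ (h - p))) n"
  proof (cases "p \<le> n \<and> n - p \<le> h - p")
    case True
    then show ?thesis by (simp add: coeff_monom_mult coeff_linear_poly_power)
  next
    case False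
    have "degree ([:1, 1:] ^ (h - p) :: real poly) = h - p"
      by (simp add: degree_power_eq)
    then have "n - p > h - p \<Longrightarrow> coeff ([:1, 1:] ^ (h - p) :: real poly) (n - p) = 0"
      by (intro coeff_eq_0) simp
    with False show ?thesis by (auto simp: coeff_monom_mult not_le binomial_eq_0)
  qed
  finally show "coeff (\<Sum>j\<le>C. monom (real ((j choose p) * (h choose j))) j) n
    = coeff (smult (real (h choose p)) (monom 1 p * [:1, 1:] ^ (h - p))) n" .
qed

text \<open>Up to the factor \<open>s choose r\<close>, the sum over the \<open>x\<close> with total
  \<open>r\<close> is the coefficient of z^r in a product of one-colour generating functions, which
  collapses to a multiple of z^q (1 + z)^(s - q). The cube bound \<open>C\<close> keeps the index
  set independent of the composition \<open>h\<close>, which is random in the application.\<close>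

lemma mv_hypergeometric_moment:
  fixes h p :: "nat \<Rightarrow> nat" and d r s C :: nat
  defines "q \<equiv> (\<Sum>k=1..d. p k)"
  assumes s: "s = (\<Sum>k=1..d. h k)" and r: "r \<le> s" "r \<le> C" and q: "q \<le> s"
  shows "(\<Sum>x\<in>PiE {1..d} (\<lambda>_. {..C}). (\<Prod>k=1..d. real (x k choose p k)) * mv_hypergeometric d s r h x)
    = (\<Prod>k=1..d. real (h k choose p k)) * real (r choose q) / real (s choose q)"
proof -
  \<comment> \<open>The cube is enlarged to contain all \<open>h k\<close>; a point outside the
    original cube has total above \<open>C \<ge> r\<close> and carries no mass.\<close>
  define C' where "C' = C + s"
  have hC: "h k \<le> C'" if "k \<in> {1..d}" for k
    using member_le_sum[of k "{1..d}" h] that by (simp add: C'_def s)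
  define w where "w x = (\<Prod>k=1..d. real ((x k choose p k) * (h k choose x k)))" for x :: "nat \<Rightarrow> nat"
  have summand: "(\<Prod>k=1..d. real (x k choose p k)) * mv_hypergeometric d s r h x
      = (if (\<Sum>k=1..d. x k) = r then w x else 0) / real (s choose r)" for x
    by (auto simp: mv_hypergeometric_def w_def prod.distrib not_le binomial_eq_0)
  have "(\<Sum>x\<in>PiE {1..d} (\<lambda>_. {..C}). (\<Prod>k=1..d. real (x k choose p k)) * mv_hypergeometric d s r h x)
      = (\<Sum>x\<in>PiE {1..d} (\<lambda>_. {..C'}). (\<Prod>k=1..d. real (x k choose p k)) * mv_hypergeometric d s r h x)"
  proof (rule sum.mono_neutral_left)
    show "PiE {1..d} (\<lambda>_. {..C}) \<subseteq> PiE {1..d} (\<lambda>_. {..C'})"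
      by (auto simp: C'_def intro!: PiE_mono)
    show "\<forall>x\<in>PiE {1..d} (\<lambda>_. {..C'}) - PiE {1..d} (\<lambda>_. {..C}).
      (\<Prod>k=1..d. real (x k choose p k)) * mv_hypergeometric d s r h x = 0"
    proof
      fix x assume x: "x \<in> PiE {1..d} (\<lambda>_. {..C'}) - PiE {1..d} (\<lambda>_. {..C})"
      then obtain k where k: "k \<in> {1..d}" "x k > C" by (auto simp: PiE_iff not_le)
      then have "(\<Sum>k=1..d. x k) > C" using member_le_sum[of k "{1..d}" x] by simp
      then show "(\<Prod>k=1..d. real (x k choose p k)) * mv_hypergeometric d s r h x = 0"
        using r by (simp add: mv_hypergeometric_def)
    qed
  qed (auto intro: finite_PiE)
  also have "\<dots> = coeff (\<Sum>x\<in>PiE {1..d} (\<lambda>_. {..C'}). monom (w x) (\<Sum>k=1..d. x k)) r / real (s choose r)"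
    unfolding summand by (simp add: coeff_sum sum_divide_distrib if_distrib cong: if_cong)
  also have "(\<Sum>x\<in>PiE {1..d} (\<lambda>_. {..C'}). monom (w x) (\<Sum>k=1..d. x k))
      = (\<Prod>k=1..d. \<Sum>j\<le>C'. monom (real ((j choose p k) * (h k choose j))) j)"
  proof -
    have "finite I \<Longrightarrow> (\<Prod>k\<in>I. monom (f k) (g k)) = monom (\<Prod>k\<in>I. f k) (\<Sum>k\<in>I. g k)" for I and f :: "nat \<Rightarrow> real" and g
      by (induction I rule: finite_induct) (auto simp: mult_monom)
    then show ?thesis by (subst prod_sum_PiE) (auto simp: w_def)
  qed
  also have "\<dots> = (\<Prod>k=1..d. smult (real (h k choose p k)) (monom 1 (p k) * [:1, 1:] ^ (h k - p k)))"
    by (intro prod.cong refl binomial_moment_poly hC)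
  also have "\<dots> = smult (\<Prod>k=1..d. real (h k choose p k)) (monom 1 q * [:1, 1:] ^ (\<Sum>k=1..d. h k - p k))"
  proof -
    have "finite I \<Longrightarrow> (\<Prod>k\<in>I. smult (f k) (monom 1 (p k) * [:1, 1:] ^ g k))
        = smult (\<Prod>k\<in>I. f k) (monom 1 (\<Sum>k\<in>I. p k) * [:1, 1:] ^ (\<Sum>k\<in>I. g k))" for I and f :: "nat \<Rightarrow> real" and g
      by (induction I rule: finite_induct) (simp_all add: power_add ac_simps
        flip: mult_monom[of "1::real" _ 1, simplified])
    then show ?thesis by (simp add: q_def)
  qed
  also have "coeff \<dots> r / real (s choose r)
      = (\<Prod>k=1..d. real (h k choose p k)) * real (r choose q) / real (s choose q)"
  \<comment> \<open>If some \<open>p k\<close> exceeds \<open>h k\<close>, the common factor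
    vanishes on both sides; otherwise the truncated differences \<open>h k - p k\<close> add up to
    \<open>s - q\<close>.\<close>
  proof (cases "\<forall>k\<in>{1..d}. p k \<le> h k")
    case False
    then obtain k where "k \<in> {1..d}" "real (h k choose p k) = 0"
      by (auto simp: not_le binomial_eq_0)
    then have z: "(\<Prod>k=1..d. real (h k choose p k)) = 0"
      by (intro prod_zero) auto
    show ?thesis by (simp only: z coeff_smult mult_zero_left div_0)
  next
    case True
    then have "\<And>k. k \<in> {1..d} \<Longrightarrow> p k \<le> h k" by blast
    then have e: "(\<Sum>k=1..d. h k - p k) = s - q"
      unfolding s q_def by (intro sum_subtractf_nat) auto
    show ?thesis
    proof (cases "q \<le> r")
      case True
      have "coeff ([:1, 1:] ^ (s - q)) (r - q) = real ((s - q) choose (r - q))"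
        using r True by (simp add: coeff_linear_poly_power)
      moreover have "real ((s - q) choose (r - q)) / real (s choose r) = real (r choose q) / real (s choose q)"
        using choose_mult[OF True r(1)] r q by (simp add: field_simps flip: of_nat_mult)
      moreover have "coeff (smult c (monom 1 q * [:1, 1:] ^ (s - q))) r = c * coeff ([:1, 1:] ^ (s - q)) (r - q)" for c :: real
        using True by (simp add: coeff_monom_mult)
      ultimately show ?thesis
        unfolding e by (metis times_divide_eq_right)
    qed (simp add: e coeff_monom_mult binomial_eq_0)
  qed
  finally show ?thesis .
qed

section \<open>The filtration of the urn\<close>

lemma space_sigma_gen [simp]: "space (sigma_gen M Y) = space M"
  unfolding sigma_gen_def by (rule space_measure_of) auto

lemma sets_sigma_gen:
  "sets (sigma_gen M Y) = sigma_sets (space M) {f -` B \<inter> space M | f B. f \<in> Y}"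
  unfolding sigma_gen_def by (rule sets_measure_of) auto

lemma measurable_sigma_gen:
  "f \<in> Y \<Longrightarrow> f \<in> measurable (sigma_gen M Y) (count_space UNIV)"
  by (rule measurableI) (auto simp: sets_sigma_gen)

lemma subalgebra_sigma_gen_mono:
  "Y \<subseteq> Y' \<Longrightarrow> subalgebra (sigma_gen M Y') (sigma_gen M Y)"
  unfolding subalgebra_def sets_sigma_gen by (auto intro!: sigma_sets_mono')

lemma subalgebra_sigma_gen:
  assumes "\<And>f. f \<in> Y \<Longrightarrow> f \<in> measurable M (count_space UNIV)"
  shows "subalgebra M (sigma_gen M Y)"
  unfolding subalgebra_def sets_sigma_gen
  using assms by (auto intro!: sets.sigma_sets_subset measurable_sets)

text \<open>On the natural numbers all sets are Borel sets; this permits sums to be treated by the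
  closure rules for Borel measurability.\<close>

lemma measurable_nat_of_borel:
  fixes f :: "'a \<Rightarrow> nat"
  shows "f \<in> borel_measurable M \<Longrightarrow> f \<in> measurable M (count_space UNIV)"
  using measurable_cong_sets[OF refl sets_borel_eq_count_space, of M] by auto

lemma measurable_nat_to_borel:
  fixes f :: "'a \<Rightarrow> nat"
  shows "f \<in> measurable M (count_space UNIV) \<Longrightarrow> f \<in> borel_measurable M"
  using measurable_cong_sets[OF refl sets_borel_eq_count_space, of M] by auto

lemma measurable_nat_mult:
  fixes f g :: "'a \<Rightarrow> nat"
  assumes f: "f \<in> measurable M (count_space UNIV)" and g: "g \<in> measurable M (count_space UNIV)"
  shows "(\<lambda>x. f x * g x) \<in> measurable M (count_space UNIV)"
  by (rule measurable_compose_countable[OF measurable_compose[OF g measurable_count_space] f])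

context reinforced_urn
begin

abbreviation H where "H \<equiv> urn_H h0 X A"
abbreviation S where "S \<equiv> urn_S d h0 X A"
abbreviation Zn where "Zn \<equiv> urn_Z d h0 X A"
abbreviation FF where "FF \<equiv> urn_F M d N X A"
abbreviation GG where "GG \<equiv> urn_G M d N X A"

text \<open>All that precedes the replacements of stage \<open>n + 1\<close>: the history, the
  number of balls and the draw itself. By assumption (III) the replacements of that stage are
  independent of it. It lies between \<open>GG n\<close> and \<open>FF (Suc n)\<close>.\<close>

definition urn_K :: "nat \<Rightarrow> 'w measure" where
  "urn_K n = sigma_gen M (urn_hist d N X A n \<union> {N (Suc n)} \<union> {X (Suc n) k | k. k \<in> {1..d}})"

lemma urn_hist_eq:
  "urn_hist d N X A n = (\<Union>i\<in>{1..n}. insert (N i) (X i ` {1..d} \<union> A i ` {1..d}))"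
  unfolding urn_hist_def by blast

lemma urn_hist_mono: "i \<le> n \<Longrightarrow> urn_hist d N X A i \<subseteq> urn_hist d N X A n"
  unfolding urn_hist_eq by (rule UN_mono) auto

lemma hist_measurable:
  "f \<in> urn_hist d N X A n \<Longrightarrow> f \<in> measurable M (count_space UNIV)"
proof -
  assume "f \<in> urn_hist d N X A n"
  then obtain i where i: "i \<in> {1..n}" "f \<in> insert (N i) (X i ` {1..d} \<union> A i ` {1..d})"
    unfolding urn_hist_eq by blast
  from i(1) obtain j where "i = Suc j" by (cases i) auto
  with i(2) show ?thesis using N_measurable X_measurable A_measurable by auto
qed

lemma subalgebra_F: "subalgebra M (FF n)"
  unfolding urn_F_def by (rule subalgebra_sigma_gen) (rule hist_measurable)

lemma subalgebra_G: "subalgebra M (GG n)"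
  unfolding urn_G_def by (rule subalgebra_sigma_gen) (auto intro: hist_measurable N_measurable)

lemma subalgebra_K: "subalgebra M (urn_K n)"
  unfolding urn_K_def by (rule subalgebra_sigma_gen) (auto intro: hist_measurable N_measurable X_measurable)

lemma subalgebra_G_F: "subalgebra (GG n) (FF n)"
  unfolding urn_G_def urn_F_def by (rule subalgebra_sigma_gen_mono) auto

lemma subalgebra_K_G: "subalgebra (urn_K n) (GG n)"
  unfolding urn_G_def urn_K_def by (rule subalgebra_sigma_gen_mono) auto

lemma subalgebra_F_K: "subalgebra (FF (Suc n)) (urn_K n)"
  unfolding urn_F_def urn_K_def
proof (rule subalgebra_sigma_gen_mono)
  have n: "Suc n \<in> {1..Suc n}" by simp
  have "{N (Suc n)} \<union> {X (Suc n) k | k. k \<in> {1..d}} \<subseteq> urn_hist d N X A (Suc n)"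
    unfolding urn_hist_eq using n by blast
  then show "urn_hist d N X A n \<union> {N (Suc n)} \<union> {X (Suc n) k | k. k \<in> {1..d}} \<subseteq> urn_hist d N X A (Suc n)"
    using urn_hist_mono[of n "Suc n"] by auto
qed

lemma subalgebra_trans: "subalgebra P Q \<Longrightarrow> subalgebra Q R \<Longrightarrow> subalgebra P R"
  by (auto simp: subalgebra_def)

lemma subalgebra_K_F: "subalgebra (urn_K n) (FF n)"
  by (rule subalgebra_trans[OF subalgebra_K_G subalgebra_G_F])

lemma subalgebra_F_mono: "i \<le> n \<Longrightarrow> subalgebra (FF n) (FF i)"
  unfolding urn_F_def by (rule subalgebra_sigma_gen_mono) (rule urn_hist_mono)

lemma A_measurable_F: "i < n \<Longrightarrow> k \<in> {1..d} \<Longrightarrow> A (Suc i) k \<in> measurable (FF n) (count_space UNIV)"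
  unfolding urn_F_def by (rule measurable_sigma_gen) (use Suc_le_eq[of i n] in \<open>force simp: urn_hist_eq\<close>)

lemma X_measurable_F: "i < n \<Longrightarrow> k \<in> {1..d} \<Longrightarrow> X (Suc i) k \<in> measurable (FF n) (count_space UNIV)"
  unfolding urn_F_def by (rule measurable_sigma_gen) (use Suc_le_eq[of i n] in \<open>force simp: urn_hist_eq\<close>)

lemma N_measurable_F: "i < n \<Longrightarrow> N (Suc i) \<in> measurable (FF n) (count_space UNIV)"
  unfolding urn_F_def by (rule measurable_sigma_gen) (use Suc_le_eq[of i n] in \<open>force simp: urn_hist_eq\<close>)

lemma X_measurable_K: "k \<in> {1..d} \<Longrightarrow> X (Suc n) k \<in> measurable (urn_K n) (count_space UNIV)"
  unfolding urn_K_def by (rule measurable_sigma_gen) auto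

lemma H_measurable_F: "i \<le> n \<Longrightarrow> k \<in> {1..d} \<Longrightarrow> H i k \<in> measurable (FF n) (count_space UNIV)"
proof -
  assume a: "i \<le> n" "k \<in> {1..d}"
  have *: "H i k = (\<lambda>\<omega>. h0 k + (\<Sum>j<i. A (Suc j) k \<omega> * X (Suc j) k \<omega>))"
    by (auto simp: urn_H_def fun_eq_iff sum.atLeast1_atMost_eq)
  show ?thesis
    unfolding * by (rule measurable_nat_of_borel, intro borel_measurable_add borel_measurable_sum
      measurable_nat_to_borel[OF measurable_nat_mult] A_measurable_F X_measurable_F) (use a in auto)
qed

lemma S_measurable_F: "i \<le> n \<Longrightarrow> S i \<in> measurable (FF n) (count_space UNIV)"
  unfolding urn_S_def[abs_def]
  by (rule measurable_nat_of_borel, intro borel_measurable_sum measurable_nat_to_borel H_measurable_F) auto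

lemma measurable_M_of_F: "f \<in> measurable (FF n) L \<Longrightarrow> f \<in> measurable M L"
  by (rule measurable_from_subalg[OF subalgebra_F])
lemma measurable_G_of_F: "f \<in> measurable (FF n) L \<Longrightarrow> f \<in> measurable (GG n) L"
  by (rule measurable_from_subalg[OF subalgebra_G_F])
lemma measurable_K_of_F: "f \<in> measurable (FF n) L \<Longrightarrow> f \<in> measurable (urn_K n) L"
  by (rule measurable_from_subalg[OF subalgebra_K_F])

lemma H_measurable [measurable]: "k \<in> {1..d} \<Longrightarrow> H n k \<in> measurable M (count_space UNIV)"
  by (rule measurable_M_of_F[OF H_measurable_F[OF order_refl]])
lemma S_measurable [measurable]: "S n \<in> measurable M (count_space UNIV)"
  by (rule measurable_M_of_F[OF S_measurable_F[OF order_refl]])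
declare N_measurable [measurable] X_measurable [measurable] A_measurable [measurable]

lemma H_Suc: "H (Suc n) k \<omega> = H n k \<omega> + A (Suc n) k \<omega> * X (Suc n) k \<omega>"
  by (simp add: urn_H_def)

lemma H_pos: "k \<in> {1..d} \<Longrightarrow> H n k \<omega> > 0"
  using h0_pos[of k] by (simp add: urn_H_def)

lemma S_ge_d: "S n \<omega> \<ge> d"
proof -
  have "(\<Sum>k=1..d. 1) \<le> (\<Sum>k=1..d. H n k \<omega>)"
    using H_pos by (intro sum_mono) (simp add: Suc_le_eq)
  then show ?thesis by (simp add: urn_S_def)
qed

lemma H_le_S: "k \<in> {1..d} \<Longrightarrow> H n k \<omega> \<le> S n \<omega>"
  unfolding urn_S_def by (rule member_le_sum) auto

text \<open>The pathwise part of the standing assumptions, at all stages at once, so that elementary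
  estimates hold on a single event of probability one.\<close>

definition good :: "'w \<Rightarrow> bool" where
  "good \<omega> \<longleftrightarrow> (\<forall>n. (\<Sum>k=1..d. X (Suc n) k \<omega>) = N (Suc n) \<omega> \<and>
     N (Suc n) \<omega> \<in> {1..min (S n \<omega>) C1} \<and> (\<forall>k\<in>{1..d}. A (Suc n) k \<omega> \<ge> 1))"

lemma AE_good: "AE \<omega> in M. good \<omega>"
proof -
  have "AE \<omega> in M. \<forall>k\<in>{1..d}. A (Suc n) k \<omega> \<ge> 1" for n
    using A_ge_1 by (simp add: AE_ball_countable)
  then show ?thesis
    unfolding good_def AE_all_countable using X_sum N_range by auto
qed

lemma good_X_le: "good \<omega> \<Longrightarrow> k \<in> {1..d} \<Longrightarrow> X (Suc n) k \<omega> \<le> N (Suc n) \<omega>"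
  using member_le_sum[of k "{1..d}" "\<lambda>k. X (Suc n) k \<omega>"] by (auto simp: good_def)

lemma good_N: "good \<omega> \<Longrightarrow> 1 \<le> N (Suc n) \<omega>" "good \<omega> \<Longrightarrow> N (Suc n) \<omega> \<le> C1"
  "good \<omega> \<Longrightarrow> N (Suc n) \<omega> \<le> S n \<omega>"
  by (auto simp: good_def)

lemma good_X_le_C1: "good \<omega> \<Longrightarrow> k \<in> {1..d} \<Longrightarrow> X (Suc n) k \<omega> \<le> C1"
  using good_X_le good_N(2) order_trans by blast

text \<open>Almost surely the draw lies in a finite cube, so the moment is a finite combination of
  cell probabilities, whose conditional values are prescribed by assumption (II). The order of the
  moment is at most \<open>d\<close>, hence at most \<open>S n\<close>; as \<open>d \<ge> 2\<close>,
  first and second moments are covered.\<close>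

lemma X_conditional_moment:
  assumes W: "W \<in> borel_measurable (GG n)" "integrable M W" and q: "(\<Sum>k=1..d. p k) \<le> d"
  shows "(\<integral>\<omega>. W \<omega> * (\<Prod>k=1..d. real (X (Suc n) k \<omega> choose p k)) \<partial>M)
    = (\<integral>\<omega>. W \<omega> * ((\<Prod>k=1..d. real (H n k \<omega> choose p k))
        * real (N (Suc n) \<omega> choose (\<Sum>k=1..d. p k)) / real (S n \<omega> choose (\<Sum>k=1..d. p k))) \<partial>M)"
proof -
  interpret G: finite_measure_subalgebra M "GG n"
    by unfold_locales (rule subalgebra_G)
  have [measurable]: "W \<in> borel_measurable M" using W(2) by auto
  define P where "P = PiE {1..d} (\<lambda>_. {..C1})"
  define E where "E x = {\<omega> \<in> space M. \<forall>k\<in>{1..d}. X (Suc n) k \<omega> = x k}" for x :: "nat \<Rightarrow> nat"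
  define c where "c x = (\<Prod>k=1..d. real (x k choose p k))" for x :: "nat \<Rightarrow> nat"
  define hyp where "hyp x \<omega> = mv_hypergeometric d (S n \<omega>) (N (Suc n) \<omega>) (\<lambda>k. H n k \<omega>) x" for x \<omega>
  have finP: "finite P" unfolding P_def by (auto intro: finite_PiE)
  have E [measurable]: "E x \<in> sets M" for x
    unfolding E_def by measurable
  have hyp [measurable]: "hyp x \<in> borel_measurable M" for x
    unfolding hyp_def mv_hypergeometric_def by measurable
  have ce: "AE \<omega> in M. real_cond_exp M (GG n) (indicator (E x)) \<omega> = hyp x \<omega>" for x
    unfolding E_def hyp_def by (rule X_hypergeometric)
  have intW: "integrable M (\<lambda>\<omega>. W \<omega> * indicator (E x) \<omega>)" for x
    using integrable_mult_indicator[OF E W(2)] by (simp add: mult.commute)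
  have 1: "integrable M (\<lambda>\<omega>. W \<omega> * hyp x \<omega>)"
    "(\<integral>\<omega>. W \<omega> * hyp x \<omega> \<partial>M) = (\<integral>\<omega>. W \<omega> * indicator (E x) \<omega> \<partial>M)" for x
  proof -
    have ae: "AE \<omega> in M. W \<omega> * real_cond_exp M (GG n) (indicator (E x)) \<omega> = W \<omega> * hyp x \<omega>"
      using ce[of x] by eventually_elim simp
    note * = G.real_cond_exp_intg[OF intW[of x] W(1)]
    show "integrable M (\<lambda>\<omega>. W \<omega> * hyp x \<omega>)"
      by (rule integrable_cong_AE_imp[OF *(1)], measurable) (use ae in eventually_elim, simp)
    show "(\<integral>\<omega>. W \<omega> * hyp x \<omega> \<partial>M) = (\<integral>\<omega>. W \<omega> * indicator (E x) \<omega> \<partial>M)"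
      using integral_cong_AE[OF _ _ ae] *(2) by simp
  qed
  have "(\<integral>\<omega>. W \<omega> * (\<Prod>k=1..d. real (X (Suc n) k \<omega> choose p k)) \<partial>M)
      = (\<integral>\<omega>. (\<Sum>x\<in>P. c x * (W \<omega> * indicator (E x) \<omega>)) \<partial>M)"
  proof (rule integral_cong_AE)
    show "AE \<omega> in M. W \<omega> * (\<Prod>k=1..d. real (X (Suc n) k \<omega> choose p k)) = (\<Sum>x\<in>P. c x * (W \<omega> * indicator (E x) \<omega>))"
      using AE_good AE_space
    proof eventually_elim
      case (elim \<omega>)
      \<comment> \<open>Restriction makes the draw a member of the extensional function space
        \<open>P\<close>, where exactly one cell contains \<omega>.\<close>
      define y where "y = restrict (\<lambda>k. X (Suc n) k \<omega>) {1..d}"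
      have y: "y \<in> P" using good_X_le_C1[OF elim(1)] by (auto simp: y_def P_def)
      have "indicator (E x) \<omega> = (if x = y then 1 else 0 :: real)" if "x \<in> P" for x
      proof -
        have "\<omega> \<in> E x \<longleftrightarrow> x = y"
          using that elim unfolding E_def y_def P_def by (auto simp: PiE_iff extensional_def fun_eq_iff)
        then show ?thesis by (simp add: indicator_def)
      qed
      then have "(\<Sum>x\<in>P. c x * (W \<omega> * indicator (E x) \<omega>)) = (\<Sum>x\<in>P. if x = y then c y * W \<omega> else 0)"
        by (intro sum.cong) auto
      also have "\<dots> = c y * W \<omega>" using y finP by simp
      finally show ?case by (simp add: c_def y_def)
    qed
  qed measurable
  also have "\<dots> = (\<Sum>x\<in>P. c x * (\<integral>\<omega>. W \<omega> * hyp x \<omega> \<partial>M))"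
    using intW 1 by simp
  also have "\<dots> = (\<integral>\<omega>. (\<Sum>x\<in>P. c x * (W \<omega> * hyp x \<omega>)) \<partial>M)"
    using 1 by simp
  also have "\<dots> = (\<integral>\<omega>. W \<omega> * ((\<Prod>k=1..d. real (H n k \<omega> choose p k))
        * real (N (Suc n) \<omega> choose (\<Sum>k=1..d. p k)) / real (S n \<omega> choose (\<Sum>k=1..d. p k))) \<partial>M)"
  proof (rule integral_cong_AE)
    show "AE \<omega> in M. (\<Sum>x\<in>P. c x * (W \<omega> * hyp x \<omega>)) = W \<omega> * ((\<Prod>k=1..d. real (H n k \<omega> choose p k))
        * real (N (Suc n) \<omega> choose (\<Sum>k=1..d. p k)) / real (S n \<omega> choose (\<Sum>k=1..d. p k)))"
      using AE_good
    proof eventually_elim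
      case (elim \<omega>)
      have "(\<Sum>x\<in>P. c x * (W \<omega> * hyp x \<omega>)) = W \<omega> * (\<Sum>x\<in>P. c x * hyp x \<omega>)"
        by (simp add: sum_distrib_left mult.left_commute)
      also have "(\<Sum>x\<in>P. c x * hyp x \<omega>) = (\<Prod>k=1..d. real (H n k \<omega> choose p k))
        * real (N (Suc n) \<omega> choose (\<Sum>k=1..d. p k)) / real (S n \<omega> choose (\<Sum>k=1..d. p k))"
        unfolding P_def c_def hyp_def
        using good_N[OF elim] S_ge_d[of n \<omega>] q by (intro mv_hypergeometric_moment) (auto simp: urn_S_def)
      finally show ?case .
    qed
  qed measurable
  finally show ?thesis .
qed

lemma X_conditional_mean:
  assumes W: "W \<in> borel_measurable (GG n)" "integrable M W" and k: "k \<in> {1..d}"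
  shows "(\<integral>\<omega>. W \<omega> * real (X (Suc n) k \<omega>) \<partial>M)
    = (\<integral>\<omega>. W \<omega> * (real (N (Suc n) \<omega>) * real (H n k \<omega>) / real (S n \<omega>)) \<partial>M)"
proof -
  have p: "(\<Prod>i=1..d. real (f i choose (if i = k then 1 else 0))) = real (f k)" for f
  proof -
    have "(\<Prod>i=1..d. real (f i choose (if i = k then 1 else 0))) = (\<Prod>i=1..d. if i = k then real (f k) else 1)"
      by (rule prod.cong) auto
    then show ?thesis using k by simp
  qed
  have q: "(\<Sum>i=1..d. if i = k then 1 else 0 :: nat) = 1" using k by simp
  show ?thesis
    using X_conditional_moment[OF W, of "\<lambda>i. if i = k then 1 else 0"] d_ge_2
    unfolding p q by (simp add: mult.commute)
qed

lemma choose_2_real: "real (n choose 2) = real n * (real n - 1) / 2"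
  by (induction n) (auto simp: numeral_2_eq_2 field_simps)

text \<open>Subtracting \<delta> produces the factorial moment X(X - 1) on the diagonal and the
  plain product off it, the two quantities for which the hypergeometric law has a closed
  form.\<close>

lemma X_conditional_second:
  assumes W: "W \<in> borel_measurable (GG n)" "integrable M W" and k: "i \<in> {1..d}" "j \<in> {1..d}"
  defines "\<delta> \<equiv> (if i = j then 1 else 0 :: real)"
  shows "(\<integral>\<omega>. W \<omega> * (real (X (Suc n) i \<omega>) * (real (X (Suc n) j \<omega>) - \<delta>)) \<partial>M)
    = (\<integral>\<omega>. W \<omega> * (real (N (Suc n) \<omega>) * (real (N (Suc n) \<omega>) - 1)
        * (real (H n i \<omega>) * (real (H n j \<omega>) - \<delta>)) / (real (S n \<omega>) * (real (S n \<omega>) - 1))) \<partial>M)"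
proof -
  define p :: "nat \<Rightarrow> nat" where "p l = (if l = i then 1 else 0) + (if l = j then 1 else 0)" for l
  have q: "(\<Sum>l=1..d. p l) = 2" using k by (simp add: p_def sum.distrib)
  \<comment> \<open>On the diagonal (x choose 2) is half of x(x - 1); the same factor stands on both
    sides and cancels at the end.\<close>
  define \<gamma> :: real where "\<gamma> = (if i = j then 1 / 2 else 1)"
  have p: "(\<Prod>l=1..d. real (f l choose p l)) = \<gamma> * (real (f i) * (real (f j) - \<delta>))" for f
  proof (cases "i = j")
    case True
    have "(\<Prod>l=1..d. real (f l choose p l)) = (\<Prod>l=1..d. if l = i then real (f i choose 2) else 1)"
      by (rule prod.cong) (auto simp: p_def True numeral_2_eq_2)
    then show ?thesis using k True by (simp add: \<gamma>_def \<delta>_def choose_2_real[unfolded numeral_2_eq_2] numeral_2_eq_2)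
  next
    case False
    have "(\<Prod>l=1..d. real (f l choose p l)) = (\<Prod>l=1..d. (if l = i then real (f i) else 1) * (if l = j then real (f j) else 1))"
      by (rule prod.cong) (auto simp: p_def False)
    then show ?thesis using k False by (simp add: \<gamma>_def \<delta>_def prod.distrib)
  qed
  have "\<gamma> * (\<integral>\<omega>. W \<omega> * (real (X (Suc n) i \<omega>) * (real (X (Suc n) j \<omega>) - \<delta>)) \<partial>M)
      = (\<integral>\<omega>. W \<omega> * (\<Prod>l=1..d. real (X (Suc n) l \<omega> choose p l)) \<partial>M)"
    unfolding p by (simp add: mult.left_commute flip: integral_mult_right_zero)
  also have "\<dots> = (\<integral>\<omega>. W \<omega> * ((\<Prod>l=1..d. real (H n l \<omega> choose p l))
        * real (N (Suc n) \<omega> choose 2) / real (S n \<omega> choose 2)) \<partial>M)"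
    using X_conditional_moment[OF W, of p] d_ge_2 unfolding q by simp
  also have "\<dots> = \<gamma> * (\<integral>\<omega>. W \<omega> * (real (N (Suc n) \<omega>) * (real (N (Suc n) \<omega>) - 1)
        * (real (H n i \<omega>) * (real (H n j \<omega>) - \<delta>)) / (real (S n \<omega>) * (real (S n \<omega>) - 1))) \<partial>M)"
    unfolding p choose_2_real integral_mult_right_zero[symmetric]
    by (intro Bochner_Integration.integral_cong refl) (simp add: ac_simps)
  finally show ?thesis by (simp add: \<gamma>_def split: if_splits)
qed

text \<open>Assumption (III) in integrated form. The general field allows both real integrands
  (moments) and complex ones (exponentials).\<close>

lemma A_independent:
  fixes W g :: "'w \<Rightarrow> 'b::{real_normed_field, banach, second_countable_topology}"
  assumes W: "W \<in> borel_measurable (urn_K n)" "integrable M W"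
    and g: "g \<in> borel_measurable (sigma_gen M {A (Suc n) k | k. k \<in> {1..d}})" "integrable M g"
  shows "(\<integral>\<omega>. W \<omega> * g \<omega> \<partial>M) = (\<integral>\<omega>. W \<omega> \<partial>M) * (\<integral>\<omega>. g \<omega> \<partial>M)"
    and "integrable M (\<lambda>\<omega>. W \<omega> * g \<omega>)"
proof -
  have "indep_var borel g borel W"
    unfolding indep_var_eq
  proof (intro conjI)
    show "random_variable borel g" "random_variable borel W" using W g by auto
    show "indep_set (sigma_sets (space M) {g -` B \<inter> space M |B. B \<in> sets borel})
       (sigma_sets (space M) {W -` B \<inter> space M |B. B \<in> sets borel})"
      unfolding indep_set_def
    proof (rule indep_sets_mono_sets[OF A_indep[unfolded indep_set_def]])
      have 1: "sigma_sets (space M) {g -` B \<inter> space M |B. B \<in> sets borel}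
          \<subseteq> sets (sigma_gen M {A (Suc n) k | k. k \<in> {1..d}})"
        using measurable_sets[OF g(1)]
        by (intro sets.sigma_sets_subset[of _ "sigma_gen M _", simplified]) auto
      have 2: "sigma_sets (space M) {W -` B \<inter> space M |B. B \<in> sets borel} \<subseteq> sets (urn_K n)"
        using measurable_sets[OF W(1)] unfolding urn_K_def
        by (intro sets.sigma_sets_subset[of _ "sigma_gen M _", simplified]) auto
      show "(case i of True \<Rightarrow> sigma_sets (space M) {g -` B \<inter> space M |B. B \<in> sets borel}
          | False \<Rightarrow> sigma_sets (space M) {W -` B \<inter> space M |B. B \<in> sets borel})
        \<subseteq> (case i of True \<Rightarrow> sets (sigma_gen M {A (Suc n) k | k. k \<in> {1..d}})
          | False \<Rightarrow> sets (sigma_gen M (urn_hist d N X A n \<union> {N (Suc n)} \<union> {X (Suc n) k | k. k \<in> {1..d}})))" for i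
        using 1 2 by (auto simp: urn_K_def split: bool.split)
    qed
  qed
  from indep_var_lebesgue_integral[OF this g(2) W(2)] indep_var_integrable[OF this g(2) W(2)]
  show "(\<integral>\<omega>. W \<omega> * g \<omega> \<partial>M) = (\<integral>\<omega>. W \<omega> \<partial>M) * (\<integral>\<omega>. g \<omega> \<partial>M)" "integrable M (\<lambda>\<omega>. W \<omega> * g \<omega>)"
    by (simp_all add: mult.commute)
qed

lemma A_measurable_self: "k \<in> {1..d} \<Longrightarrow>
  A (Suc n) k \<in> measurable (sigma_gen M {A (Suc n) k | k. k \<in> {1..d}}) (count_space UNIV)"
  by (rule measurable_sigma_gen) auto

end

section \<open>Moments of the replacements\<close>

lemma (in finite_measure) integrable_mult_AE_bounded:
  fixes W f :: "'a \<Rightarrow> real"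
  assumes "integrable M W" "f \<in> borel_measurable M" "AE \<omega> in M. \<bar>f \<omega>\<bar> \<le> B"
  shows "integrable M (\<lambda>\<omega>. W \<omega> * f \<omega>)"
proof (rule Bochner_Integration.integrable_bound)
  show "integrable M (\<lambda>\<omega>. B * W \<omega>)" using assms by simp
  show "AE \<omega> in M. norm (W \<omega> * f \<omega>) \<le> norm (B * W \<omega>)"
    using assms(3)
  proof eventually_elim
    case (elim \<omega>)
    then have "\<bar>W \<omega>\<bar> * \<bar>f \<omega>\<bar> \<le> \<bar>W \<omega>\<bar> * \<bar>B\<bar>" by (intro mult_left_mono) auto
    then show ?case by (simp add: abs_mult mult.commute)
  qed
qed (use assms in measurable)

lemma (in finite_measure) integrable_AE_bounded:
  fixes f :: "'a \<Rightarrow> real"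
  assumes "f \<in> borel_measurable M" "AE \<omega> in M. \<bar>f \<omega>\<bar> \<le> B"
  shows "integrable M f"
  using integrable_mult_AE_bounded[of "\<lambda>_. 1" f B] assms by simp

lemma summable_inverse_Suc_squares: "summable (\<lambda>n. 1 / (real (Suc n))\<^sup>2)"
  using inverse_power_summable[of 2, where 'a=real] summable_Suc_iff[of "\<lambda>n. inverse (real n ^ 2)"]
  by (simp add: inverse_eq_divide)

locale reinforced_urn_limit = reinforced_urn M d C1 h0 N X A
  for M :: "'w measure" and d C1 :: nat and h0 :: "nat \<Rightarrow> nat"
    and N :: "nat \<Rightarrow> 'w \<Rightarrow> nat" and X A :: "nat \<Rightarrow> nat \<Rightarrow> 'w \<Rightarrow> nat" +
  fixes t :: nat and C2 :: real and m q :: "nat \<Rightarrow> real" and qq :: "nat \<Rightarrow> nat \<Rightarrow> real"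
    and NN Q :: "'w \<Rightarrow> real"
  assumes A1: "\<And>k. k \<in> {1..d} \<Longrightarrow>
      (SUP n\<in>{1..}. \<integral>\<^sup>+\<omega>. ennreal (real (A n k \<omega>) ^ 3) \<partial>M) < ennreal C2"
    and A2_lim: "\<And>k. k \<in> {1..d} \<Longrightarrow> (\<lambda>n. urn_mean M A n k) \<longlonglongrightarrow> m k"
    and A2_t: "t \<in> {1..d}"
    and A2_eq: "\<And>k. k \<in> {1..t} \<Longrightarrow> m k = m 1"
    and A2_gap: "t < d \<Longrightarrow> m t > m (t + 1)"
    and A2_decr: "\<And>k. t < k \<Longrightarrow> k < d \<Longrightarrow> m k \<ge> m (k + 1)"
    and A3: "\<And>k j. k \<in> {1..d} \<Longrightarrow> j \<in> {1..d} \<Longrightarrow>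
      summable (\<lambda>n. \<bar>urn_mean M A (n + 1) k * m j - m k * urn_mean M A (n + 1) j\<bar> / real n)"
    and A4: "\<And>k. k \<in> {1..d} \<Longrightarrow>
      (\<lambda>n. \<bar>urn_mean M A n k - m k\<bar>) \<in> o(\<lambda>n. real n powr (- m k / (2 * m 1)))"
    and NN_rv: "NN \<in> borel_measurable M"
    and NN_lim: "AE \<omega> in M.
      (\<lambda>n. real_cond_exp M (urn_F M d N X A n) (\<lambda>\<omega>. real (N (n + 1) \<omega>)) \<omega>) \<longlonglongrightarrow> NN \<omega>"
    and Q_rv: "Q \<in> borel_measurable M"
    and Q_lim: "AE \<omega> in M.
      (\<lambda>n. real_cond_exp M (urn_F M d N X A n) (\<lambda>\<omega>. (real (N (n + 1) \<omega>))\<^sup>2) \<omega>) \<longlonglongrightarrow> Q \<omega>"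
    and M_sq: "\<And>k. k \<in> {1..d} \<Longrightarrow> (\<lambda>n. \<integral>\<omega>. (real (A n k \<omega>))\<^sup>2 \<partial>M) \<longlonglongrightarrow> q k"
    and M_mix: "\<And>k s. k \<in> {1..d} \<Longrightarrow> s \<in> {1..d} \<Longrightarrow>
      (\<lambda>n. \<integral>\<omega>. real (A n k \<omega>) * real (A n s \<omega>) \<partial>M) \<longlonglongrightarrow> qq k s"
begin

declare NN_rv [measurable] Q_rv [measurable]

text \<open>Index \<open>n\<close> in \<open>Ar\<close>, \<open>Xr\<close>, \<open>Nr\<close>, and
  in \<open>mu\<close>, \<open>Ac\<close>, \<open>cov\<close>, refers to stage \<open>n + 1\<close>,
  whereas \<open>Hr n\<close> and \<open>Sr n\<close> describe the urn from which that stage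
  draws.\<close>

abbreviation Ar where "Ar n k \<omega> \<equiv> real (A (Suc n) k \<omega>)"
abbreviation Xr where "Xr n k \<omega> \<equiv> real (X (Suc n) k \<omega>)"
abbreviation Hr where "Hr n k \<omega> \<equiv> real (H n k \<omega>)"
abbreviation Nr where "Nr n \<omega> \<equiv> real (N (Suc n) \<omega>)"
abbreviation Sr where "Sr n \<omega> \<equiv> real (S n \<omega>)"

definition mu :: "nat \<Rightarrow> nat \<Rightarrow> real" where "mu n k = urn_mean M A (Suc n) k"
definition Ac :: "nat \<Rightarrow> nat \<Rightarrow> 'w \<Rightarrow> real" where "Ac n k \<omega> = Ar n k \<omega> - mu n k"
definition cov :: "nat \<Rightarrow> nat \<Rightarrow> nat \<Rightarrow> real" where "cov n i j = (\<integral>\<omega>. Ac n i \<omega> * Ac n j \<omega> \<partial>M)"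

lemma Hr_pos: "k \<in> {1..d} \<Longrightarrow> Hr n k \<omega> > 0" using H_pos by simp
lemma Hr_ge_1: "k \<in> {1..d} \<Longrightarrow> Hr n k \<omega> \<ge> 1" using H_pos[of k n \<omega>] by simp
lemma Sr_ge_2: "Sr n \<omega> \<ge> 2" using S_ge_d[of n \<omega>] d_ge_2 by simp
lemma Hr_le_Sr: "k \<in> {1..d} \<Longrightarrow> Hr n k \<omega> \<le> Sr n \<omega>" using H_le_S by simp

lemma Hr_Suc: "Hr (Suc n) k \<omega> = Hr n k \<omega> + Ar n k \<omega> * Xr n k \<omega>"
  by (simp add: H_Suc)

lemma A_cube:
  assumes k: "k \<in> {1..d}"
  shows "integrable M (\<lambda>\<omega>. Ar n k \<omega> ^ 3)" "(\<integral>\<omega>. Ar n k \<omega> ^ 3 \<partial>M) \<le> C2"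
proof -
  note [measurable] = A_measurable[OF k]
  have "(\<integral>\<^sup>+\<omega>. ennreal (Ar n k \<omega> ^ 3) \<partial>M) \<le> (SUP n\<in>{1..}. \<integral>\<^sup>+\<omega>. ennreal (real (A n k \<omega>) ^ 3) \<partial>M)"
    by (rule SUP_upper) auto
  with A1[OF k] have *: "(\<integral>\<^sup>+\<omega>. ennreal (Ar n k \<omega> ^ 3) \<partial>M) < ennreal C2" by simp
  also have "\<dots> < \<infinity>" by simp
  finally show int: "integrable M (\<lambda>\<omega>. Ar n k \<omega> ^ 3)"
    by (intro integrableI_nonneg) auto
  have "ennreal (\<integral>\<omega>. Ar n k \<omega> ^ 3 \<partial>M) < ennreal C2"
    using * nn_integral_eq_integral[OF int] by simp
  then show "(\<integral>\<omega>. Ar n k \<omega> ^ 3 \<partial>M) \<le> C2"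
    by (simp add: ennreal_less_iff)
qed

lemma nat_power_mono: "i \<le> j \<Longrightarrow> 0 < i \<Longrightarrow> real (n::nat) ^ i \<le> real n ^ j"
  by (cases "n = 0") (auto intro!: power_increasing simp: power_0_left)

lemma A_moments:
  assumes k: "k \<in> {1..d}"
  shows "integrable M (Ar n k)" "integrable M (\<lambda>\<omega>. (Ar n k \<omega>)\<^sup>2)"
    "(\<integral>\<omega>. (Ar n k \<omega>)\<^sup>2 \<partial>M) \<le> C2" "1 \<le> mu n k" "mu n k \<le> C2"
proof -
  note [measurable] = A_measurable[OF k]
  show i1: "integrable M (Ar n k)"
    by (rule Bochner_Integration.integrable_bound[OF A_cube(1)[OF k, of n]])
      (use nat_power_mono[of 1 3] in \<open>auto intro!: AE_I2\<close>)
  show i2: "integrable M (\<lambda>\<omega>. (Ar n k \<omega>)\<^sup>2)"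
    by (rule Bochner_Integration.integrable_bound[OF A_cube(1)[OF k, of n]])
      (use nat_power_mono[of 2 3] in \<open>auto intro!: AE_I2\<close>)
  have "(\<integral>\<omega>. (Ar n k \<omega>)\<^sup>2 \<partial>M) \<le> (\<integral>\<omega>. Ar n k \<omega> ^ 3 \<partial>M)"
    using i2 A_cube(1)[OF k] nat_power_mono[of 2 3] by (intro integral_mono) auto
  then show "(\<integral>\<omega>. (Ar n k \<omega>)\<^sup>2 \<partial>M) \<le> C2" using A_cube(2)[OF k, of n] by linarith
  have "mu n k \<le> (\<integral>\<omega>. Ar n k \<omega> ^ 3 \<partial>M)"
    unfolding mu_def urn_mean_def using i1 A_cube(1)[OF k] nat_power_mono[of 1 3] by (intro integral_mono) auto
  then show "mu n k \<le> C2" using A_cube(2)[OF k, of n] by linarith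
  have "(\<integral>\<omega>. 1 \<partial>M) \<le> mu n k"
    unfolding mu_def urn_mean_def using i1 A_ge_1[OF k, of n] by (intro integral_mono_AE) auto
  then show "1 \<le> mu n k" by (simp add: prob_space)
qed

lemma C2_ge_1: "C2 \<ge> 1"
  using A_moments(4,5)[of 1 0] d_ge_2 by force

lemma Ac_measurable_self: "k \<in> {1..d} \<Longrightarrow>
    Ac n k \<in> borel_measurable (sigma_gen M {A (Suc n) k | k. k \<in> {1..d}})"
  unfolding Ac_def[abs_def] using measurable_compose[OF A_measurable_self borel_measurable_count_space]
  by (intro borel_measurable_diff borel_measurable_const) auto

lemma Ac_measurable_F: "i < n \<Longrightarrow> k \<in> {1..d} \<Longrightarrow> Ac i k \<in> borel_measurable (FF n)"
  unfolding Ac_def[abs_def]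
  by (intro borel_measurable_diff borel_measurable_const measurable_compose[OF A_measurable_F borel_measurable_count_space])

lemma Ac_measurable [measurable]: "k \<in> {1..d} \<Longrightarrow> Ac n k \<in> borel_measurable M"
  by (rule measurable_M_of_F[OF Ac_measurable_F[of n "Suc n"]]) auto

lemma Ac_moments:
  assumes k: "k \<in> {1..d}"
  shows "integrable M (Ac n k)" "integrable M (\<lambda>\<omega>. (Ac n k \<omega>)\<^sup>2)"
    "(\<integral>\<omega>. Ac n k \<omega> \<partial>M) = 0" "(\<integral>\<omega>. (Ac n k \<omega>)\<^sup>2 \<partial>M) \<le> C2"
    "integrable M (\<lambda>\<omega>. \<bar>Ac n k \<omega>\<bar> ^ 3)" "(\<integral>\<omega>. \<bar>Ac n k \<omega>\<bar> ^ 3 \<partial>M) \<le> C2 + C2 ^ 3"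
proof -
  note A = A_moments[OF k, of n]
  show i1: "integrable M (Ac n k)" unfolding Ac_def[abs_def] using A by simp
  show "(\<integral>\<omega>. Ac n k \<omega> \<partial>M) = 0"
    using A by (simp add: Ac_def mu_def urn_mean_def prob_space)
  have sq: "(Ac n k \<omega>)\<^sup>2 = (Ar n k \<omega>)\<^sup>2 - 2 * mu n k * Ar n k \<omega> + (mu n k)\<^sup>2" for \<omega>
    by (simp add: Ac_def power2_diff)
  show i2: "integrable M (\<lambda>\<omega>. (Ac n k \<omega>)\<^sup>2)" unfolding sq using A by simp
  have "(\<integral>\<omega>. (Ac n k \<omega>)\<^sup>2 \<partial>M) = (\<integral>\<omega>. (Ar n k \<omega>)\<^sup>2 \<partial>M) - (mu n k)\<^sup>2"
    unfolding sq using A by (simp add: prob_space mu_def urn_mean_def power2_eq_square)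
  then show "(\<integral>\<omega>. (Ac n k \<omega>)\<^sup>2 \<partial>M) \<le> C2" using A(3) by (smt (verit) zero_le_power2)
  \<comment> \<open>For nonnegative numbers the difference is at most the larger one, so no binomial
    factor enters the bound.\<close>
  have "\<bar>a - b\<bar> ^ 3 \<le> a ^ 3 + b ^ 3" if "a \<ge> 0" "b \<ge> 0" for a b :: real
  proof -
    have "\<bar>a - b\<bar> ^ 3 \<le> (max a b) ^ 3" using that by (intro power_mono) auto
    also have "\<dots> \<le> a ^ 3 + b ^ 3" using that by (auto simp: max_def)
    finally show ?thesis .
  qed
  then have b: "\<bar>Ac n k \<omega>\<bar> ^ 3 \<le> Ar n k \<omega> ^ 3 + mu n k ^ 3" for \<omega>
    using A by (simp add: Ac_def)
  have i: "integrable M (\<lambda>\<omega>. Ar n k \<omega> ^ 3 + mu n k ^ 3)" using A_cube(1)[OF k] by simp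
  show i3: "integrable M (\<lambda>\<omega>. \<bar>Ac n k \<omega>\<bar> ^ 3)"
    by (rule Bochner_Integration.integrable_bound[OF i])
      (use b k A in \<open>auto intro!: AE_I2 order_trans[OF b abs_ge_self] simp: power_abs[symmetric]\<close>)
  have "(\<integral>\<omega>. \<bar>Ac n k \<omega>\<bar> ^ 3 \<partial>M) \<le> (\<integral>\<omega>. Ar n k \<omega> ^ 3 + mu n k ^ 3 \<partial>M)"
    by (rule integral_mono[OF i3 i b])
  also have "\<dots> = (\<integral>\<omega>. Ar n k \<omega> ^ 3 \<partial>M) + mu n k ^ 3"
    using A_cube(1)[OF k] by (simp add: prob_space)
  also have "\<dots> \<le> C2 + C2 ^ 3"
    using A_cube(2)[OF k, of n] A by (intro add_mono power_mono) auto
  finally show "(\<integral>\<omega>. \<bar>Ac n k \<omega>\<bar> ^ 3 \<partial>M) \<le> C2 + C2 ^ 3" .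
qed

lemma Ac_prod_integrable:
  "i \<in> {1..d} \<Longrightarrow> j \<in> {1..d} \<Longrightarrow> integrable M (\<lambda>\<omega>. Ac n i \<omega> * Ac n j \<omega>)"
  by (intro square_integrable_mult Ac_moments Ac_measurable)

lemma abs_cov_le:
  assumes "i \<in> {1..d}" "j \<in> {1..d}"
  shows "\<bar>cov n i j\<bar> \<le> C2"
proof -
  have "\<bar>cov n i j\<bar> \<le> (\<integral>\<omega>. \<bar>Ac n i \<omega> * Ac n j \<omega>\<bar> \<partial>M)"
    unfolding cov_def by (rule integral_abs_bound)
  also have "\<dots> \<le> (\<integral>\<omega>. ((Ac n i \<omega>)\<^sup>2 + (Ac n j \<omega>)\<^sup>2) / 2 \<partial>M)"
  proof (rule integral_mono)
    show "\<bar>Ac n i \<omega> * Ac n j \<omega>\<bar> \<le> ((Ac n i \<omega>)\<^sup>2 + (Ac n j \<omega>)\<^sup>2) / 2" for \<omega>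
      using sum_squares_bound[of "\<bar>Ac n i \<omega>\<bar>" "\<bar>Ac n j \<omega>\<bar>"] by (simp add: abs_mult)
  qed (use assms Ac_prod_integrable Ac_moments in auto)
  also have "\<dots> \<le> (C2 + C2) / 2"
    using Ac_moments(2)[OF assms(1), of n] Ac_moments(2)[OF assms(2), of n]
      Ac_moments(4)[OF assms(1), of n] Ac_moments(4)[OF assms(2), of n] by simp
  finally show ?thesis by simp
qed

lemma mu_lim: "k \<in> {1..d} \<Longrightarrow> (\<lambda>n. mu n k) \<longlonglongrightarrow> m k"
  unfolding mu_def by (rule LIMSEQ_Suc[OF A2_lim])

lemma cov_lim:
  assumes "i \<in> {1..d}" "j \<in> {1..d}"
  shows "(\<lambda>n. cov n i j) \<longlonglongrightarrow> qq i j - m i * m j"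
proof -
  have "cov n i j = (\<integral>\<omega>. Ar n i \<omega> * Ar n j \<omega> \<partial>M) - mu n i * mu n j" for n
  proof -
    have int: "integrable M (\<lambda>\<omega>. Ar n i \<omega> * Ar n j \<omega>)"
      using assms A_moments by (intro square_integrable_mult) auto
    have "cov n i j = (\<integral>\<omega>. Ar n i \<omega> * Ar n j \<omega> - mu n j * Ar n i \<omega> - mu n i * Ar n j \<omega> + mu n i * mu n j \<partial>M)"
      unfolding cov_def Ac_def by (intro Bochner_Integration.integral_cong) (auto simp: algebra_simps)
    also have "\<dots> = (\<integral>\<omega>. Ar n i \<omega> * Ar n j \<omega> \<partial>M) - mu n j * mu n i - mu n i * mu n j + mu n i * mu n j"
      using int A_moments assms by (simp add: prob_space mu_def urn_mean_def)
    finally show ?thesis by simp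
  qed
  then show ?thesis
    using LIMSEQ_Suc[OF M_mix[OF assms]] mu_lim assms by (auto intro!: tendsto_diff tendsto_mult)
qed

lemma m_ge_1: "k \<in> {1..d} \<Longrightarrow> m k \<ge> 1"
  by (rule LIMSEQ_le_const[OF mu_lim]) (use A_moments(4) in auto)

lemma m_decreasing_beyond: "t < k \<Longrightarrow> k \<le> d \<Longrightarrow> m k < m 1"
proof (induction k)
  case (Suc k)
  show ?case
  proof (cases "k = t")
    case True
    with Suc A2_gap A2_eq[of t] A2_t show ?thesis by auto
  next
    case False
    with Suc A2_decr[of k] show ?thesis by auto
  qed
qed simp

text \<open>The growth exponent of colour \<open>k\<close>: \<open>H n k\<close> is of order
  \<open>n powr ex k\<close>, and \<open>ex k = 1\<close> exactly for the dominant colours.\<close>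

definition ex :: "nat \<Rightarrow> real" where "ex k = m k / m 1"

lemma ex_bounds: assumes "k \<in> {1..d}" shows "0 < ex k" "ex k \<le> 1" "k \<le> t \<Longrightarrow> ex k = 1" "t < k \<Longrightarrow> ex k < 1"
proof -
  have m1: "m 1 \<ge> 1" "m k \<ge> 1" using m_ge_1[of 1] m_ge_1[OF assms] d_ge_2 by auto
  show "0 < ex k" "k \<le> t \<Longrightarrow> ex k = 1" "t < k \<Longrightarrow> ex k < 1"
    using m1 A2_eq[of k] assms m_decreasing_beyond[of k] by (auto simp: ex_def)
  then show "ex k \<le> 1" by (cases "k \<le> t") auto
qed

section \<open>Martingales of the urn\<close>

text \<open>At every stage at least one ball is drawn, and each drawn ball adds at least one. The
  linear lower bound makes the squares of \<open>Nr / Sr\<close> summable.\<close>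

lemma good_S_ge:
  assumes "good \<omega>" shows "Sr n \<omega> \<ge> real (Suc n)"
proof (induction n)
  case 0
  then show ?case using Sr_ge_2[of 0 \<omega>] by simp
next
  case (Suc n)
  have "1 \<le> (\<Sum>k=1..d. X (Suc n) k \<omega>)" using assms by (auto simp: good_def)
  also have "\<dots> \<le> (\<Sum>k=1..d. A (Suc n) k \<omega> * X (Suc n) k \<omega>)"
    using assms by (intro sum_mono) (auto simp: good_def)
  finally have "S (Suc n) \<omega> \<ge> S n \<omega> + 1"
    by (simp add: urn_S_def H_Suc sum.distrib)
  with Suc show ?case by simp
qed

text \<open>A stage at which colour \<open>k\<close> is drawn increases \<open>H\<^sub>k\<close> by at least 1, so the squared
  ratios are dominated by a telescoping series, whatever the growth of \<open>H\<^sub>k\<close>.\<close>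

lemma good_ratio_squares:
  assumes g: "good \<omega>" and k: "k \<in> {1..d}"
  shows "(Xr n k \<omega> / Hr n k \<omega>)\<^sup>2 \<le> 2 * (real C1)\<^sup>2 * (1 / Hr n k \<omega> - 1 / Hr (Suc n) k \<omega>)"
proof (cases "X (Suc n) k \<omega> = 0")
  case True
  then show ?thesis by (simp add: H_Suc)
next
  case False
  define h where "h = Hr n k \<omega>"
  have h: "h \<ge> 1" unfolding h_def by (rule Hr_ge_1[OF k])
  have "0 < A (Suc n) k \<omega> * X (Suc n) k \<omega>" using g k False by (auto simp: good_def Suc_le_eq)
  then have "H (Suc n) k \<omega> \<ge> H n k \<omega> + 1" by (simp add: H_Suc)
  then have h1: "Hr (Suc n) k \<omega> \<ge> h + 1" unfolding h_def by linarith
  \<comment> \<open>The right-hand side is 2 / (h (h + 1)), and h + 1 \<le> 2 h; hence the factor 2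
    in the statement.\<close>
  have "1 / h\<^sup>2 \<le> 2 * (1 / h - 1 / (h + 1))"
    using h by (simp add: divide_simps power2_eq_square)
  also have "\<dots> \<le> 2 * (1 / h - 1 / Hr (Suc n) k \<omega>)"
    using h1 h by (simp add: frac_le)
  finally have *: "1 / h\<^sup>2 \<le> 2 * (1 / h - 1 / Hr (Suc n) k \<omega>)" .
  have "(Xr n k \<omega> / h)\<^sup>2 \<le> (real C1)\<^sup>2 * (1 / h\<^sup>2)"
    using good_X_le_C1[OF g k, of n] by (simp add: power_divide divide_right_mono)
  also have "\<dots> \<le> (real C1)\<^sup>2 * (2 * (1 / h - 1 / Hr (Suc n) k \<omega>))"
    by (rule mult_left_mono[OF *]) simp
  finally show ?thesis unfolding h_def by (simp only: mult_ac)
qed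

lemma ratio_squares:
  assumes k: "k \<in> {1..d}"
  shows "integrable M (\<lambda>\<omega>. (Xr n k \<omega> / Hr n k \<omega>)\<^sup>2)"
    and "summable (\<lambda>n. \<integral>\<omega>. (Xr n k \<omega> / Hr n k \<omega>)\<^sup>2 \<partial>M)"
proof -
  note [measurable] = X_measurable[OF k] H_measurable[OF k]
  have i1: "integrable M (\<lambda>\<omega>. 1 / Hr n k \<omega>)" for n
    using Hr_ge_1[OF k] by (intro integrable_AE_bounded[where B=1] AE_I2) (auto simp: divide_le_eq_1)
  show int: "integrable M (\<lambda>\<omega>. (Xr n k \<omega> / Hr n k \<omega>)\<^sup>2)" for n
  proof (rule integrable_AE_bounded[where B="2 * (real C1)\<^sup>2"])
    show "AE \<omega> in M. \<bar>(Xr n k \<omega> / Hr n k \<omega>)\<^sup>2\<bar> \<le> 2 * (real C1)\<^sup>2"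
      using AE_good
    proof eventually_elim
      case (elim \<omega>)
      have "1 / Hr n k \<omega> - 1 / Hr (Suc n) k \<omega> \<le> 1"
        using Hr_ge_1[OF k, of n \<omega>] Hr_ge_1[OF k, of "Suc n" \<omega>] by (smt (verit) divide_le_eq_1 zero_le_divide_1_iff)
      then have "2 * (real C1)\<^sup>2 * (1 / Hr n k \<omega> - 1 / Hr (Suc n) k \<omega>) \<le> 2 * (real C1)\<^sup>2 * 1"
        by (intro mult_left_mono) auto
      with good_ratio_squares[OF elim k, of n] show ?case by simp
    qed
  qed measurable
  define e where "e n = (\<integral>\<omega>. 1 / Hr n k \<omega> \<partial>M)" for n
  have le: "(\<integral>\<omega>. (Xr n k \<omega> / Hr n k \<omega>)\<^sup>2 \<partial>M) \<le> 2 * (real C1)\<^sup>2 * (e n - e (Suc n))" for n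
  proof -
    have "(\<integral>\<omega>. (Xr n k \<omega> / Hr n k \<omega>)\<^sup>2 \<partial>M) \<le> (\<integral>\<omega>. 2 * (real C1)\<^sup>2 * (1 / Hr n k \<omega> - 1 / Hr (Suc n) k \<omega>) \<partial>M)"
      using AE_good int i1[of n] i1[of "Suc n"] good_ratio_squares[OF _ k] by (intro integral_mono_AE) auto
    then show ?thesis using i1[of n] i1[of "Suc n"] by (simp add: e_def)
  qed
  have e0: "e n \<ge> 0" for n unfolding e_def by simp
  have part: "(\<Sum>i<n. \<integral>\<omega>. (Xr i k \<omega> / Hr i k \<omega>)\<^sup>2 \<partial>M) \<le> 2 * (real C1)\<^sup>2 * e 0" for n
  proof -
    have "(\<Sum>i<n. \<integral>\<omega>. (Xr i k \<omega> / Hr i k \<omega>)\<^sup>2 \<partial>M) \<le> (\<Sum>i<n. 2 * (real C1)\<^sup>2 * (e i - e (Suc i)))"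
      by (intro sum_mono le)
    also have "\<dots> = 2 * (real C1)\<^sup>2 * (e 0 - e n)"
      unfolding sum_distrib_left[symmetric] by (simp add: sum_lessThan_telescope')
    also have "\<dots> \<le> 2 * (real C1)\<^sup>2 * e 0" using e0[of n] by (intro mult_left_mono) auto
    finally show ?thesis .
  qed
  show "summable (\<lambda>n. \<integral>\<omega>. (Xr n k \<omega> / Hr n k \<omega>)\<^sup>2 \<partial>M)"
    by (rule summableI_nonneg_bounded[OF _ part]) simp
qed

lemma Xr_measurable_F: "i < n \<Longrightarrow> k \<in> {1..d} \<Longrightarrow> Xr i k \<in> borel_measurable (FF n)"
  by (rule measurable_compose[OF X_measurable_F]) auto
lemma Nr_measurable_F: "i < n \<Longrightarrow> Nr i \<in> borel_measurable (FF n)"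
  by (rule measurable_compose[OF N_measurable_F]) auto
lemma Hr_measurable_F: "i \<le> n \<Longrightarrow> k \<in> {1..d} \<Longrightarrow> Hr i k \<in> borel_measurable (FF n)"
  by (rule measurable_compose[OF H_measurable_F]) auto
lemma Sr_measurable_F: "i \<le> n \<Longrightarrow> Sr i \<in> borel_measurable (FF n)"
  by (rule measurable_compose[OF S_measurable_F]) auto
lemma Xr_measurable_K: "k \<in> {1..d} \<Longrightarrow> Xr n k \<in> borel_measurable (urn_K n)"
  by (rule measurable_compose[OF X_measurable_K]) auto

lemma integrable_of_square_F:
  fixes W :: "'w \<Rightarrow> real"
  shows "W \<in> borel_measurable (FF n) \<Longrightarrow> integrable M (\<lambda>\<omega>. (W \<omega>)\<^sup>2) \<Longrightarrow> integrable M W"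
  by (rule square_integrable_imp_integrable[OF measurable_M_of_F])

text \<open>The ratio of draw to content is known before the replacement, so by independence the
  second moment of the replacement factors out and is at most \<open>C2\<close>; what is left is
  summable by \<open>ratio_squares\<close>. The second series will bound the error of linearising
  the logarithm.\<close>

lemma AE_summable_replacement_noise:
  assumes k: "k \<in> {1..d}"
  shows "AE \<omega> in M. summable (\<lambda>n. Ac n k \<omega> * Xr n k \<omega> / Hr n k \<omega>)"
    and "AE \<omega> in M. summable (\<lambda>n. (Ar n k \<omega> * Xr n k \<omega> / Hr n k \<omega>)\<^sup>2)"
proof -
  note [measurable] = X_measurable[OF k] H_measurable[OF k] A_measurable[OF k] Ac_measurable[OF k]
  have RK: "(\<lambda>\<omega>. Xr n k \<omega> / Hr n k \<omega>) \<in> borel_measurable (urn_K n)" for n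
    by (intro borel_measurable_divide Xr_measurable_K[OF k] measurable_K_of_F[OF Hr_measurable_F] order_refl k)
  have RK2: "(\<lambda>\<omega>. (Xr n k \<omega> / Hr n k \<omega>)\<^sup>2) \<in> borel_measurable (urn_K n)" for n
    by (intro borel_measurable_power RK)
  have sqAc: "(\<lambda>\<omega>. (Ac n k \<omega>)\<^sup>2) \<in> borel_measurable (sigma_gen M {A (Suc n) k | k. k \<in> {1..d}})" for n
    by (intro borel_measurable_power Ac_measurable_self k)
  have sqAr: "(\<lambda>\<omega>. (Ar n k \<omega>)\<^sup>2) \<in> borel_measurable (sigma_gen M {A (Suc n) k | k. k \<in> {1..d}})" for n
    by (intro borel_measurable_power measurable_compose[OF A_measurable_self borel_measurable_count_space] k)
  have eq: "(Ac n k \<omega> * Xr n k \<omega> / Hr n k \<omega>)\<^sup>2 = (Xr n k \<omega> / Hr n k \<omega>)\<^sup>2 * (Ac n k \<omega>)\<^sup>2" for n \<omega>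
    by (simp add: power_divide power_mult_distrib)
  have eq': "(Ar n k \<omega> * Xr n k \<omega> / Hr n k \<omega>)\<^sup>2 = (Xr n k \<omega> / Hr n k \<omega>)\<^sup>2 * (Ar n k \<omega>)\<^sup>2" for n \<omega>
    by (simp add: power_divide power_mult_distrib)
  note E1 = A_independent[OF RK2 ratio_squares(1)[OF k] sqAc Ac_moments(2)[OF k]]
  note E2 = A_independent[OF RK2 ratio_squares(1)[OF k] sqAr A_moments(2)[OF k]]
  have nonneg: "(\<integral>\<omega>. (Xr n k \<omega> / Hr n k \<omega>)\<^sup>2 \<partial>M) \<ge> 0" for n by simp
  show "AE \<omega> in M. summable (\<lambda>n. Ac n k \<omega> * Xr n k \<omega> / Hr n k \<omega>)"
  proof (rule martingale_differences_summable[where F=FF])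
    show "subalgebra M (FF n)" "subalgebra (FF (Suc n)) (FF n)" for n
      by (auto intro: subalgebra_F subalgebra_F_mono)
    show "(\<lambda>\<omega>. Ac n k \<omega> * Xr n k \<omega> / Hr n k \<omega>) \<in> borel_measurable (FF (Suc n))" for n
      by (intro borel_measurable_divide borel_measurable_times Ac_measurable_F Xr_measurable_F Hr_measurable_F k) auto
    show "integrable M (\<lambda>\<omega>. (Ac n k \<omega> * Xr n k \<omega> / Hr n k \<omega>)\<^sup>2)" for n
      unfolding eq by (rule E1(2))
    show "summable (\<lambda>n. \<integral>\<omega>. (Ac n k \<omega> * Xr n k \<omega> / Hr n k \<omega>)\<^sup>2 \<partial>M)"
      unfolding eq E1(1)
      by (rule summable_comparison_test'[OF summable_mult[OF ratio_squares(2)[OF k], of C2], of 0])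
        (use Ac_moments(4)[OF k] nonneg in \<open>auto simp: abs_mult mult.commute[of C2] intro!: mult_left_mono\<close>)
    fix n and W :: "'w \<Rightarrow> real" assume W: "W \<in> borel_measurable (FF n)" "integrable M (\<lambda>\<omega>. (W \<omega>)\<^sup>2)"
    have WK: "(\<lambda>\<omega>. W \<omega> * (Xr n k \<omega> / Hr n k \<omega>)) \<in> borel_measurable (urn_K n)"
      by (intro borel_measurable_times measurable_K_of_F[OF W(1)] RK)
    have Wi: "integrable M (\<lambda>\<omega>. W \<omega> * (Xr n k \<omega> / Hr n k \<omega>))"
      by (intro square_integrable_mult measurable_M_of_F[OF W(1)] W(2) ratio_squares(1)[OF k]) measurable
    show "(\<integral>\<omega>. W \<omega> * (Ac n k \<omega> * Xr n k \<omega> / Hr n k \<omega>) \<partial>M) = 0"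
      using A_independent(1)[OF WK Wi Ac_measurable_self[OF k] Ac_moments(1)[OF k]] Ac_moments(3)[OF k, of n]
      by (simp add: mult_ac)
  qed
  show "AE \<omega> in M. summable (\<lambda>n. (Ar n k \<omega> * Xr n k \<omega> / Hr n k \<omega>)\<^sup>2)"
  proof (rule AE_summable_of_summable_integral)
    show "integrable M (\<lambda>\<omega>. (Ar n k \<omega> * Xr n k \<omega> / Hr n k \<omega>)\<^sup>2)" for n
      unfolding eq' by (rule E2(2))
    show "summable (\<lambda>n. \<integral>\<omega>. (Ar n k \<omega> * Xr n k \<omega> / Hr n k \<omega>)\<^sup>2 \<partial>M)"
      unfolding eq' E2(1)
      by (rule summable_comparison_test'[OF summable_mult[OF ratio_squares(2)[OF k], of C2], of 0])
        (use A_moments(3)[OF k] nonneg in \<open>auto simp: abs_mult mult.commute[of C2] intro!: mult_left_mono\<close>)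
  qed simp
qed

text \<open>Reduces a noise to a pathwise bound and an orthogonality check. The two squared ratios
  have summable means by \<open>ratio_squares\<close>, and the last term takes up errors of order 1
  / n such as \<open>Nr / Sr\<close>.\<close>

lemma AE_summable_dominated:
  assumes ij: "i \<in> {1..d}" "j \<in> {1..d}"
    and D: "\<And>n. D n \<in> borel_measurable (FF (Suc n))"
    and dom: "\<And>n. AE \<omega> in M. (D n \<omega>)\<^sup>2 \<le> B * ((Xr n i \<omega> / Hr n i \<omega>)\<^sup>2 + (Xr n j \<omega> / Hr n j \<omega>)\<^sup>2 + 1 / (real (Suc n))\<^sup>2)"
    and orth: "\<And>n W. W \<in> borel_measurable (FF n) \<Longrightarrow> integrable M (\<lambda>\<omega>. (W \<omega>)\<^sup>2) \<Longrightarrow>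
      (\<integral>\<omega>. W \<omega> * D n \<omega> \<partial>M) = 0"
  shows "AE \<omega> in M. summable (\<lambda>n. D n \<omega>)"
proof (rule martingale_differences_summable[where F=FF])
  have DM [measurable]: "D n \<in> borel_measurable M" for n by (rule measurable_M_of_F[OF D])
  show "subalgebra M (FF n)" "subalgebra (FF (Suc n)) (FF n)" for n
    by (auto intro: subalgebra_F subalgebra_F_mono)
  have int: "integrable M (\<lambda>\<omega>. B * ((Xr n i \<omega> / Hr n i \<omega>)\<^sup>2 + (Xr n j \<omega> / Hr n j \<omega>)\<^sup>2 + 1 / (real (Suc n))\<^sup>2))" for n
    using ratio_squares(1) ij by simp
  show intD: "integrable M (\<lambda>\<omega>. (D n \<omega>)\<^sup>2)" for n
    by (rule Bochner_Integration.integrable_bound[OF int[of n]]) (use dom[of n] in auto)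
  have "(\<integral>\<omega>. (D n \<omega>)\<^sup>2 \<partial>M) \<le> B * ((\<integral>\<omega>. (Xr n i \<omega> / Hr n i \<omega>)\<^sup>2 \<partial>M) + (\<integral>\<omega>. (Xr n j \<omega> / Hr n j \<omega>)\<^sup>2 \<partial>M) + 1 / (real (Suc n))\<^sup>2)" for n
    using integral_mono_AE[OF intD int dom[of n]] ratio_squares(1) ij by (simp add: prob_space)
  then show "summable (\<lambda>n. \<integral>\<omega>. (D n \<omega>)\<^sup>2 \<partial>M)"
    by (intro summable_comparison_test'[OF summable_mult[OF summable_add[OF summable_add[OF
      ratio_squares(2)[OF ij(1)] ratio_squares(2)[OF ij(2)]] summable_inverse_Suc_squares], of B], of 0]) simp
qed (use D orth in auto)

lemma square_diff_le: "(a - b)\<^sup>2 \<le> 2 * a\<^sup>2 + 2 * (b::real)\<^sup>2"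
  using zero_le_power2[of "a + b"] by (simp add: power2_sum power2_diff)

text \<open>Taken with \<open>c n = mu n k\<close> for the drift of ln H_k, and with
  \<open>c n = 1\<close> to compare the number of draws with its compensator.\<close>

lemma AE_summable_drawing_noise:
  assumes k: "k \<in> {1..d}" and c: "\<And>n. \<bar>c n\<bar> \<le> K"
  shows "AE \<omega> in M. summable (\<lambda>n. c n * (Xr n k \<omega> / Hr n k \<omega> - Nr n \<omega> / Sr n \<omega>))"
proof (rule AE_summable_dominated[OF k k, where B = "2 * K\<^sup>2 * (1 + (real C1)\<^sup>2)"])
  show "(\<lambda>\<omega>. c n * (Xr n k \<omega> / Hr n k \<omega> - Nr n \<omega> / Sr n \<omega>)) \<in> borel_measurable (FF (Suc n))" for n
    by (intro borel_measurable_times borel_measurable_const borel_measurable_diff borel_measurable_divide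
      Xr_measurable_F Hr_measurable_F Nr_measurable_F Sr_measurable_F k) auto
  have K: "K \<ge> 0" using c[of 0] by linarith
  show "AE \<omega> in M. (c n * (Xr n k \<omega> / Hr n k \<omega> - Nr n \<omega> / Sr n \<omega>))\<^sup>2 \<le> 2 * K\<^sup>2 * (1 + (real C1)\<^sup>2) *
      ((Xr n k \<omega> / Hr n k \<omega>)\<^sup>2 + (Xr n k \<omega> / Hr n k \<omega>)\<^sup>2 + 1 / (real (Suc n))\<^sup>2)" for n
    using AE_good
  proof eventually_elim
    case (elim \<omega>)
    have c2: "(c n)\<^sup>2 \<le> K\<^sup>2" using c[of n] K by (simp add: abs_le_square_iff[symmetric])
    have "Nr n \<omega> / Sr n \<omega> \<le> real C1 / real (Suc n)"
      using good_N(2)[OF elim, of n] good_S_ge[OF elim, of n] by (intro frac_le) auto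
    then have "(Nr n \<omega> / Sr n \<omega>)\<^sup>2 \<le> (real C1 / real (Suc n))\<^sup>2" by (intro power_mono) auto
    then have NS: "(Nr n \<omega> / Sr n \<omega>)\<^sup>2 \<le> (real C1)\<^sup>2 * (1 / (real (Suc n))\<^sup>2)" by (simp add: power_divide)
    have "(c n * (Xr n k \<omega> / Hr n k \<omega> - Nr n \<omega> / Sr n \<omega>))\<^sup>2
        \<le> K\<^sup>2 * (2 * (Xr n k \<omega> / Hr n k \<omega>)\<^sup>2 + 2 * (Nr n \<omega> / Sr n \<omega>)\<^sup>2)"
      unfolding power_mult_distrib by (intro mult_mono c2 square_diff_le) auto
    also have "\<dots> \<le> K\<^sup>2 * (2 * (Xr n k \<omega> / Hr n k \<omega>)\<^sup>2 + 2 * ((real C1)\<^sup>2 * (1 / (real (Suc n))\<^sup>2)))"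
      using NS by (intro mult_left_mono add_left_mono) auto
    also have "\<dots> \<le> K\<^sup>2 * (2 * (1 + (real C1)\<^sup>2) * ((Xr n k \<omega> / Hr n k \<omega>)\<^sup>2 + (Xr n k \<omega> / Hr n k \<omega>)\<^sup>2 + 1 / (real (Suc n))\<^sup>2))"
    proof (rule mult_left_mono)
      have *: "2 * x + 2 * (b * y) \<le> 2 * (1 + b) * (x + x + y)" if "x \<ge> 0" "b \<ge> 0" "y \<ge> 0" for x b y :: real
        using that mult_nonneg_nonneg[OF that(2,1)] by (simp add: algebra_simps)
      show "2 * (Xr n k \<omega> / Hr n k \<omega>)\<^sup>2 + 2 * ((real C1)\<^sup>2 * (1 / (real (Suc n))\<^sup>2))
        \<le> 2 * (1 + (real C1)\<^sup>2) * ((Xr n k \<omega> / Hr n k \<omega>)\<^sup>2 + (Xr n k \<omega> / Hr n k \<omega>)\<^sup>2 + 1 / (real (Suc n))\<^sup>2)"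
        by (rule *) auto
    qed simp
    finally show ?case by (simp only: mult_ac)
  qed
  fix n and W :: "'w \<Rightarrow> real" assume W: "W \<in> borel_measurable (FF n)" "integrable M (\<lambda>\<omega>. (W \<omega>)\<^sup>2)"
  note [measurable] = X_measurable[OF k] H_measurable[OF k] measurable_M_of_F[OF W(1)]
  have Wi: "integrable M W" by (rule integrable_of_square_F[OF W])
  define V where "V \<omega> = W \<omega> * (1 / Hr n k \<omega>)" for \<omega>
  have VG: "V \<in> borel_measurable (GG n)"
    unfolding V_def by (intro borel_measurable_times borel_measurable_divide borel_measurable_const
      measurable_G_of_F[OF W(1)] measurable_G_of_F[OF Hr_measurable_F] k order_refl)
  have Vi: "integrable M V"
    unfolding V_def by (rule integrable_mult_AE_bounded[OF Wi, of _ 1]) (use Hr_ge_1[OF k] in \<open>auto simp: divide_le_eq_1 intro!: AE_I2\<close>)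
  have VX: "integrable M (\<lambda>\<omega>. V \<omega> * Xr n k \<omega>)"
    by (rule integrable_mult_AE_bounded[OF Vi, of _ C1]) (use AE_good good_X_le_C1[OF _ k] in auto)
  have WN: "integrable M (\<lambda>\<omega>. W \<omega> * (Nr n \<omega> / Sr n \<omega>))"
    by (rule integrable_mult_AE_bounded[OF Wi, of _ 1], measurable)
      (use AE_good good_N(3) in \<open>auto simp: divide_le_eq_1\<close>)
  have "(\<integral>\<omega>. V \<omega> * Xr n k \<omega> \<partial>M) = (\<integral>\<omega>. V \<omega> * (Nr n \<omega> * Hr n k \<omega> / Sr n \<omega>) \<partial>M)"
    by (rule X_conditional_mean[OF VG Vi k])
  also have "\<dots> = (\<integral>\<omega>. W \<omega> * (Nr n \<omega> / Sr n \<omega>) \<partial>M)"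
    using Hr_pos[OF k, of n] by (intro Bochner_Integration.integral_cong) (auto simp: V_def less_imp_neq[symmetric])
  finally have "(\<integral>\<omega>. V \<omega> * Xr n k \<omega> - W \<omega> * (Nr n \<omega> / Sr n \<omega>) \<partial>M) = 0"
    using VX WN by simp
  then have "c n * (\<integral>\<omega>. V \<omega> * Xr n k \<omega> - W \<omega> * (Nr n \<omega> / Sr n \<omega>) \<partial>M) = 0" by simp
  then show "(\<integral>\<omega>. W \<omega> * (c n * (Xr n k \<omega> / Hr n k \<omega> - Nr n \<omega> / Sr n \<omega>)) \<partial>M) = 0"
    unfolding integral_mult_right_zero[symmetric] by (simp add: V_def algebra_simps)
qed

text \<open>The number of ordered pairs of distinct drawn balls with colours \<open>i\<close> and \<open>j\<close>, and its
  conditional mean.\<close>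

definition Y :: "nat \<Rightarrow> nat \<Rightarrow> nat \<Rightarrow> 'w \<Rightarrow> real" where
  "Y i j n \<omega> = Xr n i \<omega> * (Xr n j \<omega> - (if i = j then 1 else 0))"
definition yc :: "nat \<Rightarrow> nat \<Rightarrow> nat \<Rightarrow> 'w \<Rightarrow> real" where
  "yc i j n \<omega> = Nr n \<omega> * (Nr n \<omega> - 1) * (Hr n i \<omega> * (Hr n j \<omega> - (if i = j then 1 else 0))) / (Sr n \<omega> * (Sr n \<omega> - 1))"

text \<open>The factor 2 comes from \<open>Sr n \<omega> - 1 \<ge> Sr n \<omega> / 2\<close>, valid
  since the urn holds at least two balls, and \<open>C1\<close> bounds
  \<open>Nr n \<omega> - 1\<close>.\<close>

lemma yc_bounds:
  assumes g: "good \<omega>" and ij: "i \<in> {1..d}" "j \<in> {1..d}"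
  shows "0 \<le> yc i j n \<omega>"
    and "yc i j n \<omega> \<le> 2 * real C1 * (Nr n \<omega> * (Hr n i \<omega> / Sr n \<omega>) * (Hr n j \<omega> / Sr n \<omega>))"
proof -
  have N: "Nr n \<omega> \<ge> 1" "Nr n \<omega> \<le> real C1" using good_N[OF g, of n] by auto
  have H: "Hr n j \<omega> - (if i = j then 1 else 0) \<ge> 0" "Hr n j \<omega> - (if i = j then 1 else 0) \<le> Hr n j \<omega>"
    using Hr_ge_1[OF ij(2), of n \<omega>] by auto
  have S: "Sr n \<omega> \<ge> 2" "Sr n \<omega> / 2 \<le> Sr n \<omega> - 1" using Sr_ge_2[of n \<omega>] by auto
  show "0 \<le> yc i j n \<omega>" unfolding yc_def using N H S by (intro divide_nonneg_nonneg mult_nonneg_nonneg) auto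
  have "yc i j n \<omega> \<le> Nr n \<omega> * real C1 * (Hr n i \<omega> * Hr n j \<omega>) / (Sr n \<omega> * (Sr n \<omega> / 2))"
    unfolding yc_def using N H S by (intro frac_le mult_mono) auto
  also have "\<dots> = 2 * real C1 * (Nr n \<omega> * (Hr n i \<omega> / Sr n \<omega>) * (Hr n j \<omega> / Sr n \<omega>))"
    using S by (simp add: field_simps)
  finally show "yc i j n \<omega> \<le> 2 * real C1 * (Nr n \<omega> * (Hr n i \<omega> / Sr n \<omega>) * (Hr n j \<omega> / Sr n \<omega>))" .
qed

text \<open>The product of the square roots of H_i and H_j has the order of the normalisation in the
  covariance, so this is the series needed for Kronecker's lemma. With x and y the two ratios of
  draw to content, the squared \<open>Y\<close> term is at most C1^2 x y, hence at most C1^2 (x^2 +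
  y^2); the squared conditional mean contributes 4 C1^4 / S^2. Both are doubled in the constant
  \<open>B\<close>.\<close>

lemma AE_summable_product_noise:
  assumes ij: "i \<in> {1..d}" "j \<in> {1..d}"
  shows "AE \<omega> in M. summable (\<lambda>n. (Y i j n \<omega> - yc i j n \<omega>) / sqrt (Hr n i \<omega> * Hr n j \<omega>))"
proof (rule AE_summable_dominated[OF ij, where B = "2 * (real C1)\<^sup>2 + 8 * real C1 ^ 4"])
  note [measurable] = X_measurable[OF ij(1)] H_measurable[OF ij(1)] X_measurable[OF ij(2)] H_measurable[OF ij(2)]
  show "(\<lambda>\<omega>. (Y i j n \<omega> - yc i j n \<omega>) / sqrt (Hr n i \<omega> * Hr n j \<omega>)) \<in> borel_measurable (FF (Suc n))" for n
    unfolding Y_def yc_def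
    by (intro borel_measurable_times borel_measurable_const borel_measurable_diff borel_measurable_divide
      measurable_compose[OF _ borel_measurable_sqrt] Xr_measurable_F Hr_measurable_F Nr_measurable_F Sr_measurable_F ij) auto
  show "AE \<omega> in M. ((Y i j n \<omega> - yc i j n \<omega>) / sqrt (Hr n i \<omega> * Hr n j \<omega>))\<^sup>2 \<le> (2 * (real C1)\<^sup>2 + 8 * real C1 ^ 4) *
      ((Xr n i \<omega> / Hr n i \<omega>)\<^sup>2 + (Xr n j \<omega> / Hr n j \<omega>)\<^sup>2 + 1 / (real (Suc n))\<^sup>2)" for n
    using AE_good
  proof eventually_elim
    case (elim \<omega>)
    define x y where "x = Xr n i \<omega> / Hr n i \<omega>" and "y = Xr n j \<omega> / Hr n j \<omega>"
    have H: "Hr n i \<omega> > 0" "Hr n j \<omega> > 0" using Hr_pos ij by auto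
    have XC: "Xr n i \<omega> \<le> real C1" "Xr n j \<omega> \<le> real C1" using good_X_le_C1[OF elim] ij by auto
    have Y: "0 \<le> Y i j n \<omega>" "Y i j n \<omega> \<le> Xr n i \<omega> * Xr n j \<omega>"
    proof -
      show "0 \<le> Y i j n \<omega>"
        by (cases "i = j"; cases "X (Suc n) j \<omega> = 0") (auto simp: Y_def)
      show "Y i j n \<omega> \<le> Xr n i \<omega> * Xr n j \<omega>"
        unfolding Y_def by (intro mult_left_mono) auto
    qed
    have "(Y i j n \<omega>)\<^sup>2 \<le> (Xr n i \<omega> * Xr n j \<omega>)\<^sup>2" using Y by (intro power_mono) auto
    also have "\<dots> = (Xr n i \<omega> * Xr n j \<omega>) * (Xr n i \<omega> * Xr n j \<omega>)" by (simp add: power2_eq_square)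
    also have "\<dots> \<le> (real C1 * real C1) * (Xr n i \<omega> * Xr n j \<omega>)"
      using XC by (intro mult_right_mono mult_mono) auto
    finally have "(Y i j n \<omega>)\<^sup>2 / (Hr n i \<omega> * Hr n j \<omega>) \<le> (real C1)\<^sup>2 * (x * y)"
      using H by (simp add: x_def y_def divide_right_mono power2_eq_square)
    also have "\<dots> \<le> (real C1)\<^sup>2 * (x\<^sup>2 + y\<^sup>2)"
    proof (rule mult_left_mono)
      have "2 * (x * y) \<le> x\<^sup>2 + y\<^sup>2" "0 \<le> x * y"
        using sum_squares_bound[of x y] by (auto simp: x_def y_def)
      then show "x * y \<le> x\<^sup>2 + y\<^sup>2" by linarith
    qed simp
    finally have 1: "(Y i j n \<omega>)\<^sup>2 / (Hr n i \<omega> * Hr n j \<omega>) \<le> (real C1)\<^sup>2 * (x\<^sup>2 + y\<^sup>2)" .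
    have S: "Sr n \<omega> \<ge> real (Suc n)" "Sr n \<omega> > 0" using good_S_ge[OF elim, of n] by auto
    have HS: "Hr n i \<omega> / Sr n \<omega> \<le> 1" "Hr n j \<omega> / Sr n \<omega> \<le> 1" using Hr_le_Sr ij S by (auto simp: divide_le_eq_1)
    have "yc i j n \<omega> \<le> 2 * real C1 * (Nr n \<omega> * (Hr n i \<omega> / Sr n \<omega>) * (Hr n j \<omega> / Sr n \<omega>))"
      by (rule yc_bounds[OF elim ij])
    also have "\<dots> \<le> 2 * real C1 * (real C1 * (Hr n i \<omega> / Sr n \<omega>) * (Hr n j \<omega> / Sr n \<omega>))"
      using good_N(2)[OF elim, of n] H S by (intro mult_left_mono mult_right_mono) auto
    finally have "(yc i j n \<omega>)\<^sup>2 \<le> (2 * real C1 * (real C1 * (Hr n i \<omega> / Sr n \<omega>) * (Hr n j \<omega> / Sr n \<omega>)))\<^sup>2"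
      using yc_bounds(1)[OF elim ij] by (intro power_mono) auto
    also have "\<dots> = 4 * real C1 ^ 4 * ((Hr n i \<omega> / Sr n \<omega>) * (Hr n j \<omega> / Sr n \<omega>)) * ((Hr n i \<omega> * Hr n j \<omega>) / (Sr n \<omega>)\<^sup>2)"
      by (simp add: power2_eq_square power4_eq_xxxx field_simps)
    also have "\<dots> \<le> 4 * real C1 ^ 4 * 1 * ((Hr n i \<omega> * Hr n j \<omega>) / (Sr n \<omega>)\<^sup>2)"
      using HS H S by (intro mult_right_mono mult_left_mono mult_le_one) auto
    finally have "(yc i j n \<omega>)\<^sup>2 / (Hr n i \<omega> * Hr n j \<omega>) \<le> 4 * real C1 ^ 4 / (Sr n \<omega>)\<^sup>2"
      using H by (simp add: field_simps)
    also have "\<dots> \<le> 4 * real C1 ^ 4 / (real (Suc n))\<^sup>2"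
      using S by (intro divide_left_mono power_mono mult_pos_pos) auto
    finally have 2: "(yc i j n \<omega>)\<^sup>2 / (Hr n i \<omega> * Hr n j \<omega>) \<le> 4 * real C1 ^ 4 * (1 / (real (Suc n))\<^sup>2)" by simp
    have "((Y i j n \<omega> - yc i j n \<omega>) / sqrt (Hr n i \<omega> * Hr n j \<omega>))\<^sup>2 = (Y i j n \<omega> - yc i j n \<omega>)\<^sup>2 / (Hr n i \<omega> * Hr n j \<omega>)"
      using H by (simp add: power_divide)
    also have "\<dots> \<le> (2 * (Y i j n \<omega>)\<^sup>2 + 2 * (yc i j n \<omega>)\<^sup>2) / (Hr n i \<omega> * Hr n j \<omega>)"
      using H by (intro divide_right_mono square_diff_le) auto
    also have "\<dots> \<le> 2 * ((real C1)\<^sup>2 * (x\<^sup>2 + y\<^sup>2)) + 2 * (4 * real C1 ^ 4 * (1 / (real (Suc n))\<^sup>2))"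
      unfolding add_divide_distrib using mult_left_mono[OF 1, of 2] mult_left_mono[OF 2, of 2] by simp
    also have "\<dots> \<le> (2 * (real C1)\<^sup>2 + 8 * real C1 ^ 4) * (x\<^sup>2 + y\<^sup>2 + 1 / (real (Suc n))\<^sup>2)"
    proof -
      have *: "2 * (a * u) + 2 * (4 * b * v) \<le> (2 * a + 8 * b) * (u + v)" if "a \<ge> 0" "b \<ge> 0" "u \<ge> 0" "v \<ge> 0" for a b u v :: real
        using mult_nonneg_nonneg[OF that(1,4)] mult_nonneg_nonneg[OF that(2,3)] by (simp add: algebra_simps)
      show ?thesis by (rule *) auto
    qed
    finally show ?case by (simp add: x_def y_def)
  qed
  fix n and W :: "'w \<Rightarrow> real" assume W: "W \<in> borel_measurable (FF n)" "integrable M (\<lambda>\<omega>. (W \<omega>)\<^sup>2)"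
  note [measurable] = measurable_M_of_F[OF W(1)]
  have Wi: "integrable M W" by (rule integrable_of_square_F[OF W])
  define V where "V \<omega> = W \<omega> * (1 / sqrt (Hr n i \<omega> * Hr n j \<omega>))" for \<omega>
  have VG: "V \<in> borel_measurable (GG n)"
    unfolding V_def by (intro borel_measurable_times borel_measurable_divide borel_measurable_const measurable_compose[OF _ borel_measurable_sqrt]
      measurable_G_of_F[OF W(1)] measurable_G_of_F[OF Hr_measurable_F] ij order_refl)
  have s1: "sqrt (Hr n i \<omega> * Hr n j \<omega>) \<ge> 1" for \<omega>
  proof -
    have "1 * 1 \<le> Hr n i \<omega> * Hr n j \<omega>" using Hr_ge_1 ij by (intro mult_mono) auto
    then show ?thesis by simp
  qed
  have Vi: "integrable M V"
    unfolding V_def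
  proof (rule integrable_mult_AE_bounded[OF Wi, of _ 1])
    show "AE \<omega> in M. \<bar>1 / sqrt (Hr n i \<omega> * Hr n j \<omega>)\<bar> \<le> 1"
    proof (rule AE_I2)
      fix \<omega> show "\<bar>1 / sqrt (Hr n i \<omega> * Hr n j \<omega>)\<bar> \<le> 1"
        using s1[of \<omega>] by (subst abs_of_nonneg) (auto simp: divide_le_eq_1)
    qed
  qed measurable
  have YM: "Y i j n \<in> borel_measurable M" "yc i j n \<in> borel_measurable M"
    unfolding Y_def[abs_def] yc_def[abs_def] by measurable
  have VY: "integrable M (\<lambda>\<omega>. V \<omega> * Y i j n \<omega>)"
  proof (rule integrable_mult_AE_bounded[OF Vi YM(1), of "real C1 * (real C1 + 1)"])
    show "AE \<omega> in M. \<bar>Y i j n \<omega>\<bar> \<le> real C1 * (real C1 + 1)"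
      using AE_good
    proof eventually_elim
      case (elim \<omega>)
      then have XC: "Xr n i \<omega> \<le> real C1" "Xr n j \<omega> \<le> real C1" using good_X_le_C1[OF elim] ij by auto
      then show ?case unfolding Y_def abs_mult by (intro mult_mono) auto
    qed
  qed
  have Vy: "integrable M (\<lambda>\<omega>. V \<omega> * yc i j n \<omega>)"
  proof (rule integrable_mult_AE_bounded[OF Vi YM(2), of "2 * real C1 * (real C1 * 1 * 1)"])
    show "AE \<omega> in M. \<bar>yc i j n \<omega>\<bar> \<le> 2 * real C1 * (real C1 * 1 * 1)"
      using AE_good
    proof eventually_elim
      case (elim \<omega>)
      have HS: "Hr n i \<omega> / Sr n \<omega> \<le> 1" "Hr n j \<omega> / Sr n \<omega> \<le> 1"
        using Hr_le_Sr ij Sr_ge_2[of n \<omega>] by (auto simp: divide_le_eq_1)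
      have "yc i j n \<omega> \<le> 2 * real C1 * (Nr n \<omega> * (Hr n i \<omega> / Sr n \<omega>) * (Hr n j \<omega> / Sr n \<omega>))"
        by (rule yc_bounds[OF elim ij])
      also have "\<dots> \<le> 2 * real C1 * (real C1 * 1 * 1)"
        using good_N(2)[OF elim, of n] HS by (intro mult_left_mono mult_mono) auto
      finally show ?case using yc_bounds(1)[OF elim ij] by simp
    qed
  qed
  have "(\<integral>\<omega>. V \<omega> * Y i j n \<omega> \<partial>M) = (\<integral>\<omega>. V \<omega> * yc i j n \<omega> \<partial>M)"
    unfolding Y_def yc_def by (rule X_conditional_second[OF VG Vi ij])
  then have "(\<integral>\<omega>. V \<omega> * Y i j n \<omega> - V \<omega> * yc i j n \<omega> \<partial>M) = 0" using VY Vy by simp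
  then show "(\<integral>\<omega>. W \<omega> * ((Y i j n \<omega> - yc i j n \<omega>) / sqrt (Hr n i \<omega> * Hr n j \<omega>)) \<partial>M) = 0"
    by (simp add: V_def diff_divide_distrib right_diff_distrib)
qed

text \<open>Only conditional means are assumed to converge. The differences from the actual values
  are bounded and orthogonal to the past, so divided by \<open>n + 1\<close> they are summable, and
  Kronecker's lemma removes them from the averages.\<close>

lemma AE_cesaro_of_conditional:
  fixes f :: "nat \<Rightarrow> real" and G :: "'w \<Rightarrow> real"
  assumes f: "\<And>i. 0 \<le> f i" "\<And>i. i \<le> C1 \<Longrightarrow> f i \<le> K"
    and lim: "AE \<omega> in M. (\<lambda>n. real_cond_exp M (FF n) (\<lambda>\<omega>. f (N (Suc n) \<omega>)) \<omega>) \<longlonglongrightarrow> G \<omega>"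
  shows "AE \<omega> in M. (\<lambda>n. (\<Sum>i<n. f (N (Suc i) \<omega>)) / real (Suc n)) \<longlonglongrightarrow> G \<omega>"
proof -
  define e where "e n = real_cond_exp M (FF n) (\<lambda>\<omega>. f (N (Suc n) \<omega>))" for n
  have fb: "AE \<omega> in M. \<bar>f (N (Suc n) \<omega>)\<bar> \<le> K" for n
    using AE_good by eventually_elim (use f good_N(2) in auto)
  have fi: "integrable M (\<lambda>\<omega>. f (N (Suc n) \<omega>))" for n
    by (rule integrable_AE_bounded[OF _ fb]) measurable
  have eF: "e n \<in> borel_measurable (FF n)" for n
    unfolding e_def by (rule borel_measurable_cond_exp)
  have eM [measurable]: "e n \<in> borel_measurable M" for n by (rule measurable_M_of_F[OF eF])
  have eb: "AE \<omega> in M. \<bar>e n \<omega>\<bar> \<le> K" for n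
  proof -
    interpret F: finite_measure_subalgebra M "FF n"
      by unfold_locales (rule subalgebra_F)
    have le: "AE \<omega> in M. f (N (Suc n) \<omega>) \<le> K" using fb[of n] by eventually_elim simp
    have "AE \<omega> in M. e n \<omega> \<ge> 0" unfolding e_def
      by (rule F.real_cond_exp_ge_c[OF fi]) (simp add: f)
    moreover have "AE \<omega> in M. e n \<omega> \<le> K" unfolding e_def
      by (rule F.real_cond_exp_le_c[OF fi le])
    ultimately show ?thesis by eventually_elim auto
  qed
  have one: "1 \<in> {1..d}" using d_ge_2 by simp
  \<comment> \<open>The last of the three dominating terms controls a bounded noise divided by
    \<open>n + 1\<close>; colour 1 fills the places of the other two.\<close>
  have "AE \<omega> in M. summable (\<lambda>n. (f (N (Suc n) \<omega>) - e n \<omega>) / real (Suc n))"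
  proof (rule AE_summable_dominated[OF one one, where B = "4 * K\<^sup>2"])
    show "(\<lambda>\<omega>. (f (N (Suc n) \<omega>) - e n \<omega>) / real (Suc n)) \<in> borel_measurable (FF (Suc n))" for n
      by (intro borel_measurable_divide borel_measurable_const borel_measurable_diff
        measurable_compose[OF N_measurable_F, of _ _ f] measurable_from_subalg[OF subalgebra_F_mono eF]) auto
    show "AE \<omega> in M. ((f (N (Suc n) \<omega>) - e n \<omega>) / real (Suc n))\<^sup>2
      \<le> 4 * K\<^sup>2 * ((Xr n 1 \<omega> / Hr n 1 \<omega>)\<^sup>2 + (Xr n 1 \<omega> / Hr n 1 \<omega>)\<^sup>2 + 1 / (real (Suc n))\<^sup>2)" for n
      using fb[of n] eb[of n]
    proof eventually_elim
      case (elim \<omega>)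
      have "(f (N (Suc n) \<omega>) - e n \<omega>)\<^sup>2 \<le> 2 * (f (N (Suc n) \<omega>))\<^sup>2 + 2 * (e n \<omega>)\<^sup>2" by (rule square_diff_le)
      also have "\<dots> \<le> 4 * K\<^sup>2"
        using elim abs_le_square_iff[of "f (N (Suc n) \<omega>)" K] abs_le_square_iff[of "e n \<omega>" K] by simp
      finally have "((f (N (Suc n) \<omega>) - e n \<omega>) / real (Suc n))\<^sup>2 \<le> 4 * K\<^sup>2 * (1 / (real (Suc n))\<^sup>2)"
        by (simp add: power_divide divide_right_mono)
      also have "\<dots> \<le> 4 * K\<^sup>2 * ((Xr n 1 \<omega> / Hr n 1 \<omega>)\<^sup>2 + (Xr n 1 \<omega> / Hr n 1 \<omega>)\<^sup>2 + 1 / (real (Suc n))\<^sup>2)"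
        by (intro mult_left_mono) auto
      finally show ?case .
    qed
    fix n and W :: "'w \<Rightarrow> real" assume W: "W \<in> borel_measurable (FF n)" "integrable M (\<lambda>\<omega>. (W \<omega>)\<^sup>2)"
    interpret F: finite_measure_subalgebra M "FF n"
      by unfold_locales (rule subalgebra_F)
    have Wi: "integrable M W" by (rule integrable_of_square_F[OF W])
    have Wf: "integrable M (\<lambda>\<omega>. W \<omega> * f (N (Suc n) \<omega>))"
      by (rule integrable_mult_AE_bounded[OF Wi _ fb]) measurable
    have We: "integrable M (\<lambda>\<omega>. W \<omega> * e n \<omega>)"
      by (rule integrable_mult_AE_bounded[OF Wi _ eb]) measurable
    have "(\<integral>\<omega>. W \<omega> * e n \<omega> \<partial>M) = (\<integral>\<omega>. W \<omega> * f (N (Suc n) \<omega>) \<partial>M)"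
      unfolding e_def by (rule F.real_cond_exp_intg(2)[OF Wf W(1)]) measurable
    then have "(\<integral>\<omega>. (W \<omega> * f (N (Suc n) \<omega>) - W \<omega> * e n \<omega>) / real (Suc n) \<partial>M) = 0"
      using Wf We by simp
    then show "(\<integral>\<omega>. W \<omega> * ((f (N (Suc n) \<omega>) - e n \<omega>) / real (Suc n)) \<partial>M) = 0"
      by (simp add: right_diff_distrib)
  qed
  then show ?thesis using lim
  proof eventually_elim
    case (elim \<omega>)
    have top: "filterlim (\<lambda>n. real (Suc n)) at_top sequentially"
      by (rule filterlim_compose[OF filterlim_real_sequentially filterlim_Suc])
    have "(\<lambda>n. (\<Sum>i<n. f (N (Suc i) \<omega>) - e i \<omega>) / real (Suc n)) \<longlonglongrightarrow> 0"
      by (rule kronecker_lemma[OF elim(1) _ _ top]) (auto simp: incseq_def)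
    moreover have "(\<lambda>n. (\<Sum>i<n. 1::real) / real (Suc n)) \<longlonglongrightarrow> 1"
      using LIMSEQ_n_over_Suc_n by simp
    then have "(\<lambda>n. (\<Sum>i<n. e i \<omega> * 1) / real (Suc n)) \<longlonglongrightarrow> G \<omega> * 1"
      by (intro weighted_cesaro[OF _ _ _ top]) (use elim in \<open>auto simp: e_def\<close>)
    ultimately have "(\<lambda>n. (\<Sum>i<n. f (N (Suc i) \<omega>) - e i \<omega>) / real (Suc n) + (\<Sum>i<n. e i \<omega> * 1) / real (Suc n)) \<longlonglongrightarrow> 0 + G \<omega> * 1"
      by (rule tendsto_add)
    then show ?case by (simp add: sum_subtractf add_divide_distrib[symmetric])
  qed
qed

text \<open>The almost sure event on which all further limits are deterministic consequences.\<close>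

definition regular :: "'w \<Rightarrow> bool" where
  "regular \<omega> \<longleftrightarrow> good \<omega> \<and>
    (\<forall>k\<in>{1..d}. summable (\<lambda>n. Ac n k \<omega> * Xr n k \<omega> / Hr n k \<omega>)) \<and>
    (\<forall>k\<in>{1..d}. summable (\<lambda>n. (Ar n k \<omega> * Xr n k \<omega> / Hr n k \<omega>)\<^sup>2)) \<and>
    (\<forall>k\<in>{1..d}. summable (\<lambda>n. mu n k * (Xr n k \<omega> / Hr n k \<omega> - Nr n \<omega> / Sr n \<omega>))) \<and>
    (\<forall>k\<in>{1..d}. summable (\<lambda>n. Xr n k \<omega> / Hr n k \<omega> - Nr n \<omega> / Sr n \<omega>)) \<and>
    (\<forall>i\<in>{1..d}. \<forall>j\<in>{1..d}. summable (\<lambda>n. (Y i j n \<omega> - yc i j n \<omega>) / sqrt (Hr n i \<omega> * Hr n j \<omega>))) \<and>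
    (\<lambda>n. (\<Sum>i<n. Nr i \<omega>) / real (Suc n)) \<longlonglongrightarrow> NN \<omega> \<and>
    (\<lambda>n. (\<Sum>i<n. (Nr i \<omega>)\<^sup>2) / real (Suc n)) \<longlonglongrightarrow> Q \<omega>"

lemma AE_regular: "AE \<omega> in M. regular \<omega>"
proof -
  have fin: "finite {1..d}" by simp
  have mub: "\<bar>mu n k\<bar> \<le> C2" if "k \<in> {1..d}" for n k
    using A_moments(4,5)[OF that, of n] by simp
  have 1: "AE \<omega> in M. \<forall>k\<in>{1..d}. summable (\<lambda>n. Ac n k \<omega> * Xr n k \<omega> / Hr n k \<omega>)"
    by (intro AE_finite_allI fin AE_summable_replacement_noise)
  have 2: "AE \<omega> in M. \<forall>k\<in>{1..d}. summable (\<lambda>n. (Ar n k \<omega> * Xr n k \<omega> / Hr n k \<omega>)\<^sup>2)"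
    by (intro AE_finite_allI fin AE_summable_replacement_noise)
  have 3: "AE \<omega> in M. \<forall>k\<in>{1..d}. summable (\<lambda>n. mu n k * (Xr n k \<omega> / Hr n k \<omega> - Nr n \<omega> / Sr n \<omega>))"
    by (intro AE_finite_allI fin AE_summable_drawing_noise[OF _ mub])
  have 4: "AE \<omega> in M. \<forall>k\<in>{1..d}. summable (\<lambda>n. Xr n k \<omega> / Hr n k \<omega> - Nr n \<omega> / Sr n \<omega>)"
    using AE_summable_drawing_noise[of _ "\<lambda>_. 1" 1] by (intro AE_finite_allI fin) simp
  have 5: "AE \<omega> in M. \<forall>i\<in>{1..d}. \<forall>j\<in>{1..d}. summable (\<lambda>n. (Y i j n \<omega> - yc i j n \<omega>) / sqrt (Hr n i \<omega> * Hr n j \<omega>))"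
    by (intro AE_finite_allI fin AE_summable_product_noise)
  have 6: "AE \<omega> in M. (\<lambda>n. (\<Sum>i<n. Nr i \<omega>) / real (Suc n)) \<longlonglongrightarrow> NN \<omega>"
    by (rule AE_cesaro_of_conditional[where f=real and K="real C1"]) (use NN_lim in auto)
  have 7: "AE \<omega> in M. (\<lambda>n. (\<Sum>i<n. (Nr i \<omega>)\<^sup>2) / real (Suc n)) \<longlonglongrightarrow> Q \<omega>"
    by (rule AE_cesaro_of_conditional[where f="\<lambda>i. (real i)\<^sup>2" and K="(real C1)\<^sup>2"]) (use Q_lim in auto)
  show ?thesis
    using AE_good 1 2 3 4 5 6 7 by eventually_elim (simp add: regular_def)
qed

end

section \<open>Growth of the urn composition\<close>

lemma abs_ln_one_plus_minus_le_square:
  fixes x :: real assumes "0 \<le> x" shows "\<bar>ln (1 + x) - x\<bar> \<le> x\<^sup>2"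
proof (cases "x \<le> 1")
  case True
  then show ?thesis using abs_ln_one_plus_x_minus_x_bound_nonneg[of x] assms by simp
next
  case False
  then have "ln (1 + x) \<ge> 0" "ln (1 + x) \<le> x" using ln_add_one_self_le_self[of x] by auto
  moreover have "x * 1 \<le> x * x" using False by (intro mult_left_mono) auto
  ultimately show ?thesis by (simp add: power2_eq_square)
qed

lemma LIMSEQ_imp_bounded:
  fixes x :: "nat \<Rightarrow> real"
  assumes "x \<longlonglongrightarrow> l"
  obtains B where "\<And>n. \<bar>x n\<bar> \<le> B"
proof -
  have "Bseq x" by (rule convergent_imp_Bseq[OF convergentI[OF assms]])
  then obtain K where "\<And>n. norm (x n) \<le> K" unfolding Bseq_def by blast
  then show ?thesis using that[of K] by simp
qed

lemma powr_at_top: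
  assumes "0 < p" shows "filterlim (\<lambda>x::real. x powr p) at_top at_top"
proof -
  have "filterlim (\<lambda>x. exp (p * ln x)) at_top at_top"
    by (rule filterlim_compose[OF exp_at_top filterlim_tendsto_pos_mult_at_top[OF tendsto_const assms ln_at_top]])
  moreover have "\<forall>\<^sub>F x in at_top. exp (p * ln x) = x powr p"
    using eventually_gt_at_top[of "0::real"] by eventually_elim (simp add: powr_def)
  ultimately show ?thesis by (rule filterlim_mono_eventually[OF _ order_refl order_refl])
qed

lemma filterlim_real_Suc: "filterlim (\<lambda>n. real (Suc n)) at_top sequentially"
  by (rule filterlim_compose[OF filterlim_real_sequentially filterlim_Suc])

context reinforced_urn_limit
begin

abbreviation Zl where "Zl \<equiv> urn_Zlim d h0 X A"
abbreviation Dr where "Dr n k \<omega> \<equiv> real (urn_drawn X n k \<omega>)"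

lemma regular_good: "regular \<omega> \<Longrightarrow> good \<omega>" by (simp add: regular_def)

lemma Dr_eq: "Dr n k \<omega> = (\<Sum>i<n. Xr i k \<omega>)"
  by (simp add: urn_drawn_def sum.atLeast1_atMost_eq)

lemma Zn_eq: "Zn n k \<omega> = Hr n k \<omega> / Sr n \<omega>" by (simp add: urn_Z_def)

lemma one_in: "1 \<in> {1..d}" using d_ge_2 by simp

text \<open>With relative increment x = A X / H, the increment ln (1 + x) differs from x by at most
  x^2, and x is the sum of replacement noise, drawing noise and drift. All but the drift are
  summable on the regular event.\<close>

lemma regular_ln_increments:
  assumes \<omega>: "regular \<omega>" and k: "k \<in> {1..d}"
  shows "summable (\<lambda>n. (ln (Hr (Suc n) k \<omega>) - ln (Hr n k \<omega>)) - mu n k * (Nr n \<omega> / Sr n \<omega>))"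
proof -
  define x where "x n = Ar n k \<omega> * Xr n k \<omega> / Hr n k \<omega>" for n
  have x0: "x n \<ge> 0" for n by (simp add: x_def)
  have sq: "summable (\<lambda>n. (x n)\<^sup>2)" using \<omega> k by (simp add: regular_def x_def)
  have 1: "summable (\<lambda>n. ln (1 + x n) - x n)"
    by (rule summable_comparison_test'[OF sq, of 0]) (use abs_ln_one_plus_minus_le_square[OF x0] in auto)
  have 2: "summable (\<lambda>n. Ac n k \<omega> * Xr n k \<omega> / Hr n k \<omega>)"
    and 3: "summable (\<lambda>n. mu n k * (Xr n k \<omega> / Hr n k \<omega> - Nr n \<omega> / Sr n \<omega>))"
    using \<omega> k by (auto simp: regular_def)
  have "(ln (Hr (Suc n) k \<omega>) - ln (Hr n k \<omega>)) - mu n k * (Nr n \<omega> / Sr n \<omega>)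
      = (ln (1 + x n) - x n) + Ac n k \<omega> * Xr n k \<omega> / Hr n k \<omega>
        + mu n k * (Xr n k \<omega> / Hr n k \<omega> - Nr n \<omega> / Sr n \<omega>)" for n
  proof -
    have H: "Hr n k \<omega> > 0" by (rule Hr_pos[OF k])
    then have "Hr (Suc n) k \<omega> = Hr n k \<omega> * (1 + x n)"
      unfolding Hr_Suc x_def by (simp add: field_simps)
    then have "ln (Hr (Suc n) k \<omega>) = ln (Hr n k \<omega>) + ln (1 + x n)"
      using H x0[of n] by (simp add: ln_mult)
    moreover have "x n = Ac n k \<omega> * Xr n k \<omega> / Hr n k \<omega> + mu n k * (Xr n k \<omega> / Hr n k \<omega>)"
      by (simp add: x_def Ac_def left_diff_distrib diff_divide_distrib)
    ultimately show ?thesis by (simp add: right_diff_distrib)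
  qed
  then show ?thesis using summable_add[OF summable_add[OF 1 2] 3] by simp
qed

text \<open>By (A3) the logarithms of \<open>H\<^sub>k\<close> and of \<open>H\<^sub>1\<close> have proportional drifts up to a summable error.\<close>

lemma regular_log_ratio_convergent:
  assumes \<omega>: "regular \<omega>" and k: "k \<in> {1..d}"
  shows "convergent (\<lambda>n. ln (Hr n k \<omega>) - ex k * ln (Hr n 1 \<omega>))"
proof -
  have m1: "m 1 \<ge> 1" by (rule m_ge_1[OF one_in])
  define u where "u n = Nr n \<omega> / Sr n \<omega>" for n
  have u: "0 \<le> u n" "u n \<le> real C1 / real (Suc n)" for n
    using good_N(2)[OF regular_good[OF \<omega>], of n] good_S_ge[OF regular_good[OF \<omega>], of n]
    unfolding u_def by (auto intro!: frac_le)
  have "summable (\<lambda>n. (mu n k - ex k * mu n 1) * u n)"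
  \<comment> \<open>The comparison starts at 1, because the summand of (A3) at index 0 is a division
    by zero.\<close>
  proof (rule summable_comparison_test'[OF summable_mult[OF A3[OF k one_in], of "real C1 / m 1"], of 1])
    fix n :: nat assume n: "n \<ge> 1"
    have "\<bar>(mu n k - ex k * mu n 1) * u n\<bar> \<le> \<bar>mu n k - ex k * mu n 1\<bar> * (real C1 / real n)"
      unfolding abs_mult
    proof (rule mult_left_mono)
      have "real C1 / real (Suc n) \<le> real C1 / real n" using n by (intro divide_left_mono) auto
      then show "\<bar>u n\<bar> \<le> real C1 / real n" using u[of n] by simp
    qed simp
    also have "\<bar>mu n k - ex k * mu n 1\<bar> = \<bar>mu n k * m 1 - m k * mu n 1\<bar> / m 1"
    proof -
      have "mu n k - ex k * mu n 1 = (mu n k * m 1 - m k * mu n 1) / m 1"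
        using m1 by (simp add: ex_def field_simps)
      then show ?thesis using m1 by simp
    qed
    finally show "norm ((mu n k - ex k * mu n 1) * u n)
        \<le> real C1 / m 1 * (\<bar>urn_mean M A (n + 1) k * m 1 - m k * urn_mean M A (n + 1) 1\<bar> / real n)"
      by (simp add: mu_def mult_ac)
  qed
  from summable_add[OF summable_diff[OF regular_ln_increments[OF \<omega> k] summable_mult[OF regular_ln_increments[OF \<omega> one_in], of "ex k"]] this]
  have "summable (\<lambda>n. (ln (Hr (Suc n) k \<omega>) - ex k * ln (Hr (Suc n) 1 \<omega>)) - (ln (Hr n k \<omega>) - ex k * ln (Hr n 1 \<omega>)))"
    by (simp add: u_def algebra_simps)
  then have "convergent (\<lambda>n. \<Sum>i<n. (ln (Hr (Suc i) k \<omega>) - ex k * ln (Hr (Suc i) 1 \<omega>)) - (ln (Hr i k \<omega>) - ex k * ln (Hr i 1 \<omega>)))"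
    by (simp only: summable_iff_convergent)
  then have "convergent (\<lambda>n. (ln (Hr n k \<omega>) - ex k * ln (Hr n 1 \<omega>)) - (ln (Hr 0 k \<omega>) - ex k * ln (Hr 0 1 \<omega>)))"
    by (simp only: sum_lessThan_telescope[of "\<lambda>i. ln (Hr i k \<omega>) - ex k * ln (Hr i 1 \<omega>)"])
  from convergent_add[OF this convergent_const[of "ln (Hr 0 k \<omega>) - ex k * ln (Hr 0 1 \<omega>)"]]
  show ?thesis by simp
qed

text \<open>The limit is positive because it is an exponential; this is what makes
  \<open>ex k\<close> the exact exponent and not just an upper bound.\<close>

lemma regular_H_power:
  assumes \<omega>: "regular \<omega>" and k: "k \<in> {1..d}"
  obtains \<rho> where "\<rho> > 0" "(\<lambda>n. Hr n k \<omega> / Hr n 1 \<omega> powr ex k) \<longlonglongrightarrow> \<rho>"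
proof -
  obtain L where L: "(\<lambda>n. ln (Hr n k \<omega>) - ex k * ln (Hr n 1 \<omega>)) \<longlonglongrightarrow> L"
    using regular_log_ratio_convergent[OF \<omega> k] by (auto simp: convergent_def)
  have "exp (ln (Hr n k \<omega>) - ex k * ln (Hr n 1 \<omega>)) = Hr n k \<omega> / Hr n 1 \<omega> powr ex k" for n
    using Hr_pos[OF k, of n \<omega>] Hr_pos[OF one_in, of n \<omega>] by (simp add: exp_diff powr_def)
  then have "(\<lambda>n. Hr n k \<omega> / Hr n 1 \<omega> powr ex k) \<longlonglongrightarrow> exp L"
    using tendsto_exp[OF L] by simp
  then show ?thesis using that[of "exp L"] by simp
qed

text \<open>No growth rate is known yet. Since \<open>ex k \<le> 1\<close>, every H_k, and hence S,
  is bounded by a constant multiple of H_1, while S grows at least linearly.\<close>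

lemma regular_H1_top:
  assumes \<omega>: "regular \<omega>"
  shows "filterlim (\<lambda>n. Hr n 1 \<omega>) at_top sequentially"
proof -
  have "\<exists>B. \<forall>n. Hr n k \<omega> \<le> B * Hr n 1 \<omega>" if k: "k \<in> {1..d}" for k
  proof -
    obtain \<rho> where "(\<lambda>n. Hr n k \<omega> / Hr n 1 \<omega> powr ex k) \<longlonglongrightarrow> \<rho>"
      using regular_H_power[OF \<omega> k] .
    then obtain B where B: "\<And>n. \<bar>Hr n k \<omega> / Hr n 1 \<omega> powr ex k\<bar> \<le> B"
      by (rule LIMSEQ_imp_bounded) blast
    have "Hr n k \<omega> \<le> B * Hr n 1 \<omega>" for n
    proof -
      have h: "Hr n 1 \<omega> \<ge> 1" by (rule Hr_ge_1[OF one_in])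
      have p: "Hr n 1 \<omega> powr ex k \<le> Hr n 1 \<omega>"
        using powr_mono[OF ex_bounds(2)[OF k] h] h by simp
      have "Hr n k \<omega> = (Hr n k \<omega> / Hr n 1 \<omega> powr ex k) * Hr n 1 \<omega> powr ex k" using h by simp
      also have "\<dots> \<le> B * Hr n 1 \<omega>"
      proof (rule mult_mono)
        show "Hr n k \<omega> / Hr n 1 \<omega> powr ex k \<le> B" using B[of n] by simp
        show "0 \<le> B" using B[of n] abs_ge_zero order_trans by blast
      qed (use p in auto)
      finally show ?thesis .
    qed
    then show ?thesis by blast
  qed
  then have "\<forall>k\<in>{1..d}. \<exists>B. \<forall>n. Hr n k \<omega> \<le> B * Hr n 1 \<omega>" by blast
  from bchoice[OF this] obtain B where B: "\<And>k n. k \<in> {1..d} \<Longrightarrow> Hr n k \<omega> \<le> B k * Hr n 1 \<omega>"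
    by blast
  define b where "b = (\<Sum>k=1..d. B k)"
  have S: "Sr n \<omega> \<le> b * Hr n 1 \<omega>" for n
    unfolding urn_S_def of_nat_sum b_def sum_distrib_right by (intro sum_mono B)
  have lower: "real (Suc n) \<le> b * Hr n 1 \<omega>" for n
    using S[of n] good_S_ge[OF regular_good[OF \<omega>], of n] by linarith
  have b: "b > 0"
    using lower[of 0] Hr_pos[OF one_in, of 0 \<omega>] by (smt (verit) mult_nonpos_nonneg of_nat_0_less_iff zero_less_Suc)
  have "filterlim (\<lambda>n. inverse b * real (Suc n)) at_top sequentially"
    using b by (intro filterlim_tendsto_pos_mult_at_top[OF tendsto_const _ filterlim_real_Suc]) simp
  then show ?thesis
    by (rule filterlim_at_top_mono) (use lower b in \<open>simp add: field_simps\<close>)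
qed

lemma regular_H_top:
  assumes \<omega>: "regular \<omega>" and k: "k \<in> {1..d}"
  shows "filterlim (\<lambda>n. Hr n k \<omega>) at_top sequentially"
proof -
  obtain \<rho> where \<rho>: "\<rho> > 0" "(\<lambda>n. Hr n k \<omega> / Hr n 1 \<omega> powr ex k) \<longlonglongrightarrow> \<rho>"
    using regular_H_power[OF \<omega> k] .
  have "filterlim (\<lambda>n. Hr n 1 \<omega> powr ex k) at_top sequentially"
    using filterlim_compose[OF powr_at_top regular_H1_top[OF \<omega>]] ex_bounds(1)[OF k] by simp
  from filterlim_tendsto_pos_mult_at_top[OF \<rho>(2,1) this]
  show ?thesis using Hr_pos[OF one_in] by (simp add: less_imp_neq[symmetric])
qed

lemma regular_S_top:
  assumes \<omega>: "regular \<omega>" shows "filterlim (\<lambda>n. Sr n \<omega>) at_top sequentially"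
  by (rule filterlim_at_top_mono[OF filterlim_real_Suc]) (use good_S_ge[OF regular_good[OF \<omega>]] in auto)

lemma regular_H_ratio:
  assumes \<omega>: "regular \<omega>" and k: "k \<in> {1..d}"
  obtains \<rho> where "(\<lambda>n. Hr n k \<omega> / Hr n 1 \<omega>) \<longlonglongrightarrow> \<rho>" "k \<le> t \<Longrightarrow> \<rho> > 0" "t < k \<Longrightarrow> \<rho> = 0"
proof -
  obtain \<rho> where \<rho>: "\<rho> > 0" "(\<lambda>n. Hr n k \<omega> / Hr n 1 \<omega> powr ex k) \<longlonglongrightarrow> \<rho>"
    using regular_H_power[OF \<omega> k] .
  show ?thesis
  proof (cases "k \<le> t")
    case True
    then have "(\<lambda>n. Hr n k \<omega> / Hr n 1 \<omega>) \<longlonglongrightarrow> \<rho>" using \<rho>(2) ex_bounds(3)[OF k] by simp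
    then show ?thesis using that \<rho> True by auto
  next
    case False
    have "((\<lambda>n. Hr n 1 \<omega> powr (ex k - 1)) \<longlongrightarrow> 0) sequentially"
      using ex_bounds(4)[OF k] False by (intro tendsto_neg_powr regular_H1_top[OF \<omega>]) auto
    from tendsto_mult[OF \<rho>(2) this]
    have "(\<lambda>n. Hr n k \<omega> / Hr n 1 \<omega> powr ex k * Hr n 1 \<omega> powr (ex k - 1)) \<longlonglongrightarrow> 0" by simp
    moreover have "Hr n k \<omega> / Hr n 1 \<omega> powr ex k * Hr n 1 \<omega> powr (ex k - 1) = Hr n k \<omega> / Hr n 1 \<omega>" for n
      using Hr_pos[OF one_in, of n \<omega>] by (simp add: powr_diff)
    ultimately show ?thesis using that[of 0] False by simp
  qed
qed

lemma regular_Z: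
  assumes \<omega>: "regular \<omega>" and k: "k \<in> {1..d}"
  shows "(\<lambda>n. Zn n k \<omega>) \<longlonglongrightarrow> Zl k \<omega>" "k \<le> t \<Longrightarrow> Zl k \<omega> > 0" "t < k \<Longrightarrow> Zl k \<omega> = 0"
proof -
  have "\<forall>k\<in>{1..d}. \<exists>\<rho>. (\<lambda>n. Hr n k \<omega> / Hr n 1 \<omega>) \<longlonglongrightarrow> \<rho> \<and> (k \<le> t \<longrightarrow> \<rho> > 0) \<and> (t < k \<longrightarrow> \<rho> = 0)"
  proof
    fix k assume "k \<in> {1..d}"
    from regular_H_ratio[OF \<omega> this] show "\<exists>\<rho>. (\<lambda>n. Hr n k \<omega> / Hr n 1 \<omega>) \<longlonglongrightarrow> \<rho> \<and> (k \<le> t \<longrightarrow> \<rho> > 0) \<and> (t < k \<longrightarrow> \<rho> = 0)"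
      by blast
  qed
  from bchoice[OF this] obtain \<rho> where \<rho>: "\<And>k. k \<in> {1..d} \<Longrightarrow> (\<lambda>n. Hr n k \<omega> / Hr n 1 \<omega>) \<longlonglongrightarrow> \<rho> k"
    "\<And>k. k \<in> {1..d} \<Longrightarrow> k \<le> t \<Longrightarrow> \<rho> k > 0" "\<And>k. k \<in> {1..d} \<Longrightarrow> t < k \<Longrightarrow> \<rho> k = 0" by blast
  define \<sigma> where "\<sigma> = (\<Sum>k=1..d. \<rho> k)"
  have \<sigma>: "\<sigma> > 0"
    unfolding \<sigma>_def
  proof (rule sum_pos2[OF _ one_in])
    show "0 < \<rho> 1" using \<rho>(2)[OF one_in] A2_t by auto
    show "0 \<le> \<rho> i" if "i \<in> {1..d}" for i using \<rho>(2,3)[OF that] by (cases "i \<le> t") auto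
  qed simp
  have "(\<lambda>n. \<Sum>k=1..d. Hr n k \<omega> / Hr n 1 \<omega>) \<longlonglongrightarrow> \<sigma>"
    unfolding \<sigma>_def by (intro tendsto_sum \<rho>)
  then have "(\<lambda>n. Sr n \<omega> / Hr n 1 \<omega>) \<longlonglongrightarrow> \<sigma>"
    by (simp add: urn_S_def sum_divide_distrib)
  from tendsto_divide[OF \<rho>(1)[OF k] this] \<sigma>
  have "(\<lambda>n. (Hr n k \<omega> / Hr n 1 \<omega>) / (Sr n \<omega> / Hr n 1 \<omega>)) \<longlonglongrightarrow> \<rho> k / \<sigma>" by simp
  moreover have "(Hr n k \<omega> / Hr n 1 \<omega>) / (Sr n \<omega> / Hr n 1 \<omega>) = Zn n k \<omega>" for n
    using Hr_pos[OF one_in, of n \<omega>] by (simp add: Zn_eq)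
  ultimately have lim: "(\<lambda>n. Zn n k \<omega>) \<longlonglongrightarrow> \<rho> k / \<sigma>" by simp
  then have Zl: "Zl k \<omega> = \<rho> k / \<sigma>" unfolding urn_Zlim_def by (rule limI)
  show "(\<lambda>n. Zn n k \<omega>) \<longlonglongrightarrow> Zl k \<omega>" using lim Zl by simp
  show "k \<le> t \<Longrightarrow> Zl k \<omega> > 0" "t < k \<Longrightarrow> Zl k \<omega> = 0"
    using Zl \<rho>(2,3)[OF k] \<sigma> by auto
qed

lemma regular_Z_nonneg: "regular \<omega> \<Longrightarrow> k \<in> {1..d} \<Longrightarrow> Zl k \<omega> \<ge> 0"
  using regular_Z(2,3)[of \<omega> k] by (cases "k \<le> t") auto

lemma regular_Z_sum:
  assumes \<omega>: "regular \<omega>" shows "(\<Sum>k=1..d. Zl k \<omega>) = 1"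
proof (rule LIMSEQ_unique)
  show "(\<lambda>n. \<Sum>k=1..d. Zn n k \<omega>) \<longlonglongrightarrow> (\<Sum>k=1..d. Zl k \<omega>)"
    by (intro tendsto_sum regular_Z[OF \<omega>])
  have "(\<Sum>k=1..d. Zn n k \<omega>) = 1" for n
  proof -
    have "(\<Sum>k=1..d. Zn n k \<omega>) = (\<Sum>k=1..d. Hr n k \<omega>) / Sr n \<omega>"
      unfolding Zn_eq by (rule sum_divide_distrib[symmetric])
    also have "(\<Sum>k=1..d. Hr n k \<omega>) = Sr n \<omega>" by (simp add: urn_S_def)
    finally show ?thesis using Sr_ge_2[of n \<omega>] by simp
  qed
  then show "(\<lambda>n. \<Sum>k=1..d. Zn n k \<omega>) \<longlonglongrightarrow> 1" by simp
qed

section \<open>Draws compared with the composition, and linear growth of the urn\<close>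

lemma incseq_Hr: "incseq (\<lambda>n. Hr n k \<omega>)"
  by (rule incseq_SucI) (simp add: H_Suc)

lemma regular_noise_negligible:
  assumes \<omega>: "regular \<omega>" and k: "k \<in> {1..d}"
  shows "(\<lambda>n. (\<Sum>i<n. Ac i k \<omega> * Xr i k \<omega>) / Hr n k \<omega>) \<longlonglongrightarrow> 0"
  by (rule kronecker_lemma[OF _ incseq_Hr Hr_pos[OF k] regular_H_top[OF \<omega> k]])
    (use \<omega> k in \<open>simp add: regular_def\<close>)

lemma good_Dr_le_Hr: "good \<omega> \<Longrightarrow> k \<in> {1..d} \<Longrightarrow> Dr n k \<omega> \<le> Hr n k \<omega>"
proof (induction n)
  case (Suc n)
  have "1 * Xr n k \<omega> \<le> Ar n k \<omega> * Xr n k \<omega>" using Suc by (intro mult_right_mono) (auto simp: good_def)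
  with Suc show ?case by (simp add: Dr_eq Hr_Suc)
qed (simp add: urn_drawn_def)

text \<open>H_k is its initial value plus the sum of A X. Replacing A by m_k costs the centred
  noise, negligible by Kronecker's lemma, and the bias of the means, negligible by the Toeplitz
  argument since the draws are bounded by H_k.\<close>

lemma regular_drawn_ratio:
  assumes \<omega>: "regular \<omega>" and k: "k \<in> {1..d}"
  shows "(\<lambda>n. Dr n k \<omega> / Hr n k \<omega>) \<longlonglongrightarrow> 1 / m k"
proof -
  have mk: "m k > 0" using m_ge_1[OF k] by simp
  have 1: "(\<lambda>n. (\<Sum>i<n. (mu i k - m k) * Xr i k \<omega>) / Hr n k \<omega>) \<longlonglongrightarrow> 0"
  proof (rule toeplitz_null[OF _ _ _ regular_H_top[OF \<omega> k], of _ _ 1])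
    show "(\<lambda>i. mu i k - m k) \<longlonglongrightarrow> 0" using mu_lim[OF k] by (simp add: LIM_zero_iff)
    show "(\<Sum>i<n. Xr i k \<omega>) \<le> 1 * Hr n k \<omega>" for n
      using good_Dr_le_Hr[OF regular_good[OF \<omega>] k, of n] by (simp add: Dr_eq)
  qed simp
  have 2: "(\<lambda>n. Hr 0 k \<omega> / Hr n k \<omega>) \<longlonglongrightarrow> 0"
    by (rule real_tendsto_divide_at_top[OF tendsto_const regular_H_top[OF \<omega> k]])
  have eq: "m k * Dr n k \<omega> = Hr n k \<omega> - Hr 0 k \<omega> - (\<Sum>i<n. Ac i k \<omega> * Xr i k \<omega>)
      - (\<Sum>i<n. (mu i k - m k) * Xr i k \<omega>)" for n
    unfolding Dr_eq by (induction n) (auto simp: Hr_Suc Ac_def algebra_simps)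
  have "(\<lambda>n. 1 - Hr 0 k \<omega> / Hr n k \<omega> - (\<Sum>i<n. Ac i k \<omega> * Xr i k \<omega>) / Hr n k \<omega>
      - (\<Sum>i<n. (mu i k - m k) * Xr i k \<omega>) / Hr n k \<omega>) \<longlonglongrightarrow> 1 - 0 - 0 - 0"
    by (intro tendsto_diff tendsto_const 1 2 regular_noise_negligible[OF \<omega> k])
  moreover have "1 - Hr 0 k \<omega> / Hr n k \<omega> - (\<Sum>i<n. Ac i k \<omega> * Xr i k \<omega>) / Hr n k \<omega>
      - (\<Sum>i<n. (mu i k - m k) * Xr i k \<omega>) / Hr n k \<omega> = m k * (Dr n k \<omega> / Hr n k \<omega>)" for n
    using Hr_pos[OF k, of n \<omega>] unfolding times_divide_eq_right eq by (simp add: field_simps)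
  ultimately have "(\<lambda>n. m k * (Dr n k \<omega> / Hr n k \<omega>)) \<longlonglongrightarrow> 1" by simp
  from tendsto_divide[OF this tendsto_const, of "m k"] mk show ?thesis by simp
qed

lemma regular_drawn_inverse_ratio:
  assumes \<omega>: "regular \<omega>" and k: "k \<in> {1..d}"
  shows "(\<lambda>n. Hr n k \<omega> / Dr n k \<omega>) \<longlonglongrightarrow> m k"
  using tendsto_inverse[OF regular_drawn_ratio[OF \<omega> k]] m_ge_1[OF k] by (simp add: inverse_eq_divide)

text \<open>The sum is the compensator of the draws; it will provide the weights for averaging the
  proportions of a minor colour.\<close>

lemma regular_expected_drawn_ratio:
  assumes \<omega>: "regular \<omega>" and k: "k \<in> {1..d}"
  shows "(\<lambda>n. (\<Sum>i<n. Nr i \<omega> * Zn i k \<omega>) / Hr n k \<omega>) \<longlonglongrightarrow> 1 / m k"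
proof -
  have "summable (\<lambda>n. (Xr n k \<omega> - Nr n \<omega> * Zn n k \<omega>) / Hr n k \<omega>)"
  proof -
    have "(Xr n k \<omega> - Nr n \<omega> * Zn n k \<omega>) / Hr n k \<omega> = Xr n k \<omega> / Hr n k \<omega> - Nr n \<omega> / Sr n \<omega>" for n
      using Hr_pos[OF k, of n \<omega>] by (simp add: Zn_eq diff_divide_distrib)
    then show ?thesis using \<omega> k by (simp add: regular_def)
  qed
  then have "(\<lambda>n. (\<Sum>i<n. Xr i k \<omega> - Nr i \<omega> * Zn i k \<omega>) / Hr n k \<omega>) \<longlonglongrightarrow> 0"
    by (rule kronecker_lemma[OF _ incseq_Hr Hr_pos[OF k] regular_H_top[OF \<omega> k]])
  from tendsto_diff[OF regular_drawn_ratio[OF \<omega> k] this]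
  show ?thesis by (simp add: Dr_eq sum_subtractf diff_divide_distrib)
qed

text \<open>The pointwise inequalities N - 1 \<le> N(N - 1) \<le> C1 (N - 1) survive averaging.
  Together they show that \<open>Q = NN\<close> holds exactly where \<open>NN = 1\<close>.\<close>

lemma regular_limits_of_N:
  assumes \<omega>: "regular \<omega>"
  shows "NN \<omega> \<ge> 1" "NN \<omega> - 1 \<le> Q \<omega> - NN \<omega>" "Q \<omega> - NN \<omega> \<le> real C1 * (NN \<omega> - 1)"
proof -
  have g: "good \<omega>" by (rule regular_good[OF \<omega>])
  have 1: "(\<lambda>n. (\<Sum>i<n. Nr i \<omega>) / real (Suc n)) \<longlonglongrightarrow> NN \<omega>"
    and 2: "(\<lambda>n. (\<Sum>i<n. (Nr i \<omega>)\<^sup>2) / real (Suc n)) \<longlonglongrightarrow> Q \<omega>"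
    using \<omega> by (auto simp: regular_def)
  have 3: "(\<lambda>n. (\<Sum>i<n. 1::real) / real (Suc n)) \<longlonglongrightarrow> 1" using LIMSEQ_n_over_Suc_n by simp
  have N: "Nr i \<omega> \<ge> 1" "Nr i \<omega> \<le> real C1" for i using good_N[OF g, of i] by auto
  show "NN \<omega> \<ge> 1"
    by (rule LIMSEQ_le[OF 3 1]) (auto intro!: divide_right_mono sum_mono N simp del: sum_constant)
  have a: "(\<lambda>n. (\<Sum>i<n. Nr i \<omega> - 1) / real (Suc n)) \<longlonglongrightarrow> NN \<omega> - 1"
    using tendsto_diff[OF 1 3] by (simp add: sum_subtractf diff_divide_distrib)
  have b: "(\<lambda>n. (\<Sum>i<n. (Nr i \<omega>)\<^sup>2 - Nr i \<omega>) / real (Suc n)) \<longlonglongrightarrow> Q \<omega> - NN \<omega>"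
    using tendsto_diff[OF 2 1] by (simp add: sum_subtractf diff_divide_distrib)
  have c: "(\<lambda>n. (\<Sum>i<n. real C1 * (Nr i \<omega> - 1)) / real (Suc n)) \<longlonglongrightarrow> real C1 * (NN \<omega> - 1)"
    using tendsto_mult_left[OF a, of "real C1"] by (simp add: sum_distrib_left)
  have eq: "(Nr i \<omega>)\<^sup>2 - Nr i \<omega> = Nr i \<omega> * (Nr i \<omega> - 1)" for i
    by (simp add: power2_eq_square algebra_simps)
  have le1: "Nr i \<omega> - 1 \<le> (Nr i \<omega>)\<^sup>2 - Nr i \<omega>" for i
    unfolding eq using N[of i] mult_right_mono[of 1 "Nr i \<omega>" "Nr i \<omega> - 1"] by simp
  have le2: "(Nr i \<omega>)\<^sup>2 - Nr i \<omega> \<le> real C1 * (Nr i \<omega> - 1)" for i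
    unfolding eq using N[of i] by (intro mult_right_mono) auto
  show "NN \<omega> - 1 \<le> Q \<omega> - NN \<omega>"
    by (rule LIMSEQ_le[OF a b]) (intro exI[of _ 0] allI impI divide_right_mono sum_mono le1, simp)
  show "Q \<omega> - NN \<omega> \<le> real C1 * (NN \<omega> - 1)"
    by (rule LIMSEQ_le[OF b c]) (intro exI[of _ 0] allI impI divide_right_mono sum_mono le2, simp)
qed

text \<open>The sum over k of (D_k / H_k) Z_k equals the total number of drawn balls over S. Its
  limit, the sum of Z_k / m_k, is 1 / m_1, as Z_k vanishes for the minor colours and m_k = m_1 for
  the others.\<close>

lemma regular_S_limit:
  assumes \<omega>: "regular \<omega>"
  shows "(\<lambda>n. Sr n \<omega> / real (Suc n)) \<longlonglongrightarrow> m 1 * NN \<omega>"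
proof -
  have m1: "m 1 \<ge> 1" by (rule m_ge_1[OF one_in])
  have "(\<lambda>n. \<Sum>k=1..d. Dr n k \<omega> / Hr n k \<omega> * Zn n k \<omega>) \<longlonglongrightarrow> (\<Sum>k=1..d. 1 / m k * Zl k \<omega>)"
    by (intro tendsto_sum tendsto_mult regular_drawn_ratio[OF \<omega>] regular_Z(1)[OF \<omega>])
  also have "(\<Sum>k=1..d. 1 / m k * Zl k \<omega>) = (\<Sum>k=1..d. 1 / m 1 * Zl k \<omega>)"
  proof (intro sum.cong refl)
    fix k assume k: "k \<in> {1..d}"
    show "1 / m k * Zl k \<omega> = 1 / m 1 * Zl k \<omega>"
      using regular_Z(3)[OF \<omega> k] A2_eq[of k] k by (cases "k \<le> t") auto
  qed
  also have "\<dots> = 1 / m 1" unfolding sum_distrib_left[symmetric] regular_Z_sum[OF \<omega>] by simp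
  also have "(\<lambda>n. \<Sum>k=1..d. Dr n k \<omega> / Hr n k \<omega> * Zn n k \<omega>) = (\<lambda>n. (\<Sum>i<n. Nr i \<omega>) / Sr n \<omega>)"
  proof
    fix n
    have "(\<Sum>k=1..d. Dr n k \<omega> / Hr n k \<omega> * Zn n k \<omega>) = (\<Sum>k=1..d. Dr n k \<omega> / Sr n \<omega>)"
      using Hr_pos[of _ n \<omega>] by (intro sum.cong refl) (auto simp: Zn_eq less_imp_neq[symmetric])
    also have "\<dots> = (\<Sum>k=1..d. \<Sum>i<n. Xr i k \<omega>) / Sr n \<omega>" by (simp add: sum_divide_distrib Dr_eq)
    also have "(\<Sum>k=1..d. \<Sum>i<n. Xr i k \<omega>) = (\<Sum>i<n. \<Sum>k=1..d. Xr i k \<omega>)" by (rule sum.swap)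
    also have "\<dots> = (\<Sum>i<n. Nr i \<omega>)"
      using regular_good[OF \<omega>] by (intro sum.cong refl) (simp add: good_def flip: of_nat_sum)
    finally show "(\<Sum>k=1..d. Dr n k \<omega> / Hr n k \<omega> * Zn n k \<omega>) = (\<Sum>i<n. Nr i \<omega>) / Sr n \<omega>" .
  qed
  finally have 1: "(\<lambda>n. (\<Sum>i<n. Nr i \<omega>) / Sr n \<omega>) \<longlonglongrightarrow> 1 / m 1" .
  have 2: "(\<lambda>n. (\<Sum>i<n. Nr i \<omega>) / real (Suc n)) \<longlonglongrightarrow> NN \<omega>" using \<omega> by (simp add: regular_def)
  from tendsto_divide[OF 2 1] m1
  have 3: "(\<lambda>n. ((\<Sum>i<n. Nr i \<omega>) / real (Suc n)) / ((\<Sum>i<n. Nr i \<omega>) / Sr n \<omega>)) \<longlonglongrightarrow> m 1 * NN \<omega>"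
    by (simp add: mult.commute)
  have "((\<Sum>i<n. Nr i \<omega>) / real (Suc n)) / ((\<Sum>i<n. Nr i \<omega>) / Sr n \<omega>) = Sr n \<omega> / real (Suc n)" if "n \<ge> 1" for n
  proof -
    have "(\<Sum>i<n. Nr i \<omega>) > 0"
      using that good_N(1)[OF regular_good[OF \<omega>]] by (intro sum_pos) (auto simp: Suc_le_eq)
    then show ?thesis by simp
  qed
  then have "eventually (\<lambda>n. ((\<Sum>i<n. Nr i \<omega>) / real (Suc n)) / ((\<Sum>i<n. Nr i \<omega>) / Sr n \<omega>) = Sr n \<omega> / real (Suc n)) sequentially"
    unfolding eventually_sequentially by blast
  from Lim_transform_eventually[OF 3 this] show ?thesis .
qed

lemma regular_drawn_limit:
  assumes \<omega>: "regular \<omega>" and k: "k \<in> {1..d}"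
  shows "(\<lambda>n. Dr n k \<omega> / real (Suc n)) \<longlonglongrightarrow> Zl k \<omega> * NN \<omega>"
proof -
  have m1: "m 1 \<ge> 1" by (rule m_ge_1[OF one_in])
  have "(\<lambda>n. Dr n k \<omega> / Hr n k \<omega> * Zn n k \<omega> * (Sr n \<omega> / real (Suc n))) \<longlonglongrightarrow> 1 / m k * Zl k \<omega> * (m 1 * NN \<omega>)"
    by (intro tendsto_mult regular_drawn_ratio[OF \<omega> k] regular_Z(1)[OF \<omega> k] regular_S_limit[OF \<omega>])
  also have "1 / m k * Zl k \<omega> * (m 1 * NN \<omega>) = Zl k \<omega> * NN \<omega>"
    using regular_Z(3)[OF \<omega> k] A2_eq[of k] k m1 by (cases "k \<le> t") auto
  also have "(\<lambda>n. Dr n k \<omega> / Hr n k \<omega> * Zn n k \<omega> * (Sr n \<omega> / real (Suc n))) = (\<lambda>n. Dr n k \<omega> / real (Suc n))"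
  proof
    fix n show "Dr n k \<omega> / Hr n k \<omega> * Zn n k \<omega> * (Sr n \<omega> / real (Suc n)) = Dr n k \<omega> / real (Suc n)"
      using Hr_pos[OF k, of n \<omega>] Sr_ge_2[of n \<omega>] by (simp add: Zn_eq)
  qed
  finally show ?thesis .
qed

text \<open>H_1 grows linearly with the positive rate Z_1 m_1 N; the other colours follow it through
  \<open>regular_H_power\<close>.\<close>

lemma regular_H_growth:
  assumes \<omega>: "regular \<omega>" and k: "k \<in> {1..d}"
  obtains w where "w > 0" "(\<lambda>n. Hr n k \<omega> / real (Suc n) powr ex k) \<longlonglongrightarrow> w"
proof -
  obtain \<rho> where \<rho>: "\<rho> > 0" "(\<lambda>n. Hr n k \<omega> / Hr n 1 \<omega> powr ex k) \<longlonglongrightarrow> \<rho>"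
    using regular_H_power[OF \<omega> k] .
  define z where "z = Zl 1 \<omega> * (m 1 * NN \<omega>)"
  have "1 \<le> t" using A2_t by simp
  then have z: "z > 0"
    unfolding z_def using regular_Z(2)[OF \<omega> one_in] m_ge_1[OF one_in] regular_limits_of_N(1)[OF \<omega>] by simp
  have "(\<lambda>n. Zn n 1 \<omega> * (Sr n \<omega> / real (Suc n))) \<longlonglongrightarrow> z"
    unfolding z_def by (intro tendsto_mult regular_Z(1)[OF \<omega> one_in] regular_S_limit[OF \<omega>])
  moreover have "Zn n 1 \<omega> * (Sr n \<omega> / real (Suc n)) = Hr n 1 \<omega> / real (Suc n)" for n
    using Sr_ge_2[of n \<omega>] by (simp add: Zn_eq)
  ultimately have "(\<lambda>n. Hr n 1 \<omega> / real (Suc n)) \<longlonglongrightarrow> z" by simp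
  then have "(\<lambda>n. (Hr n 1 \<omega> / real (Suc n)) powr ex k) \<longlonglongrightarrow> z powr ex k"
    using z by (intro tendsto_powr tendsto_const) auto
  from tendsto_mult[OF \<rho>(2) this]
  have "(\<lambda>n. Hr n k \<omega> / Hr n 1 \<omega> powr ex k * (Hr n 1 \<omega> / real (Suc n)) powr ex k) \<longlonglongrightarrow> \<rho> * z powr ex k" .
  moreover have "Hr n k \<omega> / Hr n 1 \<omega> powr ex k * (Hr n 1 \<omega> / real (Suc n)) powr ex k = Hr n k \<omega> / real (Suc n) powr ex k" for n
    using Hr_pos[OF one_in, of n \<omega>] by (simp add: powr_divide del: of_nat_Suc)
  ultimately show ?thesis using that[of "\<rho> * z powr ex k"] \<rho>(1) z by simp
qed

text \<open>Kronecker's lemma replaces the pairs \<open>Y\<close> by their conditional means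
  \<open>yc\<close>, which are about N(N - 1) Z_i Z_j. The average of N(N - 1) is Q - N, and
  division by the numbers of draws, about n N times the geometric mean of Z_i and Z_j, leaves the
  stated limit.\<close>

lemma regular_product_limit:
  assumes \<omega>: "regular \<omega>" and ij: "i \<in> {1..d}" "j \<in> {1..d}"
  shows "(\<lambda>n. (\<Sum>l<n. Y i j l \<omega>) / sqrt (Dr n i \<omega> * Dr n j \<omega>)) \<longlonglongrightarrow> sqrt (Zl i \<omega> * Zl j \<omega>) * (Q \<omega> / NN \<omega> - 1)"
proof -
  have g: "good \<omega>" by (rule regular_good[OF \<omega>])
  have NN: "NN \<omega> \<ge> 1" by (rule regular_limits_of_N(1)[OF \<omega>])
  have Hi: "\<And>n. Hr n i \<omega> > 0" "\<And>n. Hr n j \<omega> > 0" using Hr_pos ij by auto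
  define b where "b n = sqrt (Hr n i \<omega> * Hr n j \<omega>)" for n
  have b_inc: "incseq b"
    unfolding b_def using incseq_Hr Hi by (intro incseq_SucI) (auto intro!: mult_mono simp: H_Suc)
  have b_pos: "b n > 0" for n using Hi by (simp add: b_def)
  have b_top: "filterlim b at_top sequentially"
  proof (rule filterlim_at_top_mono[OF filterlim_compose[OF sqrt_at_top regular_H_top[OF \<omega> ij(1)]]])
    have "sqrt (Hr n i \<omega>) \<le> b n" for n
      unfolding b_def using Hr_ge_1[OF ij(2), of n \<omega>] mult_left_mono[of 1 "Hr n j \<omega>" "Hr n i \<omega>"] by simp
    then show "\<forall>\<^sub>F n in sequentially. sqrt (Hr n i \<omega>) \<le> b n" by simp
  qed
  have 1: "(\<lambda>n. (\<Sum>l<n. Y i j l \<omega> - yc i j l \<omega>) / b n) \<longlonglongrightarrow> 0"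
    by (rule kronecker_lemma[OF _ b_inc b_pos b_top]) (use \<omega> ij in \<open>simp add: regular_def b_def\<close>)
  have HD: "(\<lambda>n. sqrt ((Hr n i \<omega> / Dr n i \<omega>) * (Hr n j \<omega> / Dr n j \<omega>))) \<longlonglongrightarrow> sqrt (m i * m j)"
    by (intro tendsto_real_sqrt tendsto_mult regular_drawn_inverse_ratio[OF \<omega>] ij)
  have 2: "(\<lambda>n. (\<Sum>l<n. Y i j l \<omega> - yc i j l \<omega>) / b n * sqrt ((Hr n i \<omega> / Dr n i \<omega>) * (Hr n j \<omega> / Dr n j \<omega>))) \<longlonglongrightarrow> 0 * sqrt (m i * m j)"
    by (intro tendsto_mult 1 HD)
  have 2: "(\<lambda>n. (\<Sum>l<n. Y i j l \<omega> - yc i j l \<omega>) / sqrt (Dr n i \<omega> * Dr n j \<omega>)) \<longlonglongrightarrow> 0"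
  proof -
    have "(\<Sum>l<n. Y i j l \<omega> - yc i j l \<omega>) / b n * sqrt ((Hr n i \<omega> / Dr n i \<omega>) * (Hr n j \<omega> / Dr n j \<omega>))
      = (\<Sum>l<n. Y i j l \<omega> - yc i j l \<omega>) / sqrt (Dr n i \<omega> * Dr n j \<omega>)" for n
      using Hi(1)[of n] Hi(2)[of n] by (simp add: b_def real_sqrt_divide real_sqrt_mult)
    then show ?thesis using 2 by simp
  qed
  have 3: "(\<lambda>n. (\<Sum>l<n. yc i j l \<omega>) / sqrt (Dr n i \<omega> * Dr n j \<omega>)) \<longlonglongrightarrow> sqrt (Zl i \<omega> * Zl j \<omega>) * (Q \<omega> / NN \<omega> - 1)"
  proof (cases "i \<le> t \<and> j \<le> t")
    case True
    define z where "z = Zl i \<omega> * Zl j \<omega>"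
    have Z: "z > 0" unfolding z_def using regular_Z(2)[OF \<omega>] ij True by simp
    define \<delta> where "\<delta> = (if i = j then 1 else 0 :: real)"
    have inv: "(\<lambda>n. c / Sr n \<omega>) \<longlonglongrightarrow> 0" for c
      by (rule real_tendsto_divide_at_top[OF tendsto_const regular_S_top[OF \<omega>]])
    have "(\<lambda>n. Zn n i \<omega> * ((Zn n j \<omega> - \<delta> / Sr n \<omega>) / (1 - 1 / Sr n \<omega>))) \<longlonglongrightarrow> Zl i \<omega> * ((Zl j \<omega> - 0) / (1 - 0))"
      by (intro tendsto_mult tendsto_divide tendsto_diff tendsto_const inv regular_Z[OF \<omega>] ij) simp
    then have x: "(\<lambda>n. Zn n i \<omega> * ((Zn n j \<omega> - \<delta> / Sr n \<omega>) / (1 - 1 / Sr n \<omega>))) \<longlonglongrightarrow> z" by (simp add: z_def)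
    have w: "(\<lambda>n. (\<Sum>l<n. Nr l \<omega> * (Nr l \<omega> - 1)) / real (Suc n)) \<longlonglongrightarrow> Q \<omega> - NN \<omega>"
    proof -
      have "(\<lambda>n. (\<Sum>l<n. (Nr l \<omega>)\<^sup>2) / real (Suc n) - (\<Sum>l<n. Nr l \<omega>) / real (Suc n)) \<longlonglongrightarrow> Q \<omega> - NN \<omega>"
        using \<omega> by (intro tendsto_diff) (auto simp: regular_def)
      then show ?thesis by (simp add: power2_eq_square right_diff_distrib sum_subtractf diff_divide_distrib)
    qed
    \<comment> \<open>The composition factor converges pathwise, the factors
      \<open>N (N - 1)\<close> only on average; the latter therefore serve as weights.\<close>
    have "(\<lambda>n. (\<Sum>l<n. (Zn l i \<omega> * ((Zn l j \<omega> - \<delta> / Sr l \<omega>) / (1 - 1 / Sr l \<omega>))) * (Nr l \<omega> * (Nr l \<omega> - 1))) / real (Suc n)) \<longlonglongrightarrow> z * (Q \<omega> - NN \<omega>)"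
      by (rule weighted_cesaro[OF x _ w filterlim_real_Suc]) (use good_N(1)[OF g] in auto)
    moreover have "(Zn l i \<omega> * ((Zn l j \<omega> - \<delta> / Sr l \<omega>) / (1 - 1 / Sr l \<omega>))) * (Nr l \<omega> * (Nr l \<omega> - 1)) = yc i j l \<omega>" for l
    proof -
      have "a / s * ((b' / s - \<delta> / s) / (1 - 1 / s)) * c = c * (a * (b' - \<delta>)) / (s * (s - 1))" if "s \<ge> 2" for a b' c s :: real
      proof -
        have "(b' / s - \<delta> / s) / (1 - 1 / s) = (b' - \<delta>) / (s - 1)"
          using that by (simp add: divide_simps)
        then show ?thesis by (simp add: mult_ac)
      qed
      from this[OF Sr_ge_2] show ?thesis by (simp add: Zn_eq yc_def \<delta>_def)
    qed
    ultimately have a: "(\<lambda>n. (\<Sum>l<n. yc i j l \<omega>) / real (Suc n)) \<longlonglongrightarrow> z * (Q \<omega> - NN \<omega>)" by simp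
    have "(\<lambda>n. sqrt ((Dr n i \<omega> / real (Suc n)) * (Dr n j \<omega> / real (Suc n)))) \<longlonglongrightarrow> sqrt ((Zl i \<omega> * NN \<omega>) * (Zl j \<omega> * NN \<omega>))"
      by (intro tendsto_real_sqrt tendsto_mult[of "\<lambda>n. Dr n i \<omega> / real (Suc n)"] regular_drawn_limit[OF \<omega>] ij)
    moreover have "sqrt ((Zl i \<omega> * NN \<omega>) * (Zl j \<omega> * NN \<omega>)) = sqrt z * NN \<omega>"
    proof -
      have "(Zl i \<omega> * NN \<omega>) * (Zl j \<omega> * NN \<omega>) = z * (NN \<omega>)\<^sup>2" by (simp add: z_def power2_eq_square)
      then show ?thesis using NN by (simp add: real_sqrt_mult)
    qed
    moreover have "sqrt ((Dr n i \<omega> / real (Suc n)) * (Dr n j \<omega> / real (Suc n))) = sqrt (Dr n i \<omega> * Dr n j \<omega>) / real (Suc n)" for n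
    proof -
      have "(Dr n i \<omega> / real (Suc n)) * (Dr n j \<omega> / real (Suc n)) = (Dr n i \<omega> * Dr n j \<omega>) / (real (Suc n))\<^sup>2"
        by (simp add: power2_eq_square)
      then show ?thesis by (simp add: real_sqrt_divide)
    qed
    ultimately have c: "(\<lambda>n. sqrt (Dr n i \<omega> * Dr n j \<omega>) / real (Suc n)) \<longlonglongrightarrow> sqrt z * NN \<omega>" by simp
    have "(\<lambda>n. ((\<Sum>l<n. yc i j l \<omega>) / real (Suc n)) / (sqrt (Dr n i \<omega> * Dr n j \<omega>) / real (Suc n))) \<longlonglongrightarrow> z * (Q \<omega> - NN \<omega>) / (sqrt z * NN \<omega>)"
      by (rule tendsto_divide[OF a c]) (use Z NN in simp)
    moreover have "z * (Q \<omega> - NN \<omega>) / (sqrt z * NN \<omega>) = sqrt z * (Q \<omega> / NN \<omega> - 1)"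
    proof -
      have "z = sqrt z * sqrt z" using Z by simp
      then have "z * (Q \<omega> - NN \<omega>) / (sqrt z * NN \<omega>) = sqrt z * (sqrt z * (Q \<omega> - NN \<omega>)) / (sqrt z * NN \<omega>)"
        by (metis mult.assoc)
      also have "\<dots> = sqrt z * ((Q \<omega> - NN \<omega>) / NN \<omega>)" using Z by simp
      finally show ?thesis using NN by (simp add: diff_divide_distrib)
    qed
    moreover have "((\<Sum>l<n. yc i j l \<omega>) / real (Suc n)) / (sqrt (Dr n i \<omega> * Dr n j \<omega>) / real (Suc n)) = (\<Sum>l<n. yc i j l \<omega>) / sqrt (Dr n i \<omega> * Dr n j \<omega>)" for n
      by (simp del: of_nat_Suc)
    ultimately show ?thesis by (simp only: z_def)
  next
    \<comment> \<open>A minor colour grows more slowly than n, so linear averages do not resolve its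
      scale. By Cauchy--Schwarz the sum is at most a geometric mean of two one-colour averages, with
      limits Z_i and Z_j, one of which is 0.\<close>
    case False
    have sq: "(\<lambda>n. (\<Sum>l<n. Nr l \<omega> * (Zn l k \<omega>)\<^sup>2) / Dr n k \<omega>) \<longlonglongrightarrow> Zl k \<omega>" if k: "k \<in> {1..d}" for k
    proof -
      have "(\<lambda>n. (\<Sum>l<n. Zn l k \<omega> * (Nr l \<omega> * Zn l k \<omega>)) / Hr n k \<omega>) \<longlonglongrightarrow> Zl k \<omega> * (1 / m k)"
        by (rule weighted_cesaro[OF regular_Z(1)[OF \<omega> k] _ regular_expected_drawn_ratio[OF \<omega> k] regular_H_top[OF \<omega> k] Hr_pos[OF k]])
          (simp add: Zn_eq)
      from tendsto_mult[OF this regular_drawn_inverse_ratio[OF \<omega> k]] m_ge_1[OF k]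
      have "(\<lambda>n. (\<Sum>l<n. Zn l k \<omega> * (Nr l \<omega> * Zn l k \<omega>)) / Hr n k \<omega> * (Hr n k \<omega> / Dr n k \<omega>)) \<longlonglongrightarrow> Zl k \<omega>"
        by simp
      moreover have "(\<Sum>l<n. Zn l k \<omega> * (Nr l \<omega> * Zn l k \<omega>)) / Hr n k \<omega> * (Hr n k \<omega> / Dr n k \<omega>)
          = (\<Sum>l<n. Nr l \<omega> * (Zn l k \<omega>)\<^sup>2) / Dr n k \<omega>" for n
        using Hr_pos[OF k, of n \<omega>] by (simp add: power2_eq_square mult_ac)
      ultimately show ?thesis by (simp only:)
    qed
    have z0: "Zl i \<omega> * Zl j \<omega> = 0" using False regular_Z(3)[OF \<omega>] ij by (auto simp: not_le)
    have up: "(\<lambda>n. 2 * real C1 * sqrt (((\<Sum>l<n. Nr l \<omega> * (Zn l i \<omega>)\<^sup>2) / Dr n i \<omega>) * ((\<Sum>l<n. Nr l \<omega> * (Zn l j \<omega>)\<^sup>2) / Dr n j \<omega>))) \<longlonglongrightarrow> 2 * real C1 * sqrt (Zl i \<omega> * Zl j \<omega>)"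
      by (intro tendsto_mult tendsto_const tendsto_real_sqrt tendsto_mult[of "\<lambda>n. (\<Sum>l<n. Nr l \<omega> * (Zn l i \<omega>)\<^sup>2) / Dr n i \<omega>"] sq ij)
    have "(\<lambda>n. (\<Sum>l<n. yc i j l \<omega>) / sqrt (Dr n i \<omega> * Dr n j \<omega>)) \<longlonglongrightarrow> 0"
    proof (rule tendsto_sandwich[OF _ _ tendsto_const up[unfolded z0 real_sqrt_zero mult_zero_right]])
      show "\<forall>\<^sub>F n in sequentially. 0 \<le> (\<Sum>l<n. yc i j l \<omega>) / sqrt (Dr n i \<omega> * Dr n j \<omega>)"
        by (intro always_eventually allI divide_nonneg_nonneg sum_nonneg yc_bounds(1)[OF g ij]) auto
      have "(\<Sum>l<n. yc i j l \<omega>) / sqrt (Dr n i \<omega> * Dr n j \<omega>)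
          \<le> 2 * real C1 * sqrt (((\<Sum>l<n. Nr l \<omega> * (Zn l i \<omega>)\<^sup>2) / Dr n i \<omega>) * ((\<Sum>l<n. Nr l \<omega> * (Zn l j \<omega>)\<^sup>2) / Dr n j \<omega>))" for n
      proof -
        have "(\<Sum>l<n. yc i j l \<omega>) \<le> (\<Sum>l<n. 2 * real C1 * (Nr l \<omega> * Zn l i \<omega> * Zn l j \<omega>))"
          unfolding Zn_eq by (intro sum_mono yc_bounds(2)[OF g ij])
        also have "\<dots> = 2 * real C1 * (\<Sum>l<n. (sqrt (Nr l \<omega>) * Zn l i \<omega>) * (sqrt (Nr l \<omega>) * Zn l j \<omega>))"
        proof -
          have "(sqrt (Nr l \<omega>) * Zn l i \<omega>) * (sqrt (Nr l \<omega>) * Zn l j \<omega>) = Nr l \<omega> * Zn l i \<omega> * Zn l j \<omega>" for l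
            using real_sqrt_mult_self[of "Nr l \<omega>"] by (simp add: mult_ac)
          then show ?thesis by (simp only: sum_distrib_left)
        qed
        also have "\<dots> \<le> 2 * real C1 * sqrt ((\<Sum>l<n. Nr l \<omega> * (Zn l i \<omega>)\<^sup>2) * (\<Sum>l<n. Nr l \<omega> * (Zn l j \<omega>)\<^sup>2))"
          using Cauchy_Schwarz_ineq_sum[of "\<lambda>l. sqrt (Nr l \<omega>) * Zn l i \<omega>" "\<lambda>l. sqrt (Nr l \<omega>) * Zn l j \<omega>" "{..<n}"]
          by (intro mult_left_mono real_le_rsqrt) (simp_all add: power_mult_distrib)
        finally have "(\<Sum>l<n. yc i j l \<omega>) / sqrt (Dr n i \<omega> * Dr n j \<omega>)
          \<le> 2 * real C1 * sqrt ((\<Sum>l<n. Nr l \<omega> * (Zn l i \<omega>)\<^sup>2) * (\<Sum>l<n. Nr l \<omega> * (Zn l j \<omega>)\<^sup>2)) / sqrt (Dr n i \<omega> * Dr n j \<omega>)"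
          by (intro divide_right_mono) auto
        then show ?thesis by (simp add: real_sqrt_divide real_sqrt_mult)
      qed
      then show "\<forall>\<^sub>F n in sequentially. (\<Sum>l<n. yc i j l \<omega>) / sqrt (Dr n i \<omega> * Dr n j \<omega>)
          \<le> 2 * real C1 * sqrt (((\<Sum>l<n. Nr l \<omega> * (Zn l i \<omega>)\<^sup>2) / Dr n i \<omega>) * ((\<Sum>l<n. Nr l \<omega> * (Zn l j \<omega>)\<^sup>2) / Dr n j \<omega>))"
        by simp
    qed
    then show ?thesis unfolding z0 by simp
  qed
  from tendsto_add[OF 2 3] show ?thesis
    by (simp add: sum_subtractf diff_divide_distrib)
qed

text \<open>By (A4) the bias of the means is \<open>e i * p i\<close> with \<open>e\<close> null.
  Since H_k is at most of order \<open>n powr ex k\<close>, the factor \<open>p i\<close> is at most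
  of order 1 / sqrt H_k, so the weighted draws are dominated by increments of sqrt H_k and the
  Toeplitz argument applies with that normalisation.\<close>

lemma regular_bias_negligible:
  assumes \<omega>: "regular \<omega>" and k: "k \<in> {1..d}"
  shows "(\<lambda>n. (\<Sum>i<n. (mu i k - m k) * Xr i k \<omega>) / sqrt (Dr n k \<omega>)) \<longlonglongrightarrow> 0"
proof -
  have g: "good \<omega>" by (rule regular_good[OF \<omega>])
  define p where "p i = real (Suc i) powr (- (ex k / 2))" for i
  have p: "p i > 0" for i by (simp add: p_def)
  define e where "e i = (mu i k - m k) / p i" for i
  have "((\<lambda>n. \<bar>urn_mean M A n k - m k\<bar> / (real n powr (- m k / (2 * m 1)))) \<longlongrightarrow> 0) sequentially"
    by (rule smalloD_tendsto[OF A4[OF k]])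
  from LIMSEQ_Suc[OF this] have "(\<lambda>i. \<bar>e i\<bar>) \<longlonglongrightarrow> 0"
    by (simp add: e_def p_def mu_def ex_def abs_divide mult.commute)
  then have e: "e \<longlonglongrightarrow> 0" by (simp add: tendsto_rabs_zero_iff)
  obtain w where "(\<lambda>n. Hr n k \<omega> / real (Suc n) powr ex k) \<longlonglongrightarrow> w"
    using regular_H_growth[OF \<omega> k] .
  then obtain K where "\<And>n. \<bar>Hr n k \<omega> / real (Suc n) powr ex k\<bar> \<le> K"
    by (rule LIMSEQ_imp_bounded) blast
  then have K: "Hr n k \<omega> \<le> K * real (Suc n) powr ex k" for n
    by (simp add: divide_le_eq)
  have K0: "K \<ge> 0" using K[of 0] Hr_pos[OF k, of 0 \<omega>] by simp
  \<comment> \<open>One factor 2 bounds the sum of the two square roots by twice the larger; the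
    factor 2 under the root pays for the shift from \<open>i + 2\<close> to \<open>i + 1\<close> in
    the power bound on H_k.\<close>
  have step: "Xr i k \<omega> * p i \<le> 2 * sqrt (2 * K) * (sqrt (Hr (Suc i) k \<omega>) - sqrt (Hr i k \<omega>))" for i
  proof -
    define a b where "a = Hr i k \<omega>" and "b = Hr (Suc i) k \<omega>"
    have a: "a > 0" using Hr_pos[OF k] by (simp add: a_def)
    have "1 * Xr i k \<omega> \<le> Ar i k \<omega> * Xr i k \<omega>" using g k by (intro mult_right_mono) (auto simp: good_def)
    then have ab: "Xr i k \<omega> \<le> b - a" "a \<le> b" by (auto simp: a_def b_def Hr_Suc)
    have "b \<le> K * real (Suc (Suc i)) powr ex k" unfolding b_def by (rule K)
    also have "\<dots> \<le> K * (2 * real (Suc i) powr ex k)"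
    proof (rule mult_left_mono[OF _ K0])
      have "real (Suc (Suc i)) powr ex k \<le> (2 * real (Suc i)) powr ex k"
        using ex_bounds(1)[OF k] by (intro powr_mono2) auto
      also have "\<dots> = 2 powr ex k * real (Suc i) powr ex k" by (simp add: powr_mult del: of_nat_Suc)
      also have "\<dots> \<le> 2 * real (Suc i) powr ex k"
        using powr_mono[OF ex_bounds(2)[OF k], of 2] by (intro mult_right_mono) auto
      finally show "real (Suc (Suc i)) powr ex k \<le> 2 * real (Suc i) powr ex k" .
    qed
    finally have "b \<le> (2 * K) * real (Suc i) powr ex k" by simp
    then have "sqrt b \<le> sqrt (2 * K) * sqrt (real (Suc i) powr ex k)"
      by (metis real_sqrt_le_iff real_sqrt_mult)
    also have "sqrt (real (Suc i) powr ex k) = inverse (p i)"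
      by (simp add: p_def powr_half_sqrt[symmetric] powr_powr powr_minus)
    finally have pb: "sqrt b * p i \<le> sqrt (2 * K)" using p[of i] by (simp add: field_simps)
    have "Xr i k \<omega> \<le> (sqrt b - sqrt a) * (sqrt b + sqrt a)"
      using ab a by (simp add: algebra_simps)
    also have "\<dots> \<le> (sqrt b - sqrt a) * (2 * sqrt b)"
      using ab by (intro mult_left_mono) auto
    finally have "Xr i k \<omega> * p i \<le> (sqrt b - sqrt a) * (2 * sqrt b) * p i"
      using p[of i] by (intro mult_right_mono) auto
    also have "\<dots> = 2 * (sqrt b * p i) * (sqrt b - sqrt a)" by simp
    also have "\<dots> \<le> 2 * sqrt (2 * K) * (sqrt b - sqrt a)"
      using pb ab by (intro mult_right_mono mult_left_mono) auto
    finally show ?thesis by (simp add: a_def b_def)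
  qed
  have "(\<lambda>n. (\<Sum>i<n. e i * (Xr i k \<omega> * p i)) / sqrt (Hr n k \<omega>)) \<longlonglongrightarrow> 0"
  proof (rule toeplitz_null[OF e, where C="2 * sqrt (2 * K)"])
    show "0 \<le> Xr i k \<omega> * p i" for i using p[of i] by simp
    show "filterlim (\<lambda>n. sqrt (Hr n k \<omega>)) at_top sequentially"
      by (rule filterlim_compose[OF sqrt_at_top regular_H_top[OF \<omega> k]])
    fix n
    have "(\<Sum>i<n. Xr i k \<omega> * p i) \<le> (\<Sum>i<n. 2 * sqrt (2 * K) * (sqrt (Hr (Suc i) k \<omega>) - sqrt (Hr i k \<omega>)))"
      by (intro sum_mono step)
    also have "\<dots> = 2 * sqrt (2 * K) * (sqrt (Hr n k \<omega>) - sqrt (Hr 0 k \<omega>))"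
      unfolding sum_distrib_left[symmetric] sum_lessThan_telescope[of "\<lambda>i. sqrt (Hr i k \<omega>)"] ..
    also have "\<dots> \<le> 2 * sqrt (2 * K) * sqrt (Hr n k \<omega>)" using K0 by (intro mult_left_mono) auto
    finally show "(\<Sum>i<n. Xr i k \<omega> * p i) \<le> 2 * sqrt (2 * K) * sqrt (Hr n k \<omega>)" .
  qed
  moreover have "e i * (Xr i k \<omega> * p i) = (mu i k - m k) * Xr i k \<omega>" for i
    using p[of i] by (simp add: e_def)
  ultimately have 1: "(\<lambda>n. (\<Sum>i<n. (mu i k - m k) * Xr i k \<omega>) / sqrt (Hr n k \<omega>)) \<longlonglongrightarrow> 0" by simp
  have 2: "(\<lambda>n. sqrt (Hr n k \<omega> / Dr n k \<omega>)) \<longlonglongrightarrow> sqrt (m k)"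
    by (intro tendsto_real_sqrt regular_drawn_inverse_ratio[OF \<omega> k])
  have "(\<Sum>i<n. (mu i k - m k) * Xr i k \<omega>) / sqrt (Hr n k \<omega>) * sqrt (Hr n k \<omega> / Dr n k \<omega>)
      = (\<Sum>i<n. (mu i k - m k) * Xr i k \<omega>) / sqrt (Dr n k \<omega>)" for n
    using Hr_pos[OF k, of n \<omega>] by (simp add: real_sqrt_divide)
  then show ?thesis using tendsto_mult[OF 1 2] by simp
qed

end

section \<open>The exponential martingale\<close>

lemma abs_sum_power3_le:
  fixes y :: "nat \<Rightarrow> real"
  assumes d: "d \<ge> 1"
  shows "\<bar>\<Sum>k=1..d. y k\<bar> ^ 3 \<le> real d ^ 3 * (\<Sum>k=1..d. \<bar>y k\<bar> ^ 3)"
proof -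
  have "Max ((\<lambda>k. \<bar>y k\<bar>) ` {1..d}) \<in> (\<lambda>k. \<bar>y k\<bar>) ` {1..d}"
    using d by (intro Max_in) auto
  then obtain k0 where k0: "k0 \<in> {1..d}" "\<And>k. k \<in> {1..d} \<Longrightarrow> \<bar>y k\<bar> \<le> \<bar>y k0\<bar>"
    using Max_ge[of "(\<lambda>k. \<bar>y k\<bar>) ` {1..d}"] by fastforce
  have "\<bar>\<Sum>k=1..d. y k\<bar> \<le> (\<Sum>k=1..d. \<bar>y k0\<bar>)"
    by (rule order_trans[OF sum_abs]) (intro sum_mono k0)
  then have "\<bar>\<Sum>k=1..d. y k\<bar> \<le> real d * \<bar>y k0\<bar>" by simp
  then have "\<bar>\<Sum>k=1..d. y k\<bar> ^ 3 \<le> (real d * \<bar>y k0\<bar>) ^ 3" by (intro power_mono) auto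
  also have "\<dots> = real d ^ 3 * \<bar>y k0\<bar> ^ 3" by (simp add: power_mult_distrib)
  also have "\<dots> \<le> real d ^ 3 * (\<Sum>k=1..d. \<bar>y k\<bar> ^ 3)"
    using member_le_sum[OF k0(1), of "\<lambda>k. \<bar>y k\<bar> ^ 3"] by (intro mult_left_mono) auto
  finally show ?thesis .
qed

lemma integral_double_sum:
  fixes f :: "'i \<Rightarrow> 'j \<Rightarrow> 'a \<Rightarrow> 'b::{banach, second_countable_topology}"
  assumes "\<And>i j. i \<in> I \<Longrightarrow> j \<in> J \<Longrightarrow> integrable M (f i j)"
  shows "(\<integral>\<omega>. (\<Sum>i\<in>I. \<Sum>j\<in>J. f i j \<omega>) \<partial>M) = (\<Sum>i\<in>I. \<Sum>j\<in>J. \<integral>\<omega>. f i j \<omega> \<partial>M)"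
proof -
  have "(\<integral>\<omega>. (\<Sum>i\<in>I. \<Sum>j\<in>J. f i j \<omega>) \<partial>M) = (\<Sum>i\<in>I. \<integral>\<omega>. (\<Sum>j\<in>J. f i j \<omega>) \<partial>M)"
    by (rule Bochner_Integration.integral_sum) (intro Bochner_Integration.integrable_sum assms)
  also have "\<dots> = (\<Sum>i\<in>I. \<Sum>j\<in>J. \<integral>\<omega>. f i j \<omega> \<partial>M)"
    by (intro sum.cong refl Bochner_Integration.integral_sum assms)
  finally show ?thesis .
qed

text \<open>With y half the conditional variance, 1 - y is the second-order mean of the exponential
  and exp y its compensator; they cancel up to y^2. The lower bound rests on (1 + y)(1 - y + y^2) =
  1 + y^3.\<close>

lemma exp_one_minus_bound:
  fixes y :: real assumes "0 \<le> y" shows "\<bar>exp y * (1 - y) - 1\<bar> \<le> exp y * y\<^sup>2"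
proof -
  have "1 - y \<le> exp (- y)" using exp_ge_add_one_self[of "-y"] by simp
  then have "exp y * (1 - y) \<le> exp y * exp (- y)" by (intro mult_left_mono) auto
  then have up: "exp y * (1 - y) \<le> 1" by (simp flip: exp_add)
  have "1 - exp y * (1 - y) \<le> exp y * y\<^sup>2"
  proof -
    have "1 \<le> (1 + y) * (1 - y + y\<^sup>2)"
    proof -
      have "(1 + y) * (1 - y + y\<^sup>2) = 1 + y ^ 3" by (simp add: algebra_simps power2_eq_square power3_eq_cube)
      then show ?thesis using assms by simp
    qed
    also have "\<dots> \<le> exp y * (1 - y + y\<^sup>2)"
    proof (rule mult_right_mono)
      have "0 \<le> (y - 1/2)\<^sup>2 + 3/4" by simp
      then show "0 \<le> 1 - y + y\<^sup>2" by (simp add: power2_eq_square algebra_simps)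
    qed simp
    finally show ?thesis by (simp add: algebra_simps)
  qed
  with up show ?thesis by simp
qed

lemma iexp_taylor2: "cmod (iexp x - (1 + \<i> * complex_of_real x - complex_of_real (x\<^sup>2) / 2)) \<le> \<bar>x\<bar> ^ 3 / 6"
proof -
  have "(\<Sum>k\<le>2. (\<i> * complex_of_real x) ^ k / fact k) = 1 + \<i> * complex_of_real x - complex_of_real (x\<^sup>2) / 2"
    by (simp add: numeral_2_eq_2 power_mult_distrib)
  then show ?thesis using iexp_approx1[of x 2] by (simp add: numeral_3_eq_3 fact_numeral numeral_2_eq_2)
qed

context reinforced_urn_limit
begin

text \<open>The variance of the linear form with coefficients \<open>x k\<close> in the centred
  replacements \<open>Ac l k\<close>.\<close>

definition quad :: "nat \<Rightarrow> (nat \<Rightarrow> real) \<Rightarrow> real" where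
  "quad l x = (\<Sum>i=1..d. \<Sum>j=1..d. x i * x j * cov l i j)"

lemma quad_nonneg: "0 \<le> quad l x"
proof -
  have "quad l x = (\<integral>\<omega>. (\<Sum>i=1..d. \<Sum>j=1..d. x i * x j * (Ac l i \<omega> * Ac l j \<omega>)) \<partial>M)"
    unfolding quad_def cov_def
    using Ac_prod_integrable by (subst integral_double_sum) auto
  also have "\<dots> = (\<integral>\<omega>. (\<Sum>i=1..d. x i * Ac l i \<omega>)\<^sup>2 \<partial>M)"
    by (intro Bochner_Integration.integral_cong refl)
      (simp add: power2_eq_square sum_product mult_ac)
  also have "\<dots> \<ge> 0" by simp
  finally show ?thesis .
qed

lemma quad_le: "quad l x \<le> C2 * real d * (\<Sum>i=1..d. (x i)\<^sup>2)"
proof -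
  have "quad l x \<le> (\<Sum>i=1..d. \<Sum>j=1..d. \<bar>x i\<bar> * \<bar>x j\<bar> * C2)"
    unfolding quad_def
  proof (intro sum_mono)
    fix i j assume ij: "i \<in> {1..d}" "j \<in> {1..d}"
    have "x i * x j * cov l i j \<le> \<bar>x i * x j * cov l i j\<bar>" by simp
    also have "\<dots> \<le> \<bar>x i\<bar> * \<bar>x j\<bar> * C2"
      unfolding abs_mult by (intro mult_left_mono abs_cov_le ij) auto
    finally show "x i * x j * cov l i j \<le> \<bar>x i\<bar> * \<bar>x j\<bar> * C2" .
  qed
  also have "\<dots> = C2 * (\<Sum>i=1..d. \<bar>x i\<bar>)\<^sup>2"
    by (simp add: power2_eq_square sum_product sum_distrib_left mult_ac)
  also have "(\<Sum>i=1..d. \<bar>x i\<bar>)\<^sup>2 \<le> real d * (\<Sum>i=1..d. (x i)\<^sup>2)"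
    using Cauchy_Schwarz_ineq_sum[of "\<lambda>i. \<bar>x i\<bar>" "\<lambda>_. 1" "{1..d}"] by (simp add: mult.commute)
  finally show ?thesis using C2_ge_1 by (simp add: mult_left_mono mult.assoc)
qed

text \<open>The exponential bounds the compensator, as \<open>quad\<close> is at most
  \<open>C2 * d * d\<close> for coefficients bounded by 1. The first summand comes from the square
  of \<open>quad\<close>, the second from third absolute moments of the replacements.\<close>

definition step_const :: real where
  "step_const = exp (C2 * real d * real d / 2) * (C2\<^sup>2 * real d ^ 3 + real d ^ 3 * (C2 + C2 ^ 3))"

text \<open>After a second-order expansion the linear term integrates to zero and the quadratic one
  integrates like its conditional variance, because \<open>Ac l\<close> is independent of everything
  else in the integrand. The two errors, of order v^2 and of third order, both gain a factor
  \<epsilon> over the sum of squares, so their total over all stages stays small.\<close>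

lemma one_step:
  fixes Yc :: "'w \<Rightarrow> complex" and x :: "nat \<Rightarrow> 'w \<Rightarrow> real"
  assumes Yc: "Yc \<in> borel_measurable (urn_K l)" "\<And>\<omega>. cmod (Yc \<omega>) \<le> B"
    and x: "\<And>k. k \<in> {1..d} \<Longrightarrow> x k \<in> borel_measurable (urn_K l)"
      "\<And>k \<omega>. k \<in> {1..d} \<Longrightarrow> \<bar>x k \<omega>\<bar> \<le> \<epsilon>" and \<epsilon>: "0 \<le> \<epsilon>" "\<epsilon> \<le> 1"
  shows "cmod (\<integral>\<omega>. Yc \<omega> * (iexp (\<Sum>k=1..d. x k \<omega> * Ac l k \<omega>)
      * complex_of_real (exp (quad l (\<lambda>k. x k \<omega>) / 2)) - 1) \<partial>M)
    \<le> B * step_const * \<epsilon> * (\<integral>\<omega>. (\<Sum>k=1..d. (x k \<omega>)\<^sup>2) \<partial>M)"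
proof -
  define \<xi> where "\<xi> \<omega> = (\<Sum>k=1..d. x k \<omega> * Ac l k \<omega>)" for \<omega>
  define v where "v \<omega> = quad l (\<lambda>k. x k \<omega>)" for \<omega>
  define s where "s \<omega> = (\<Sum>k=1..d. (x k \<omega>)\<^sup>2)" for \<omega>
  define V where "V = C2 * real d * real d"
  define P where "P \<omega> = Yc \<omega> * complex_of_real (exp (v \<omega> / 2))" for \<omega>
  define R where "R \<omega> = iexp (\<xi> \<omega>) - (1 + \<i> * complex_of_real (\<xi> \<omega>) - complex_of_real ((\<xi> \<omega>)\<^sup>2) / 2)" for \<omega>
  note KM = measurable_from_subalg[OF subalgebra_K]
  note YM [measurable] = KM[OF Yc(1)]
  have xM [measurable]: "k \<in> {1..d} \<Longrightarrow> x k \<in> borel_measurable M" for k by (rule KM[OF x(1)])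
  have B: "B \<ge> 0" using Yc(2)[of undefined] norm_ge_zero order_trans by blast
  have C2: "C2 \<ge> 1" by (rule C2_ge_1)
  have vK: "v \<in> borel_measurable (urn_K l)"
    unfolding v_def quad_def by (intro borel_measurable_sum borel_measurable_times borel_measurable_const x(1))
  have [measurable]: "v \<in> borel_measurable M" by (rule KM[OF vK])
  have PK: "P \<in> borel_measurable (urn_K l)"
  proof -
    note [measurable] = Yc(1) vK
    show ?thesis unfolding P_def by measurable
  qed
  have PM [measurable]: "P \<in> borel_measurable M" by (rule KM[OF PK])
  have \<xi>M [measurable]: "\<xi> \<in> borel_measurable M" unfolding \<xi>_def by measurable
  have x2: "(x k \<omega>)\<^sup>2 \<le> \<epsilon>\<^sup>2" if "k \<in> {1..d}" for k \<omega>
    using x(2)[OF that, of \<omega>] \<epsilon> by (simp add: abs_le_square_iff[symmetric])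
  have s0: "s \<omega> \<ge> 0" for \<omega> by (simp add: s_def sum_nonneg)
  have sb: "s \<omega> \<le> real d * \<epsilon>\<^sup>2" for \<omega>
    unfolding s_def using sum_mono[of "{1..d}" "\<lambda>k. (x k \<omega>)\<^sup>2" "\<lambda>_. \<epsilon>\<^sup>2"] x2 by simp
  have v0: "0 \<le> v \<omega>" for \<omega> by (simp add: v_def quad_nonneg)
  have vs: "v \<omega> \<le> C2 * real d * s \<omega>" for \<omega> unfolding v_def s_def by (rule quad_le)
  have vV: "v \<omega> \<le> V" for \<omega>
  proof -
    have "\<epsilon>\<^sup>2 \<le> 1" using \<epsilon> by (simp add: power_le_one)
    then have "s \<omega> \<le> real d" using sb[of \<omega>] mult_left_mono[of "\<epsilon>\<^sup>2" 1 "real d"] by simp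
    then have "C2 * real d * s \<omega> \<le> C2 * real d * real d" using C2 by (intro mult_left_mono) auto
    with vs[of \<omega>] show ?thesis by (simp add: V_def)
  qed
  \<comment> \<open>One of the two factors \<open>s\<close> is traded for
    \<open>d * \<epsilon>\<close>, using \<open>\<epsilon>\<^sup>2 \<le> \<epsilon>\<close>.\<close>
  have v2: "(v \<omega>)\<^sup>2 \<le> C2\<^sup>2 * real d ^ 3 * \<epsilon> * s \<omega>" for \<omega>
  proof -
    have "(v \<omega>)\<^sup>2 \<le> (C2 * real d * s \<omega>)\<^sup>2" using vs v0 by (intro power_mono)
    also have "\<dots> = C2\<^sup>2 * real d ^ 2 * s \<omega> * s \<omega>" by (simp add: power_mult_distrib power2_eq_square)
    also have "\<dots> \<le> C2\<^sup>2 * real d ^ 2 * s \<omega> * (real d * \<epsilon>)"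
    proof (rule mult_left_mono)
      have "\<epsilon>\<^sup>2 \<le> \<epsilon>" using \<epsilon> mult_left_mono[of \<epsilon> 1 \<epsilon>] by (simp add: power2_eq_square)
      then show "s \<omega> \<le> real d * \<epsilon>" using sb[of \<omega>] mult_left_mono[of "\<epsilon>\<^sup>2" \<epsilon> "real d"] by simp
    qed (use s0 C2 in auto)
    also have "\<dots> = C2\<^sup>2 * real d ^ 3 * \<epsilon> * s \<omega>" by (simp add: power2_eq_square power3_eq_cube)
    finally show ?thesis .
  qed
  have eV: "exp (v \<omega> / 2) \<le> exp (V / 2)" for \<omega> using vV by simp
  have Pb: "cmod (P \<omega>) \<le> B * exp (V / 2)" for \<omega>
    unfolding P_def norm_mult using Yc(2) eV B by (intro mult_mono) auto
  have PxK: "(\<lambda>\<omega>. P \<omega> * complex_of_real (x k \<omega>)) \<in> borel_measurable (urn_K l)" if "k \<in> {1..d}" for k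
  proof -
    note [measurable] = PK x(1)[OF that]
    show ?thesis by measurable
  qed
  have PxxK: "(\<lambda>\<omega>. P \<omega> * complex_of_real (x i \<omega> * x j \<omega>)) \<in> borel_measurable (urn_K l)" if "i \<in> {1..d}" "j \<in> {1..d}" for i j
  proof -
    note [measurable] = PK x(1)[OF that(1)] x(1)[OF that(2)]
    show ?thesis by measurable
  qed
  have Bpos: "0 \<le> B * exp (V / 2)" using B by simp
  have Pxi: "integrable M (\<lambda>\<omega>. P \<omega> * complex_of_real (x k \<omega>))" if "k \<in> {1..d}" for k
  proof (rule integrable_const_bound[where B="B * exp (V / 2) * \<epsilon>"])
    show "AE \<omega> in M. cmod (P \<omega> * complex_of_real (x k \<omega>)) \<le> B * exp (V / 2) * \<epsilon>"
      unfolding norm_mult using Pb x(2)[OF that] Bpos by (intro AE_I2 mult_mono) auto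
  qed (use KM[OF PxK[OF that]] in auto)
  have Pxxi: "integrable M (\<lambda>\<omega>. P \<omega> * complex_of_real (x i \<omega> * x j \<omega>))" if "i \<in> {1..d}" "j \<in> {1..d}" for i j
  proof (rule integrable_const_bound[where B="B * exp (V / 2) * (\<epsilon> * \<epsilon>)"])
    show "AE \<omega> in M. cmod (P \<omega> * complex_of_real (x i \<omega> * x j \<omega>)) \<le> B * exp (V / 2) * (\<epsilon> * \<epsilon>)"
      unfolding norm_mult norm_of_real abs_mult using Pb x(2) that Bpos \<epsilon> by (intro AE_I2 mult_mono) auto
  qed (use KM[OF PxxK[OF that]] in auto)
  define \<A> where "\<A> = sigma_gen M {A (Suc l) k | k. k \<in> {1..d}}"
  have Ag: "(\<lambda>\<omega>. complex_of_real (Ac l k \<omega>)) \<in> borel_measurable \<A>" if "k \<in> {1..d}" for k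
    unfolding \<A>_def using Ac_measurable_self[OF that, of l] by measurable
  have AAg: "(\<lambda>\<omega>. complex_of_real (Ac l i \<omega> * Ac l j \<omega>)) \<in> borel_measurable \<A>" if "i \<in> {1..d}" "j \<in> {1..d}" for i j
    unfolding \<A>_def using Ac_measurable_self[OF that(1), of l] Ac_measurable_self[OF that(2), of l] by measurable
  have E1: "integrable M (\<lambda>\<omega>. P \<omega> * complex_of_real (\<xi> \<omega>))" "(\<integral>\<omega>. P \<omega> * complex_of_real (\<xi> \<omega>) \<partial>M) = 0"
  proof -
    have eq: "P \<omega> * complex_of_real (\<xi> \<omega>) = (\<Sum>k=1..d. (P \<omega> * complex_of_real (x k \<omega>)) * complex_of_real (Ac l k \<omega>))" for \<omega>
      by (simp add: \<xi>_def sum_distrib_left mult.assoc)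
    have i: "integrable M (\<lambda>\<omega>. (P \<omega> * complex_of_real (x k \<omega>)) * complex_of_real (Ac l k \<omega>))"
      and z: "(\<integral>\<omega>. (P \<omega> * complex_of_real (x k \<omega>)) * complex_of_real (Ac l k \<omega>) \<partial>M) = 0" if k: "k \<in> {1..d}" for k
      using A_independent[OF PxK[OF k] Pxi[OF k] Ag[OF k, unfolded \<A>_def] integrable_of_real[OF Ac_moments(1)[OF k]]]
        Ac_moments(3)[OF k, of l] by simp_all
    show "integrable M (\<lambda>\<omega>. P \<omega> * complex_of_real (\<xi> \<omega>))" unfolding eq by (intro Bochner_Integration.integrable_sum i)
    show "(\<integral>\<omega>. P \<omega> * complex_of_real (\<xi> \<omega>) \<partial>M) = 0" unfolding eq using i z by (subst Bochner_Integration.integral_sum) auto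
  qed
  have E2: "integrable M (\<lambda>\<omega>. P \<omega> * complex_of_real ((\<xi> \<omega>)\<^sup>2))" "integrable M (\<lambda>\<omega>. P \<omega> * complex_of_real (v \<omega>))"
    "(\<integral>\<omega>. P \<omega> * complex_of_real ((\<xi> \<omega>)\<^sup>2) \<partial>M) = (\<integral>\<omega>. P \<omega> * complex_of_real (v \<omega>) \<partial>M)"
  proof -
    have eq: "P \<omega> * complex_of_real ((\<xi> \<omega>)\<^sup>2) = (\<Sum>i=1..d. \<Sum>j=1..d. (P \<omega> * complex_of_real (x i \<omega> * x j \<omega>)) * complex_of_real (Ac l i \<omega> * Ac l j \<omega>))" for \<omega>
      by (simp add: \<xi>_def power2_eq_square sum_product sum_distrib_left mult_ac)
    have eqv: "P \<omega> * complex_of_real (v \<omega>) = (\<Sum>i=1..d. \<Sum>j=1..d. (P \<omega> * complex_of_real (x i \<omega> * x j \<omega>)) * complex_of_real (cov l i j))" for \<omega>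
      by (simp add: v_def quad_def sum_distrib_left mult_ac)
    have i: "integrable M (\<lambda>\<omega>. (P \<omega> * complex_of_real (x i \<omega> * x j \<omega>)) * complex_of_real (Ac l i \<omega> * Ac l j \<omega>))"
      and z: "(\<integral>\<omega>. (P \<omega> * complex_of_real (x i \<omega> * x j \<omega>)) * complex_of_real (Ac l i \<omega> * Ac l j \<omega>) \<partial>M)
        = (\<integral>\<omega>. (P \<omega> * complex_of_real (x i \<omega> * x j \<omega>)) \<partial>M) * complex_of_real (cov l i j)"
      if ij: "i \<in> {1..d}" "j \<in> {1..d}" for i j
      using A_independent[OF PxxK[OF ij] Pxxi[OF ij] AAg[OF ij, unfolded \<A>_def] integrable_of_real[OF Ac_prod_integrable[OF ij]]]
      by (simp_all only: cov_def integral_complex_of_real)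
    have iv: "integrable M (\<lambda>\<omega>. (P \<omega> * complex_of_real (x i \<omega> * x j \<omega>)) * complex_of_real (cov l i j))" if "i \<in> {1..d}" "j \<in> {1..d}" for i j
      using Pxxi[OF that] by (rule Bochner_Integration.integrable_mult_left)
    show "integrable M (\<lambda>\<omega>. P \<omega> * complex_of_real ((\<xi> \<omega>)\<^sup>2))" unfolding eq by (intro Bochner_Integration.integrable_sum i)
    show "integrable M (\<lambda>\<omega>. P \<omega> * complex_of_real (v \<omega>))" unfolding eqv by (intro Bochner_Integration.integrable_sum iv)
    have "(\<integral>\<omega>. P \<omega> * complex_of_real ((\<xi> \<omega>)\<^sup>2) \<partial>M) = (\<Sum>i=1..d. \<Sum>j=1..d. (\<integral>\<omega>. (P \<omega> * complex_of_real (x i \<omega> * x j \<omega>)) \<partial>M) * complex_of_real (cov l i j))"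
      unfolding eq by (subst integral_double_sum, erule (1) i, intro sum.cong refl z)
    also have "\<dots> = (\<integral>\<omega>. P \<omega> * complex_of_real (v \<omega>) \<partial>M)"
      unfolding eqv by (subst integral_double_sum, erule (1) iv,
        intro sum.cong refl Bochner_Integration.integral_mult_left[symmetric] Pxxi)
    finally show "(\<integral>\<omega>. P \<omega> * complex_of_real ((\<xi> \<omega>)\<^sup>2) \<partial>M) = (\<integral>\<omega>. P \<omega> * complex_of_real (v \<omega>) \<partial>M)" .
  qed
  define err where "err \<omega> = Yc \<omega> * complex_of_real (exp (v \<omega> / 2) * (1 - v \<omega> / 2) - 1) + P \<omega> * R \<omega>" for \<omega>
  \<comment> \<open>The terms in front of \<open>err\<close> have integral zero by \<open>E1\<close>
    and \<open>E2\<close>.\<close>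
  have id: "Yc \<omega> * (iexp (\<xi> \<omega>) * complex_of_real (exp (v \<omega> / 2)) - 1)
      = \<i> * (P \<omega> * complex_of_real (\<xi> \<omega>)) - (P \<omega> * complex_of_real ((\<xi> \<omega>)\<^sup>2) - P \<omega> * complex_of_real (v \<omega>)) / 2 + err \<omega>" for \<omega>
    unfolding err_def P_def R_def by (simp add: algebra_simps diff_divide_distrib)
  define bd where "bd \<omega> = B * exp (V / 2) * (C2\<^sup>2 * real d ^ 3 * \<epsilon> * s \<omega> + real d ^ 3 * (\<Sum>k=1..d. \<bar>x k \<omega>\<bar> ^ 3 * \<bar>Ac l k \<omega>\<bar> ^ 3))" for \<omega>
  have errb: "cmod (err \<omega>) \<le> bd \<omega>" for \<omega>
  proof -
    have y0: "0 \<le> v \<omega> / 2" using v0[of \<omega>] by simp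
    have "\<bar>exp (v \<omega> / 2) * (1 - v \<omega> / 2) - 1\<bar> \<le> exp (v \<omega> / 2) * (v \<omega> / 2)\<^sup>2"
      by (rule exp_one_minus_bound[OF y0])
    also have "\<dots> \<le> exp (V / 2) * (C2\<^sup>2 * real d ^ 3 * \<epsilon> * s \<omega>)"
    proof (rule mult_mono[OF eV])
      have "(v \<omega> / 2)\<^sup>2 \<le> (v \<omega>)\<^sup>2" using v0[of \<omega>] by (intro power_mono) auto
      then show "(v \<omega> / 2)\<^sup>2 \<le> C2\<^sup>2 * real d ^ 3 * \<epsilon> * s \<omega>" using v2[of \<omega>] by simp
    qed auto
    finally have 1: "cmod (Yc \<omega> * complex_of_real (exp (v \<omega> / 2) * (1 - v \<omega> / 2) - 1)) \<le> B * (exp (V / 2) * (C2\<^sup>2 * real d ^ 3 * \<epsilon> * s \<omega>))"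
      unfolding norm_mult norm_of_real using Yc(2) B by (intro mult_mono) auto
    have d1: "1 \<le> d" using d_ge_2 by simp
    have "cmod (R \<omega>) \<le> \<bar>\<xi> \<omega>\<bar> ^ 3 / 6" unfolding R_def by (rule iexp_taylor2)
    also have "\<dots> \<le> \<bar>\<xi> \<omega>\<bar> ^ 3" by simp
    also have "\<dots> \<le> real d ^ 3 * (\<Sum>k=1..d. \<bar>x k \<omega> * Ac l k \<omega>\<bar> ^ 3)"
      unfolding \<xi>_def by (rule abs_sum_power3_le[OF d1])
    also have "\<dots> = real d ^ 3 * (\<Sum>k=1..d. \<bar>x k \<omega>\<bar> ^ 3 * \<bar>Ac l k \<omega>\<bar> ^ 3)"
      by (simp add: abs_mult power_mult_distrib)
    finally have 2: "cmod (P \<omega> * R \<omega>) \<le> B * exp (V / 2) * (real d ^ 3 * (\<Sum>k=1..d. \<bar>x k \<omega>\<bar> ^ 3 * \<bar>Ac l k \<omega>\<bar> ^ 3))"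
      unfolding norm_mult using Pb[of \<omega>] Bpos by (intro mult_mono) auto
    show ?thesis unfolding err_def bd_def using norm_triangle_mono[OF 1 2] by (simp add: algebra_simps)
  qed
  have x3K: "(\<lambda>\<omega>. \<bar>x k \<omega>\<bar> ^ 3) \<in> borel_measurable (urn_K l)" if "k \<in> {1..d}" for k
    using x(1)[OF that] by measurable
  have x3b: "\<bar>x k \<omega>\<bar> ^ 3 \<le> \<epsilon> * (x k \<omega>)\<^sup>2" if "k \<in> {1..d}" for k \<omega>
    using mult_right_mono[OF x(2)[OF that, of \<omega>], of "\<bar>x k \<omega>\<bar>\<^sup>2"] by (simp add: power3_eq_cube power2_eq_square mult.assoc)
  have x2i: "integrable M (\<lambda>\<omega>. (x k \<omega>)\<^sup>2)" if "k \<in> {1..d}" for k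
    using x2[OF that] xM[OF that] by (intro integrable_AE_bounded[where B="\<epsilon>\<^sup>2"]) auto
  have x3i: "integrable M (\<lambda>\<omega>. \<bar>x k \<omega>\<bar> ^ 3)" if "k \<in> {1..d}" for k
  proof (rule integrable_AE_bounded[where B="\<epsilon> ^ 3"])
    show "AE \<omega> in M. \<bar>\<bar>x k \<omega>\<bar> ^ 3\<bar> \<le> \<epsilon> ^ 3"
    proof (rule AE_I2)
      fix \<omega>
      have "\<bar>x k \<omega>\<bar> ^ 3 \<le> \<epsilon> ^ 3" using x(2)[OF that] by (intro power_mono) auto
      then show "\<bar>\<bar>x k \<omega>\<bar> ^ 3\<bar> \<le> \<epsilon> ^ 3" by simp
    qed
  qed (use xM[OF that] in measurable)
  have A3g: "(\<lambda>\<omega>. \<bar>Ac l k \<omega>\<bar> ^ 3) \<in> borel_measurable (sigma_gen M {A (Suc l) k | k. k \<in> {1..d}})" if "k \<in> {1..d}" for k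
    using Ac_measurable_self[OF that, of l] by measurable
  have xA: "integrable M (\<lambda>\<omega>. \<bar>x k \<omega>\<bar> ^ 3 * \<bar>Ac l k \<omega>\<bar> ^ 3)"
    "(\<integral>\<omega>. \<bar>x k \<omega>\<bar> ^ 3 * \<bar>Ac l k \<omega>\<bar> ^ 3 \<partial>M) \<le> (C2 + C2 ^ 3) * (\<epsilon> * (\<integral>\<omega>. (x k \<omega>)\<^sup>2 \<partial>M))" if k: "k \<in> {1..d}" for k
  proof -
    note I = A_independent[OF x3K[OF k] x3i[OF k] A3g[OF k] Ac_moments(5)[OF k]]
    show "integrable M (\<lambda>\<omega>. \<bar>x k \<omega>\<bar> ^ 3 * \<bar>Ac l k \<omega>\<bar> ^ 3)" by (rule I(2))
    have "(\<integral>\<omega>. \<bar>x k \<omega>\<bar> ^ 3 \<partial>M) \<le> (\<integral>\<omega>. \<epsilon> * (x k \<omega>)\<^sup>2 \<partial>M)"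
      using x3i[OF k] x2i[OF k] x3b[OF k] by (intro integral_mono) auto
    then have "(\<integral>\<omega>. \<bar>x k \<omega>\<bar> ^ 3 \<partial>M) \<le> \<epsilon> * (\<integral>\<omega>. (x k \<omega>)\<^sup>2 \<partial>M)" by simp
    then have "(\<integral>\<omega>. \<bar>x k \<omega>\<bar> ^ 3 \<partial>M) * (\<integral>\<omega>. \<bar>Ac l k \<omega>\<bar> ^ 3 \<partial>M) \<le> (\<epsilon> * (\<integral>\<omega>. (x k \<omega>)\<^sup>2 \<partial>M)) * (C2 + C2 ^ 3)"
      using Ac_moments(6)[OF k, of l] \<epsilon> by (intro mult_mono) auto
    then show "(\<integral>\<omega>. \<bar>x k \<omega>\<bar> ^ 3 * \<bar>Ac l k \<omega>\<bar> ^ 3 \<partial>M) \<le> (C2 + C2 ^ 3) * (\<epsilon> * (\<integral>\<omega>. (x k \<omega>)\<^sup>2 \<partial>M))"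
      unfolding I(1) by (simp add: mult.commute)
  qed
  have si: "integrable M s" unfolding s_def by (intro Bochner_Integration.integrable_sum x2i)
  have bdi: "integrable M bd"
    unfolding bd_def using si xA(1) by (intro Bochner_Integration.integrable_mult_right Bochner_Integration.integrable_add Bochner_Integration.integrable_sum) auto
  have RM [measurable]: "R \<in> borel_measurable M" unfolding R_def by measurable
  have errM [measurable]: "err \<in> borel_measurable M" unfolding err_def by measurable
  have erri: "integrable M err"
    by (rule Bochner_Integration.integrable_bound[OF bdi errM]) (use errb in \<open>auto intro!: AE_I2 order_trans[OF errb abs_ge_self]\<close>)
  have "(\<integral>\<omega>. Yc \<omega> * (iexp (\<xi> \<omega>) * complex_of_real (exp (v \<omega> / 2)) - 1) \<partial>M) = (\<integral>\<omega>. err \<omega> \<partial>M)"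
    unfolding id using E1 E2 erri by simp
  then have "cmod (\<integral>\<omega>. Yc \<omega> * (iexp (\<xi> \<omega>) * complex_of_real (exp (v \<omega> / 2)) - 1) \<partial>M) \<le> (\<integral>\<omega>. cmod (err \<omega>) \<partial>M)"
    by simp
  also have "\<dots> \<le> (\<integral>\<omega>. bd \<omega> \<partial>M)" using erri bdi errb by (intro integral_mono) auto
  also have "\<dots> = B * exp (V / 2) * (C2\<^sup>2 * real d ^ 3 * \<epsilon> * (\<integral>\<omega>. s \<omega> \<partial>M) + real d ^ 3 * (\<Sum>k=1..d. \<integral>\<omega>. \<bar>x k \<omega>\<bar> ^ 3 * \<bar>Ac l k \<omega>\<bar> ^ 3 \<partial>M))"
  proof -
    define w where "w \<omega> = (\<Sum>k=1..d. \<bar>x k \<omega>\<bar> ^ 3 * \<bar>Ac l k \<omega>\<bar> ^ 3)" for \<omega>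
    have w: "integrable M w" "(\<integral>\<omega>. w \<omega> \<partial>M) = (\<Sum>k=1..d. \<integral>\<omega>. \<bar>x k \<omega>\<bar> ^ 3 * \<bar>Ac l k \<omega>\<bar> ^ 3 \<partial>M)"
      unfolding w_def by (intro Bochner_Integration.integrable_sum Bochner_Integration.integral_sum xA(1); simp)+
    show ?thesis unfolding bd_def w_def[symmetric] w(2)[symmetric] using si w(1) by simp
  qed
  also have "\<dots> \<le> B * exp (V / 2) * (C2\<^sup>2 * real d ^ 3 * \<epsilon> * (\<integral>\<omega>. s \<omega> \<partial>M) + real d ^ 3 * ((C2 + C2 ^ 3) * (\<epsilon> * (\<integral>\<omega>. s \<omega> \<partial>M))))"
  proof (intro mult_left_mono add_left_mono)
    have "(\<Sum>k=1..d. \<integral>\<omega>. \<bar>x k \<omega>\<bar> ^ 3 * \<bar>Ac l k \<omega>\<bar> ^ 3 \<partial>M) \<le> (\<Sum>k=1..d. (C2 + C2 ^ 3) * (\<epsilon> * (\<integral>\<omega>. (x k \<omega>)\<^sup>2 \<partial>M)))"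
      by (intro sum_mono xA)
    also have "\<dots> = (C2 + C2 ^ 3) * (\<epsilon> * (\<integral>\<omega>. s \<omega> \<partial>M))"
      unfolding s_def using x2i by (simp add: sum_distrib_left)
    finally show "(\<Sum>k=1..d. \<integral>\<omega>. \<bar>x k \<omega>\<bar> ^ 3 * \<bar>Ac l k \<omega>\<bar> ^ 3 \<partial>M) \<le> (C2 + C2 ^ 3) * (\<epsilon> * (\<integral>\<omega>. s \<omega> \<partial>M))" .
  qed (use B in auto)
  also have "\<dots> = B * step_const * \<epsilon> * (\<integral>\<omega>. s \<omega> \<partial>M)"
    by (simp add: step_const_def V_def algebra_simps)
  finally show ?thesis by (simp add: \<xi>_def v_def s_def)
qed

text \<open>The exponential martingale is nearly uncorrelated with the past: its increments have
  conditional mean zero up to third order terms.\<close>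

lemma exponential_martingale:
  fixes x :: "nat \<Rightarrow> nat \<Rightarrow> 'w \<Rightarrow> real" and h :: "'w \<Rightarrow> real" and r n :: nat
  defines "T \<equiv> \<lambda>j \<omega>. iexp (\<Sum>l\<in>{r..<j}. \<Sum>k=1..d. x l k \<omega> * Ac l k \<omega>)
      * complex_of_real (exp ((\<Sum>l\<in>{r..<j}. quad l (\<lambda>k. x l k \<omega>)) / 2))"
  assumes x: "\<And>l k. l \<in> {r..<n} \<Longrightarrow> k \<in> {1..d} \<Longrightarrow> x l k \<in> borel_measurable (urn_K l)"
      "\<And>l k \<omega>. l \<in> {r..<n} \<Longrightarrow> k \<in> {1..d} \<Longrightarrow> \<bar>x l k \<omega>\<bar> \<le> \<epsilon>"
    and \<epsilon>: "0 \<le> \<epsilon>" "\<epsilon> \<le> 1"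
    and K: "\<And>\<omega>. (\<Sum>l\<in>{r..<n}. \<Sum>k=1..d. (x l k \<omega>)\<^sup>2) \<le> K"
    and h: "h \<in> borel_measurable (FF r)" "\<And>\<omega>. \<bar>h \<omega>\<bar> \<le> G" and rn: "r \<le> n"
  shows "T n \<in> borel_measurable (FF n)"
    and "cmod (T n \<omega>) \<le> exp (C2 * real d * K / 2)"
    and "cmod ((\<integral>\<omega>. complex_of_real (h \<omega>) * T n \<omega> \<partial>M) - complex_of_real (\<integral>\<omega>. h \<omega> \<partial>M))
      \<le> G * exp (C2 * real d * K / 2) * step_const * \<epsilon> * K"
proof -
  have C2: "C2 \<ge> 1" by (rule C2_ge_1)
  have G: "G \<ge> 0" using h(2)[of undefined] abs_ge_zero order_trans by blast
  have xF: "x l k \<in> borel_measurable (FF j)" if "l \<in> {r..<n}" "k \<in> {1..d}" "l < j" for l k j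
    by (rule measurable_from_subalg[OF subalgebra_F_mono measurable_from_subalg[OF subalgebra_F_K x(1)]])
      (use that in auto)
  have TF: "T j \<in> borel_measurable (FF j)" if "j \<le> n" for j
  proof -
    have [measurable]: "(\<lambda>\<omega>. \<Sum>l\<in>{r..<j}. \<Sum>k=1..d. x l k \<omega> * Ac l k \<omega>) \<in> borel_measurable (FF j)"
      by (intro borel_measurable_sum borel_measurable_times xF Ac_measurable_F) (use that in auto)
    have [measurable]: "(\<lambda>\<omega>. \<Sum>l\<in>{r..<j}. quad l (\<lambda>k. x l k \<omega>)) \<in> borel_measurable (FF j)"
      unfolding quad_def by (intro borel_measurable_sum borel_measurable_times borel_measurable_const xF) (use that in auto)
    show ?thesis unfolding T_def by measurable
  qed
  show "T n \<in> borel_measurable (FF n)" by (rule TF) simp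
  have Tb: "cmod (T j \<omega>) \<le> exp (C2 * real d * K / 2)" if "j \<le> n" for j \<omega>
  proof -
    have "(\<Sum>l\<in>{r..<j}. quad l (\<lambda>k. x l k \<omega>)) \<le> (\<Sum>l\<in>{r..<j}. C2 * real d * (\<Sum>k=1..d. (x l k \<omega>)\<^sup>2))"
      by (intro sum_mono quad_le)
    also have "\<dots> = C2 * real d * (\<Sum>l\<in>{r..<j}. \<Sum>k=1..d. (x l k \<omega>)\<^sup>2)" by (simp add: sum_distrib_left)
    also have "\<dots> \<le> C2 * real d * (\<Sum>l\<in>{r..<n}. \<Sum>k=1..d. (x l k \<omega>)\<^sup>2)"
      using C2 that by (intro mult_left_mono sum_mono2) (auto intro!: sum_nonneg)
    also have "\<dots> \<le> C2 * real d * K" using C2 by (intro mult_left_mono K) auto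
    finally show ?thesis by (simp add: T_def norm_mult)
  qed
  show "cmod (T n \<omega>) \<le> exp (C2 * real d * K / 2)" by (rule Tb) simp
  define E where "E = exp (C2 * real d * K / 2)"
  have hM [measurable]: "h \<in> borel_measurable M" by (rule measurable_M_of_F[OF h(1)])
  have TM: "T j \<in> borel_measurable M" if "j \<le> n" for j by (rule measurable_M_of_F[OF TF[OF that]])
  have hb: "cmod (complex_of_real (h \<omega>) * T j \<omega>) \<le> G * E" if "j \<le> n" for j \<omega>
    unfolding norm_mult E_def using h(2) Tb[OF that] G by (intro mult_mono) auto
  have hTi: "integrable M (\<lambda>\<omega>. complex_of_real (h \<omega>) * T j \<omega>)" if "j \<le> n" for j
  proof (rule integrable_const_bound[where B="G * E"])
    note [measurable] = TM[OF that]
    show "(\<lambda>\<omega>. complex_of_real (h \<omega>) * T j \<omega>) \<in> borel_measurable M" by measurable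
  qed (use hb[OF that] in auto)
  \<comment> \<open>Each further stage is an application of \<open>one_step\<close> to
    \<open>h * T j\<close>, which is bounded and known before the replacement of that stage.\<close>
  have main: "cmod ((\<integral>\<omega>. complex_of_real (h \<omega>) * T j \<omega> \<partial>M) - complex_of_real (\<integral>\<omega>. h \<omega> \<partial>M))
      \<le> G * E * step_const * \<epsilon> * (\<Sum>l\<in>{r..<j}. \<integral>\<omega>. (\<Sum>k=1..d. (x l k \<omega>)\<^sup>2) \<partial>M)" if "r \<le> j" "j \<le> n" for j
    using that
  proof (induction j rule: dec_induct)
    case base
    then show ?case by (simp add: T_def)
  next
    case (step j)
    define a where "a j = (\<integral>\<omega>. complex_of_real (h \<omega>) * T j \<omega> \<partial>M)" for j
    have j: "j \<in> {r..<n}" using step by auto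
    have TS: "T (Suc j) \<omega> = T j \<omega> * (iexp (\<Sum>k=1..d. x j k \<omega> * Ac j k \<omega>) * complex_of_real (exp (quad j (\<lambda>k. x j k \<omega>) / 2)))" for \<omega>
    proof -
      have "T (Suc j) \<omega> = iexp ((\<Sum>l\<in>{r..<j}. \<Sum>k=1..d. x l k \<omega> * Ac l k \<omega>) + (\<Sum>k=1..d. x j k \<omega> * Ac j k \<omega>))
        * complex_of_real (exp ((\<Sum>l\<in>{r..<j}. quad l (\<lambda>k. x l k \<omega>)) / 2 + quad j (\<lambda>k. x j k \<omega>) / 2))"
        using step.hyps by (simp add: T_def add_divide_distrib)
      also have "\<dots> = iexp (\<Sum>l\<in>{r..<j}. \<Sum>k=1..d. x l k \<omega> * Ac l k \<omega>) * iexp (\<Sum>k=1..d. x j k \<omega> * Ac j k \<omega>)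
        * (complex_of_real (exp ((\<Sum>l\<in>{r..<j}. quad l (\<lambda>k. x l k \<omega>)) / 2)) * complex_of_real (exp (quad j (\<lambda>k. x j k \<omega>) / 2)))"
        by (simp only: exp_add of_real_add distrib_left of_real_mult)
      finally show ?thesis by (simp add: T_def mult_ac)
    qed
    have "a (Suc j) - a j = (\<integral>\<omega>. complex_of_real (h \<omega>) * T (Suc j) \<omega> - complex_of_real (h \<omega>) * T j \<omega> \<partial>M)"
      unfolding a_def using hTi[of "Suc j"] hTi[of j] step by simp
    also have "\<dots> = (\<integral>\<omega>. (complex_of_real (h \<omega>) * T j \<omega>) * (iexp (\<Sum>k=1..d. x j k \<omega> * Ac j k \<omega>) * complex_of_real (exp (quad j (\<lambda>k. x j k \<omega>) / 2)) - 1) \<partial>M)"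
      by (intro Bochner_Integration.integral_cong refl) (simp add: TS algebra_simps)
    finally have eq: "a (Suc j) - a j = \<dots>" .
    have hTK: "(\<lambda>\<omega>. complex_of_real (h \<omega>) * T j \<omega>) \<in> borel_measurable (urn_K j)"
    proof -
      have [measurable]: "h \<in> borel_measurable (urn_K j)"
        by (rule measurable_K_of_F[OF measurable_from_subalg[OF subalgebra_F_mono h(1)]]) (rule step)
      have [measurable]: "T j \<in> borel_measurable (urn_K j)"
        by (rule measurable_K_of_F[OF TF]) (use step in simp)
      show ?thesis by measurable
    qed
    have "cmod (a (Suc j) - a j) \<le> G * E * step_const * \<epsilon> * (\<integral>\<omega>. (\<Sum>k=1..d. (x j k \<omega>)\<^sup>2) \<partial>M)"
      unfolding eq by (rule one_step[OF hTK hb x(1)[OF j] x(2)[OF j] \<epsilon>]) (use step in auto)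
    moreover have "cmod (a j - complex_of_real (\<integral>\<omega>. h \<omega> \<partial>M)) \<le> G * E * step_const * \<epsilon> * (\<Sum>l\<in>{r..<j}. \<integral>\<omega>. (\<Sum>k=1..d. (x l k \<omega>)\<^sup>2) \<partial>M)"
      using step by (simp add: a_def)
    ultimately have "cmod ((a (Suc j) - a j) + (a j - complex_of_real (\<integral>\<omega>. h \<omega> \<partial>M)))
      \<le> G * E * step_const * \<epsilon> * (\<integral>\<omega>. (\<Sum>k=1..d. (x j k \<omega>)\<^sup>2) \<partial>M) + G * E * step_const * \<epsilon> * (\<Sum>l\<in>{r..<j}. \<integral>\<omega>. (\<Sum>k=1..d. (x l k \<omega>)\<^sup>2) \<partial>M)"
      by (rule norm_triangle_mono)
    moreover have "G * E * step_const * \<epsilon> * (\<integral>\<omega>. (\<Sum>k=1..d. (x j k \<omega>)\<^sup>2) \<partial>M) + G * E * step_const * \<epsilon> * (\<Sum>l\<in>{r..<j}. \<integral>\<omega>. (\<Sum>k=1..d. (x l k \<omega>)\<^sup>2) \<partial>M)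
        = G * E * step_const * \<epsilon> * (\<Sum>l\<in>{r..<Suc j}. \<integral>\<omega>. (\<Sum>k=1..d. (x l k \<omega>)\<^sup>2) \<partial>M)"
      using step.hyps by (simp add: distrib_left)
    ultimately show ?case by (simp add: a_def)
  qed
  have xi: "integrable M (\<lambda>\<omega>. (x l k \<omega>)\<^sup>2)" if "l \<in> {r..<n}" "k \<in> {1..d}" for l k
  proof (rule integrable_AE_bounded[where B="\<epsilon>\<^sup>2"])
    show "(\<lambda>\<omega>. (x l k \<omega>)\<^sup>2) \<in> borel_measurable M"
      by (intro borel_measurable_power measurable_from_subalg[OF subalgebra_K x(1)] that)
    show "AE \<omega> in M. \<bar>(x l k \<omega>)\<^sup>2\<bar> \<le> \<epsilon>\<^sup>2"
      using x(2)[OF that] \<epsilon> by (intro AE_I2) (simp add: abs_le_square_iff[symmetric])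
  qed
  have "(\<Sum>l\<in>{r..<n}. \<integral>\<omega>. (\<Sum>k=1..d. (x l k \<omega>)\<^sup>2) \<partial>M) = (\<integral>\<omega>. (\<Sum>l\<in>{r..<n}. \<Sum>k=1..d. (x l k \<omega>)\<^sup>2) \<partial>M)"
    using xi by (intro Bochner_Integration.integral_sum[symmetric] Bochner_Integration.integrable_sum) auto
  also have "\<dots> \<le> (\<integral>\<omega>. K \<partial>M)"
    using xi K by (intro integral_mono Bochner_Integration.integrable_sum) auto
  also have "\<dots> = K" by (simp add: prob_space)
  finally have "G * E * step_const * \<epsilon> * (\<Sum>l\<in>{r..<n}. \<integral>\<omega>. (\<Sum>k=1..d. (x l k \<omega>)\<^sup>2) \<partial>M) \<le> G * E * step_const * \<epsilon> * K"
    using G \<epsilon> C2 by (intro mult_left_mono) (auto simp: E_def step_const_def intro!: mult_nonneg_nonneg add_nonneg_nonneg)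
  with main[OF rn order_refl]
  show "cmod ((\<integral>\<omega>. complex_of_real (h \<omega>) * T n \<omega> \<partial>M) - complex_of_real (\<integral>\<omega>. h \<omega> \<partial>M))
      \<le> G * exp (C2 * real d * K / 2) * step_const * \<epsilon> * K"
    by (simp add: E_def)
qed

end

section \<open>The normalised martingale\<close>

lemma cmod_iexp_diff_le: "cmod (iexp a - iexp b) \<le> \<bar>a - b\<bar>"
proof -
  have "iexp a - iexp b = iexp b * (iexp (a - b) - 1)"
    by (simp add: right_diff_distrib flip: exp_add)
  then have "cmod (iexp a - iexp b) = cmod (iexp (a - b) - 1)"
    by (simp add: norm_mult)
  also have "\<dots> \<le> \<bar>a - b\<bar>" using iexp_approx1[of "a - b" 0] by simp
  finally show ?thesis .
qed

text \<open>\<open>p n\<close> is merely bounded in mean square and need not converge. Young's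
  inequality |p z| \<le> \<delta> p^2 + z^2 / (4 \<delta>) separates it from the null factor: its
  share is at most half of the prescribed error, and the rest tends to 0 by dominated
  convergence.\<close>

lemma (in prob_space) iexp_difference_vanishes:
  fixes a b e :: "nat \<Rightarrow> 'a \<Rightarrow> real" and p z :: "nat \<Rightarrow> 'i \<Rightarrow> 'a \<Rightarrow> real"
  assumes I: "finite I"
    and meas [measurable]: "\<And>n. a n \<in> borel_measurable M" "\<And>n. b n \<in> borel_measurable M"
      "\<And>n. e n \<in> borel_measurable M"
      "\<And>n k. k \<in> I \<Longrightarrow> p n k \<in> borel_measurable M" "\<And>n k. k \<in> I \<Longrightarrow> z n k \<in> borel_measurable M"
    and eq: "\<And>n \<omega>. a n \<omega> - b n \<omega> = (\<Sum>k\<in>I. p n k \<omega> * z n k \<omega>) + e n \<omega>"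
    and p: "\<And>n k. k \<in> I \<Longrightarrow> integrable M (\<lambda>\<omega>. (p n k \<omega>)\<^sup>2)"
      "\<And>n k. k \<in> I \<Longrightarrow> (\<integral>\<omega>. (p n k \<omega>)\<^sup>2 \<partial>M) \<le> C"
    and z: "\<And>k. k \<in> I \<Longrightarrow> AE \<omega> in M. (\<lambda>n. z n k \<omega>) \<longlonglongrightarrow> 0"
    and e: "AE \<omega> in M. (\<lambda>n. e n \<omega>) \<longlonglongrightarrow> 0"
  shows "(\<lambda>n. \<integral>\<omega>. cmod (iexp (a n \<omega>) - iexp (b n \<omega>)) \<partial>M) \<longlonglongrightarrow> 0"
proof (rule LIMSEQ_I)
  fix r :: real assume r: "r > 0"
  define K where "K = real (card I) * \<bar>C\<bar> + 1"
  have K: "K > 0" unfolding K_def by (intro add_nonneg_pos mult_nonneg_nonneg) auto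
  define \<delta> where "\<delta> = r / (2 * K)"
  have \<delta>: "\<delta> > 0" using r K by (simp add: \<delta>_def)
  define q where "q n \<omega> = (\<Sum>k\<in>I. (z n k \<omega>)\<^sup>2 / (4 * \<delta>)) + \<bar>e n \<omega>\<bar>" for n \<omega>
  have [measurable]: "q n \<in> borel_measurable M" for n unfolding q_def by measurable
  have q0: "q n \<omega> \<ge> 0" for n \<omega> unfolding q_def using \<delta> by (intro add_nonneg_nonneg sum_nonneg) auto
  have pz: "\<bar>x * y\<bar> \<le> \<delta> * x\<^sup>2 + y\<^sup>2 / (4 * \<delta>)" for x y :: real
  proof -
    have "0 \<le> (2 * \<delta> * \<bar>x\<bar> - \<bar>y\<bar>)\<^sup>2" by simp
    then have "4 * \<delta> * \<bar>x * y\<bar> \<le> 4 * \<delta> * (\<delta> * x\<^sup>2) + y\<^sup>2"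
      by (simp add: power2_diff power_mult_distrib abs_mult algebra_simps) (simp add: power2_eq_square)
    then show ?thesis using \<delta> by (simp add: field_simps)
  qed
  \<comment> \<open>The left side never exceeds 2, so the almost surely null part \<open>q\<close>
    may be capped; the cap supplies the dominating function.\<close>
  have pt: "cmod (iexp (a n \<omega>) - iexp (b n \<omega>)) \<le> \<delta> * (\<Sum>k\<in>I. (p n k \<omega>)\<^sup>2) + min 2 (q n \<omega>)" for n \<omega>
  proof -
    have "\<bar>a n \<omega> - b n \<omega>\<bar> \<le> (\<Sum>k\<in>I. \<bar>p n k \<omega> * z n k \<omega>\<bar>) + \<bar>e n \<omega>\<bar>"
      unfolding eq by (intro order_trans[OF abs_triangle_ineq] add_mono sum_abs order_refl)
    also have "\<dots> \<le> (\<Sum>k\<in>I. \<delta> * (p n k \<omega>)\<^sup>2 + (z n k \<omega>)\<^sup>2 / (4 * \<delta>)) + \<bar>e n \<omega>\<bar>"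
      by (intro add_mono sum_mono pz order_refl)
    also have "\<dots> = \<delta> * (\<Sum>k\<in>I. (p n k \<omega>)\<^sup>2) + q n \<omega>"
      by (simp add: q_def sum.distrib sum_distrib_left)
    finally have "cmod (iexp (a n \<omega>) - iexp (b n \<omega>)) \<le> \<delta> * (\<Sum>k\<in>I. (p n k \<omega>)\<^sup>2) + q n \<omega>"
      using cmod_iexp_diff_le order_trans by blast
    moreover have "cmod (iexp (a n \<omega>) - iexp (b n \<omega>)) \<le> 2"
      using norm_triangle_ineq4[of "iexp (a n \<omega>)" "iexp (b n \<omega>)"] by simp
    moreover have "0 \<le> \<delta> * (\<Sum>k\<in>I. (p n k \<omega>)\<^sup>2)" using \<delta> by (intro mult_nonneg_nonneg sum_nonneg) auto
    ultimately show ?thesis by linarith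
  qed
  have "AE \<omega> in M. \<forall>k\<in>I. (\<lambda>n. z n k \<omega>) \<longlonglongrightarrow> 0" by (rule AE_finite_allI[OF I z])
  then have "AE \<omega> in M. (\<lambda>n. min 2 (q n \<omega>)) \<longlonglongrightarrow> 0"
    using e
  proof eventually_elim
    case (elim \<omega>)
    have "(\<lambda>n. q n \<omega>) \<longlonglongrightarrow> (\<Sum>k\<in>I. 0\<^sup>2 / (4 * \<delta>)) + \<bar>0\<bar>"
      unfolding q_def using elim \<delta>
      by (intro tendsto_add tendsto_sum tendsto_divide tendsto_power tendsto_const tendsto_rabs) auto
    then have "(\<lambda>n. q n \<omega>) \<longlonglongrightarrow> 0" by simp
    from tendsto_min[OF tendsto_const[of 2] this] show ?case by simp
  qed
  then have "(\<lambda>n. \<integral>\<omega>. min 2 (q n \<omega>) \<partial>M) \<longlonglongrightarrow> (\<integral>\<omega>. 0 \<partial>M)"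
    by (intro integral_dominated_convergence[where w="\<lambda>_. 2"]) (use q0 in auto)
  then have "(\<lambda>n. \<integral>\<omega>. min 2 (q n \<omega>) \<partial>M) \<longlonglongrightarrow> 0" by simp
  from LIMSEQ_D[OF this, of "r / 2"] r obtain n0 where n0: "\<And>n. n \<ge> n0 \<Longrightarrow> \<bar>\<integral>\<omega>. min 2 (q n \<omega>) \<partial>M\<bar> < r / 2"
    by auto
  show "\<exists>n0. \<forall>n\<ge>n0. norm ((\<integral>\<omega>. cmod (iexp (a n \<omega>) - iexp (b n \<omega>)) \<partial>M) - 0) < r"
  proof (intro exI[of _ n0] allI impI)
    fix n assume n: "n \<ge> n0"
    have mi: "integrable M (\<lambda>\<omega>. min 2 (q n \<omega>))"
      by (rule integrable_const_bound[where B=2]) (use q0 in auto)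
    have ii: "integrable M (\<lambda>\<omega>. cmod (iexp (a n \<omega>) - iexp (b n \<omega>)))"
    proof (rule integrable_const_bound[where B=2])
      show "AE \<omega> in M. norm (cmod (iexp (a n \<omega>) - iexp (b n \<omega>))) \<le> 2"
      proof (rule AE_I2)
        fix \<omega> show "norm (cmod (iexp (a n \<omega>) - iexp (b n \<omega>))) \<le> 2"
          using norm_triangle_ineq4[of "iexp (a n \<omega>)" "iexp (b n \<omega>)"] by simp
      qed
    qed measurable
    have pi: "integrable M (\<lambda>\<omega>. \<Sum>k\<in>I. (p n k \<omega>)\<^sup>2)" by (intro Bochner_Integration.integrable_sum p)
    have "(\<integral>\<omega>. cmod (iexp (a n \<omega>) - iexp (b n \<omega>)) \<partial>M) \<le> (\<integral>\<omega>. \<delta> * (\<Sum>k\<in>I. (p n k \<omega>)\<^sup>2) + min 2 (q n \<omega>) \<partial>M)"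
      using ii mi pi pt by (intro integral_mono) auto
    also have "\<dots> = \<delta> * (\<integral>\<omega>. (\<Sum>k\<in>I. (p n k \<omega>)\<^sup>2) \<partial>M) + (\<integral>\<omega>. min 2 (q n \<omega>) \<partial>M)"
      using mi pi by simp
    also have "(\<integral>\<omega>. (\<Sum>k\<in>I. (p n k \<omega>)\<^sup>2) \<partial>M) = (\<Sum>k\<in>I. \<integral>\<omega>. (p n k \<omega>)\<^sup>2 \<partial>M)"
      by (rule Bochner_Integration.integral_sum[OF p(1)])
    also have "\<delta> * (\<Sum>k\<in>I. \<integral>\<omega>. (p n k \<omega>)\<^sup>2 \<partial>M) \<le> \<delta> * K"
    proof (rule mult_left_mono)
      have "(\<Sum>k\<in>I. \<integral>\<omega>. (p n k \<omega>)\<^sup>2 \<partial>M) \<le> (\<Sum>k\<in>I. \<bar>C\<bar>)" using p(2) by (intro sum_mono) (auto intro: order_trans[OF _ abs_ge_self])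
      then show "(\<Sum>k\<in>I. \<integral>\<omega>. (p n k \<omega>)\<^sup>2 \<partial>M) \<le> K" by (simp add: K_def)
    qed (use \<delta> in simp)
    also have "\<delta> * K = r / 2" using K by (simp add: \<delta>_def)
    finally have "(\<integral>\<omega>. cmod (iexp (a n \<omega>) - iexp (b n \<omega>)) \<partial>M) < r" using n0[OF n] by linarith
    moreover have "0 \<le> (\<integral>\<omega>. cmod (iexp (a n \<omega>) - iexp (b n \<omega>)) \<partial>M)" by simp
    ultimately show "norm ((\<integral>\<omega>. cmod (iexp (a n \<omega>) - iexp (b n \<omega>)) \<partial>M) - 0) < r" by simp
  qed
qed

text \<open>The test includes the current term, so the term that would cross \<open>L\<close> is
  itself discarded.\<close>

lemma truncated_sum_le:
  fixes c :: "nat \<Rightarrow> real"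
  assumes c: "\<And>l. 0 \<le> c l" and L: "0 \<le> L" and rn: "r \<le> n"
  shows "(\<Sum>l\<in>{r..<n}. (if (\<Sum>i\<in>{r..l}. c i) \<le> L then 1 else 0) * c l) \<le> L"
  using rn
proof (induction n rule: dec_induct)
  case (step n)
  show ?case
  proof (cases "(\<Sum>i\<in>{r..n}. c i) \<le> L")
    case True
    have "(\<Sum>l\<in>{r..<Suc n}. (if (\<Sum>i\<in>{r..l}. c i) \<le> L then 1 else 0) * c l) \<le> (\<Sum>l\<in>{r..<Suc n}. c l)"
      by (intro sum_mono) (use c in auto)
    also have "\<dots> = (\<Sum>i\<in>{r..n}. c i)" by (simp add: atLeastLessThanSuc_atLeastAtMost)
    finally show ?thesis using True by simp
  next
    case False
    then show ?thesis using step by simp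
  qed
qed (use L in simp)

text \<open>A Toeplitz lemma for weights that change with \<open>n\<close>: the windows start at
  \<open>r n\<close>, which tends to infinity, so eventually only small \<open>e l\<close>
  occur.\<close>

lemma tail_weighted_null:
  fixes e :: "nat \<Rightarrow> real" and w :: "nat \<Rightarrow> nat \<Rightarrow> real"
  assumes e: "e \<longlonglongrightarrow> 0" and w: "\<And>n l. 0 \<le> w n l" and r: "filterlim r at_top sequentially"
    and s: "(\<lambda>n. \<Sum>l\<in>{r n..<n}. w n l) \<longlonglongrightarrow> s"
  shows "(\<lambda>n. \<Sum>l\<in>{r n..<n}. e l * w n l) \<longlonglongrightarrow> 0"
proof (rule LIMSEQ_I)
  fix \<epsilon> :: real assume \<epsilon>: "\<epsilon> > 0"
  obtain B where B: "\<And>n. \<bar>\<Sum>l\<in>{r n..<n}. w n l\<bar> \<le> B" by (rule LIMSEQ_imp_bounded[OF s]) blast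
  have B0: "B \<ge> 0" using B[of 0] abs_ge_zero order_trans by blast
  define \<delta> where "\<delta> = \<epsilon> / (2 * (B + 1))"
  have \<delta>: "\<delta> > 0" using \<epsilon> B0 by (simp add: \<delta>_def)
  obtain n0 where n0: "\<And>l. l \<ge> n0 \<Longrightarrow> \<bar>e l\<bar> < \<delta>" using LIMSEQ_D[OF e \<delta>] by auto
  have "eventually (\<lambda>n. r n \<ge> n0) sequentially" using r by (simp add: filterlim_at_top)
  then obtain n1 where n1: "\<And>n. n \<ge> n1 \<Longrightarrow> r n \<ge> n0" by (auto simp: eventually_sequentially)
  show "\<exists>no. \<forall>n\<ge>no. norm ((\<Sum>l\<in>{r n..<n}. e l * w n l) - 0) < \<epsilon>"
  proof (intro exI[of _ n1] allI impI)
    fix n assume n: "n \<ge> n1"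
    have "\<bar>\<Sum>l\<in>{r n..<n}. e l * w n l\<bar> \<le> (\<Sum>l\<in>{r n..<n}. \<delta> * w n l)"
    proof (rule order_trans[OF sum_abs], rule sum_mono)
      fix l assume "l \<in> {r n..<n}"
      then have "\<bar>e l\<bar> \<le> \<delta>" using n0[of l] n1[OF n] by auto
      then show "\<bar>e l * w n l\<bar> \<le> \<delta> * w n l" using w by (simp add: abs_mult mult_right_mono)
    qed
    also have "\<dots> = \<delta> * (\<Sum>l\<in>{r n..<n}. w n l)" by (simp add: sum_distrib_left)
    also have "\<dots> \<le> \<delta> * B" using B[of n] \<delta> by (intro mult_left_mono) auto
    also have "\<dots> < \<epsilon>"
    proof -
      have "\<epsilon> * B < \<epsilon> * (2 * (B + 1))" using \<epsilon> B0 by (intro mult_strict_left_mono) auto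
      then show ?thesis using B0 by (simp add: \<delta>_def divide_less_eq)
    qed
    finally show "norm ((\<Sum>l\<in>{r n..<n}. e l * w n l) - 0) < \<epsilon>" by simp
  qed
qed

lemma filterlim_floor_sqrt: "filterlim floor_sqrt at_top sequentially"
  unfolding filterlim_at_top
proof
  fix Z :: nat
  show "\<forall>\<^sub>F n in sequentially. Z \<le> floor_sqrt n"
    using eventually_ge_at_top[of "Z\<^sup>2"]
  proof eventually_elim
    case (elim n)
    then show ?case using mono_floor_sqrt'[OF elim] by simp
  qed
qed

lemma Suc_floor_sqrt_bounds:
  "real (Suc n) \<le> (real (Suc (floor_sqrt n)))\<^sup>2" "(real (Suc (floor_sqrt n)))\<^sup>2 \<le> 2 * real (Suc n)"
proof -
  have "Suc n \<le> (Suc (floor_sqrt n))\<^sup>2" using Suc_floor_sqrt_power2_gt[of n] by simp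
  then have "real (Suc n) \<le> real ((Suc (floor_sqrt n))\<^sup>2)" by (rule of_nat_mono)
  then show "real (Suc n) \<le> (real (Suc (floor_sqrt n)))\<^sup>2" by simp
  define r where "r = real (floor_sqrt n)"
  have "real ((floor_sqrt n)\<^sup>2) \<le> real n" by (rule of_nat_mono) simp
  then have "r\<^sup>2 \<le> real n" by (simp add: r_def)
  moreover have "0 \<le> (r - 1)\<^sup>2" by simp
  ultimately have "(r + 1)\<^sup>2 \<le> 2 * (real n + 1)" by (simp add: power2_sum power2_diff)
  then show "(real (Suc (floor_sqrt n)))\<^sup>2 \<le> 2 * real (Suc n)" by (simp add: r_def add.commute)
qed

context reinforced_urn_limit
begin

text \<open>The ratio of the two time scales; between stages \<open>floor_sqrt n\<close> and
  \<open>n\<close> the content of colour \<open>k\<close> grows by about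
  \<open>rho n powr ex k\<close>.\<close>

definition rho :: "nat \<Rightarrow> real" where "rho n = real (Suc n) / real (Suc (floor_sqrt n))"

lemma rho_pos: "rho n > 0" by (simp add: rho_def)

lemma rho_top: "filterlim rho at_top sequentially"
proof (rule filterlim_at_top_mono)
  show "filterlim (\<lambda>n. (1 / 2) * real (Suc (floor_sqrt n))) at_top sequentially"
    by (rule filterlim_tendsto_pos_mult_at_top[OF tendsto_const _ filterlim_compose[OF filterlim_real_Suc filterlim_floor_sqrt]]) simp
  have "(1 / 2) * real (Suc (floor_sqrt n)) \<le> rho n" for n
  proof -
    have "real (Suc (floor_sqrt n)) * real (Suc (floor_sqrt n)) \<le> 2 * real (Suc n)"
      using Suc_floor_sqrt_bounds(2)[of n] by (simp only: power2_eq_square)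
    then show ?thesis unfolding rho_def by (simp add: le_divide_eq mult.commute del: of_nat_Suc)
  qed
  then show "\<forall>\<^sub>F n in sequentially. (1 / 2) * real (Suc (floor_sqrt n)) \<le> rho n" by simp
qed

text \<open>The normalisation \<open>bn\<close> of the draws of colour \<open>k\<close> up to stage \<open>n\<close> is extrapolated from stage
  \<open>floor_sqrt n\<close>: it is equivalent to their number, but known early.\<close>

definition bn :: "nat \<Rightarrow> nat \<Rightarrow> 'w \<Rightarrow> real" where
  "bn n k \<omega> = Hr (floor_sqrt n) k \<omega> / m k * rho n powr ex k"

lemma bn_pos: "k \<in> {1..d} \<Longrightarrow> bn n k \<omega> > 0"
  unfolding bn_def using Hr_pos m_ge_1[of k] rho_pos[of n] by simp

lemma bn_lower: "k \<in> {1..d} \<Longrightarrow> rho n powr ex k / m k \<le> bn n k \<omega>"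
  unfolding bn_def using mult_right_mono[OF Hr_ge_1[of k "floor_sqrt n" \<omega>], of "rho n powr ex k / m k"] m_ge_1[of k] by simp

lemma bn_measurable_F: "floor_sqrt n \<le> l \<Longrightarrow> k \<in> {1..d} \<Longrightarrow> bn n k \<in> borel_measurable (FF l)"
  unfolding bn_def[abs_def]
  by (intro borel_measurable_times borel_measurable_divide borel_measurable_const Hr_measurable_F)

lemma bn_measurable [measurable]: "k \<in> {1..d} \<Longrightarrow> bn n k \<in> borel_measurable M"
  by (rule measurable_M_of_F[OF bn_measurable_F[OF order_refl]])

lemma rho_powr_top: "k \<in> {1..d} \<Longrightarrow> filterlim (\<lambda>n. rho n powr ex k) at_top sequentially"
  by (rule filterlim_compose[OF powr_at_top rho_top]) (rule ex_bounds)

lemma regular_drawn_growth: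
  assumes \<omega>: "regular \<omega>" and k: "k \<in> {1..d}"
  obtains w where "w > 0" "(\<lambda>n. Hr n k \<omega> / real (Suc n) powr ex k) \<longlonglongrightarrow> w"
    "(\<lambda>n. Dr n k \<omega> / real (Suc n) powr ex k) \<longlonglongrightarrow> w / m k"
proof -
  obtain w where w: "w > 0" "(\<lambda>n. Hr n k \<omega> / real (Suc n) powr ex k) \<longlonglongrightarrow> w"
    using regular_H_growth[OF \<omega> k] .
  have "(\<lambda>n. (Dr n k \<omega> / Hr n k \<omega>) * (Hr n k \<omega> / real (Suc n) powr ex k)) \<longlonglongrightarrow> 1 / m k * w"
    by (intro tendsto_mult w regular_drawn_ratio[OF \<omega> k])
  moreover have "(Dr n k \<omega> / Hr n k \<omega>) * (Hr n k \<omega> / real (Suc n) powr ex k) = Dr n k \<omega> / real (Suc n) powr ex k" for n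
    using Hr_pos[OF k, of n \<omega>] by simp
  ultimately show ?thesis using that[OF w] by simp
qed

text \<open>Stages \<open>floor_sqrt n\<close> and \<open>n\<close> share the random constant w,
  which therefore cancels in the first ratio. In the second one the divergent factor
  \<open>rho n powr ex k\<close> is left in the denominator.\<close>

lemma regular_drawn_bn:
  assumes \<omega>: "regular \<omega>" and k: "k \<in> {1..d}"
  shows "(\<lambda>n. Dr n k \<omega> / bn n k \<omega>) \<longlonglongrightarrow> 1"
    and "(\<lambda>n. Dr (floor_sqrt n) k \<omega> / bn n k \<omega>) \<longlonglongrightarrow> 0"
proof -
  have mk: "m k > 0" using m_ge_1[OF k] by simp
  obtain w where w: "w > 0" "(\<lambda>n. Hr n k \<omega> / real (Suc n) powr ex k) \<longlonglongrightarrow> w"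
    "(\<lambda>n. Dr n k \<omega> / real (Suc n) powr ex k) \<longlonglongrightarrow> w / m k"
    using regular_drawn_growth[OF \<omega> k] .
  have wr: "(\<lambda>n. Hr (floor_sqrt n) k \<omega> / real (Suc (floor_sqrt n)) powr ex k) \<longlonglongrightarrow> w"
    by (rule filterlim_compose[OF w(2) filterlim_floor_sqrt])
  have "(\<lambda>n. m k * (Dr n k \<omega> / real (Suc n) powr ex k) / (Hr (floor_sqrt n) k \<omega> / real (Suc (floor_sqrt n)) powr ex k)) \<longlonglongrightarrow> m k * (w / m k) / w"
    using w(1) by (intro tendsto_divide tendsto_mult tendsto_const w(3) wr) auto
  moreover have "m k * (w / m k) / w = 1" using mk w(1) by simp
  moreover have "m k * (Dr n k \<omega> / real (Suc n) powr ex k) / (Hr (floor_sqrt n) k \<omega> / real (Suc (floor_sqrt n)) powr ex k) = Dr n k \<omega> / bn n k \<omega>" for n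
    unfolding bn_def rho_def by (simp add: powr_divide mult_ac del: of_nat_Suc)
  ultimately show "(\<lambda>n. Dr n k \<omega> / bn n k \<omega>) \<longlonglongrightarrow> 1" by simp
  have 1: "(\<lambda>n. Dr (floor_sqrt n) k \<omega> / Hr (floor_sqrt n) k \<omega>) \<longlonglongrightarrow> 1 / m k"
    by (rule filterlim_compose[OF regular_drawn_ratio[OF \<omega> k] filterlim_floor_sqrt])
  have 2: "(\<lambda>n. m k / rho n powr ex k) \<longlonglongrightarrow> 0"
    by (rule real_tendsto_divide_at_top[OF tendsto_const rho_powr_top[OF k]])
  have "(\<lambda>n. Dr (floor_sqrt n) k \<omega> / Hr (floor_sqrt n) k \<omega> * (m k / rho n powr ex k)) \<longlonglongrightarrow> 0"
    using tendsto_mult[OF 1 2] by simp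
  moreover have "Dr (floor_sqrt n) k \<omega> / Hr (floor_sqrt n) k \<omega> * (m k / rho n powr ex k) = Dr (floor_sqrt n) k \<omega> / bn n k \<omega>" for n
    unfolding bn_def by simp
  ultimately show "(\<lambda>n. Dr (floor_sqrt n) k \<omega> / bn n k \<omega>) \<longlonglongrightarrow> 0" by simp
qed

text \<open>The truncation \<open>In\<close> keeps the conditional variance of the normalised martingale bounded;
  almost surely it is eventually inactive.\<close>

definition Xm :: "nat \<Rightarrow> nat \<Rightarrow> 'w \<Rightarrow> real" where "Xm l k \<omega> = min (Xr l k \<omega>) (real C1)"
definition cn :: "nat \<Rightarrow> nat \<Rightarrow> 'w \<Rightarrow> real" where "cn n l \<omega> = (\<Sum>k=1..d. Xm l k \<omega> / bn n k \<omega>)"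
definition In :: "nat \<Rightarrow> nat \<Rightarrow> 'w \<Rightarrow> real" where
  "In n l \<omega> = (if (\<Sum>i\<in>{floor_sqrt n..l}. cn n i \<omega>) \<le> real d + 1 then 1 else 0)"
definition xs :: "(nat \<Rightarrow> real) \<Rightarrow> nat \<Rightarrow> nat \<Rightarrow> nat \<Rightarrow> 'w \<Rightarrow> real" where
  "xs u n l k \<omega> = In n l \<omega> * u k * Xm l k \<omega> / sqrt (bn n k \<omega>)"

text \<open>The minimum in \<open>Xm\<close> makes the upper bound hold at every point, not just
  almost surely, as \<open>exponential_martingale\<close> requires of its coefficients.\<close>

lemma Xm_bounds: "0 \<le> Xm l k \<omega>" "Xm l k \<omega> \<le> real C1" by (auto simp: Xm_def)

lemma cn_nonneg: "0 \<le> cn n l \<omega>"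
  unfolding cn_def using Xm_bounds(1) bn_pos by (intro sum_nonneg divide_nonneg_nonneg) (auto intro: less_imp_le)

lemma good_Xm: "good \<omega> \<Longrightarrow> k \<in> {1..d} \<Longrightarrow> Xm l k \<omega> = Xr l k \<omega>"
  using good_X_le_C1[of \<omega> k l] by (simp add: Xm_def)

lemma Xm_measurable_K: "i \<le> l \<Longrightarrow> k \<in> {1..d} \<Longrightarrow> Xm i k \<in> borel_measurable (urn_K l)"
  unfolding Xm_def[abs_def]
  by (cases "i = l") (auto intro!: borel_measurable_min borel_measurable_const Xr_measurable_K measurable_K_of_F[OF Xr_measurable_F])

lemma xs_measurable:
  assumes l: "floor_sqrt n \<le> l" and k: "k \<in> {1..d}"
  shows "xs u n l k \<in> borel_measurable (urn_K l)"
proof -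
  have b: "bn n j \<in> borel_measurable (urn_K l)" if "j \<in> {1..d}" for j
    by (rule measurable_K_of_F[OF bn_measurable_F[OF l that]])
  have [measurable]: "(\<lambda>\<omega>. \<Sum>i\<in>{floor_sqrt n..l}. cn n i \<omega>) \<in> borel_measurable (urn_K l)"
    unfolding cn_def by (intro borel_measurable_sum borel_measurable_divide b Xm_measurable_K) auto
  have [measurable]: "bn n k \<in> borel_measurable (urn_K l)" "Xm l k \<in> borel_measurable (urn_K l)"
    using b[OF k] Xm_measurable_K[OF order_refl k] by auto
  show ?thesis unfolding xs_def[abs_def] In_def by measurable
qed

text \<open>A deterministic null sequence that bounds all coefficients \<open>xs\<close>, available
  because \<open>H \<ge> 1\<close> gives \<open>bn\<close> a deterministic lower bound. The sum over
  colours stands in for a maximum.\<close>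

definition eps :: "real \<Rightarrow> nat \<Rightarrow> real" where
  "eps U n = (\<Sum>k=1..d. U * real C1 * sqrt (m k / rho n powr ex k))"

lemma eps_tendsto: "eps U \<longlonglongrightarrow> 0"
proof -
  have "eps U \<longlonglongrightarrow> (\<Sum>k=1..d. U * real C1 * sqrt 0)"
    unfolding eps_def
    by (intro tendsto_sum tendsto_mult tendsto_const tendsto_real_sqrt real_tendsto_divide_at_top[OF tendsto_const rho_powr_top])
  then show ?thesis by simp
qed

lemma eps_nonneg: "0 \<le> U \<Longrightarrow> 0 \<le> eps U n"
  unfolding eps_def using m_ge_1 rho_pos[of n]
  by (intro sum_nonneg mult_nonneg_nonneg real_sqrt_ge_zero divide_nonneg_nonneg) (auto intro: order_trans[of 0 1])

lemma xs_bound: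
  assumes k: "k \<in> {1..d}" and U: "\<And>k. k \<in> {1..d} \<Longrightarrow> \<bar>u k\<bar> \<le> U"
  shows "\<bar>xs u n l k \<omega>\<bar> \<le> eps U n"
proof -
  have U0: "U \<ge> 0" using U[OF k] by linarith
  have b: "bn n k \<omega> > 0" by (rule bn_pos[OF k])
  have p: "rho n powr ex k > 0" "m k > 0" using rho_pos[of n] m_ge_1[OF k] by auto
  have "\<bar>xs u n l k \<omega>\<bar> = In n l \<omega> * \<bar>u k\<bar> * Xm l k \<omega> * sqrt (1 / bn n k \<omega>)"
    unfolding xs_def using Xm_bounds(1) b by (simp add: abs_mult In_def real_sqrt_divide)
  also have "\<dots> \<le> 1 * U * real C1 * sqrt (m k / rho n powr ex k)"
  proof (intro mult_mono)
    have "1 / bn n k \<omega> \<le> 1 / (rho n powr ex k / m k)"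
      using bn_lower[OF k, of n \<omega>] p by (intro divide_left_mono mult_pos_pos b) auto
    then show "sqrt (1 / bn n k \<omega>) \<le> sqrt (m k / rho n powr ex k)" by simp
  qed (use U[OF k] U0 Xm_bounds b in \<open>auto simp: In_def\<close>)
  also have "\<dots> \<le> eps U n"
  proof -
    have "0 \<le> U * real C1 * sqrt (m j / rho n powr ex j)" if "j \<in> {1..d}" for j
      using U0 m_ge_1[OF that] by simp
    then show ?thesis
      unfolding eps_def mult_1_left
      by (intro member_le_sum[OF k, of "\<lambda>k. U * real C1 * sqrt (m k / rho n powr ex k)"]) auto
  qed
  finally show ?thesis .
qed

lemma xs_sum:
  assumes U: "\<And>k. k \<in> {1..d} \<Longrightarrow> \<bar>u k\<bar> \<le> U"
  shows "(\<Sum>l\<in>{floor_sqrt n..<n}. \<Sum>k=1..d. (xs u n l k \<omega>)\<^sup>2) \<le> U\<^sup>2 * real C1 * (real d + 1)"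
proof -
  \<comment> \<open>Of the two factors \<open>Xm\<close> in the square one is bounded by
    \<open>C1\<close>; the other is kept for the truncation, which controls sums of
    \<open>Xm / bn\<close>.\<close>
  have one: "(xs u n l k \<omega>)\<^sup>2 \<le> U\<^sup>2 * real C1 * (In n l \<omega> * (Xm l k \<omega> / bn n k \<omega>))" if k: "k \<in> {1..d}" for l k
  proof -
    have b: "bn n k \<omega> > 0" by (rule bn_pos[OF k])
    have u2: "(u k)\<^sup>2 \<le> U\<^sup>2" using power_mono[OF U[OF k], of 2] by simp
    have "(xs u n l k \<omega>)\<^sup>2 = (u k)\<^sup>2 * Xm l k \<omega> * (In n l \<omega> * (Xm l k \<omega> / bn n k \<omega>))"
      using b by (simp add: xs_def In_def power_mult_distrib power_divide power2_eq_square)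
    also have "\<dots> \<le> U\<^sup>2 * real C1 * (In n l \<omega> * (Xm l k \<omega> / bn n k \<omega>))"
      using Xm_bounds u2 b by (intro mult_mono mult_right_mono mult_nonneg_nonneg) (auto simp: In_def)
    finally show ?thesis .
  qed
  have "(\<Sum>l\<in>{floor_sqrt n..<n}. \<Sum>k=1..d. (xs u n l k \<omega>)\<^sup>2)
      \<le> (\<Sum>l\<in>{floor_sqrt n..<n}. \<Sum>k=1..d. U\<^sup>2 * real C1 * (In n l \<omega> * (Xm l k \<omega> / bn n k \<omega>)))"
    by (intro sum_mono one)
  also have "\<dots> = U\<^sup>2 * real C1 * (\<Sum>l\<in>{floor_sqrt n..<n}. In n l \<omega> * cn n l \<omega>)"
    by (simp add: cn_def sum_distrib_left)
  also have "\<dots> \<le> U\<^sup>2 * real C1 * (real d + 1)"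
    unfolding In_def by (intro mult_left_mono truncated_sum_le cn_nonneg floor_sqrt_le) auto
  finally show ?thesis .
qed

section \<open>Weak limit of the exponential functionals of the normalised martingale\<close>

definition W :: "(nat \<Rightarrow> real) \<Rightarrow> nat \<Rightarrow> 'w \<Rightarrow> real" where
  "W u n \<omega> = (\<Sum>l\<in>{floor_sqrt n..<n}. \<Sum>k=1..d. xs u n l k \<omega> * Ac l k \<omega>)"
definition vn :: "(nat \<Rightarrow> real) \<Rightarrow> nat \<Rightarrow> 'w \<Rightarrow> real" where
  "vn u n \<omega> = (\<Sum>l\<in>{floor_sqrt n..<n}. quad l (\<lambda>k. xs u n l k \<omega>))"
definition TT :: "(nat \<Rightarrow> real) \<Rightarrow> nat \<Rightarrow> 'w \<Rightarrow> complex" where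
  "TT u n \<omega> = iexp (W u n \<omega>) * complex_of_real (exp (vn u n \<omega> / 2))"

lemma xs_measurable_M [measurable]: "l \<in> {floor_sqrt n..<n} \<Longrightarrow> k \<in> {1..d} \<Longrightarrow> xs u n l k \<in> borel_measurable M"
  by (rule measurable_from_subalg[OF subalgebra_K xs_measurable]) auto

lemma W_measurable [measurable]: "W u n \<in> borel_measurable M"
  unfolding W_def[abs_def] by (intro borel_measurable_sum borel_measurable_times xs_measurable_M Ac_measurable)

lemma vn_measurable [measurable]: "vn u n \<in> borel_measurable M"
  unfolding vn_def[abs_def] quad_def
  by (intro borel_measurable_sum borel_measurable_times borel_measurable_const xs_measurable_M)

lemma TT_measurable [measurable]: "TT u n \<in> borel_measurable M"
  unfolding TT_def[abs_def] by measurable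

lemma vn_nonneg: "0 \<le> vn u n \<omega>" unfolding vn_def by (intro sum_nonneg quad_nonneg)

text \<open>From \<open>n0\<close> on \<open>eps U\<close> is at most 1, which
  \<open>exponential_martingale\<close> requires. A test function of any fixed past is eventually
  known at stage \<open>floor_sqrt n\<close>, where the martingale starts.\<close>

lemma TT_properties:
  assumes U: "\<And>k. k \<in> {1..d} \<Longrightarrow> \<bar>u k\<bar> \<le> U" and U0: "0 \<le> U"
  obtains n0 E where "\<And>n. n \<ge> n0 \<Longrightarrow> TT u n \<in> borel_measurable (FF n)"
    "\<And>n \<omega>. n \<ge> n0 \<Longrightarrow> cmod (TT u n \<omega>) \<le> E"
    "\<And>m h G. h \<in> borel_measurable (FF m) \<Longrightarrow> (\<And>\<omega>. \<bar>h \<omega>\<bar> \<le> G) \<Longrightarrow>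
      (\<lambda>n. \<integral>\<omega>. complex_of_real (h \<omega>) * TT u n \<omega> \<partial>M) \<longlonglongrightarrow> complex_of_real (\<integral>\<omega>. h \<omega> \<partial>M)"
proof -
  define K where "K = U\<^sup>2 * real C1 * (real d + 1)"
  have "\<forall>\<^sub>F n in sequentially. eps U n < 1" by (rule order_tendstoD(2)[OF eps_tendsto]) simp
  then obtain n0 where n0: "\<And>n. n \<ge> n0 \<Longrightarrow> eps U n \<le> 1"
    by (auto simp: eventually_sequentially intro: less_imp_le)
  have m: "xs u n l k \<in> borel_measurable (urn_K l)" if "l \<in> {floor_sqrt n..<n}" "k \<in> {1..d}" for n l k
    by (rule xs_measurable) (use that in auto)
  have xb: "\<bar>xs u n l k \<omega>\<bar> \<le> eps U n" if "l \<in> {floor_sqrt n..<n}" "k \<in> {1..d}" for n l k \<omega>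
    by (rule xs_bound[OF that(2) U])
  have xK: "(\<Sum>l\<in>{floor_sqrt n..<n}. \<Sum>k=1..d. (xs u n l k \<omega>)\<^sup>2) \<le> K" for n \<omega>
    unfolding K_def by (rule xs_sum[OF U])
  have EM: "TT u n \<in> borel_measurable (FF n)" "cmod (TT u n \<omega>) \<le> exp (C2 * real d * K / 2)"
    "cmod ((\<integral>\<omega>. complex_of_real (h \<omega>) * TT u n \<omega> \<partial>M) - complex_of_real (\<integral>\<omega>. h \<omega> \<partial>M))
      \<le> G * exp (C2 * real d * K / 2) * step_const * eps U n * K"
    if n: "n \<ge> n0" and h: "h \<in> borel_measurable (FF (floor_sqrt n))" "\<And>\<omega>. \<bar>h \<omega>\<bar> \<le> G" for n h G \<omega>
  proof -
    note E = exponential_martingale[where x="xs u n" and r="floor_sqrt n" and n=n and \<epsilon>="eps U n"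
        and K=K and h=h and G=G, folded W_def vn_def TT_def]
    show "TT u n \<in> borel_measurable (FF n)"
      by (rule E(1)) (fact m xb eps_nonneg[OF U0] n0[OF n] xK h floor_sqrt_le)+
    show "cmod (TT u n \<omega>) \<le> exp (C2 * real d * K / 2)"
      by (rule E(2)) (fact m xb eps_nonneg[OF U0] n0[OF n] xK h floor_sqrt_le)+
    show "cmod ((\<integral>\<omega>. complex_of_real (h \<omega>) * TT u n \<omega> \<partial>M) - complex_of_real (\<integral>\<omega>. h \<omega> \<partial>M))
      \<le> G * exp (C2 * real d * K / 2) * step_const * eps U n * K"
      by (rule E(3)) (fact m xb eps_nonneg[OF U0] n0[OF n] xK h floor_sqrt_le)+
  qed
  have z: "(\<lambda>_. 0) \<in> borel_measurable (FF j)" for j by simp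
  show ?thesis
  proof (rule that[of n0 "exp (C2 * real d * K / 2)"])
    show "TT u n \<in> borel_measurable (FF n)" if "n \<ge> n0" for n
      by (rule EM(1)[OF that z, of 0]) simp
    show "cmod (TT u n \<omega>) \<le> exp (C2 * real d * K / 2)" if "n \<ge> n0" for n \<omega>
      by (rule EM(2)[OF that z, of 0]) simp
    fix m :: nat and h :: "'w \<Rightarrow> real" and G :: real
    assume h: "h \<in> borel_measurable (FF m)" "\<And>\<omega>. \<bar>h \<omega>\<bar> \<le> G"
    define c where "c = G * exp (C2 * real d * K / 2) * step_const"
    have "\<forall>\<^sub>F n in sequentially. floor_sqrt n \<ge> m"
      using filterlim_floor_sqrt by (simp add: filterlim_at_top)
    then have "\<forall>\<^sub>F n in sequentially. norm ((\<integral>\<omega>. complex_of_real (h \<omega>) * TT u n \<omega> \<partial>M) - complex_of_real (\<integral>\<omega>. h \<omega> \<partial>M)) \<le> c * eps U n * K"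
      using eventually_ge_at_top[of n0]
    proof eventually_elim
      case (elim n)
      show ?case unfolding c_def
        by (rule EM(3)[OF elim(2) measurable_from_subalg[OF subalgebra_F_mono[OF elim(1)] h(1)] h(2)])
    qed
    moreover have "(\<lambda>n. c * eps U n * K) \<longlonglongrightarrow> 0"
      using tendsto_mult[OF tendsto_mult[OF tendsto_const[of c] eps_tendsto] tendsto_const[of K]] by simp
    ultimately have "(\<lambda>n. (\<integral>\<omega>. complex_of_real (h \<omega>) * TT u n \<omega> \<partial>M) - complex_of_real (\<integral>\<omega>. h \<omega> \<partial>M)) \<longlonglongrightarrow> 0"
      by (rule Lim_null_comparison)
    then show "(\<lambda>n. \<integral>\<omega>. complex_of_real (h \<omega>) * TT u n \<omega> \<partial>M) \<longlonglongrightarrow> complex_of_real (\<integral>\<omega>. h \<omega> \<partial>M)"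
      by (simp add: LIM_zero_iff)
  qed
qed

text \<open>Extends the test functions from a fixed past to all bounded random variables. The
  variables \<open>TT - 1\<close> are themselves functions of the past, so real and imaginary parts
  are asymptotically orthogonal sequences and converge weakly to 0.\<close>

lemma TT_weak_limit:
  assumes U: "\<And>k. k \<in> {1..d} \<Longrightarrow> \<bar>u k\<bar> \<le> U" and U0: "0 \<le> U"
    and g [measurable]: "g \<in> borel_measurable M" and gb: "\<And>\<omega>. \<bar>g \<omega>\<bar> \<le> (G::real)"
  shows "(\<lambda>n. \<integral>\<omega>. complex_of_real (g \<omega>) * TT u n \<omega> \<partial>M) \<longlonglongrightarrow> complex_of_real (\<integral>\<omega>. g \<omega> \<partial>M)"
proof -
  obtain n0 E where TF: "\<And>n. n \<ge> n0 \<Longrightarrow> TT u n \<in> borel_measurable (FF n)"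
    and TE: "\<And>n \<omega>. n \<ge> n0 \<Longrightarrow> cmod (TT u n \<omega>) \<le> E"
    and past: "\<And>m h G. h \<in> borel_measurable (FF m) \<Longrightarrow> (\<And>\<omega>. \<bar>h \<omega>\<bar> \<le> G) \<Longrightarrow>
      (\<lambda>n. \<integral>\<omega>. complex_of_real (h \<omega>) * TT u n \<omega> \<partial>M) \<longlonglongrightarrow> complex_of_real (\<integral>\<omega>. h \<omega> \<partial>M)"
    using TT_properties[where u=u and U=U, OF U U0] by blast
  have E0: "E \<ge> 0" using TE[OF order_refl, of undefined] norm_ge_zero order_trans by blast
  \<comment> \<open>Shifted so that measurability and the bound \<open>E\<close> hold for every
    index.\<close>
  define T where "T n = TT u (n + n0)" for n
  have TM [measurable]: "T n \<in> borel_measurable M" for n unfolding T_def by measurable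
  have Tb: "cmod (T n \<omega>) \<le> E" for n \<omega> unfolding T_def by (rule TE) simp
  have hT: "integrable M (\<lambda>\<omega>. complex_of_real (h \<omega>) * T n \<omega>)"
    if [measurable]: "h \<in> borel_measurable M" and "\<And>\<omega>. \<bar>h \<omega>\<bar> \<le> B" for h n B
  proof (rule integrable_const_bound[where B="B * E"])
    show "AE \<omega> in M. cmod (complex_of_real (h \<omega>) * T n \<omega>) \<le> B * E"
      unfolding norm_mult using that(2) Tb order_trans[OF abs_ge_zero that(2)] by (intro AE_I2 mult_mono) auto
  qed measurable
  have Re: "Re (\<integral>\<omega>. complex_of_real (h \<omega>) * T n \<omega> \<partial>M) = (\<integral>\<omega>. h \<omega> * Re (T n \<omega>) \<partial>M)"
    and Im: "Im (\<integral>\<omega>. complex_of_real (h \<omega>) * T n \<omega> \<partial>M) = (\<integral>\<omega>. h \<omega> * Im (T n \<omega>) \<partial>M)"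
    if "h \<in> borel_measurable M" "\<And>\<omega>. \<bar>h \<omega>\<bar> \<le> B" for h n B
    using hT[OF that, of n] by (simp_all flip: integral_Re integral_Im)
  have pastT: "(\<lambda>n. \<integral>\<omega>. complex_of_real (h \<omega>) * T n \<omega> \<partial>M) \<longlonglongrightarrow> complex_of_real (\<integral>\<omega>. h \<omega> \<partial>M)"
    if "h \<in> borel_measurable (FF m)" "\<And>\<omega>. \<bar>h \<omega>\<bar> \<le> B" for h m B
    unfolding T_def by (rule LIMSEQ_ignore_initial_segment[OF past[OF that]])
  define R where "R n \<omega> = Re (T n \<omega>) - 1" for n \<omega>
  define J where "J n \<omega> = Im (T n \<omega>)" for n \<omega>
  have Rb: "\<bar>R n \<omega>\<bar> \<le> E + 1" for n \<omega>
    using abs_Re_le_cmod[of "T n \<omega>"] Tb[of n \<omega>] by (simp add: R_def)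
  have Jb: "\<bar>J n \<omega>\<bar> \<le> E" for n \<omega>
    using abs_Im_le_cmod[of "T n \<omega>"] Tb[of n \<omega>] by (simp add: J_def)
  have RF: "R n \<in> borel_measurable (FF (n + n0))" "J n \<in> borel_measurable (FF (n + n0))" for n
    unfolding R_def[abs_def] J_def[abs_def] T_def using TF[of "n + n0"] by measurable
  have RM [measurable]: "R n \<in> borel_measurable M" "J n \<in> borel_measurable M" for n
    by (rule measurable_M_of_F[OF RF(1)], rule measurable_M_of_F[OF RF(2)])
  have eqR: "(\<integral>\<omega>. h \<omega> * R n \<omega> \<partial>M) = Re (\<integral>\<omega>. complex_of_real (h \<omega>) * T n \<omega> \<partial>M) - (\<integral>\<omega>. h \<omega> \<partial>M)"
    if [measurable]: "h \<in> borel_measurable M" and hb: "\<And>\<omega>. \<bar>h \<omega>\<bar> \<le> B" for h n B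
  proof -
    have "integrable M h" by (rule integrable_const_bound[where B=B]) (use hb in auto)
    moreover have "integrable M (\<lambda>\<omega>. h \<omega> * Re (T n \<omega>))"
      using integrable_Re[OF hT[OF that, of n]] by simp
    ultimately show ?thesis unfolding Re[OF that] R_def by (simp add: right_diff_distrib)
  qed
  \<comment> \<open>The test function is \<open>R m\<close> itself, known at stage
    \<open>m + n0\<close>.\<close>
  have oR: "(\<lambda>n. \<integral>\<omega>. R m \<omega> * R n \<omega> \<partial>M) \<longlonglongrightarrow> 0" for m
    unfolding eqR[OF RM(1) Rb]
    using tendsto_diff[OF tendsto_Re[OF pastT[OF RF(1)[of m] Rb]] tendsto_const[of "\<integral>\<omega>. R m \<omega> \<partial>M"]] by simp
  have oJ: "(\<lambda>n. \<integral>\<omega>. J m \<omega> * J n \<omega> \<partial>M) \<longlonglongrightarrow> 0" for m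
    using tendsto_Im[OF pastT[OF RF(2)[of m] Jb]] unfolding Im[OF RM(2) Jb] by (simp add: J_def)
  have "(\<lambda>n. \<integral>\<omega>. g \<omega> * R n \<omega> \<partial>M) \<longlonglongrightarrow> 0"
    by (rule asymptotically_orthogonal_weakly_null[OF RM(1) Rb oR g gb])
  then have 1: "(\<lambda>n. Re (\<integral>\<omega>. complex_of_real (g \<omega>) * T n \<omega> \<partial>M)) \<longlonglongrightarrow> (\<integral>\<omega>. g \<omega> \<partial>M)"
    unfolding eqR[OF g gb] by (simp add: LIM_zero_iff)
  have "(\<lambda>n. \<integral>\<omega>. g \<omega> * J n \<omega> \<partial>M) \<longlonglongrightarrow> 0"
    by (rule asymptotically_orthogonal_weakly_null[OF RM(2) Jb oJ g gb])
  then have 2: "(\<lambda>n. Im (\<integral>\<omega>. complex_of_real (g \<omega>) * T n \<omega> \<partial>M)) \<longlonglongrightarrow> 0"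
    unfolding Im[OF g gb] by (simp add: J_def)
  have "(\<lambda>n. \<integral>\<omega>. complex_of_real (g \<omega>) * T n \<omega> \<partial>M) \<longlonglongrightarrow> complex_of_real (\<integral>\<omega>. g \<omega> \<partial>M)"
    unfolding tendsto_complex_iff using 1 2 by simp
  then show ?thesis unfolding T_def by (rule LIMSEQ_offset)
qed

text \<open>The limiting covariance without case distinction: for a minor colour Z vanishes, so the
  single formula agrees with \<open>urn_Sigma\<close> on the regular event.\<close>

definition Sg :: "nat \<Rightarrow> nat \<Rightarrow> 'w \<Rightarrow> real" where
  "Sg i j \<omega> = (qq i j - m i * m j) * (sqrt (Zl i \<omega> * Zl j \<omega>) * (Q \<omega> / NN \<omega> - 1) + (if i = j then 1 else 0))"

definition gam :: "nat \<Rightarrow> nat \<Rightarrow> nat \<Rightarrow> 'w \<Rightarrow> real" where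
  "gam n i j \<omega> = (\<Sum>l\<in>{floor_sqrt n..<n}. cov l i j * (Xr l i \<omega> * Xr l j \<omega> / sqrt (bn n i \<omega> * bn n j \<omega>)))"

text \<open>The product of the draws of i and j is \<open>Y\<close>, plus the draws themselves when
  i = j; the latter give the summand 1 in \<open>Sg\<close>. \<open>bn\<close> may replace the
  numbers of draws, the stages before \<open>floor_sqrt n\<close> are negligible, and
  \<open>cov\<close> may be replaced by its limit.\<close>

lemma regular_gam:
  assumes \<omega>: "regular \<omega>" and ij: "i \<in> {1..d}" "j \<in> {1..d}"
  shows "(\<lambda>n. gam n i j \<omega>) \<longlonglongrightarrow> Sg i j \<omega>"
proof -
  define R where "R = sqrt (Zl i \<omega> * Zl j \<omega>) * (Q \<omega> / NN \<omega> - 1) + (if i = j then 1 else 0)"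
  define P where "P n = (\<Sum>l<n. Xr l i \<omega> * Xr l j \<omega>)" for n
  have b: "\<And>n. bn n i \<omega> > 0" "\<And>n. bn n j \<omega> > 0" using bn_pos ij by auto
  have P: "(\<lambda>n. P n / sqrt (Dr n i \<omega> * Dr n j \<omega>)) \<longlonglongrightarrow> R"
  proof (cases "i = j")
    case True
    have D: "filterlim (\<lambda>n. Dr n i \<omega>) at_top sequentially"
    proof -
      have "filterlim (\<lambda>n. Dr n i \<omega> / Hr n i \<omega> * Hr n i \<omega>) at_top sequentially"
        using m_ge_1[OF ij(1)] by (intro filterlim_tendsto_pos_mult_at_top[OF regular_drawn_ratio[OF \<omega> ij(1)] _ regular_H_top[OF \<omega> ij(1)]]) auto
      moreover have "Dr n i \<omega> / Hr n i \<omega> * Hr n i \<omega> = Dr n i \<omega>" for n using Hr_pos[OF ij(1), of n \<omega>] by simp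
      ultimately show ?thesis by simp
    qed
    then have ev: "\<forall>\<^sub>F n in sequentially. Dr n i \<omega> > 0" unfolding filterlim_at_top_dense by blast
    have "(\<lambda>n. (\<Sum>l<n. Y i j l \<omega>) / sqrt (Dr n i \<omega> * Dr n j \<omega>) + 1) \<longlonglongrightarrow> R"
      unfolding R_def using True tendsto_add[OF regular_product_limit[OF \<omega> ij] tendsto_const[of 1]] by simp
    then show ?thesis
    proof (rule Lim_transform_eventually)
      show "\<forall>\<^sub>F n in sequentially. (\<Sum>l<n. Y i j l \<omega>) / sqrt (Dr n i \<omega> * Dr n j \<omega>) + 1 = P n / sqrt (Dr n i \<omega> * Dr n j \<omega>)"
        using ev
      proof eventually_elim
        case (elim n)
        have "P n = (\<Sum>l<n. Y i j l \<omega>) + Dr n i \<omega>"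
          unfolding P_def Y_def Dr_eq using True by (simp add: sum.distrib[symmetric] right_diff_distrib)
        then show ?case using elim True by (simp add: add_divide_distrib)
      qed
    qed
  next
    case False
    then have "P n = (\<Sum>l<n. Y i j l \<omega>)" for n by (simp add: P_def Y_def)
    then show ?thesis using regular_product_limit[OF \<omega> ij] False by (simp add: R_def)
  qed
  have sq: "sqrt (a / c) * sqrt (b' / e) = sqrt (a * b') / sqrt (c * e)" for a b' c e :: real
    by (simp add: real_sqrt_divide real_sqrt_mult)
  have "(\<lambda>n. sqrt (Dr n i \<omega> / bn n i \<omega>) * sqrt (Dr n j \<omega> / bn n j \<omega>)) \<longlonglongrightarrow> sqrt 1 * sqrt 1"
    by (intro tendsto_mult tendsto_real_sqrt regular_drawn_bn(1)[OF \<omega>] ij)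
  from tendsto_mult[OF P this]
  have P1: "(\<lambda>n. P n / sqrt (Dr n i \<omega> * Dr n j \<omega>) * (sqrt (Dr n i \<omega> * Dr n j \<omega>) / sqrt (bn n i \<omega> * bn n j \<omega>))) \<longlonglongrightarrow> R"
    by (simp add: sq)
  \<comment> \<open>If a colour has not been drawn, the cancellation below would divide by zero; it
    remains valid because the numerator vanishes as well.\<close>
  have Pz: "P n = 0" if "Dr n i \<omega> * Dr n j \<omega> = 0" for n
  proof -
    have "Dr n i \<omega> = 0 \<or> Dr n j \<omega> = 0" using that by simp
    then have "\<forall>l<n. Xr l i \<omega> * Xr l j \<omega> = 0" unfolding Dr_eq by (auto simp: sum_nonneg_eq_0_iff)
    then show ?thesis unfolding P_def by (intro sum.neutral) auto
  qed
  have canc: "P n / sqrt (Dr n i \<omega> * Dr n j \<omega>) * (sqrt (Dr n i \<omega> * Dr n j \<omega>) / c) = P n / c" for n c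
    using Pz[of n] by (cases "Dr n i \<omega> * Dr n j \<omega> = 0") auto
  have P1': "(\<lambda>n. P n / sqrt (bn n i \<omega> * bn n j \<omega>)) \<longlonglongrightarrow> R" using P1 unfolding canc .
  have Pr: "(\<lambda>n. P (floor_sqrt n) / sqrt (Dr (floor_sqrt n) i \<omega> * Dr (floor_sqrt n) j \<omega>)) \<longlonglongrightarrow> R"
    by (rule filterlim_compose[OF P filterlim_floor_sqrt])
  have "(\<lambda>n. sqrt (Dr (floor_sqrt n) i \<omega> / bn n i \<omega>) * sqrt (Dr (floor_sqrt n) j \<omega> / bn n j \<omega>)) \<longlonglongrightarrow> sqrt 0 * sqrt 0"
    by (intro tendsto_mult tendsto_real_sqrt regular_drawn_bn(2)[OF \<omega>] ij)
  from tendsto_mult[OF Pr this]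
  have "(\<lambda>n. P (floor_sqrt n) / sqrt (Dr (floor_sqrt n) i \<omega> * Dr (floor_sqrt n) j \<omega>)
      * (sqrt (Dr (floor_sqrt n) i \<omega> * Dr (floor_sqrt n) j \<omega>) / sqrt (bn n i \<omega> * bn n j \<omega>))) \<longlonglongrightarrow> 0"
    by (simp add: sq)
  then have P2: "(\<lambda>n. P (floor_sqrt n) / sqrt (bn n i \<omega> * bn n j \<omega>)) \<longlonglongrightarrow> 0" unfolding canc .
  define w where "w n l = Xr l i \<omega> * Xr l j \<omega> / sqrt (bn n i \<omega> * bn n j \<omega>)" for n l
  have w0: "w n l \<ge> 0" for n l unfolding w_def using b[of n] by simp
  have "(\<Sum>l\<in>{floor_sqrt n..<n}. w n l) = P n / sqrt (bn n i \<omega> * bn n j \<omega>) - P (floor_sqrt n) / sqrt (bn n i \<omega> * bn n j \<omega>)" for n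
  proof -
    have "(\<Sum>l<n. Xr l i \<omega> * Xr l j \<omega>) = P (floor_sqrt n) + (\<Sum>l\<in>{floor_sqrt n..<n}. Xr l i \<omega> * Xr l j \<omega>)"
      unfolding P_def lessThan_atLeast0 by (rule sum.atLeastLessThan_concat[symmetric]) (auto intro: floor_sqrt_le)
    then have "(\<Sum>l\<in>{floor_sqrt n..<n}. Xr l i \<omega> * Xr l j \<omega>) = P n - P (floor_sqrt n)" by (simp add: P_def)
    then show ?thesis unfolding w_def sum_divide_distrib[symmetric] by (simp add: diff_divide_distrib)
  qed
  then have w1: "(\<lambda>n. \<Sum>l\<in>{floor_sqrt n..<n}. w n l) \<longlonglongrightarrow> R"
    using tendsto_diff[OF P1' P2] by simp
  have "(\<lambda>l. cov l i j - (qq i j - m i * m j)) \<longlonglongrightarrow> 0" using cov_lim[OF ij] by (simp add: LIM_zero_iff)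
  from tendsto_add[OF tail_weighted_null[where w=w, OF this w0 filterlim_floor_sqrt w1] tendsto_mult_left[OF w1, of "qq i j - m i * m j"]]
  have "(\<lambda>n. \<Sum>l\<in>{floor_sqrt n..<n}. cov l i j * w n l) \<longlonglongrightarrow> (qq i j - m i * m j) * R"
    by (simp add: left_diff_distrib sum_subtractf sum_distrib_left)
  then show ?thesis by (simp add: gam_def w_def Sg_def R_def)
qed

text \<open>The truncated sums are at most the sum over k of D_k / bn_k, whose limit is
  \<open>d\<close>; this is the origin of the threshold \<open>d + 1\<close>.\<close>

lemma regular_truncation_inactive:
  assumes \<omega>: "regular \<omega>"
  shows "\<forall>\<^sub>F n in sequentially. \<forall>l\<in>{floor_sqrt n..<n}. In n l \<omega> = 1"
proof -
  have g: "good \<omega>" by (rule regular_good[OF \<omega>])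
  have "(\<lambda>n. \<Sum>k=1..d. Dr n k \<omega> / bn n k \<omega>) \<longlonglongrightarrow> (\<Sum>k=1..d. 1)"
    by (intro tendsto_sum regular_drawn_bn(1)[OF \<omega>])
  then have "(\<lambda>n. \<Sum>k=1..d. Dr n k \<omega> / bn n k \<omega>) \<longlonglongrightarrow> real d" by simp
  from order_tendstoD(2)[OF this, of "real d + 1"]
  have "\<forall>\<^sub>F n in sequentially. (\<Sum>k=1..d. Dr n k \<omega> / bn n k \<omega>) < real d + 1" by simp
  then show ?thesis
  proof eventually_elim
    case (elim n)
    show ?case
    proof
      fix l assume l: "l \<in> {floor_sqrt n..<n}"
      have "(\<Sum>i\<in>{floor_sqrt n..l}. cn n i \<omega>) \<le> (\<Sum>i<n. cn n i \<omega>)"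
        using l by (intro sum_mono2) (auto intro: cn_nonneg)
      also have "\<dots> = (\<Sum>k=1..d. \<Sum>i<n. Xm i k \<omega> / bn n k \<omega>)"
        unfolding cn_def by (rule sum.swap)
      also have "\<dots> = (\<Sum>k=1..d. Dr n k \<omega> / bn n k \<omega>)"
        by (intro sum.cong refl) (simp add: good_Xm[OF g] Dr_eq sum_divide_distrib)
      finally show "In n l \<omega> = 1" using elim by (simp add: In_def)
    qed
  qed
qed

lemma regular_vn:
  assumes \<omega>: "regular \<omega>"
  shows "(\<lambda>n. vn u n \<omega>) \<longlonglongrightarrow> (\<Sum>i=1..d. \<Sum>j=1..d. u i * Sg i j \<omega> * u j)"
proof -
  have g: "good \<omega>" by (rule regular_good[OF \<omega>])
  have "(\<lambda>n. \<Sum>i=1..d. \<Sum>j=1..d. u i * gam n i j \<omega> * u j) \<longlonglongrightarrow> (\<Sum>i=1..d. \<Sum>j=1..d. u i * Sg i j \<omega> * u j)"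
    by (intro tendsto_sum tendsto_mult tendsto_const regular_gam[OF \<omega>])
  then show ?thesis
  proof (rule Lim_transform_eventually)
    show "\<forall>\<^sub>F n in sequentially. (\<Sum>i=1..d. \<Sum>j=1..d. u i * gam n i j \<omega> * u j) = vn u n \<omega>"
      using regular_truncation_inactive[OF \<omega>]
    proof eventually_elim
      case (elim n)
      have "vn u n \<omega> = (\<Sum>l\<in>{floor_sqrt n..<n}. \<Sum>i=1..d. \<Sum>j=1..d.
          u i * (cov l i j * (Xr l i \<omega> * Xr l j \<omega> / sqrt (bn n i \<omega> * bn n j \<omega>))) * u j)"
        unfolding vn_def quad_def
      proof (intro sum.cong refl)
        fix l i j assume "l \<in> {floor_sqrt n..<n}" "i \<in> {1..d}" "j \<in> {1..d}"
        then show "xs u n l i \<omega> * xs u n l j \<omega> * cov l i j = u i * (cov l i j * (Xr l i \<omega> * Xr l j \<omega> / sqrt (bn n i \<omega> * bn n j \<omega>))) * u j"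
          using elim by (simp add: xs_def good_Xm[OF g] real_sqrt_mult)
      qed
      also have "\<dots> = (\<Sum>i=1..d. \<Sum>l\<in>{floor_sqrt n..<n}. \<Sum>j=1..d.
          u i * (cov l i j * (Xr l i \<omega> * Xr l j \<omega> / sqrt (bn n i \<omega> * bn n j \<omega>))) * u j)"
        by (rule sum.swap)
      also have "\<dots> = (\<Sum>i=1..d. \<Sum>j=1..d. \<Sum>l\<in>{floor_sqrt n..<n}.
          u i * (cov l i j * (Xr l i \<omega> * Xr l j \<omega> / sqrt (bn n i \<omega> * bn n j \<omega>))) * u j)"
        by (intro sum.cong refl sum.swap)
      also have "\<dots> = (\<Sum>i=1..d. \<Sum>j=1..d. u i * gam n i j \<omega> * u j)"
        by (simp add: gam_def sum_distrib_left sum_distrib_right)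
      finally show ?case ..
    qed
  qed
qed

text \<open>The quadratic form is a limit of conditional variances, so positive semidefiniteness
  requires no inspection of the matrix.\<close>

lemma regular_Sg_psd: "regular \<omega> \<Longrightarrow> 0 \<le> (\<Sum>i=1..d. \<Sum>j=1..d. u i * Sg i j \<omega> * u j)"
  by (rule LIMSEQ_le_const[OF regular_vn]) (auto intro: vn_nonneg)

section \<open>Stable convergence of the estimators\<close>

text \<open>Orthogonality of martingale increments: the mixed term vanishes because
  \<open>Ac j k\<close> is centred and independent of \<open>urn_K j\<close>.\<close>

lemma replacement_sum_second_moment:
  assumes k: "k \<in> {1..d}" and rn: "r \<le> n"
    and y: "\<And>l. l \<in> {r..<n} \<Longrightarrow> y l \<in> borel_measurable (urn_K l)" "\<And>l \<omega>. l \<in> {r..<n} \<Longrightarrow> \<bar>y l \<omega>\<bar> \<le> B"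
  shows "integrable M (\<lambda>\<omega>. (\<Sum>l\<in>{r..<n}. y l \<omega> * Ac l k \<omega>)\<^sup>2)"
    and "(\<integral>\<omega>. (\<Sum>l\<in>{r..<n}. y l \<omega> * Ac l k \<omega>)\<^sup>2 \<partial>M) \<le> C2 * (\<Sum>l\<in>{r..<n}. \<integral>\<omega>. (y l \<omega>)\<^sup>2 \<partial>M)"
proof -
  note KM = measurable_from_subalg[OF subalgebra_K]
  define P where "P j \<omega> = (\<Sum>l\<in>{r..<j}. y l \<omega> * Ac l k \<omega>)" for j \<omega>
  have PF: "P j \<in> borel_measurable (FF j)" if "j \<le> n" for j
    unfolding P_def
  proof (intro borel_measurable_sum borel_measurable_times)
    fix l assume l: "l \<in> {r..<j}"
    show "y l \<in> borel_measurable (FF j)"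
      by (rule measurable_from_subalg[OF subalgebra_F_mono measurable_from_subalg[OF subalgebra_F_K y(1)]])
        (use l that in auto)
    show "Ac l k \<in> borel_measurable (FF j)" by (rule Ac_measurable_F[OF _ k]) (use l in auto)
  qed
  have "integrable M (\<lambda>\<omega>. (P j \<omega>)\<^sup>2) \<and> (\<integral>\<omega>. (P j \<omega>)\<^sup>2 \<partial>M) \<le> C2 * (\<Sum>l\<in>{r..<j}. \<integral>\<omega>. (y l \<omega>)\<^sup>2 \<partial>M)"
    if "r \<le> j" "j \<le> n" for j
    using that
  proof (induction j rule: dec_induct)
    case base
    then show ?case by (simp add: P_def)
  next
    case (step j)
    have j: "j \<in> {r..<n}" using step by auto
    have IH: "integrable M (\<lambda>\<omega>. (P j \<omega>)\<^sup>2)"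
      "(\<integral>\<omega>. (P j \<omega>)\<^sup>2 \<partial>M) \<le> C2 * (\<Sum>l\<in>{r..<j}. \<integral>\<omega>. (y l \<omega>)\<^sup>2 \<partial>M)" using step by auto
    have PK: "P j \<in> borel_measurable (urn_K j)" by (rule measurable_K_of_F[OF PF]) (use step in simp)
    have yM: "y j \<in> borel_measurable M" by (rule KM[OF y(1)[OF j]])
    have Pi: "integrable M (P j)" by (rule square_integrable_imp_integrable[OF KM[OF PK] IH(1)])
    have Py: "integrable M (\<lambda>\<omega>. P j \<omega> * y j \<omega>)"
      by (rule integrable_mult_AE_bounded[OF Pi yM, of B]) (use y(2)[OF j] in auto)
    have y2: "integrable M (\<lambda>\<omega>. (y j \<omega>)\<^sup>2)"
    proof (rule integrable_AE_bounded[where B="B\<^sup>2"])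
      show "AE \<omega> in M. \<bar>(y j \<omega>)\<^sup>2\<bar> \<le> B\<^sup>2"
        using power_mono[OF y(2)[OF j], of _ 2] by (intro AE_I2) simp
    qed (use yM in measurable)
    have PyK: "(\<lambda>\<omega>. P j \<omega> * y j \<omega>) \<in> borel_measurable (urn_K j)"
      by (intro borel_measurable_times PK y(1)[OF j])
    have y2K: "(\<lambda>\<omega>. (y j \<omega>)\<^sup>2) \<in> borel_measurable (urn_K j)"
      by (intro borel_measurable_power y(1)[OF j])
    have A2g: "(\<lambda>\<omega>. (Ac j k \<omega>)\<^sup>2) \<in> borel_measurable (sigma_gen M {A (Suc j) k | k. k \<in> {1..d}})"
      by (intro borel_measurable_power Ac_measurable_self k)
    note c1 = A_independent[OF PyK Py Ac_measurable_self[OF k] Ac_moments(1)[OF k]]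
    note c2 = A_independent[OF y2K y2 A2g Ac_moments(2)[OF k]]
    have eq: "(P (Suc j) \<omega>)\<^sup>2 = (P j \<omega>)\<^sup>2 + 2 * (P j \<omega> * y j \<omega> * Ac j k \<omega>) + (y j \<omega>)\<^sup>2 * (Ac j k \<omega>)\<^sup>2" for \<omega>
      using step.hyps by (simp add: P_def power2_sum power_mult_distrib mult.assoc)
    have "(\<integral>\<omega>. (P (Suc j) \<omega>)\<^sup>2 \<partial>M) = (\<integral>\<omega>. (P j \<omega>)\<^sup>2 \<partial>M) + (\<integral>\<omega>. (y j \<omega>)\<^sup>2 \<partial>M) * (\<integral>\<omega>. (Ac j k \<omega>)\<^sup>2 \<partial>M)"
      unfolding eq using IH(1) c1 c2 Ac_moments(3)[OF k, of j] by simp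
    also have "\<dots> \<le> C2 * (\<Sum>l\<in>{r..<j}. \<integral>\<omega>. (y l \<omega>)\<^sup>2 \<partial>M) + (\<integral>\<omega>. (y j \<omega>)\<^sup>2 \<partial>M) * C2"
      by (intro add_mono IH(2) mult_left_mono Ac_moments(4)[OF k]) simp
    also have "\<dots> = C2 * (\<Sum>l\<in>{r..<Suc j}. \<integral>\<omega>. (y l \<omega>)\<^sup>2 \<partial>M)"
      using step.hyps by (simp add: distrib_left mult.commute)
    finally have "(\<integral>\<omega>. (P (Suc j) \<omega>)\<^sup>2 \<partial>M) \<le> C2 * (\<Sum>l\<in>{r..<Suc j}. \<integral>\<omega>. (y l \<omega>)\<^sup>2 \<partial>M)" .
    moreover have "integrable M (\<lambda>\<omega>. (P (Suc j) \<omega>)\<^sup>2)"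
      unfolding eq using IH(1) c1(2) c2(2) by simp
    ultimately show ?case by simp
  qed
  from this[OF rn order_refl]
  show "integrable M (\<lambda>\<omega>. (\<Sum>l\<in>{r..<n}. y l \<omega> * Ac l k \<omega>)\<^sup>2)"
    "(\<integral>\<omega>. (\<Sum>l\<in>{r..<n}. y l \<omega> * Ac l k \<omega>)\<^sup>2 \<partial>M) \<le> C2 * (\<Sum>l\<in>{r..<n}. \<integral>\<omega>. (y l \<omega>)\<^sup>2 \<partial>M)"
    by (auto simp: P_def)
qed

section \<open>Comparison of the estimators with the normalised martingale\<close>

definition Mt :: "nat \<Rightarrow> nat \<Rightarrow> 'w \<Rightarrow> real" where
  "Mt n k \<omega> = (\<Sum>l\<in>{floor_sqrt n..<n}. xs (\<lambda>_. 1) n l k \<omega> * Ac l k \<omega>)"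

lemma Mt_measurable [measurable]: "k \<in> {1..d} \<Longrightarrow> Mt n k \<in> borel_measurable M"
  unfolding Mt_def[abs_def] by (intro borel_measurable_sum borel_measurable_times xs_measurable_M Ac_measurable)

lemma W_eq_Mt: "W u n \<omega> = (\<Sum>k=1..d. u k * Mt n k \<omega>)"
proof -
  have "W u n \<omega> = (\<Sum>k=1..d. \<Sum>l\<in>{floor_sqrt n..<n}. xs u n l k \<omega> * Ac l k \<omega>)"
    unfolding W_def by (rule sum.swap)
  also have "\<dots> = (\<Sum>k=1..d. u k * Mt n k \<omega>)"
    unfolding Mt_def sum_distrib_left by (intro sum.cong refl) (simp add: xs_def)
  finally show ?thesis .
qed

text \<open>A bound uniform in \<open>n\<close>, as needed when \<open>Mt\<close> plays the part of
  \<open>p\<close> in \<open>iexp_difference_vanishes\<close>.\<close>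

lemma Mt_second_moment:
  assumes k: "k \<in> {1..d}"
  shows "integrable M (\<lambda>\<omega>. (Mt n k \<omega>)\<^sup>2)" "(\<integral>\<omega>. (Mt n k \<omega>)\<^sup>2 \<partial>M) \<le> C2 * (real C1 * (real d + 1))"
proof -
  have y: "xs (\<lambda>_. 1) n l k \<in> borel_measurable (urn_K l)" "\<bar>xs (\<lambda>_. 1) n l k \<omega>\<bar> \<le> eps 1 n"
    if "l \<in> {floor_sqrt n..<n}" for l \<omega>
    by (rule xs_measurable) (use that k in auto, rule xs_bound[OF k], simp)
  have int: "integrable M (\<lambda>\<omega>. (\<Sum>l\<in>{floor_sqrt n..<n}. xs (\<lambda>_. 1) n l k \<omega> * Ac l k \<omega>)\<^sup>2)"
    and le: "(\<integral>\<omega>. (\<Sum>l\<in>{floor_sqrt n..<n}. xs (\<lambda>_. 1) n l k \<omega> * Ac l k \<omega>)\<^sup>2 \<partial>M)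
      \<le> C2 * (\<Sum>l\<in>{floor_sqrt n..<n}. \<integral>\<omega>. (xs (\<lambda>_. 1) n l k \<omega>)\<^sup>2 \<partial>M)"
    by (rule replacement_sum_second_moment[OF k floor_sqrt_le]; fact y)+
  have xi: "integrable M (\<lambda>\<omega>. (xs (\<lambda>_. 1) n l j \<omega>)\<^sup>2)" if "l \<in> {floor_sqrt n..<n}" "j \<in> {1..d}" for l j
  proof (rule integrable_AE_bounded[where B="(eps 1 n)\<^sup>2"])
    have "\<bar>xs (\<lambda>_. 1) n l j \<omega>\<bar> \<le> eps 1 n" for \<omega> by (rule xs_bound[OF that(2)]) simp
    from power_mono[OF this, where n=2] show "AE \<omega> in M. \<bar>(xs (\<lambda>_. 1) n l j \<omega>)\<^sup>2\<bar> \<le> (eps 1 n)\<^sup>2"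
      by (intro AE_I2) simp
  qed (use xs_measurable_M[OF that] in measurable)
  have "(\<Sum>l\<in>{floor_sqrt n..<n}. \<integral>\<omega>. (xs (\<lambda>_. 1) n l k \<omega>)\<^sup>2 \<partial>M)
      = (\<integral>\<omega>. (\<Sum>l\<in>{floor_sqrt n..<n}. (xs (\<lambda>_. 1) n l k \<omega>)\<^sup>2) \<partial>M)"
    using xi k by (intro Bochner_Integration.integral_sum[symmetric]) auto
  also have "\<dots> \<le> (\<integral>\<omega>. real C1 * (real d + 1) \<partial>M)"
  proof (rule integral_mono)
    fix \<omega>
    have "(\<Sum>l\<in>{floor_sqrt n..<n}. (xs (\<lambda>_. 1) n l k \<omega>)\<^sup>2) \<le> (\<Sum>l\<in>{floor_sqrt n..<n}. \<Sum>k=1..d. (xs (\<lambda>_. 1) n l k \<omega>)\<^sup>2)"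
      by (intro sum_mono member_le_sum[OF k, of "\<lambda>k. (xs (\<lambda>_. 1) n _ k \<omega>)\<^sup>2"]) auto
    also have "\<dots> \<le> 1\<^sup>2 * real C1 * (real d + 1)" by (rule xs_sum) simp
    finally show "(\<Sum>l\<in>{floor_sqrt n..<n}. (xs (\<lambda>_. 1) n l k \<omega>)\<^sup>2) \<le> real C1 * (real d + 1)" by simp
  qed (use xi k in auto)
  also have "\<dots> = real C1 * (real d + 1)" by (simp add: prob_space)
  finally have "C2 * (\<Sum>l\<in>{floor_sqrt n..<n}. \<integral>\<omega>. (xs (\<lambda>_. 1) n l k \<omega>)\<^sup>2 \<partial>M) \<le> C2 * (real C1 * (real d + 1))"
    using C2_ge_1 by (intro mult_left_mono) auto
  with int le show "integrable M (\<lambda>\<omega>. (Mt n k \<omega>)\<^sup>2)" "(\<integral>\<omega>. (Mt n k \<omega>)\<^sup>2 \<partial>M) \<le> C2 * (real C1 * (real d + 1))"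
    by (auto simp: Mt_def)
qed

definition V :: "nat \<Rightarrow> nat \<Rightarrow> 'w \<Rightarrow> real" where
  "V n k \<omega> = sqrt (Dr n k \<omega>) * (urn_mhat X A n k \<omega> - m k)"

lemma V_eq:
  "V n k \<omega> = (\<Sum>l<n. Ac l k \<omega> * Xr l k \<omega>) / sqrt (Dr n k \<omega>) + (\<Sum>l<n. (mu l k - m k) * Xr l k \<omega>) / sqrt (Dr n k \<omega>)"
proof (cases "Dr n k \<omega> = 0")
  \<comment> \<open>Before the first draw of colour \<open>k\<close> both sides are 0, by
    \<open>sqrt 0 = 0\<close> and division by zero.\<close>
  case True
  then show ?thesis by (simp add: V_def)
next
  case False
  then have D: "Dr n k \<omega> > 0" by simp
  have "urn_mhat X A n k \<omega> = (\<Sum>l<n. Ar l k \<omega> * Xr l k \<omega>) / Dr n k \<omega>"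
    by (simp add: urn_mhat_def sum.atLeast1_atMost_eq)
  moreover have "(\<Sum>l<n. Ar l k \<omega> * Xr l k \<omega>) = (\<Sum>l<n. Ac l k \<omega> * Xr l k \<omega>) + (\<Sum>l<n. (mu l k - m k) * Xr l k \<omega>) + m k * Dr n k \<omega>"
    unfolding Dr_eq sum_distrib_left by (simp add: sum.distrib[symmetric] Ac_def algebra_simps)
  ultimately have "urn_mhat X A n k \<omega> - m k = ((\<Sum>l<n. Ac l k \<omega> * Xr l k \<omega>) + (\<Sum>l<n. (mu l k - m k) * Xr l k \<omega>)) / Dr n k \<omega>"
    using D by (simp add: add_divide_distrib)
  then have V: "V n k \<omega> = sqrt (Dr n k \<omega>) * (((\<Sum>l<n. Ac l k \<omega> * Xr l k \<omega>) + (\<Sum>l<n. (mu l k - m k) * Xr l k \<omega>)) / Dr n k \<omega>)"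
    unfolding V_def by (rule arg_cong)
  have s: "sqrt a * (s / a) = s / sqrt a" if "a > 0" for a s :: real
    using that by (simp add: real_div_sqrt field_simps)
  show ?thesis using V unfolding s[OF D] unfolding add_divide_distrib .
qed

lemma Dr_measurable [measurable]: "k \<in> {1..d} \<Longrightarrow> (\<lambda>\<omega>. Dr n k \<omega>) \<in> borel_measurable M"
  unfolding Dr_eq by measurable

lemma V_measurable [measurable]: "k \<in> {1..d} \<Longrightarrow> V n k \<in> borel_measurable M"
  unfolding V_eq[abs_def] by measurable

text \<open>Writing r for \<open>floor_sqrt n\<close>, the noise up to stage r is o(H_k) at that
  stage, and H_k is of order r^(ex k). Since r^2 is of order n, this is o(n^(ex k / 2)), and sqrt
  D_k at stage n is of exactly that order.\<close>

lemma regular_start_negligible: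
  assumes \<omega>: "regular \<omega>" and k: "k \<in> {1..d}"
  shows "(\<lambda>n. (\<Sum>l<floor_sqrt n. Ac l k \<omega> * Xr l k \<omega>) / sqrt (Dr n k \<omega>)) \<longlonglongrightarrow> 0"
proof -
  let ?r = floor_sqrt
  obtain w where w: "w > 0" "(\<lambda>n. Hr n k \<omega> / real (Suc n) powr ex k) \<longlonglongrightarrow> w"
    "(\<lambda>n. Dr n k \<omega> / real (Suc n) powr ex k) \<longlonglongrightarrow> w / m k"
    using regular_drawn_growth[OF \<omega> k] .
  have mk: "m k > 0" using m_ge_1[OF k] by simp
  have f: "(\<lambda>n. (\<Sum>l<?r n. Ac l k \<omega> * Xr l k \<omega>) / Hr (?r n) k \<omega> * (Hr (?r n) k \<omega> / real (Suc (?r n)) powr ex k)) \<longlonglongrightarrow> 0 * w"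
    by (intro tendsto_mult filterlim_compose[OF regular_noise_negligible[OF \<omega> k] filterlim_floor_sqrt]
      filterlim_compose[OF w(2) filterlim_floor_sqrt])
  define g where "g n = real (Suc (?r n)) powr ex k / real (Suc n) powr (ex k / 2)" for n
  have g0: "0 \<le> g n" for n by (simp add: g_def)
  \<comment> \<open>\<open>(floor_sqrt n + 1)\<^sup>2\<close> is at most \<open>2 * (n + 1)\<close>,
    and raising to the power \<open>ex k / 2 \<le> 1\<close> leaves at most the factor 2.\<close>
  have g2: "g n \<le> 2" for n
  proof -
    have "real (Suc (?r n)) powr ex k = ((real (Suc (?r n)))\<^sup>2) powr (ex k / 2)"
      by (simp add: powr_powr flip: powr_numeral)
    also have "\<dots> \<le> (2 * real (Suc n)) powr (ex k / 2)"
      using ex_bounds(1)[OF k] Suc_floor_sqrt_bounds(2) by (intro powr_mono2) auto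
    also have "\<dots> = 2 powr (ex k / 2) * real (Suc n) powr (ex k / 2)" by (simp add: powr_mult del: of_nat_Suc)
    also have "\<dots> \<le> 2 * real (Suc n) powr (ex k / 2)"
      using powr_mono[of "ex k / 2" 1 2] ex_bounds(2)[OF k] by (intro mult_right_mono) auto
    finally show ?thesis by (simp add: g_def divide_le_eq del: of_nat_Suc)
  qed
  have fg: "(\<lambda>n. (\<Sum>l<?r n. Ac l k \<omega> * Xr l k \<omega>) / Hr (?r n) k \<omega> * (Hr (?r n) k \<omega> / real (Suc (?r n)) powr ex k) * g n) \<longlonglongrightarrow> 0"
  proof (rule Lim_null_comparison)
    show "\<forall>\<^sub>F n in sequentially. norm ((\<Sum>l<?r n. Ac l k \<omega> * Xr l k \<omega>) / Hr (?r n) k \<omega> * (Hr (?r n) k \<omega> / real (Suc (?r n)) powr ex k) * g n)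
      \<le> \<bar>(\<Sum>l<?r n. Ac l k \<omega> * Xr l k \<omega>) / Hr (?r n) k \<omega> * (Hr (?r n) k \<omega> / real (Suc (?r n)) powr ex k)\<bar> * 2"
      using g0 g2 by (intro always_eventually allI) (auto simp only: real_norm_def abs_mult intro!: mult_left_mono; simp add: abs_of_nonneg)
    show "(\<lambda>n. \<bar>(\<Sum>l<?r n. Ac l k \<omega> * Xr l k \<omega>) / Hr (?r n) k \<omega> * (Hr (?r n) k \<omega> / real (Suc (?r n)) powr ex k)\<bar> * 2) \<longlonglongrightarrow> 0"
      using tendsto_mult[OF tendsto_rabs[OF f] tendsto_const[of 2]] by simp
  qed
  have "(\<lambda>n. sqrt (inverse (Dr n k \<omega> / real (Suc n) powr ex k))) \<longlonglongrightarrow> sqrt (inverse (w / m k))"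
    using w(1) mk by (intro tendsto_real_sqrt tendsto_inverse w(3)) auto
  from tendsto_mult[OF fg this]
  have "(\<lambda>n. (\<Sum>l<?r n. Ac l k \<omega> * Xr l k \<omega>) / Hr (?r n) k \<omega> * (Hr (?r n) k \<omega> / real (Suc (?r n)) powr ex k) * g n
      * sqrt (inverse (Dr n k \<omega> / real (Suc n) powr ex k))) \<longlonglongrightarrow> 0" by simp
  moreover have "(\<Sum>l<?r n. Ac l k \<omega> * Xr l k \<omega>) / Hr (?r n) k \<omega> * (Hr (?r n) k \<omega> / real (Suc (?r n)) powr ex k) * g n
      * sqrt (inverse (Dr n k \<omega> / real (Suc n) powr ex k)) = (\<Sum>l<?r n. Ac l k \<omega> * Xr l k \<omega>) / sqrt (Dr n k \<omega>)" for n
  proof -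
    have h: "s / h * (h / a) * (a / b) * (b / q) = s / q" if "h > 0" "a > 0" "b > 0" for s h a b q :: real
      using that by simp
    have "sqrt (inverse (Dr n k \<omega> / real (Suc n) powr ex k)) = real (Suc n) powr (ex k / 2) / sqrt (Dr n k \<omega>)"
      by (simp add: real_sqrt_divide powr_half_sqrt[symmetric] powr_powr del: of_nat_Suc)
    then show ?thesis unfolding g_def by (simp only:) (rule h, use Hr_pos[OF k] in auto)
  qed
  ultimately show ?thesis by simp
qed

lemma regular_bn_drawn:
  assumes \<omega>: "regular \<omega>" and k: "k \<in> {1..d}"
  shows "(\<lambda>n. sqrt (bn n k \<omega> / Dr n k \<omega>)) \<longlonglongrightarrow> 1"
  using tendsto_real_sqrt[OF tendsto_inverse[OF regular_drawn_bn(1)[OF \<omega> k]]] by simp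

text \<open>Once the truncation is inactive, the rescaled \<open>Mt\<close> is the noise from stage
  \<open>floor_sqrt n\<close> on; the difference from \<open>V\<close> consists of the earlier noise
  and the bias of the means.\<close>

lemma regular_remainder:
  assumes \<omega>: "regular \<omega>" and k: "k \<in> {1..d}"
  shows "(\<lambda>n. V n k \<omega> - Mt n k \<omega> * sqrt (bn n k \<omega> / Dr n k \<omega>)) \<longlonglongrightarrow> 0"
proof -
  have "(\<lambda>n. (\<Sum>l<floor_sqrt n. Ac l k \<omega> * Xr l k \<omega>) / sqrt (Dr n k \<omega>) + (\<Sum>l<n. (mu l k - m k) * Xr l k \<omega>) / sqrt (Dr n k \<omega>)) \<longlonglongrightarrow> 0 + 0"
    by (intro tendsto_add regular_start_negligible[OF \<omega> k] regular_bias_negligible[OF \<omega> k])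
  then have "(\<lambda>n. (\<Sum>l<floor_sqrt n. Ac l k \<omega> * Xr l k \<omega>) / sqrt (Dr n k \<omega>) + (\<Sum>l<n. (mu l k - m k) * Xr l k \<omega>) / sqrt (Dr n k \<omega>)) \<longlonglongrightarrow> 0" by simp
  then show ?thesis
  proof (rule Lim_transform_eventually)
    show "\<forall>\<^sub>F n in sequentially. (\<Sum>l<floor_sqrt n. Ac l k \<omega> * Xr l k \<omega>) / sqrt (Dr n k \<omega>) + (\<Sum>l<n. (mu l k - m k) * Xr l k \<omega>) / sqrt (Dr n k \<omega>)
        = V n k \<omega> - Mt n k \<omega> * sqrt (bn n k \<omega> / Dr n k \<omega>)"
      using regular_truncation_inactive[OF \<omega>]
    proof eventually_elim
      case (elim n)
      have b: "bn n k \<omega> > 0" by (rule bn_pos[OF k])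
      have "Mt n k \<omega> = (\<Sum>l\<in>{floor_sqrt n..<n}. Ac l k \<omega> * Xr l k \<omega>) / sqrt (bn n k \<omega>)"
        unfolding Mt_def sum_divide_distrib using elim
        by (intro sum.cong refl) (simp add: xs_def good_Xm[OF regular_good[OF \<omega>] k])
      then have "Mt n k \<omega> * sqrt (bn n k \<omega> / Dr n k \<omega>) = (\<Sum>l\<in>{floor_sqrt n..<n}. Ac l k \<omega> * Xr l k \<omega>) / sqrt (Dr n k \<omega>)"
        using b by (simp add: real_sqrt_divide)
      moreover have "(\<Sum>l<n. Ac l k \<omega> * Xr l k \<omega>) = (\<Sum>l<floor_sqrt n. Ac l k \<omega> * Xr l k \<omega>) + (\<Sum>l\<in>{floor_sqrt n..<n}. Ac l k \<omega> * Xr l k \<omega>)"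
        unfolding lessThan_atLeast0 by (rule sum.atLeastLessThan_concat[symmetric]) (auto intro: floor_sqrt_le)
      ultimately show ?case unfolding V_eq by (simp add: add_divide_distrib)
    qed
  qed
qed

section \<open>The limiting covariance matrix and the characteristic functions\<close>

lemma Zl_measurable [measurable]: "k \<in> {1..d} \<Longrightarrow> Zl k \<in> borel_measurable M"
  unfolding urn_Zlim_def[abs_def] urn_Z_def by measurable

lemma qq_diag: "k \<in> {1..d} \<Longrightarrow> qq k k = q k"
  using LIMSEQ_unique[OF M_mix M_sq[unfolded power2_eq_square]] .

lemma qq_sym: "i \<in> {1..d} \<Longrightarrow> j \<in> {1..d} \<Longrightarrow> qq i j = qq j i"
proof -
  assume ij: "i \<in> {1..d}" "j \<in> {1..d}"
  have "(\<lambda>n. \<integral>\<omega>. real (A n j \<omega>) * real (A n i \<omega>) \<partial>M) \<longlonglongrightarrow> qq i j"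
    using M_mix[OF ij] by (subst mult.commute)
  then show ?thesis by (rule LIMSEQ_unique[OF _ M_mix[OF ij(2,1)]])
qed

abbreviation \<Sigma>l where
  "\<Sigma>l \<equiv> urn_Sigma t (\<lambda>k. q k - (m k)\<^sup>2) (\<lambda>i j. qq i j - m i * m j) Zl NN Q"

lemma \<Sigma>l_measurable [measurable]: "i \<in> {1..d} \<Longrightarrow> j \<in> {1..d} \<Longrightarrow> \<Sigma>l i j \<in> borel_measurable M"
  unfolding urn_Sigma_def[abs_def] by measurable

lemma regular_\<Sigma>l:
  assumes \<omega>: "regular \<omega>" and ij: "i \<in> {1..d}" "j \<in> {1..d}"
  shows "\<Sigma>l i j \<omega> = Sg i j \<omega>"
proof (cases "i = j")
  case True
  have "sqrt (Zl i \<omega> * Zl i \<omega>) = Zl i \<omega>" using regular_Z_nonneg[OF \<omega> ij(1)] by simp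
  then show ?thesis
    using True regular_Z(3)[OF \<omega> ij(1)] qq_diag[OF ij(1)]
    by (cases "i \<le> t") (auto simp: urn_Sigma_def Sg_def power2_eq_square)
next
  case False
  then show ?thesis
    using regular_Z(3)[OF \<omega> ij(1)] regular_Z(3)[OF \<omega> ij(2)]
    by (cases "i \<le> t"; cases "j \<le> t") (auto simp: urn_Sigma_def Sg_def)
qed

lemma regular_\<Sigma>l_quadratic:
  assumes \<omega>: "regular \<omega>"
  shows "(\<Sum>i=1..d. \<Sum>j=1..d. u i * \<Sigma>l i j \<omega> * u j) = (\<Sum>i=1..d. \<Sum>j=1..d. u i * Sg i j \<omega> * u j)"
  by (intro sum.cong refl) (simp add: regular_\<Sigma>l[OF \<omega>])

text \<open>Three replacements: the estimators by the martingale \<open>W\<close> inside the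
  exponential; then \<open>iexp W\<close>, which is \<open>TT\<close> times exp(-vn/2), by
  \<open>TT\<close> times exp(-\<eta>/2), at a cost controlled by dominated convergence; finally
  \<open>TT\<close> by 1, by its weak limit tested against the indicator of \<open>B\<close> times
  exp(-\<eta>/2).\<close>

lemma characteristic_function_limit:
  assumes B [measurable]: "B \<in> sets M"
  shows "(\<lambda>n. LINT \<omega>:B|M. iexp (\<Sum>k=1..d. u k * V n k \<omega>)) \<longlonglongrightarrow>
    complex_of_real (LINT \<omega>:B|M. exp (- (\<Sum>i=1..d. \<Sum>j=1..d. u i * \<Sigma>l i j \<omega> * u j) / 2))"
proof -
  define U where "U = (\<Sum>k=1..d. \<bar>u k\<bar>)"
  have U: "\<bar>u k\<bar> \<le> U" if "k \<in> {1..d}" for k unfolding U_def by (rule member_le_sum[OF that]) auto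
  have U0: "0 \<le> U" unfolding U_def by (simp add: sum_nonneg)
  \<comment> \<open>The quadratic form is nonnegative only almost surely; the maximum makes
    exp(-\<eta>/2) bounded by 1 at every point, as \<open>TT_weak_limit\<close> requires.\<close>
  define \<eta> where "\<eta> \<omega> = max 0 (\<Sum>i=1..d. \<Sum>j=1..d. u i * \<Sigma>l i j \<omega> * u j)" for \<omega>
  have \<eta>M [measurable]: "\<eta> \<in> borel_measurable M" unfolding \<eta>_def[abs_def] by measurable
  have \<eta>0: "\<eta> \<omega> \<ge> 0" for \<omega> by (simp add: \<eta>_def)
  have \<eta>: "AE \<omega> in M. \<eta> \<omega> = (\<Sum>i=1..d. \<Sum>j=1..d. u i * \<Sigma>l i j \<omega> * u j)"
    using AE_regular
  proof eventually_elim
    case (elim \<omega>)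
    show ?case unfolding \<eta>_def regular_\<Sigma>l_quadratic[OF elim] using regular_Sg_psd[OF elim, of u] by simp
  qed
  obtain n0 E where "\<And>n. n \<ge> n0 \<Longrightarrow> TT u n \<in> borel_measurable (FF n)"
    and TE: "\<And>n \<omega>. n \<ge> n0 \<Longrightarrow> cmod (TT u n \<omega>) \<le> E"
    and "\<And>m h G. h \<in> borel_measurable (FF m) \<Longrightarrow> (\<And>\<omega>. \<bar>h \<omega>\<bar> \<le> G) \<Longrightarrow>
      (\<lambda>n. \<integral>\<omega>. complex_of_real (h \<omega>) * TT u n \<omega> \<partial>M) \<longlonglongrightarrow> complex_of_real (\<integral>\<omega>. h \<omega> \<partial>M)"
    using TT_properties[where u=u and U=U, OF U U0] by blast
  have E0: "E \<ge> 0" using TE[OF order_refl, of undefined] norm_ge_zero order_trans by blast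
  define a where "a n \<omega> = (\<Sum>k=1..d. u k * V n k \<omega>)" for n \<omega>
  have aM [measurable]: "a n \<in> borel_measurable M" for n unfolding a_def[abs_def] by measurable
  define iB :: "'w \<Rightarrow> real" where "iB = indicator B"
  have iBM [measurable]: "iB \<in> borel_measurable M" unfolding iB_def by measurable
  have iB: "0 \<le> iB \<omega>" "iB \<omega> \<le> 1" for \<omega> by (auto simp: iB_def indicator_def)
  \<comment> \<open>\<open>V\<close> is \<open>Mt\<close> times \<open>sqrt (bn / Dr)\<close> plus a
    null remainder, so its difference from \<open>Mt\<close> is \<open>Mt\<close> times a null
    factor plus that remainder.\<close>
  define z where "z n k \<omega> = u k * (sqrt (bn n k \<omega> / Dr n k \<omega>) - 1)" for n k \<omega>
  define e where "e n \<omega> = (\<Sum>k=1..d. u k * (V n k \<omega> - Mt n k \<omega> * sqrt (bn n k \<omega> / Dr n k \<omega>)))" for n \<omega>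
  have 1: "(\<lambda>n. \<integral>\<omega>. cmod (iexp (a n \<omega>) - iexp (W u n \<omega>)) \<partial>M) \<longlonglongrightarrow> 0"
  proof (rule iexp_difference_vanishes[where I="{1..d}" and p=Mt and z=z and e=e and C="C2 * (real C1 * (real d + 1))"])
    show "e n \<in> borel_measurable M" for n unfolding e_def[abs_def] by measurable
    show "z n k \<in> borel_measurable M" if "k \<in> {1..d}" for n k unfolding z_def[abs_def] using that by measurable
    show "a n \<omega> - W u n \<omega> = (\<Sum>k\<in>{1..d}. Mt n k \<omega> * z n k \<omega>) + e n \<omega>" for n \<omega>
      unfolding a_def W_eq_Mt z_def e_def by (simp add: sum_subtractf[symmetric] sum.distrib[symmetric] algebra_simps)
    show "AE \<omega> in M. (\<lambda>n. z n k \<omega>) \<longlonglongrightarrow> 0" if "k \<in> {1..d}" for k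
      using AE_regular
    proof eventually_elim
      case (elim \<omega>)
      from tendsto_mult[OF tendsto_const[of "u k"] tendsto_diff[OF regular_bn_drawn[OF elim that] tendsto_const[of 1]]]
      show ?case by (simp add: z_def)
    qed
    show "AE \<omega> in M. (\<lambda>n. e n \<omega>) \<longlonglongrightarrow> 0"
      using AE_regular
    proof eventually_elim
      case (elim \<omega>)
      have "(\<lambda>n. e n \<omega>) \<longlonglongrightarrow> (\<Sum>k=1..d. u k * 0)"
        unfolding e_def by (intro tendsto_sum tendsto_mult tendsto_const regular_remainder[OF elim])
      then show ?case by simp
    qed
  qed (use Mt_second_moment in auto)
  have iexp_int: "integrable M (\<lambda>\<omega>. complex_of_real (iB \<omega>) * iexp (f \<omega>))" if [measurable]: "f \<in> borel_measurable M" for f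
    by (rule integrable_const_bound[where B=1]) (use iB in \<open>auto simp: norm_mult\<close>)
  have 2: "(\<lambda>n. (\<integral>\<omega>. complex_of_real (iB \<omega>) * iexp (a n \<omega>) \<partial>M) - (\<integral>\<omega>. complex_of_real (iB \<omega>) * iexp (W u n \<omega>) \<partial>M)) \<longlonglongrightarrow> 0"
  proof (rule Lim_null_comparison[OF _ 1])
    show "\<forall>\<^sub>F n in sequentially. norm ((\<integral>\<omega>. complex_of_real (iB \<omega>) * iexp (a n \<omega>) \<partial>M) - (\<integral>\<omega>. complex_of_real (iB \<omega>) * iexp (W u n \<omega>) \<partial>M))
      \<le> (\<integral>\<omega>. cmod (iexp (a n \<omega>) - iexp (W u n \<omega>)) \<partial>M)"
    proof (intro always_eventually allI)
      fix n
      have eq: "(\<integral>\<omega>. complex_of_real (iB \<omega>) * iexp (a n \<omega>) \<partial>M) - (\<integral>\<omega>. complex_of_real (iB \<omega>) * iexp (W u n \<omega>) \<partial>M)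
          = (\<integral>\<omega>. complex_of_real (iB \<omega>) * (iexp (a n \<omega>) - iexp (W u n \<omega>)) \<partial>M)"
        using iexp_int[OF aM] iexp_int[OF W_measurable] by (simp add: right_diff_distrib)
      have "norm (\<integral>\<omega>. complex_of_real (iB \<omega>) * (iexp (a n \<omega>) - iexp (W u n \<omega>)) \<partial>M)
          \<le> (\<integral>\<omega>. norm (complex_of_real (iB \<omega>) * (iexp (a n \<omega>) - iexp (W u n \<omega>))) \<partial>M)"
        by (rule integral_norm_bound)
      also have "\<dots> \<le> (\<integral>\<omega>. cmod (iexp (a n \<omega>) - iexp (W u n \<omega>)) \<partial>M)"
      proof (rule integral_mono)
        have b2: "cmod (iexp x - iexp y) \<le> 2" for x y
          using norm_triangle_ineq4[of "iexp x" "iexp y"] by simp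
        show i: "integrable M (\<lambda>\<omega>. cmod (iexp (a n \<omega>) - iexp (W u n \<omega>)))"
          by (rule integrable_const_bound[where B=2]) (use b2 in auto)
        show le: "norm (complex_of_real (iB \<omega>) * (iexp (a n \<omega>) - iexp (W u n \<omega>))) \<le> cmod (iexp (a n \<omega>) - iexp (W u n \<omega>))" for \<omega>
          unfolding norm_mult norm_of_real using iB[of \<omega>] by (intro mult_left_le_one_le) auto
        show "integrable M (\<lambda>\<omega>. norm (complex_of_real (iB \<omega>) * (iexp (a n \<omega>) - iexp (W u n \<omega>))))"
          by (rule Bochner_Integration.integrable_bound[OF i]) (use le in auto)
      qed
      finally show "norm ((\<integral>\<omega>. complex_of_real (iB \<omega>) * iexp (a n \<omega>) \<partial>M) - (\<integral>\<omega>. complex_of_real (iB \<omega>) * iexp (W u n \<omega>) \<partial>M))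
        \<le> (\<integral>\<omega>. cmod (iexp (a n \<omega>) - iexp (W u n \<omega>)) \<partial>M)" unfolding eq .
    qed
  qed
  define g where "g \<omega> = iB \<omega> * exp (- \<eta> \<omega> / 2)" for \<omega>
  have gM [measurable]: "g \<in> borel_measurable M" unfolding g_def[abs_def] by measurable
  have gb: "\<bar>g \<omega>\<bar> \<le> 1" for \<omega>
    unfolding g_def abs_mult using iB[of \<omega>] \<eta>0[of \<omega>] by (intro mult_le_one) auto
  have 3: "(\<lambda>n. \<integral>\<omega>. complex_of_real (g \<omega>) * TT u n \<omega> \<partial>M) \<longlonglongrightarrow> complex_of_real (\<integral>\<omega>. g \<omega> \<partial>M)"
    by (rule TT_weak_limit[where u=u and U=U, OF U U0 gM gb])
  define \<delta> where "\<delta> n \<omega> = \<bar>exp (- vn u n \<omega> / 2) - exp (- \<eta> \<omega> / 2)\<bar>" for n \<omega>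
  have \<delta>M [measurable]: "\<delta> n \<in> borel_measurable M" for n unfolding \<delta>_def[abs_def] by measurable
  have \<delta>b: "\<bar>\<delta> n \<omega>\<bar> \<le> 1" for n \<omega>
  proof -
    have "0 < exp (- vn u n \<omega> / 2)" "exp (- vn u n \<omega> / 2) \<le> 1" "0 < exp (- \<eta> \<omega> / 2)" "exp (- \<eta> \<omega> / 2) \<le> 1"
      using vn_nonneg[of u n \<omega>] \<eta>0[of \<omega>] by auto
    then show ?thesis unfolding \<delta>_def by linarith
  qed
  have \<delta>i: "integrable M (\<delta> n)" for n by (rule integrable_const_bound[where B=1]) (use \<delta>b in auto)
  have "(\<lambda>n. \<integral>\<omega>. \<delta> n \<omega> \<partial>M) \<longlonglongrightarrow> (\<integral>\<omega>. 0 \<partial>M)"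
  proof (rule integral_dominated_convergence[where w="\<lambda>_. 1"])
    show "AE \<omega> in M. (\<lambda>n. \<delta> n \<omega>) \<longlonglongrightarrow> 0"
      using AE_regular \<eta>
    proof eventually_elim
      case (elim \<omega>)
      have "(\<lambda>n. vn u n \<omega>) \<longlonglongrightarrow> \<eta> \<omega>"
        unfolding elim(2) regular_\<Sigma>l_quadratic[OF elim(1)] by (rule regular_vn[OF elim(1)])
      then have "(\<lambda>n. \<delta> n \<omega>) \<longlonglongrightarrow> \<bar>exp (- \<eta> \<omega> / 2) - exp (- \<eta> \<omega> / 2)\<bar>"
        unfolding \<delta>_def by (intro tendsto_rabs tendsto_diff tendsto_exp tendsto_divide tendsto_minus tendsto_const) auto
      then show ?case by simp
    qed
  qed (use \<delta>b in auto)
  then have \<delta>0: "(\<lambda>n. E * (\<integral>\<omega>. \<delta> n \<omega> \<partial>M)) \<longlonglongrightarrow> 0"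
    using tendsto_mult[OF tendsto_const[of E]] by fastforce
  have 4: "(\<lambda>n. (\<integral>\<omega>. complex_of_real (iB \<omega>) * iexp (W u n \<omega>) \<partial>M) - (\<integral>\<omega>. complex_of_real (g \<omega>) * TT u n \<omega> \<partial>M)) \<longlonglongrightarrow> 0"
  proof (rule Lim_null_comparison[OF _ \<delta>0])
    show "\<forall>\<^sub>F n in sequentially. norm ((\<integral>\<omega>. complex_of_real (iB \<omega>) * iexp (W u n \<omega>) \<partial>M) - (\<integral>\<omega>. complex_of_real (g \<omega>) * TT u n \<omega> \<partial>M))
      \<le> E * (\<integral>\<omega>. \<delta> n \<omega> \<partial>M)"
      using eventually_ge_at_top[of n0]
    proof eventually_elim
      case (elim n)
      have gT: "integrable M (\<lambda>\<omega>. complex_of_real (g \<omega>) * TT u n \<omega>)"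
      proof (rule integrable_const_bound[where B="1 * E"])
        show "AE \<omega> in M. cmod (complex_of_real (g \<omega>) * TT u n \<omega>) \<le> 1 * E"
          unfolding norm_mult norm_of_real using gb TE[OF elim] by (intro AE_I2 mult_mono) auto
      qed measurable
      have W: "iexp (W u n \<omega>) = TT u n \<omega> * complex_of_real (exp (- vn u n \<omega> / 2))" for \<omega>
      proof -
        have "complex_of_real (exp (vn u n \<omega> / 2)) * complex_of_real (exp (- vn u n \<omega> / 2)) = 1"
          by (simp only: of_real_mult[symmetric] exp_add[symmetric]) simp
        then show ?thesis by (simp add: TT_def mult.assoc)
      qed
      have d: "complex_of_real (iB \<omega>) * iexp (W u n \<omega>) - complex_of_real (g \<omega>) * TT u n \<omega>
        = complex_of_real (iB \<omega>) * (TT u n \<omega> * complex_of_real (exp (- vn u n \<omega> / 2) - exp (- \<eta> \<omega> / 2)))" for \<omega>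
        unfolding W g_def by (simp add: algebra_simps)
      have db: "norm (complex_of_real (iB \<omega>) * (TT u n \<omega> * complex_of_real (exp (- vn u n \<omega> / 2) - exp (- \<eta> \<omega> / 2)))) \<le> 1 * (E * \<delta> n \<omega>)" for \<omega>
        unfolding norm_mult norm_of_real \<delta>_def using iB[of \<omega>] TE[OF elim, of \<omega>] E0 by (intro mult_mono) auto
      have eq: "(\<integral>\<omega>. complex_of_real (iB \<omega>) * iexp (W u n \<omega>) \<partial>M) - (\<integral>\<omega>. complex_of_real (g \<omega>) * TT u n \<omega> \<partial>M)
          = (\<integral>\<omega>. complex_of_real (iB \<omega>) * (TT u n \<omega> * complex_of_real (exp (- vn u n \<omega> / 2) - exp (- \<eta> \<omega> / 2))) \<partial>M)"
        unfolding d[symmetric] using gT iexp_int[OF W_measurable] by simp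
      have "norm (\<integral>\<omega>. complex_of_real (iB \<omega>) * (TT u n \<omega> * complex_of_real (exp (- vn u n \<omega> / 2) - exp (- \<eta> \<omega> / 2))) \<partial>M)
          \<le> (\<integral>\<omega>. norm (complex_of_real (iB \<omega>) * (TT u n \<omega> * complex_of_real (exp (- vn u n \<omega> / 2) - exp (- \<eta> \<omega> / 2)))) \<partial>M)"
        by (rule integral_norm_bound)
      also have "\<dots> \<le> (\<integral>\<omega>. 1 * (E * \<delta> n \<omega>) \<partial>M)"
      proof (rule integral_mono[OF _ _ db])
        show i: "integrable M (\<lambda>\<omega>. 1 * (E * \<delta> n \<omega>))" using \<delta>i by simp
        show "integrable M (\<lambda>\<omega>. norm (complex_of_real (iB \<omega>) * (TT u n \<omega> * complex_of_real (exp (- vn u n \<omega> / 2) - exp (- \<eta> \<omega> / 2)))))"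
          by (rule Bochner_Integration.integrable_bound[OF i]) (measurable, intro AE_I2, use order_trans[OF db abs_ge_self] in \<open>simp only: real_norm_def abs_norm_cancel\<close>)
      qed
      finally show ?case unfolding eq by simp
    qed
  qed
  have "(\<lambda>n. ((\<integral>\<omega>. complex_of_real (iB \<omega>) * iexp (a n \<omega>) \<partial>M) - (\<integral>\<omega>. complex_of_real (iB \<omega>) * iexp (W u n \<omega>) \<partial>M))
      + ((\<integral>\<omega>. complex_of_real (iB \<omega>) * iexp (W u n \<omega>) \<partial>M) - (\<integral>\<omega>. complex_of_real (g \<omega>) * TT u n \<omega> \<partial>M))
      + (\<integral>\<omega>. complex_of_real (g \<omega>) * TT u n \<omega> \<partial>M)) \<longlonglongrightarrow> 0 + 0 + complex_of_real (\<integral>\<omega>. g \<omega> \<partial>M)"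
    by (intro tendsto_add 2 3 4)
  then have "(\<lambda>n. \<integral>\<omega>. complex_of_real (iB \<omega>) * iexp (a n \<omega>) \<partial>M) \<longlonglongrightarrow> complex_of_real (\<integral>\<omega>. g \<omega> \<partial>M)" by simp
  moreover have "(\<integral>\<omega>. complex_of_real (iB \<omega>) * iexp (a n \<omega>) \<partial>M) = (LINT \<omega>:B|M. iexp (\<Sum>k=1..d. u k * V n k \<omega>))" for n
    unfolding set_lebesgue_integral_def iB_def a_def by (simp add: scaleR_conv_of_real)
  moreover have "(\<integral>\<omega>. g \<omega> \<partial>M) = (LINT \<omega>:B|M. exp (- (\<Sum>i=1..d. \<Sum>j=1..d. u i * \<Sigma>l i j \<omega> * u j) / 2))"
    unfolding set_lebesgue_integral_def
  proof (rule integral_cong_AE)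
    show "AE \<omega> in M. g \<omega> = indicator B \<omega> *\<^sub>R exp (- (\<Sum>i=1..d. \<Sum>j=1..d. u i * \<Sigma>l i j \<omega> * u j) / 2)"
      using \<eta> by eventually_elim (simp add: g_def iB_def)
  qed measurable
  ultimately show ?thesis by simp
qed

lemma V_stably_normal: "stably_normal M d V \<Sigma>l"
  unfolding stably_normal_def
proof (intro conjI allI ballI)
  show "V n k \<in> borel_measurable M" if "k \<in> {1..d}" for n k by (rule V_measurable[OF that])
  show "\<Sigma>l i j \<in> borel_measurable M" if "i \<in> {1..d}" "j \<in> {1..d}" for i j by (rule \<Sigma>l_measurable[OF that])
  show "AE \<omega> in M. (\<forall>i\<in>{1..d}. \<forall>j\<in>{1..d}. \<Sigma>l i j \<omega> = \<Sigma>l j i \<omega>) \<and>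
      (\<forall>u. 0 \<le> (\<Sum>i=1..d. \<Sum>j=1..d. u i * \<Sigma>l i j \<omega> * u j))"
    using AE_regular
  proof eventually_elim
    case (elim \<omega>)
    have "\<Sigma>l i j \<omega> = \<Sigma>l j i \<omega>" if "i \<in> {1..d}" "j \<in> {1..d}" for i j
      unfolding regular_\<Sigma>l[OF elim that] regular_\<Sigma>l[OF elim that(2,1)] Sg_def
      using qq_sym[OF that] by (simp add: mult.commute eq_commute)
    then show ?case using regular_\<Sigma>l_quadratic[OF elim] regular_Sg_psd[OF elim] by simp
  qed
qed (rule characteristic_function_limit)

lemma variance_limit:
  assumes k: "k \<in> {1..d}"
  shows "(\<lambda>n. variance (\<lambda>\<omega>. real (A n k \<omega>))) \<longlonglongrightarrow> q k - (m k)\<^sup>2"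
proof (rule LIMSEQ_imp_Suc)
  have "variance (Ar n k) = (\<integral>\<omega>. (Ar n k \<omega>)\<^sup>2 \<partial>M) - (mu n k)\<^sup>2" for n
    unfolding mu_def urn_mean_def by (rule variance_eq[OF A_moments(1,2)[OF k]])
  then show "(\<lambda>n. variance (\<lambda>\<omega>. Ar n k \<omega>)) \<longlonglongrightarrow> q k - (m k)\<^sup>2"
    using tendsto_diff[OF LIMSEQ_Suc[OF M_sq[OF k]] tendsto_power[OF mu_lim[OF k], of 2]] by simp
qed

lemma regular_single_draw_iff: "regular \<omega> \<Longrightarrow> Q \<omega> = NN \<omega> \<longleftrightarrow> NN \<omega> = 1"
  using regular_limits_of_N[of \<omega>] by auto

end

theorem theorem4p2:
  fixes M :: "'w measure" and d t C1 :: nat and C2 :: real and h0 :: "nat \<Rightarrow> nat"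
    and N :: "nat \<Rightarrow> 'w \<Rightarrow> nat" and X A :: "nat \<Rightarrow> nat \<Rightarrow> 'w \<Rightarrow> nat"
    and m q :: "nat \<Rightarrow> real" and qq :: "nat \<Rightarrow> nat \<Rightarrow> real"
    and NN Q :: "'w \<Rightarrow> real"
    and Z :: "nat \<Rightarrow> 'w \<Rightarrow> real" and v :: "nat \<Rightarrow> real" and c :: "nat \<Rightarrow> nat \<Rightarrow> real"
    and \<Sigma> :: "nat \<Rightarrow> nat \<Rightarrow> 'w \<Rightarrow> real"
  defines "Z \<equiv> urn_Zlim d h0 X A"
    and "v \<equiv> \<lambda>k. q k - (m k)\<^sup>2"
    and "c \<equiv> \<lambda>i j. qq i j - m i * m j"
    and "\<Sigma> \<equiv> urn_Sigma t v c Z NN Q"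
  assumes urn: "reinforced_urn M d C1 h0 N X A"
    and A1: "\<And>k. k \<in> {1..d} \<Longrightarrow>
      (SUP n\<in>{1..}. \<integral>\<^sup>+\<omega>. ennreal (real (A n k \<omega>) ^ 3) \<partial>M) < ennreal C2"
    and A2_lim: "\<And>k. k \<in> {1..d} \<Longrightarrow> (\<lambda>n. urn_mean M A n k) \<longlonglongrightarrow> m k"
    and A2_t: "t \<in> {1..d}"
    and A2_eq: "\<And>k. k \<in> {1..t} \<Longrightarrow> m k = m 1"
    and A2_gap: "t < d \<Longrightarrow> m t > m (t + 1)"
    and A2_decr: "\<And>k. t < k \<Longrightarrow> k < d \<Longrightarrow> m k \<ge> m (k + 1)"
    and A2_mean_eq: "\<And>n k. n \<ge> 1 \<Longrightarrow> k \<in> {1..t} \<Longrightarrow> urn_mean M A n k = urn_mean M A n 1"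
    and A3: "\<And>k j. k \<in> {1..d} \<Longrightarrow> j \<in> {1..d} \<Longrightarrow>
      summable (\<lambda>n. \<bar>urn_mean M A (n + 1) k * m j - m k * urn_mean M A (n + 1) j\<bar> / real n)"
    and A4: "\<And>k. k \<in> {1..d} \<Longrightarrow>
      (\<lambda>n. \<bar>urn_mean M A n k - m k\<bar>) \<in> o(\<lambda>n. real n powr (- m k / (2 * m 1)))"
    and NN_rv: "NN \<in> borel_measurable M"
    and NN_lim: "AE \<omega> in M.
      (\<lambda>n. real_cond_exp M (urn_F M d N X A n) (\<lambda>\<omega>. real (N (n + 1) \<omega>)) \<omega>) \<longlonglongrightarrow> NN \<omega>"
    and Q_rv: "Q \<in> borel_measurable M"
    and Q_lim: "AE \<omega> in M.
      (\<lambda>n. real_cond_exp M (urn_F M d N X A n) (\<lambda>\<omega>. (real (N (n + 1) \<omega>))\<^sup>2) \<omega>) \<longlonglongrightarrow> Q \<omega>"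
    and M_sq: "\<And>k. k \<in> {1..d} \<Longrightarrow> (\<lambda>n. \<integral>\<omega>. (real (A n k \<omega>))\<^sup>2 \<partial>M) \<longlonglongrightarrow> q k"
    and M_mix: "\<And>k s. k \<in> {1..d} \<Longrightarrow> s \<in> {1..d} \<Longrightarrow>
      (\<lambda>n. \<integral>\<omega>. real (A n k \<omega>) * real (A n s \<omega>) \<partial>M) \<longlonglongrightarrow> qq k s"
  shows "(\<forall>k\<in>{1..d}. AE \<omega> in M. (\<lambda>n. urn_Z d h0 X A n k \<omega>) \<longlonglongrightarrow> Z k \<omega>) \<and>
    stably_normal M d
      (\<lambda>n k \<omega>. sqrt (real (urn_drawn X n k \<omega>)) * (urn_mhat X A n k \<omega> - m k)) \<Sigma> \<and>
    (AE \<omega> in M. Q \<omega> = NN \<omega> \<longleftrightarrow> NN \<omega> = 1) \<and>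
    (AE \<omega> in M. Q \<omega> = NN \<omega> \<longrightarrow>
      (\<forall>i\<in>{1..d}. \<forall>j\<in>{1..d}. i \<noteq> j \<longrightarrow> \<Sigma> i j \<omega> = 0) \<and> (\<forall>k\<in>{1..d}. \<Sigma> k k \<omega> = v k)) \<and>
    (\<forall>k\<in>{1..d}. (\<lambda>n. prob_space.variance M (\<lambda>\<omega>. real (A n k \<omega>))) \<longlonglongrightarrow> v k)"
proof -
  interpret reinforced_urn_limit M d C1 h0 N X A t C2 m q qq NN Q
    by (rule reinforced_urn_limit.intro[OF urn], rule reinforced_urn_limit_axioms.intro)
      (fact A1 A2_lim A2_t A2_eq A2_gap A2_decr A3 A4 NN_rv NN_lim Q_rv Q_lim M_sq M_mix)+
  have \<Sigma>: "\<Sigma> = urn_Sigma t (\<lambda>k. q k - (m k)\<^sup>2) (\<lambda>i j. qq i j - m i * m j) (urn_Zlim d h0 X A) NN Q"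
    unfolding \<Sigma>_def v_def c_def Z_def ..
  show ?thesis
  proof (intro conjI ballI)
    show "AE \<omega> in M. (\<lambda>n. urn_Z d h0 X A n k \<omega>) \<longlonglongrightarrow> Z k \<omega>" if "k \<in> {1..d}" for k
      using AE_regular unfolding Z_def by eventually_elim (rule regular_Z(1)[OF _ that])
    show "stably_normal M d (\<lambda>n k \<omega>. sqrt (real (urn_drawn X n k \<omega>)) * (urn_mhat X A n k \<omega> - m k)) \<Sigma>"
      using V_stably_normal unfolding \<Sigma> V_def[abs_def] .
    show "AE \<omega> in M. Q \<omega> = NN \<omega> \<longleftrightarrow> NN \<omega> = 1"
      using AE_regular by eventually_elim (rule regular_single_draw_iff)
    show "AE \<omega> in M. Q \<omega> = NN \<omega> \<longrightarrow>
      (\<forall>i\<in>{1..d}. \<forall>j\<in>{1..d}. i \<noteq> j \<longrightarrow> \<Sigma> i j \<omega> = 0) \<and> (\<forall>k\<in>{1..d}. \<Sigma> k k \<omega> = v k)"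
      using AE_regular
    proof eventually_elim
      case (elim \<omega>)
      \<comment> \<open>As \<open>NN\<close> is at least 1, \<open>Q = NN\<close> makes
        \<open>Q / NN - 1\<close> vanish, and only the variances on the diagonal remain.\<close>
      then show ?case using regular_limits_of_N(1)[OF elim] by (auto simp: \<Sigma> urn_Sigma_def v_def)
    qed
    show "(\<lambda>n. variance (\<lambda>\<omega>. real (A n k \<omega>))) \<longlonglongrightarrow> v k" if "k \<in> {1..d}" for k
      unfolding v_def by (rule variance_limit[OF that])
  qed
qed

end
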